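(* Let $v=(v_1,\dots,v_{p'})\in(F^\times)^{p'}$ be such that $v_k/v_l\notin\langle q\rangle$ for all $k\neq l$. There is an (explicit) $F$-algebra isomorphism $$\mathcal H_n^{\Lambda}(q,v)\simeq\bigoplus_{\lambda}\mathrm{Mat}_{m_\lambda}\Big(\mathcal H_{\lambda_1}^{\Lambda^1}(q)\otimes\cdots\otimes\mathcal H_{\lambda_{p'}}^{\Lambda^{p'}}(q)\Big),$$ where $\lambda=(\lambda_1,\dots,\lambda_{p'})$ runs over all tuples of non-negative integers with $\lambda_1+\dots+\lambda_{p'}=n$, and $m_\lambda=\frac{n!}{\lambda_1!\cdots\lambda_{p'}!}$.
   Context: $d,p,n$ are positive integers, $n\ge2$, $r=dp$. $F$ is a field containing a primitive $p$-th root of unity $\zeta$. $q\in F\setminus\{0,1\}$ has order $e\in\mathbb N_{\ge2}\cup\{\infty\}$ in $F^\times$; $I=\mathbb Z/e\mathbb Z$ if $e<\infty$ and $I=\mathbb Z$ if $e=\infty$. $p'=\min\{m\ge1:\zeta^m\in\langle q\rangle\}$, $J'=\{1,\dots,p'\}$. $\Lambda=(\Lambda_{i,j})_{(i,j)\in I\times J'}$ is a finitely supported tuple of non-negative integers with sum $r$, and $\Lambda^j=(\Lambda_{i,j})_{i\in I}$ for $j\in J'$. $\mathcal H_n^\Lambda(q,v)$ is the unital associative $F$-algebra generated by $S,T_1,\dots,T_{n-1}$ with relations $\prod_{i\in I}\prod_{j\in J'}(S-v_jq^i)^{\Lambda_{i,j}}=0$, $(T_a+1)(T_a-q)=0$,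 $ST_1ST_1=T_1ST_1S$, $ST_a=T_aS$ if $a>1$, $T_aT_b=T_bT_a$ if $|a-b|>1$, $T_aT_{a+1}T_a=T_{a+1}T_aT_{a+1}$. For $m\ge1$ and $j\in J'$, $\mathcal H_m^{\Lambda^j}(q)$ is the unital associative $F$-algebra generated by $S,T_1,\dots,T_{m-1}$ with the same relations among these generators, except that the first relation is replaced by $\prod_{i\in I}(S-q^i)^{\Lambda_{i,j}}=0$; and $\mathcal H_0^{\Lambda^j}(q)=F$. Tensor products are over $F$. *)

theory Defs
  imports
    "HOL-Algebra.QuotRing"
    "HOL-Algebra.Module"
    "HOL-Computational_Algebra.Polynomial"
    "HOL-Library.Extended_Nat"
begin

text \<open>
  The ground field is a type \<open>'f\<close> of class \<open>field\<close>. An \<open>'f\<close>-algebra is a record of type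
  \<open>('f, 'a) module\<close>: a (not necessarily commutative) HOL-Algebra ring together with a scalar
  multiplication by all elements of \<open>'f\<close>.
\<close>

section \<open>Orders and cyclic subgroups in the multiplicative group of a field\<close>

definition mult_order :: "'f::field \<Rightarrow> enat" where
  "mult_order x = Inf {enat k | k. k \<ge> 1 \<and> x ^ k = 1}"

definition cyclic_subgroup :: "'f::field \<Rightarrow> 'f set" where
  "cyclic_subgroup x = range (\<lambda>k::int. x powi k)"

text \<open>
  The index set $\mathbb{Z}/e\mathbb{Z}$ is represented by the residues $0,\dots,e-1$; an index
  \<open>i\<close> is only used through $q^i$ for an element \<open>q\<close> of order \<open>e\<close>.
\<close>

definition residue_indices :: "enat \<Rightarrow> int set" where
  "residue_indices e = (case e of enat k \<Rightarrow> {0..<int k} | \<infinity> \<Rightarrow> UNIV)"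

section \<open>Constructions of algebras\<close>

definition algebra_iso :: "('f::field, 'a) module \<Rightarrow> ('f, 'b) module \<Rightarrow> ('a \<Rightarrow> 'b) set" where
  "algebra_iso A B =
     {h \<in> ring_iso A B. \<forall>c. \<forall>x\<in>carrier A. h (c \<odot>\<^bsub>A\<^esub> x) = c \<odot>\<^bsub>B\<^esub> h x}"

text \<open>The scalar multiplication on cosets follows the pattern of \<open>rcoset_mult\<close>.\<close>

definition quotient_algebra ::
    "('f::field, 'a) module \<Rightarrow> 'a set \<Rightarrow> ('f, 'a set) module" where
  "quotient_algebra A J =
     \<lparr>carrier = carrier (A Quot J), monoid.mult = monoid.mult (A Quot J), one = one (A Quot J),
      zero = zero (A Quot J), add = add (A Quot J),
      module.smult = (\<lambda>c X. \<Union>x\<in>X. J +>\<^bsub>A\<^esub> (c \<odot>\<^bsub>A\<^esub> x))\<rparr>"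

definition monoid_algebra :: "'m monoid \<Rightarrow> ('f::field, 'm \<Rightarrow> 'f) module" where
  "monoid_algebra M =
     \<lparr>carrier = {f. finite {x. f x \<noteq> 0} \<and> {x. f x \<noteq> 0} \<subseteq> carrier M},
      monoid.mult = (\<lambda>f g z. \<Sum>(x, y) \<in> {(x, y). f x \<noteq> 0 \<and> g y \<noteq> 0 \<and> x \<otimes>\<^bsub>M\<^esub> y = z}. f x * g y),
      one = (\<lambda>x. if x = \<one>\<^bsub>M\<^esub> then 1 else 0),
      zero = (\<lambda>x. 0),
      add = (\<lambda>f g x. f x + g x),
      module.smult = (\<lambda>c f x. c * f x)\<rparr>"

definition basis_vector :: "'m \<Rightarrow> 'm \<Rightarrow> 'f::field" where
  "basis_vector x = (\<lambda>y. if y = x then 1 else 0)"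

definition word_monoid :: "'g set \<Rightarrow> 'g list monoid" where
  "word_monoid G = \<lparr>carrier = lists G, monoid.mult = (@), one = []\<rparr>"

abbreviation free_algebra :: "'g set \<Rightarrow> ('f::field, 'g list \<Rightarrow> 'f) module" where
  "free_algebra G \<equiv> monoid_algebra (word_monoid G)"

definition presented_algebra ::
    "'g set \<Rightarrow> ('g list \<Rightarrow> 'f::field) set \<Rightarrow> ('f, ('g list \<Rightarrow> 'f) set) module" where
  "presented_algebra G R = quotient_algebra (free_algebra G) (Idl\<^bsub>free_algebra G\<^esub> R)"

definition product_monoid :: "'i set \<Rightarrow> ('i \<Rightarrow> ('a, 'c) monoid_scheme) \<Rightarrow> ('i \<Rightarrow> 'a) monoid" where
  "product_monoid K M =
     \<lparr>carrier = (\<Pi>\<^sub>E k\<in>K. carrier (M k)),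
      monoid.mult = (\<lambda>x y. \<lambda>k\<in>K. x k \<otimes>\<^bsub>M k\<^esub> y k),
      one = (\<lambda>k\<in>K. \<one>\<^bsub>M k\<^esub>)\<rparr>"

text \<open>
  The tensor product over \<open>'f\<close> of a finite family of algebras: the vector space with basis all
  tuples $(x_k)_{k}$, with componentwise multiplication of basis elements, modulo the
  multilinearity relations. The linear span of these relations is stable under multiplication by
  tuples, so that it coincides with the two-sided ideal they generate.
\<close>

definition multilinear_relations ::
    "'i set \<Rightarrow> ('i \<Rightarrow> ('f::field, 'a) module) \<Rightarrow> (('i \<Rightarrow> 'a) \<Rightarrow> 'f) set" where
  "multilinear_relations K A =
     (let F = monoid_algebra (product_monoid K A) in
       {basis_vector (x(k := a \<oplus>\<^bsub>A k\<^esub> b))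
          \<ominus>\<^bsub>F\<^esub> (basis_vector (x(k := a)) \<oplus>\<^bsub>F\<^esub> basis_vector (x(k := b))) | x k a b.
          x \<in> (\<Pi>\<^sub>E l\<in>K. carrier (A l)) \<and> k \<in> K \<and> a \<in> carrier (A k) \<and> b \<in> carrier (A k)} \<union>
       {basis_vector (x(k := c \<odot>\<^bsub>A k\<^esub> a)) \<ominus>\<^bsub>F\<^esub> c \<odot>\<^bsub>F\<^esub> basis_vector (x(k := a)) | x k a c.
          x \<in> (\<Pi>\<^sub>E l\<in>K. carrier (A l)) \<and> k \<in> K \<and> a \<in> carrier (A k)})"

definition tensor_algebra ::
    "'i set \<Rightarrow> ('i \<Rightarrow> ('f::field, 'a) module) \<Rightarrow> ('f, (('i \<Rightarrow> 'a) \<Rightarrow> 'f) set) module" where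
  "tensor_algebra K A =
     quotient_algebra (monoid_algebra (product_monoid K A))
       (Idl\<^bsub>monoid_algebra (product_monoid K A)\<^esub> (multilinear_relations K A))"

definition matrix_algebra ::
    "nat \<Rightarrow> ('f::field, 'a) module \<Rightarrow> ('f, nat \<times> nat \<Rightarrow> 'a) module" where
  "matrix_algebra m A =
     \<lparr>carrier = ({..<m} \<times> {..<m}) \<rightarrow>\<^sub>E carrier A,
      monoid.mult = (\<lambda>X Y. \<lambda>(i, j)\<in>{..<m} \<times> {..<m}. \<Oplus>\<^bsub>A\<^esub>k\<in>{..<m}. X (i, k) \<otimes>\<^bsub>A\<^esub> Y (k, j)),
      one = (\<lambda>(i, j)\<in>{..<m} \<times> {..<m}. if i = j then \<one>\<^bsub>A\<^esub> else \<zero>\<^bsub>A\<^esub>),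
      zero = (\<lambda>_\<in>{..<m} \<times> {..<m}. \<zero>\<^bsub>A\<^esub>),
      add = (\<lambda>X Y. \<lambda>p\<in>{..<m} \<times> {..<m}. X p \<oplus>\<^bsub>A\<^esub> Y p),
      module.smult = (\<lambda>c X. \<lambda>p\<in>{..<m} \<times> {..<m}. c \<odot>\<^bsub>A\<^esub> X p)\<rparr>"

text \<open>For a finite index set \<open>L\<close>; the direct sum is then the full product.\<close>

definition direct_sum_algebra ::
    "'l set \<Rightarrow> ('l \<Rightarrow> ('f::field, 'a) module) \<Rightarrow> ('f, 'l \<Rightarrow> 'a) module" where
  "direct_sum_algebra L A =
     \<lparr>carrier = (\<Pi>\<^sub>E l\<in>L. carrier (A l)),
      monoid.mult = (\<lambda>x y. \<lambda>l\<in>L. x l \<otimes>\<^bsub>A l\<^esub> y l),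
      one = (\<lambda>l\<in>L. \<one>\<^bsub>A l\<^esub>),
      zero = (\<lambda>l\<in>L. \<zero>\<^bsub>A l\<^esub>),
      add = (\<lambda>x y. \<lambda>l\<in>L. x l \<oplus>\<^bsub>A l\<^esub> y l),
      module.smult = (\<lambda>c x. \<lambda>l\<in>L. c \<odot>\<^bsub>A l\<^esub> x l)\<rparr>"

section \<open>Cyclotomic Hecke algebras\<close>

datatype hecke_generator = GenS | GenT nat

definition poly_eval_algebra :: "('f::field, 'a) module \<Rightarrow> 'f poly \<Rightarrow> 'a \<Rightarrow> 'a" where
  "poly_eval_algebra A P x = (\<Oplus>\<^bsub>A\<^esub>k\<in>{..degree P}. coeff P k \<odot>\<^bsub>A\<^esub> (x [^]\<^bsub>A\<^esub> k))"

definition hecke_generators :: "nat \<Rightarrow> hecke_generator set" where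
  "hecke_generators n = {GenS} \<union> GenT ` {1..<n}"

text \<open>Each element \<open>x\<close> of the following set is the relation $x = 0$.\<close>

definition hecke_relations ::
    "'f::field \<Rightarrow> 'f poly \<Rightarrow> nat \<Rightarrow> (hecke_generator list \<Rightarrow> 'f) set" where
  "hecke_relations q P n =
     (let A = free_algebra (hecke_generators n);
          S = basis_vector [GenS];
          T = (\<lambda>a. basis_vector [GenT a])
      in
        {poly_eval_algebra A P S} \<union>
        {(T a \<oplus>\<^bsub>A\<^esub> \<one>\<^bsub>A\<^esub>) \<otimes>\<^bsub>A\<^esub> (T a \<ominus>\<^bsub>A\<^esub> q \<odot>\<^bsub>A\<^esub> \<one>\<^bsub>A\<^esub>) | a. a \<in> {1..<n}} \<union>
        {S \<otimes>\<^bsub>A\<^esub> T a \<otimes>\<^bsub>A\<^esub> S \<otimes>\<^bsub>A\<^esub> T a \<ominus>\<^bsub>A\<^esub> T a \<otimes>\<^bsub>A\<^esub> S \<otimes>\<^bsub>A\<^esub> T a \<otimes>\<^bsub>A\<^esub> S | a.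
           a \<in> {1..<n} \<and> a = 1} \<union>
        {S \<otimes>\<^bsub>A\<^esub> T a \<ominus>\<^bsub>A\<^esub> T a \<otimes>\<^bsub>A\<^esub> S | a. a \<in> {1..<n} \<and> a > 1} \<union>
        {T a \<otimes>\<^bsub>A\<^esub> T b \<ominus>\<^bsub>A\<^esub> T b \<otimes>\<^bsub>A\<^esub> T a | a b.
           a \<in> {1..<n} \<and> b \<in> {1..<n} \<and> \<bar>int a - int b\<bar> > 1} \<union>
        {T a \<otimes>\<^bsub>A\<^esub> T (a + 1) \<otimes>\<^bsub>A\<^esub> T a \<ominus>\<^bsub>A\<^esub> T (a + 1) \<otimes>\<^bsub>A\<^esub> T a \<otimes>\<^bsub>A\<^esub> T (a + 1) | a.
           a \<in> {1..<n} \<and> a + 1 \<in> {1..<n}})"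

text \<open>
  The algebra on \<open>n\<close> strands whose first relation is $P(S) = 0$. For \<open>n = 0\<close> it is the ground
  field, in the form of the algebra with no generators (hence with the single word \<open>[]\<close> as basis)
  and no relations.
\<close>

definition hecke_algebra ::
    "'f::field \<Rightarrow> 'f poly \<Rightarrow> nat \<Rightarrow> ('f, (hecke_generator list \<Rightarrow> 'f) set) module" where
  "hecke_algebra q P n =
     (if n = 0 then presented_algebra {} {}
      else presented_algebra (hecke_generators n) (hecke_relations q P n))"

text \<open>
  The products over the possibly infinite index sets are restricted to the (finite) supports of
  the exponents. The first relation of $\mathcal{H}_n^\Lambda(q,v)$ is
  $\prod_{i,j} (S - v_j q^i)^{\Lambda_{i,j}} = 0$.
\<close>

definition multi_cyclotomic_hecke_algebra ::
    "int set \<Rightarrow> nat set \<Rightarrow> (int \<Rightarrow> nat \<Rightarrow> nat) \<Rightarrow> 'f::field \<Rightarrow> (nat \<Rightarrow> 'f) \<Rightarrow> nat \<Rightarrow>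
     ('f, (hecke_generator list \<Rightarrow> 'f) set) module" where
  "multi_cyclotomic_hecke_algebra I J \<Lambda> q v n =
     hecke_algebra q
       (\<Prod>(i, j) \<in> {(i, j). i \<in> I \<and> j \<in> J \<and> \<Lambda> i j \<noteq> 0}. [:- (v j * q powi i), 1:] ^ \<Lambda> i j) n"

definition cyclotomic_hecke_algebra ::
    "int set \<Rightarrow> (int \<Rightarrow> nat) \<Rightarrow> 'f::field \<Rightarrow> nat \<Rightarrow>
     ('f, (hecke_generator list \<Rightarrow> 'f) set) module" where
  "cyclotomic_hecke_algebra I \<Lambda> q m =
     hecke_algebra q (\<Prod>i \<in> {i \<in> I. \<Lambda> i \<noteq> 0}. [:- (q powi i), 1:] ^ \<Lambda> i) m"

definition weak_compositions :: "nat set \<Rightarrow> nat \<Rightarrow> (nat \<Rightarrow> nat) set" where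
  "weak_compositions J n = {\<nu> \<in> J \<rightarrow>\<^sub>E UNIV. (\<Sum>j\<in>J. \<nu> j) = n}"

definition multinomial :: "nat set \<Rightarrow> (nat \<Rightarrow> nat) \<Rightarrow> nat \<Rightarrow> nat" where
  "multinomial J \<nu> n = fact n div (\<Prod>j\<in>J. fact (\<nu> j))"

end

theory Submission
  imports Defs "HOL-Library.Function_Algebras" "HOL-Combinatorics.Transposition" "HOL-Combinatorics.Multiset_Permutations"
begin

text \<open>
  Let \<open>X\<^sub>1 = S\<close> and \<open>X\<^sub>a\<^sub>+\<^sub>1 = q\<^sup>-\<^sup>1 T\<^sub>a X\<^sub>a T\<^sub>a\<close> be the Jucys-Murphy elements. They commute and
  their eigenvalues lie in the disjoint cosets of the powers of \<open>q\<close> through the parameters \<open>v\<^sub>j\<close>, so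
  that polynomials in the \<open>X\<^sub>a\<close> give orthogonal idempotents \<open>e\<^sub>t\<close>, indexed by the colour sequences
  \<open>t : {1,\<dots>,n} \<rightarrow> J\<close>. If \<open>t\<^sub>a \<noteq> t\<^sub>a\<^sub>+\<^sub>1\<close>, then \<open>b = (q - 1) X\<^sub>a\<^sub>+\<^sub>1 / (X\<^sub>a\<^sub>+\<^sub>1 - X\<^sub>a)\<close> makes sense on \<open>e\<^sub>t\<close>,
  and \<open>T\<^sub>a = \<sigma>\<^sub>a (q - b) + b\<close> there for an invertible \<open>\<sigma>\<^sub>a\<close> that interchanges the colours \<open>t\<^sub>a\<close> and
  \<open>t\<^sub>a\<^sub>+\<^sub>1\<close>. The \<open>\<sigma>\<^sub>a\<close> satisfy the braid relations, hence they link all \<open>e\<^sub>t\<close> with the same content,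
  and the algebra is a sum of matrix algebras over the corners of the ascending sequences \<open>t\<^sub>0\<close>.

  The tensor product of the small Hecke algebras maps onto such a corner, because all matrix
  coefficients of the generators lie in the image. The map is injective, because the formula for
  \<open>T\<^sub>a\<close>, with the \<open>\<sigma>\<^sub>a\<close> acting by permutation of colour sequences, defines a representation of the
  large algebra that is induced from a faithful representation of the tensor product.
\<close>

section \<open>Endomorphism rings of function spaces, the common ground for all computations\<close>

section \<open>Linear endomorphisms\<close>

text \<open>Algebras are transported to endomorphism rings by faithful representations, since there
  products, scalars and inverses are handled by plain ring rewriting. The image of the unit is
  usually a proper idempotent, so polynomials and inverses are taken relative to a corner. No basis
  theorem or dimension formula enters. In its place the eigenvalues of each Jucys-Murphy element are
  bounded by those of its predecessor and their multiples by \<open>q\<close> and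
  \<open>1 / q\<close>, and injectivity is tested on an explicit module. The crossing is a
  normalised intertwiner: for neighbouring Jucys-Murphy elements \<open>x\<close> and
  \<open>y\<close>, \<open>T (x - y) + (q - 1) y\<close> exchanges \<open>x\<close> and
  \<open>y\<close>, and its square is \<open>(q x - y) (q y - x)\<close>. Eigenvalues of different
  colours must therefore avoid the ratios \<open>1\<close>, \<open>q\<close> and
  \<open>1 / q\<close>; the coset condition on the parameters provides this. The main obstacle is
  the cubic braid relation. It is carried from the generators to the crossings in the algebra, and
  from the crossings to the generators in the module; one identity, valid up to invertible factors
  \<open>q - b\<close>, gives both directions.\<close>

typedef (overloaded) ('x, 'f::field) endo =
  "{h :: ('x \<Rightarrow> 'f) \<Rightarrow> 'x \<Rightarrow> 'f.
      (\<forall>f g. h (f + g) = h f + h g) \<and> (\<forall>c f. h (\<lambda>x. c * f x) = (\<lambda>x. c * h f x))}"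
  by (rule exI[of _ "\<lambda>f. f"]) simp

setup_lifting type_definition_endo

instantiation endo :: (type, field) ring_1
begin

lift_definition zero_endo :: "('a, 'b) endo" is "\<lambda>f x. 0"
  by (auto simp: fun_eq_iff)

lift_definition one_endo :: "('a, 'b) endo" is "\<lambda>f. f"
  by auto

lift_definition plus_endo :: "('a, 'b) endo \<Rightarrow> ('a, 'b) endo \<Rightarrow> ('a, 'b) endo"
  is "\<lambda>A B f x. A f x + B f x"
  by (auto simp: fun_eq_iff algebra_simps)

lift_definition minus_endo :: "('a, 'b) endo \<Rightarrow> ('a, 'b) endo \<Rightarrow> ('a, 'b) endo"
  is "\<lambda>A B f x. A f x - B f x"
  by (auto simp: fun_eq_iff algebra_simps)

lift_definition uminus_endo :: "('a, 'b) endo \<Rightarrow> ('a, 'b) endo" is "\<lambda>A f x. - A f x"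
  by (auto simp: fun_eq_iff algebra_simps)

lift_definition times_endo :: "('a, 'b) endo \<Rightarrow> ('a, 'b) endo \<Rightarrow> ('a, 'b) endo"
  is "\<lambda>A B f. A (B f)"
  by auto

instance
proof
  show "(0::('a, 'b) endo) \<noteq> 1"
    by transfer (metis zero_neq_one)
qed (transfer; auto simp: fun_eq_iff plus_fun_def)+

end

lift_definition scl :: "'f::field \<Rightarrow> ('x, 'f) endo \<Rightarrow> ('x, 'f) endo" (infixr "*\<^sub>s" 75)
  is "\<lambda>c A f x. c * A f x"
  by (auto simp: fun_eq_iff algebra_simps)

interpretation endo: vector_space "scl :: 'f::field \<Rightarrow> ('x, 'f) endo \<Rightarrow> _"
  by standard (transfer; auto simp: fun_eq_iff algebra_simps)+

lemma scl_mult_left [simp]: "(c *\<^sub>s x) * y = c *\<^sub>s (x * y)"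
  by transfer auto

lemma scl_mult_right [simp]: "x * (c *\<^sub>s y) = c *\<^sub>s (x * y)"
  by transfer (auto simp: fun_eq_iff)

lemmas scl_simps = endo.scale_left_distrib endo.scale_right_distrib endo.scale_left_diff_distrib
  endo.scale_right_diff_distrib

section \<open>Non-commutative algebras over a field and their faithful representations\<close>

section \<open>Algebras and their representations\<close>

text \<open>The scalars are the whole type \<open>'f\<close>, so there is only one carrier set.
  Multiplication need not commute, and the last two axioms make the scalars central.\<close>

locale falgebra = ring A for A :: "('f::field, 'a) module" (structure) +
  assumes smult_closed [simp, intro]: "x \<in> carrier A \<Longrightarrow> c \<odot> x \<in> carrier A"
    and smult_l_distr: "x \<in> carrier A \<Longrightarrow> (c + d) \<odot> x = c \<odot> x \<oplus> d \<odot> x"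
    and smult_r_distr: "x \<in> carrier A \<Longrightarrow> y \<in> carrier A \<Longrightarrow> c \<odot> (x \<oplus> y) = c \<odot> x \<oplus> c \<odot> y"
    and smult_smult: "x \<in> carrier A \<Longrightarrow> c \<odot> (d \<odot> x) = (c * d) \<odot> x"
    and smult_one: "x \<in> carrier A \<Longrightarrow> 1 \<odot> x = x"
    and smult_mult_left: "x \<in> carrier A \<Longrightarrow> y \<in> carrier A \<Longrightarrow> (c \<odot> x) \<otimes> y = c \<odot> (x \<otimes> y)"
    and smult_mult_right: "x \<in> carrier A \<Longrightarrow> y \<in> carrier A \<Longrightarrow> x \<otimes> (c \<odot> y) = c \<odot> (x \<otimes> y)"
begin

lemma smult_zero: "x \<in> carrier A \<Longrightarrow> 0 \<odot> x = \<zero>"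
  using smult_l_distr[of x 0 0] smult_closed[of x 0] by (metis add.r_cancel_one' add_0)

lemma smult_minus: "x \<in> carrier A \<Longrightarrow> (- 1) \<odot> x = \<ominus> x"
  using smult_l_distr[of x "-1" 1] smult_closed[of x "-1"] smult_one[of x] smult_zero[of x]
  by (metis add.left_inverse minus_equality)

end

text \<open>The unit of \<open>A\<close> is mapped to an idempotent \<open>p\<close>, which need not be the identity.\<close>

definition alg_rep :: "('f::field, 'a) module \<Rightarrow> ('x, 'f) endo \<Rightarrow> ('a \<Rightarrow> ('x, 'f) endo) \<Rightarrow> bool" where
  "alg_rep A p h \<longleftrightarrow>
     (\<forall>x\<in>carrier A. \<forall>y\<in>carrier A. h (x \<oplus>\<^bsub>A\<^esub> y) = h x + h y \<and> h (x \<otimes>\<^bsub>A\<^esub> y) = h x * h y) \<and>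
     (\<forall>c. \<forall>x\<in>carrier A. h (c \<odot>\<^bsub>A\<^esub> x) = c *\<^sub>s h x) \<and> h \<one>\<^bsub>A\<^esub> = p"

locale representation = falgebra A for A :: "('f::field, 'a) module" (structure) +
  fixes p :: "('x, 'f) endo" and h :: "'a \<Rightarrow> ('x, 'f) endo"
  assumes rep: "alg_rep A p h"
begin

lemma hom_add [simp]: "x \<in> carrier A \<Longrightarrow> y \<in> carrier A \<Longrightarrow> h (x \<oplus> y) = h x + h y"
  and hom_mult [simp]: "x \<in> carrier A \<Longrightarrow> y \<in> carrier A \<Longrightarrow> h (x \<otimes> y) = h x * h y"
  and hom_smult [simp]: "x \<in> carrier A \<Longrightarrow> h (c \<odot> x) = c *\<^sub>s h x"
  and hom_one [simp]: "h \<one> = p"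
  using rep unfolding alg_rep_def by auto

lemma hom_zero [simp]: "h \<zero> = 0"
  using hom_smult[of \<one> 0] by (simp add: smult_zero)

lemma hom_uminus [simp]: "x \<in> carrier A \<Longrightarrow> h (\<ominus> x) = - h x"
  using hom_smult[of x "-1"] by (simp add: smult_minus)

lemma hom_minus [simp]: "x \<in> carrier A \<Longrightarrow> y \<in> carrier A \<Longrightarrow> h (x \<ominus> y) = h x - h y"
  by (simp add: a_minus_def)

lemma unit_left [simp]: "x \<in> carrier A \<Longrightarrow> p * h x = h x"
  and unit_right [simp]: "x \<in> carrier A \<Longrightarrow> h x * p = h x"
  using hom_mult[of \<one> x] hom_mult[of x \<one>] by simp_all

lemma hom_finsum: "finite K \<Longrightarrow> (\<And>k. k \<in> K \<Longrightarrow> f k \<in> carrier A) \<Longrightarrow>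
    h (\<Oplus>k\<in>K. f k) = (\<Sum>k\<in>K. h (f k))"
proof (induction K rule: finite_induct)
  case (insert k K)
  then show ?case by (simp add: finsum_closed Pi_def)
qed simp

text \<open>The factor \<open>p\<close> matters for \<open>k = 0\<close>: the power is then the unit
  of \<open>A\<close>, which goes to \<open>p\<close>, whereas \<open>h x ^ 0\<close> is the
  identity of \<open>endo\<close>.\<close>

lemma hom_pow: "x \<in> carrier A \<Longrightarrow> h (x [^] (k::nat)) = p * h x ^ k"
proof (induction k)
  case (Suc k)
  then show ?case by (simp add: power_Suc2 mult.assoc del: power_Suc)
qed simp

end

subsection \<open>Faithful representations\<close>

interpretation funs: vector_space "\<lambda>(c::'f::field) f. (\<lambda>x::'x. c * f x)"
  by standard (auto simp: fun_eq_iff algebra_simps)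

interpretation funs: vector_space_pair "\<lambda>(c::'f::field) f. (\<lambda>x::'x. c * f x)" "\<lambda>(c::'f::field) f. (\<lambda>x::'x. c * f x)"
  ..

text \<open>A linear left inverse of the inclusion of \<open>V\<close>, from the extension of a
  basis.\<close>

lemma linear_projection:
  fixes V :: "('x \<Rightarrow> 'f::field) set"
  assumes "funs.subspace V"
  obtains g :: "('x \<Rightarrow> 'f) \<Rightarrow> 'x \<Rightarrow> 'f"
  where "\<And>f. g f \<in> V" "\<And>f. f \<in> V \<Longrightarrow> g f = f" "\<And>f f'. g (f + f') = g f + g f'"
    "\<And>c f. g (\<lambda>x. c * f x) = (\<lambda>x. c * g f x)"
proof -
  obtain g where g: "g ` UNIV \<subseteq> V"
      "Vector_Spaces.linear (\<lambda>(c::'f) f. (\<lambda>x::'x. c * f x)) (\<lambda>(c::'f) f. (\<lambda>x::'x. c * f x)) g"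
      "\<forall>v\<in>V. g v = v"
    using funs.linear_exists_left_inverse_on[OF funs.linear_id assms] by (auto simp: id_def)
  interpret g: Vector_Spaces.linear "(\<lambda>(c::'f) f. (\<lambda>x::'x. c * f x))" "(\<lambda>(c::'f) f. (\<lambda>x::'x. c * f x))" g
    by fact
  show ?thesis
    by (rule that[of g]) (use g g.add g.scale in auto)
qed

context falgebra
begin

text \<open>The free vector space on the set \<open>carrier A\<close>; \<open>lincomb\<close> is its
  canonical map onto the algebra. In this way the theory of vector spaces of functions reaches an
  algebra that is only a subset of a type.\<close>

definition finspan :: "('a \<Rightarrow> 'f) set" where
  "finspan = {f. finite {x. f x \<noteq> 0} \<and> {x. f x \<noteq> 0} \<subseteq> carrier A}"

definition lincomb :: "('a \<Rightarrow> 'f) \<Rightarrow> 'a" where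
  "lincomb f = (\<Oplus>x\<in>{x. f x \<noteq> 0}. f x \<odot> x)"

lemma lincomb_eq:
  assumes "finite X" "{x. f x \<noteq> 0} \<subseteq> X" "X \<subseteq> carrier A"
  shows "lincomb f = (\<Oplus>x\<in>X. f x \<odot> x)"
  unfolding lincomb_def using assms
  by (intro add.finprod_mono_neutral_cong_left) (auto simp: smult_zero subset_iff)

lemma lincomb_closed: "f \<in> finspan \<Longrightarrow> lincomb f \<in> carrier A"
  unfolding lincomb_def finspan_def by (auto intro!: finsum_closed)

lemma subspace_finspan: "funs.subspace finspan"
proof (rule funs.subspaceI)
  fix f g :: "'a \<Rightarrow> 'f" assume "f \<in> finspan" "g \<in> finspan"
  moreover have "{x. (f + g) x \<noteq> 0} \<subseteq> {x. f x \<noteq> 0} \<union> {x. g x \<noteq> 0}" by auto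
  ultimately show "f + g \<in> finspan"
    unfolding finspan_def by (auto intro: finite_subset)
qed (auto simp: finspan_def)

lemma lincomb_add:
  assumes "f \<in> finspan" "g \<in> finspan"
  shows "lincomb (f + g) = lincomb f \<oplus> lincomb g"
proof -
  let ?X = "{x. f x \<noteq> 0} \<union> {x. g x \<noteq> 0}"
  have X: "finite ?X" "?X \<subseteq> carrier A" using assms by (auto simp: finspan_def)
  have "lincomb (f + g) = (\<Oplus>x\<in>?X. (f + g) x \<odot> x)"
    using X by (intro lincomb_eq) auto
  also have "\<dots> = (\<Oplus>x\<in>?X. f x \<odot> x \<oplus> g x \<odot> x)"
    using X by (intro add.finprod_cong') (auto simp: smult_l_distr subset_iff)
  also have "\<dots> = (\<Oplus>x\<in>?X. f x \<odot> x) \<oplus> (\<Oplus>x\<in>?X. g x \<odot> x)"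
    using X by (intro add.finprod_multf) (auto simp: subset_iff)
  also have "(\<Oplus>x\<in>?X. f x \<odot> x) = lincomb f"
    using X by (intro lincomb_eq[symmetric]) auto
  also have "(\<Oplus>x\<in>?X. g x \<odot> x) = lincomb g"
    using X by (intro lincomb_eq[symmetric]) auto
  finally show ?thesis .
qed

lemma smult_finsum:
  "finite X \<Longrightarrow> f \<in> X \<rightarrow> carrier A \<Longrightarrow> c \<odot> (\<Oplus>x\<in>X. f x) = (\<Oplus>x\<in>X. c \<odot> f x)"
proof (induction X rule: finite_induct)
  case empty
  show ?case using smult_smult[of \<one> c 0] by (simp add: smult_zero)
next
  case (insert x X)
  then show ?case by (subst (1 2) finsum_insert) (auto simp: smult_r_distr Pi_def)
qed

lemma lincomb_smult:
  assumes "f \<in> finspan"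
  shows "lincomb (\<lambda>x. c * f x) = c \<odot> lincomb f"
proof -
  let ?X = "{x. f x \<noteq> 0}"
  have X: "finite ?X" "?X \<subseteq> carrier A" using assms by (auto simp: finspan_def)
  have "lincomb (\<lambda>x. c * f x) = (\<Oplus>x\<in>?X. (c * f x) \<odot> x)"
    using X by (intro lincomb_eq) auto
  also have "\<dots> = (\<Oplus>x\<in>?X. c \<odot> (f x \<odot> x))"
    using X by (intro add.finprod_cong') (auto simp: smult_smult subset_iff)
  also have "\<dots> = c \<odot> lincomb f"
    unfolding lincomb_def using X by (intro smult_finsum[symmetric]) (auto simp: subset_iff)
  finally show ?thesis .
qed

lemma lincomb_basis: "x \<in> carrier A \<Longrightarrow> lincomb (basis_vector x) = x"
  by (subst lincomb_eq[of "{x}"]) (auto simp: basis_vector_def smult_one split: if_splits)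

lemma basis_finspan: "x \<in> carrier A \<Longrightarrow> basis_vector x \<in> finspan"
  by (auto simp: finspan_def basis_vector_def)

text \<open>\<open>lincomb\<close> is a linear surjection, so it splits over a field: a complement
  of its kernel inside \<open>finspan\<close> is a copy of the algebra as a space of
  functions.\<close>

lemma linear_section:
  obtains \<iota> :: "'a \<Rightarrow> 'a \<Rightarrow> 'f" and r :: "('a \<Rightarrow> 'f) \<Rightarrow> 'a"
  where "\<And>f. r f \<in> carrier A" "\<And>x. x \<in> carrier A \<Longrightarrow> r (\<iota> x) = x"
    "\<And>f g. r (f + g) = r f \<oplus> r g" "\<And>c f. r (\<lambda>x. c * f x) = c \<odot> r f"
    "\<And>x y. x \<in> carrier A \<Longrightarrow> y \<in> carrier A \<Longrightarrow> \<iota> (x \<oplus> y) = \<iota> x + \<iota> y"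
    "\<And>c x. x \<in> carrier A \<Longrightarrow> \<iota> (c \<odot> x) = (\<lambda>y. c * \<iota> x y)"
proof -
  define K where "K = {f \<in> finspan. lincomb f = \<zero>}"
  have K: "funs.subspace K"
  proof (rule funs.subspaceI)
    have "lincomb (\<lambda>x. 0) = \<zero>" unfolding lincomb_def by simp
    then show "0 \<in> K" using funs.subspace_0[OF subspace_finspan] by (simp add: K_def zero_fun_def)
  next
    fix f g assume "f \<in> K" "g \<in> K"
    then show "f + g \<in> K"
      using funs.subspace_add[OF subspace_finspan, of f g] by (simp add: K_def lincomb_add)
  next
    fix c f assume "f \<in> K"
    moreover have "c \<odot> \<zero> = \<zero>"
      using smult_smult[of \<one> c 0] by (simp add: smult_zero)
    ultimately show "(\<lambda>x. c * f x) \<in> K"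
      using funs.subspace_scale[OF subspace_finspan, of f c] by (auto simp: K_def lincomb_smult)
  qed
  obtain g where g: "\<And>f. g f \<in> finspan" "\<And>f. f \<in> finspan \<Longrightarrow> g f = f"
      "\<And>f f'. g (f + f') = g f + g f'" "\<And>c f. g (\<lambda>x. c * f x) = (\<lambda>x. c * g f x)"
    using linear_projection[OF subspace_finspan] by blast
  obtain k where k: "\<And>f. k f \<in> K" "\<And>f. f \<in> K \<Longrightarrow> k f = f"
      "\<And>f f'. k (f + f') = k f + k f'" "\<And>c f. k (\<lambda>x. c * f x) = (\<lambda>x. c * k f x)"
    using linear_projection[OF K] by blast
  \<comment> \<open>\<open>g\<close> cuts all functions down to \<open>finspan\<close> and
    \<open>k\<close> projects onto the kernel of \<open>lincomb\<close>, so \<open>pr\<close>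
    projects onto a complement of the kernel.\<close>
  define pr where "pr f = g f - k (g f)" for f
  have kg: "k f \<in> finspan" for f using k(1)[of f] by (simp add: K_def)
  have pr_fs: "pr f \<in> finspan" for f
    unfolding pr_def using funs.subspace_diff[OF subspace_finspan g(1) kg] .
  have pr_add: "pr (f + f') = pr f + pr f'" for f f'
    by (simp add: pr_def g(3) k(3))
  have pr_scale: "pr (\<lambda>x. c * f x) = (\<lambda>x. c * pr f x)" for c f
    by (simp add: pr_def g(4) k(4) fun_eq_iff algebra_simps)
  have pr_K: "pr f = 0" if "f \<in> K" for f
    using that by (simp add: pr_def g(2) k(2) K_def)
  have pr_diff: "pr (f - f') = pr f - pr f'" for f f'
    using pr_add[of "f - f'" f'] by (simp add: algebra_simps)
  have lc_neg: "lincomb (- f) = \<ominus> lincomb f" if "f \<in> finspan" for f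
    using lincomb_smult[OF that, of "-1"] that
    by (simp add: lincomb_closed smult_minus fun_Compl_def)
  have lc_diff: "lincomb (f - f') = lincomb f \<ominus> lincomb f'" if "f \<in> finspan" "f' \<in> finspan" for f f'
    using lincomb_add[of f "- f'"] lc_neg[of f'] that funs.subspace_neg[OF subspace_finspan, of f']
    by (simp add: a_minus_def)
  have lc_pr: "lincomb (pr f) = lincomb f" if "f \<in> finspan" for f
  proof -
    have "lincomb (k (g f)) = \<zero>" using k(1)[of "g f"] by (simp add: K_def)
    then show ?thesis
      using that by (simp add: pr_def lc_diff g kg lincomb_closed a_minus_def)
  qed
  \<comment> \<open>\<open>pr\<close> depends only on the value of \<open>lincomb\<close>; this
    makes the basis vectors additive and homogeneous after projection.\<close>
  have pr_eq: "pr f = pr f'" if "f \<in> finspan" "f' \<in> finspan" "lincomb f = lincomb f'" for f f'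
  proof -
    have "f - f' \<in> K"
      using that funs.subspace_diff[OF subspace_finspan that(1,2)]
      by (simp add: K_def lc_diff lincomb_closed a_minus_def r_neg)
    then show ?thesis using pr_K pr_diff[of f f'] by simp
  qed
  show ?thesis
  proof (rule that[of "\<lambda>f. lincomb (pr f)" "\<lambda>x. pr (basis_vector x)"])
    show "lincomb (pr f) \<in> carrier A" for f by (simp add: lincomb_closed pr_fs)
    show "lincomb (pr (pr (basis_vector x))) = x" if "x \<in> carrier A" for x
      using that by (simp add: lc_pr pr_fs basis_finspan lincomb_basis)
    show "lincomb (pr (f + g)) = lincomb (pr f) \<oplus> lincomb (pr g)" for f g
      by (simp add: pr_add lincomb_add pr_fs)
    show "lincomb (pr (\<lambda>x. c * f x)) = c \<odot> lincomb (pr f)" for c f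
      by (simp add: pr_scale lincomb_smult pr_fs)
    show "pr (basis_vector (x \<oplus> y)) = pr (basis_vector x) + pr (basis_vector y)"
      if "x \<in> carrier A" "y \<in> carrier A" for x y
    proof -
      have "pr (basis_vector (x \<oplus> y)) = pr (basis_vector x + basis_vector y)"
        using that by (intro pr_eq)
          (simp_all add: basis_finspan lincomb_add lincomb_basis funs.subspace_add[OF subspace_finspan])
      then show ?thesis by (simp add: pr_add)
    qed
    show "pr (basis_vector (c \<odot> x)) = (\<lambda>y. c * pr (basis_vector x) y)" if "x \<in> carrier A" for c x
    proof -
      have "pr (basis_vector (c \<odot> x)) = pr (\<lambda>y. c * basis_vector x y)"
        using that by (intro pr_eq)
          (simp_all add: basis_finspan lincomb_smult lincomb_basis funs.subspace_scale[OF subspace_finspan])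
      then show ?thesis by (simp add: pr_scale)
    qed
  qed
qed

text \<open>The left regular representation, conjugated by the linear section: \<open>h x\<close> is
  \<open>\<iota>\<close> after multiplication by \<open>x\<close> after \<open>r\<close>. Applying
  it to \<open>\<iota> \<one>\<close> recovers \<open>\<iota> x\<close>, which gives injectivity.
  The unit goes to the projection \<open>\<iota>\<close> after \<open>r\<close>, not to the
  identity.\<close>

lemma faithful_representation:
  obtains p and h :: "'a \<Rightarrow> ('a, 'f) endo" where "alg_rep A p h" "inj_on h (carrier A)"
proof -
  obtain \<iota> :: "'a \<Rightarrow> 'a \<Rightarrow> 'f" and r :: "('a \<Rightarrow> 'f) \<Rightarrow> 'a" where
    s: "\<And>f. r f \<in> carrier A" "\<And>x. x \<in> carrier A \<Longrightarrow> r (\<iota> x) = x"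
    "\<And>f g. r (f + g) = r f \<oplus> r g" "\<And>c f. r (\<lambda>x. c * f x) = c \<odot> r f"
    "\<And>x y. x \<in> carrier A \<Longrightarrow> y \<in> carrier A \<Longrightarrow> \<iota> (x \<oplus> y) = \<iota> x + \<iota> y"
    "\<And>c x. x \<in> carrier A \<Longrightarrow> \<iota> (c \<odot> x) = (\<lambda>y. c * \<iota> x y)"
    by (rule linear_section) blast
  define h where "h x = Abs_endo (\<lambda>f. \<iota> (x \<otimes> r f))" for x
  have h: "Rep_endo (h x) = (\<lambda>f. \<iota> (x \<otimes> r f))" if "x \<in> carrier A" for x
    unfolding h_def using that
    by (subst Abs_endo_inverse) (auto simp: s r_distr smult_mult_right)
  have rep: "alg_rep A (h \<one>) h"
    unfolding alg_rep_def
  proof (intro conjI ballI allI)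
    fix x y assume xy: "x \<in> carrier A" "y \<in> carrier A"
    show "h (x \<oplus> y) = h x + h y"
      using xy by (simp add: Rep_endo_inject[symmetric] plus_endo.rep_eq h s l_distr fun_eq_iff)
    show "h (x \<otimes> y) = h x * h y"
      using xy by (simp add: Rep_endo_inject[symmetric] times_endo.rep_eq h s m_assoc fun_eq_iff)
  next
    fix c x assume "x \<in> carrier A"
    then show "h (c \<odot> x) = c *\<^sub>s h x"
      by (simp add: Rep_endo_inject[symmetric] scl.rep_eq h s smult_mult_left)
  qed simp
  have "inj_on h (carrier A)"
  proof (rule inj_onI)
    fix x y assume xy: "x \<in> carrier A" "y \<in> carrier A" "h x = h y"
    then have "\<iota> (x \<otimes> r (\<iota> \<one>)) = \<iota> (y \<otimes> r (\<iota> \<one>))"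
      using h[of x] h[of y] by metis
    then have "\<iota> x = \<iota> y" using xy by (simp add: s)
    then show "x = y" using s(2) xy by metis
  qed
  with rep that show ?thesis by blast
qed

end

section \<open>Universal properties of monoid algebras, quotients, presentations and tensor
  products\<close>

section \<open>Monoid algebras, quotients and presentations\<close>

lemma monoid_algebra_simps:
  "carrier (monoid_algebra M) = {f. finite {x. f x \<noteq> 0} \<and> {x. f x \<noteq> 0} \<subseteq> carrier M}"
  "f \<oplus>\<^bsub>monoid_algebra M\<^esub> g = (\<lambda>x. f x + g x)"
  "\<zero>\<^bsub>monoid_algebra M\<^esub> = (\<lambda>x. 0)"
  "\<one>\<^bsub>monoid_algebra M\<^esub> = basis_vector \<one>\<^bsub>M\<^esub>"
  "c \<odot>\<^bsub>monoid_algebra M\<^esub> f = (\<lambda>x. c * f x)"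
  by (auto simp: monoid_algebra_def basis_vector_def fun_eq_iff)

lemma monoid_algebra_mult:
  assumes "finite X" "finite Y" "{x. f x \<noteq> 0} \<subseteq> X" "{y. g y \<noteq> 0} \<subseteq> Y"
  shows "(f \<otimes>\<^bsub>monoid_algebra M\<^esub> g) z = (\<Sum>x\<in>X. \<Sum>y\<in>Y. if x \<otimes>\<^bsub>M\<^esub> y = z then f x * g y else 0)"
proof -
  have "(f \<otimes>\<^bsub>monoid_algebra M\<^esub> g) z =
      (\<Sum>(x, y)\<in>{(x, y). f x \<noteq> 0 \<and> g y \<noteq> 0 \<and> x \<otimes>\<^bsub>M\<^esub> y = z}. f x * g y)"
    by (simp add: monoid_algebra_def)
  also have "\<dots> = (\<Sum>(x, y)\<in>X \<times> Y. if x \<otimes>\<^bsub>M\<^esub> y = z then f x * g y else 0)"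
    using assms by (intro sum.mono_neutral_cong_left) (auto split: if_splits)
  finally show ?thesis by (simp add: sum.cartesian_product)
qed

lemma monoid_algebra_mult_support:
  "{z. (f \<otimes>\<^bsub>monoid_algebra M\<^esub> g) z \<noteq> 0} \<subseteq> (\<lambda>(x, y). x \<otimes>\<^bsub>M\<^esub> y) ` ({x. f x \<noteq> 0} \<times> {y. g y \<noteq> 0})"
proof
  fix z assume "z \<in> {z. (f \<otimes>\<^bsub>monoid_algebra M\<^esub> g) z \<noteq> 0}"
  then have "(\<Sum>(x, y)\<in>{(x, y). f x \<noteq> 0 \<and> g y \<noteq> 0 \<and> x \<otimes>\<^bsub>M\<^esub> y = z}. f x * g y) \<noteq> 0"
    by (simp add: monoid_algebra_def)
  then have "{(x, y). f x \<noteq> 0 \<and> g y \<noteq> 0 \<and> x \<otimes>\<^bsub>M\<^esub> y = z} \<noteq> {}" by force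
  then show "z \<in> (\<lambda>(x, y). x \<otimes>\<^bsub>M\<^esub> y) ` ({x. f x \<noteq> 0} \<times> {y. g y \<noteq> 0})" by force
qed

text \<open>Integrates any family of additive maps against a convolution. Both halves of
  associativity and the multiplicativity of \<open>linear_extension\<close> are instances, for
  different choices of \<open>\<mu>\<close>.\<close>

lemma linear_extension_mult:
  fixes \<mu> :: "'m \<Rightarrow> 'f::field \<Rightarrow> 'b::comm_monoid_add"
  assumes "finite X" "finite Y" "{x. f x \<noteq> (0::'f)} \<subseteq> X" "{y. g y \<noteq> 0} \<subseteq> Y" "finite Z"
    "(\<lambda>(x, y). x \<otimes>\<^bsub>M\<^esub> y) ` (X \<times> Y) \<subseteq> Z"
    "\<And>z. \<mu> z 0 = 0" "\<And>z a b. \<mu> z (a + b) = \<mu> z a + \<mu> z b"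
  shows "(\<Sum>z\<in>Z. \<mu> z ((f \<otimes>\<^bsub>monoid_algebra M\<^esub> g) z)) = (\<Sum>x\<in>X. \<Sum>y\<in>Y. \<mu> (x \<otimes>\<^bsub>M\<^esub> y) (f x * g y))"
proof -
  have \<mu>_sum: "\<mu> z (sum F S) = (\<Sum>i\<in>S. \<mu> z (F i))" for z S and F :: "_ \<Rightarrow> 'f"
    by (induction S rule: infinite_finite_induct) (simp_all add: assms)
  have "(\<Sum>z\<in>Z. \<mu> z ((f \<otimes>\<^bsub>monoid_algebra M\<^esub> g) z)) =
      (\<Sum>z\<in>Z. \<Sum>x\<in>X. \<Sum>y\<in>Y. \<mu> z (if x \<otimes>\<^bsub>M\<^esub> y = z then f x * g y else 0))"
    using assms by (simp add: monoid_algebra_mult[of X Y] \<mu>_sum)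
  also have "\<dots> = (\<Sum>x\<in>X. \<Sum>y\<in>Y. \<Sum>z\<in>Z. \<mu> z (if x \<otimes>\<^bsub>M\<^esub> y = z then f x * g y else 0))"
    by (subst sum.swap[of _ X Z]) (intro sum.cong refl sum.swap)
  also have "\<dots> = (\<Sum>x\<in>X. \<Sum>y\<in>Y. \<mu> (x \<otimes>\<^bsub>M\<^esub> y) (f x * g y))"
  proof (intro sum.cong refl)
    fix x y assume "x \<in> X" "y \<in> Y"
    then have "x \<otimes>\<^bsub>M\<^esub> y \<in> Z" using assms by blast
    have "(\<Sum>z\<in>Z. \<mu> z (if x \<otimes>\<^bsub>M\<^esub> y = z then f x * g y else 0)) =
        (\<Sum>z\<in>Z. if x \<otimes>\<^bsub>M\<^esub> y = z then \<mu> z (f x * g y) else 0)"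
      by (intro sum.cong) (auto simp: assms)
    then show "(\<Sum>z\<in>Z. \<mu> z (if x \<otimes>\<^bsub>M\<^esub> y = z then f x * g y else 0)) = \<mu> (x \<otimes>\<^bsub>M\<^esub> y) (f x * g y)"
      using \<open>x \<otimes>\<^bsub>M\<^esub> y \<in> Z\<close> \<open>finite Z\<close> by simp
  qed
  finally show ?thesis .
qed

lemma monoid_algebra_closed:
  assumes "monoid M" "f \<in> carrier (monoid_algebra M)" "g \<in> carrier (monoid_algebra M)"
  shows "f \<otimes>\<^bsub>monoid_algebra M\<^esub> g \<in> carrier (monoid_algebra M)"
proof -
  interpret monoid M by fact
  let ?S = "(\<lambda>(x, y). x \<otimes>\<^bsub>M\<^esub> y) ` ({x. f x \<noteq> 0} \<times> {y. g y \<noteq> 0})"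
  have "finite ?S" "?S \<subseteq> carrier M" using assms(2,3) by (auto simp: monoid_algebra_simps)
  then show ?thesis
    using monoid_algebra_mult_support[of M f g] unfolding monoid_algebra_simps
    by (blast intro: finite_subset)
qed

lemma monoid_algebra_assoc:
  assumes M: "monoid M" and f: "f \<in> carrier (monoid_algebra M)" and g: "g \<in> carrier (monoid_algebra M)"
    and h: "h \<in> carrier (monoid_algebra M)"
  shows "(f \<otimes>\<^bsub>monoid_algebra M\<^esub> g) \<otimes>\<^bsub>monoid_algebra M\<^esub> h = f \<otimes>\<^bsub>monoid_algebra M\<^esub> (g \<otimes>\<^bsub>monoid_algebra M\<^esub> h)"
proof
  fix z
  interpret monoid M by fact
  let ?mul = "\<lambda>f g. f \<otimes>\<^bsub>monoid_algebra M\<^esub> g"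
  define X where "X = {x. f x \<noteq> 0}"
  define Y where "Y = {x. g x \<noteq> 0}"
  define W where "W = {x. h x \<noteq> 0}"
  have fin: "finite X" "finite Y" "finite W" and car: "X \<subseteq> carrier M" "Y \<subseteq> carrier M" "W \<subseteq> carrier M"
    using f g h by (auto simp: X_def Y_def W_def monoid_algebra_simps)
  let ?Z = "(\<lambda>(x, y). x \<otimes>\<^bsub>M\<^esub> y) ` (X \<times> Y)" and ?Z' = "(\<lambda>(x, y). x \<otimes>\<^bsub>M\<^esub> y) ` (Y \<times> W)"
  have "?mul (?mul f g) h z = (\<Sum>u\<in>?Z. \<Sum>w\<in>W. if u \<otimes>\<^bsub>M\<^esub> w = z then ?mul f g u * h w else 0)"
    using fin monoid_algebra_mult_support[of M f g]
    by (intro monoid_algebra_mult) (auto simp: X_def Y_def W_def)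
  also have "\<dots> = (\<Sum>x\<in>X. \<Sum>y\<in>Y. \<Sum>w\<in>W. if (x \<otimes>\<^bsub>M\<^esub> y) \<otimes>\<^bsub>M\<^esub> w = z then (f x * g y) * h w else 0)"
    using fin
    by (intro linear_extension_mult[where \<mu> = "\<lambda>u c. \<Sum>w\<in>W. if u \<otimes>\<^bsub>M\<^esub> w = z then c * h w else 0"])
      (auto simp: X_def Y_def algebra_simps sum.distrib[symmetric] cong: if_cong intro!: sum.cong)
  also have "\<dots> = (\<Sum>x\<in>X. \<Sum>y\<in>Y. \<Sum>w\<in>W. if x \<otimes>\<^bsub>M\<^esub> (y \<otimes>\<^bsub>M\<^esub> w) = z then f x * (g y * h w) else 0)"
    using car by (intro sum.cong refl) (auto simp: m_assoc subset_iff mult.assoc)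
  also have "\<dots> = (\<Sum>x\<in>X. \<Sum>u\<in>?Z'. if x \<otimes>\<^bsub>M\<^esub> u = z then f x * ?mul g h u else 0)"
    using fin
    by (intro sum.cong refl linear_extension_mult[symmetric,
          where \<mu> = "\<lambda>u c. if x \<otimes>\<^bsub>M\<^esub> u = z then f x * c else 0" for x])
      (auto simp: Y_def W_def algebra_simps)
  also have "\<dots> = ?mul f (?mul g h) z"
    using fin monoid_algebra_mult_support[of M g h]
    by (intro monoid_algebra_mult[symmetric]) (auto simp: X_def Y_def W_def)
  finally show "?mul (?mul f g) h z = ?mul f (?mul g h) z" .
qed

lemma basis_vector_carrier [simp]: "x \<in> carrier M \<Longrightarrow> basis_vector x \<in> carrier (monoid_algebra M)"
  by (auto simp: monoid_algebra_simps basis_vector_def)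

lemma basis_vector_mult [simp]:
  "basis_vector x \<otimes>\<^bsub>monoid_algebra M\<^esub> basis_vector y = basis_vector (x \<otimes>\<^bsub>M\<^esub> y)"
proof
  fix z
  show "(basis_vector x \<otimes>\<^bsub>monoid_algebra M\<^esub> basis_vector y) z = basis_vector (x \<otimes>\<^bsub>M\<^esub> y) z"
    by (subst monoid_algebra_mult[of "{x}" "{y}"]) (auto simp: basis_vector_def)
qed

lemma falgebra_monoid_algebra:
  fixes M :: "'m monoid"
  assumes "monoid M"
  shows "falgebra (monoid_algebra M :: ('f::field, 'm \<Rightarrow> 'f) module)"
proof -
  interpret monoid M by fact
  let ?A = "monoid_algebra M :: ('f, 'm \<Rightarrow> 'f) module"
  have fin: "finite {x. f x + g x \<noteq> 0}" if "finite {x. f x \<noteq> 0}" "finite {x. g x \<noteq> 0}" for f g :: "'m \<Rightarrow> 'f"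
    by (rule finite_subset[of _ "{x. f x \<noteq> 0} \<union> {x. g x \<noteq> 0}"]) (use that in auto)
  have ag: "abelian_group ?A"
  proof (rule abelian_groupI)
    fix f assume f: "f \<in> carrier ?A"
    show "\<exists>y\<in>carrier ?A. y \<oplus>\<^bsub>?A\<^esub> f = \<zero>\<^bsub>?A\<^esub>"
      by (rule bexI[of _ "\<lambda>x. - f x"]) (use f in \<open>auto simp: monoid_algebra_simps\<close>)
  next
    fix f g assume "f \<in> carrier ?A" "g \<in> carrier ?A"
    moreover have "{x. f x + g x \<noteq> 0} \<subseteq> {x. f x \<noteq> 0} \<union> {x. g x \<noteq> 0}" by auto
    ultimately have "finite {x. f x + g x \<noteq> 0}" "{x. f x + g x \<noteq> 0} \<subseteq> carrier M"
      using fin[of f g] unfolding monoid_algebra_simps by blast+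
    then show "f \<oplus>\<^bsub>?A\<^esub> g \<in> carrier ?A" by (simp add: monoid_algebra_simps)
  qed (simp_all add: monoid_algebra_simps add.assoc, simp add: add.commute)
  have mult1: "basis_vector \<one>\<^bsub>M\<^esub> \<otimes>\<^bsub>?A\<^esub> f = f" "f \<otimes>\<^bsub>?A\<^esub> basis_vector \<one>\<^bsub>M\<^esub> = f"
    if "f \<in> carrier ?A" for f
  proof -
    have fin: "finite {x. f x \<noteq> 0}" and car: "\<And>x. f x \<noteq> 0 \<Longrightarrow> x \<in> carrier M"
      using that by (auto simp: monoid_algebra_simps)
    let ?X = "{x. f x \<noteq> 0}"
    have delta: "(\<Sum>y\<in>?X. if g y = z then f y else 0) = f z" if "\<And>y. y \<in> ?X \<Longrightarrow> g y = y" for g z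
    proof -
      have "(\<Sum>y\<in>?X. if g y = z then f y else 0) = (\<Sum>y\<in>?X. if z = y then f y else 0)"
        using that by (intro sum.cong) auto
      then show ?thesis using fin by (simp only: sum.delta') simp
    qed
    have "(basis_vector \<one>\<^bsub>M\<^esub> \<otimes>\<^bsub>?A\<^esub> f) z = f z" for z
      using fin car delta[of "\<lambda>y. \<one>\<^bsub>M\<^esub> \<otimes>\<^bsub>M\<^esub> y" z]
      by (subst monoid_algebra_mult[of "{\<one>\<^bsub>M\<^esub>}" ?X]) (auto simp: basis_vector_def)
    moreover have "(f \<otimes>\<^bsub>?A\<^esub> basis_vector \<one>\<^bsub>M\<^esub>) z = f z" for z
      using fin car delta[of "\<lambda>y. y \<otimes>\<^bsub>M\<^esub> \<one>\<^bsub>M\<^esub>" z]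
      by (subst monoid_algebra_mult[of ?X "{\<one>\<^bsub>M\<^esub>}"]) (auto simp: basis_vector_def)
    ultimately show "basis_vector \<one>\<^bsub>M\<^esub> \<otimes>\<^bsub>?A\<^esub> f = f" "f \<otimes>\<^bsub>?A\<^esub> basis_vector \<one>\<^bsub>M\<^esub> = f" by auto
  qed
  have mon: "Group.monoid ?A"
  proof (rule monoidI)
    show "\<one>\<^bsub>?A\<^esub> \<in> carrier ?A" by (simp add: monoid_algebra_simps(4))
  qed (auto simp: monoid_algebra_closed[OF assms] monoid_algebra_assoc[OF assms] monoid_algebra_simps(4) mult1)
  have distr: "(\<lambda>x. f x + g x) \<otimes>\<^bsub>?A\<^esub> h = (\<lambda>x. (f \<otimes>\<^bsub>?A\<^esub> h) x + (g \<otimes>\<^bsub>?A\<^esub> h) x)"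
     "h \<otimes>\<^bsub>?A\<^esub> (\<lambda>x. f x + g x) = (\<lambda>x. (h \<otimes>\<^bsub>?A\<^esub> f) x + (h \<otimes>\<^bsub>?A\<^esub> g) x)"
    if "f \<in> carrier ?A" "g \<in> carrier ?A" "h \<in> carrier ?A" for f g h
  proof -
    let ?X = "{x. f x \<noteq> 0} \<union> {x. g x \<noteq> 0}" and ?Y = "{x. h x \<noteq> 0}"
    have "finite ?X" "finite ?Y" using that by (auto simp: monoid_algebra_simps)
    moreover have "{x. f x + g x \<noteq> 0} \<subseteq> ?X" by auto
    moreover have "(if b then (u + v) * w else 0) = (if b then u * w else 0) + (if b then v * w else 0)"
      "(if b then w * (u + v) else 0) = (if b then w * u else 0) + (if b then w * v else 0)" for b and u v w :: 'f
      by (simp_all add: distrib_left distrib_right)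
    ultimately show "(\<lambda>x. f x + g x) \<otimes>\<^bsub>?A\<^esub> h = (\<lambda>x. (f \<otimes>\<^bsub>?A\<^esub> h) x + (g \<otimes>\<^bsub>?A\<^esub> h) x)"
      "h \<otimes>\<^bsub>?A\<^esub> (\<lambda>x. f x + g x) = (\<lambda>x. (h \<otimes>\<^bsub>?A\<^esub> f) x + (h \<otimes>\<^bsub>?A\<^esub> g) x)"
      by (simp_all add: fun_eq_iff monoid_algebra_mult[of ?X ?Y] monoid_algebra_mult[of ?Y ?X] sum.distrib)
  qed
  have scale: "(\<lambda>x. c * f x) \<otimes>\<^bsub>?A\<^esub> h = (\<lambda>x. c * (f \<otimes>\<^bsub>?A\<^esub> h) x)"
     "h \<otimes>\<^bsub>?A\<^esub> (\<lambda>x. c * f x) = (\<lambda>x. c * (h \<otimes>\<^bsub>?A\<^esub> f) x)"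
    if "f \<in> carrier ?A" "h \<in> carrier ?A" for f h c
  proof -
    let ?X = "{x. f x \<noteq> 0}" and ?Y = "{x. h x \<noteq> 0}"
    have "finite ?X" "finite ?Y" using that by (auto simp: monoid_algebra_simps)
    moreover have "{x. c * f x \<noteq> 0} \<subseteq> ?X" by auto
    moreover have "(if b then c * u * v else 0) = c * (if b then u * v else 0)"
      "(if b then v * (c * u) else 0) = c * (if b then v * u else 0)" for b and u v :: 'f
      by simp_all
    ultimately show "(\<lambda>x. c * f x) \<otimes>\<^bsub>?A\<^esub> h = (\<lambda>x. c * (f \<otimes>\<^bsub>?A\<^esub> h) x)"
      "h \<otimes>\<^bsub>?A\<^esub> (\<lambda>x. c * f x) = (\<lambda>x. c * (h \<otimes>\<^bsub>?A\<^esub> f) x)"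
      by (simp_all add: fun_eq_iff monoid_algebra_mult[of ?X ?Y] monoid_algebra_mult[of ?Y ?X]
          sum_distrib_left)
  qed
  interpret A: ring ?A
    by (rule ringI[OF ag mon]) (auto simp: monoid_algebra_simps(2) distr)
  show ?thesis
  proof
    show "c \<odot>\<^bsub>?A\<^esub> x \<in> carrier ?A" if "x \<in> carrier ?A" for c x
    proof -
      have "{y. c * x y \<noteq> 0} \<subseteq> {y. x y \<noteq> 0}" by auto
      then show ?thesis using that by (auto simp: monoid_algebra_simps intro: finite_subset)
    qed
  next
    fix x y :: "'m \<Rightarrow> 'f" and c assume "x \<in> carrier ?A" "y \<in> carrier ?A"
    then show "(c \<odot>\<^bsub>?A\<^esub> x) \<otimes>\<^bsub>?A\<^esub> y = c \<odot>\<^bsub>?A\<^esub> (x \<otimes>\<^bsub>?A\<^esub> y)"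
      "x \<otimes>\<^bsub>?A\<^esub> (c \<odot>\<^bsub>?A\<^esub> y) = c \<odot>\<^bsub>?A\<^esub> (x \<otimes>\<^bsub>?A\<^esub> y)"
      unfolding monoid_algebra_simps(5) using scale[of x y] scale[of y x] by blast+
  qed (simp_all only: monoid_algebra_simps(2,5) distrib_left distrib_right mult.assoc mult_1)
qed

lemma monoid_algebra_induct [consumes 1, case_names basis add smult zero]:
  fixes M :: "'m monoid" and f :: "'m \<Rightarrow> 'f::field"
  assumes "f \<in> carrier (monoid_algebra M)"
    and "\<And>x. x \<in> carrier M \<Longrightarrow> P (basis_vector x)"
    and "\<And>f g. f \<in> carrier (monoid_algebra M) \<Longrightarrow> g \<in> carrier (monoid_algebra M) \<Longrightarrow> P f \<Longrightarrow> P g \<Longrightarrow> P (\<lambda>x. f x + g x)"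
    and "\<And>c f. f \<in> carrier (monoid_algebra M) \<Longrightarrow> P f \<Longrightarrow> P (\<lambda>x. c * f x)"
    and "P (\<lambda>x. 0)"
  shows "P f"
proof -
  have "\<forall>f. {x. f x \<noteq> 0} \<subseteq> X \<longrightarrow> P f" if "finite X" "X \<subseteq> carrier M" for X
    using that
  proof (induction X rule: finite_induct)
    case empty
    then show ?case using assms(5) by (auto simp: fun_eq_iff intro: back_subst[of P])
  next
    case (insert x X)
    show ?case
    proof (intro allI impI)
      fix f :: "'m \<Rightarrow> 'f" assume f: "{y. f y \<noteq> 0} \<subseteq> insert x X"
      have fin: "finite {y. (f(x := 0)) y \<noteq> 0}"
        by (rule finite_subset[OF _ insert.hyps(1)]) (use f in auto)
      have "P (\<lambda>y. (f(x := 0)) y + f x * basis_vector x y)"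
      proof (rule assms(3))
        have "{y. (f(x := 0)) y \<noteq> 0} \<subseteq> X" using f by auto
        then show "P (f(x := 0))" using insert.IH insert.prems by blast
        show "P (\<lambda>y. f x * basis_vector x y)" using insert assms(2,4) by auto
        show "f(x := 0) \<in> carrier (monoid_algebra M)"
          using fin f insert.prems by (auto simp: monoid_algebra_simps)
        show "(\<lambda>y. f x * basis_vector x y) \<in> carrier (monoid_algebra M)"
          using insert.prems by (auto simp: monoid_algebra_simps basis_vector_def)
      qed
      moreover have "(\<lambda>y. (f(x := 0)) y + f x * basis_vector x y) = f"
          by (rule ext) (simp add: basis_vector_def)
      ultimately show "P f" by (rule back_subst[of P])
    qed
  qed
  then show ?thesis using assms(1) by (auto simp: monoid_algebra_simps)
qed

definition linear_extension :: "('m \<Rightarrow> ('x, 'f::field) endo) \<Rightarrow> ('m \<Rightarrow> 'f) \<Rightarrow> ('x, 'f) endo" where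
  "linear_extension \<mu> f = (\<Sum>x | f x \<noteq> 0. f x *\<^sub>s \<mu> x)"

lemma linear_extension_eq:
  "finite X \<Longrightarrow> {x. f x \<noteq> 0} \<subseteq> X \<Longrightarrow> linear_extension \<mu> f = (\<Sum>x\<in>X. f x *\<^sub>s \<mu> x)"
  unfolding linear_extension_def by (intro sum.mono_neutral_cong_left) auto

lemma linear_extension_basis [simp]: "linear_extension \<mu> (basis_vector x) = \<mu> x"
  by (subst linear_extension_eq[of "{x}"]) (auto simp: basis_vector_def)

lemma alg_rep_linear_extension:
  fixes M :: "'m monoid" and \<mu> :: "'m \<Rightarrow> ('x, 'f::field) endo"
  assumes "monoid M" "\<And>x y. x \<in> carrier M \<Longrightarrow> y \<in> carrier M \<Longrightarrow> \<mu> (x \<otimes>\<^bsub>M\<^esub> y) = \<mu> x * \<mu> y"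
  shows "alg_rep (monoid_algebra M) (\<mu> \<one>\<^bsub>M\<^esub>) (linear_extension \<mu>)"
  unfolding alg_rep_def
proof (intro conjI ballI allI)
  fix f g :: "'m \<Rightarrow> 'f" assume fg: "f \<in> carrier (monoid_algebra M)" "g \<in> carrier (monoid_algebra M)"
  let ?X = "{x. f x \<noteq> 0}" and ?Y = "{x. g x \<noteq> 0}"
  have fin: "finite ?X" "finite ?Y" and car: "?X \<subseteq> carrier M" "?Y \<subseteq> carrier M"
    using fg by (auto simp: monoid_algebra_simps)
  have "linear_extension \<mu> (\<lambda>x. f x + g x) = (\<Sum>x\<in>?X \<union> ?Y. (f x + g x) *\<^sub>s \<mu> x)"
    using fin by (intro linear_extension_eq) auto
  also have "\<dots> = (\<Sum>x\<in>?X \<union> ?Y. f x *\<^sub>s \<mu> x) + (\<Sum>x\<in>?X \<union> ?Y. g x *\<^sub>s \<mu> x)"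
    by (simp add: scl_simps sum.distrib)
  also have "\<dots> = linear_extension \<mu> f + linear_extension \<mu> g"
    using fin by (intro arg_cong2[where f = "(+)"] linear_extension_eq[symmetric]) auto
  finally show "linear_extension \<mu> (f \<oplus>\<^bsub>monoid_algebra M\<^esub> g) = linear_extension \<mu> f + linear_extension \<mu> g"
    by (simp add: monoid_algebra_simps)
  let ?Z = "(\<lambda>(x, y). x \<otimes>\<^bsub>M\<^esub> y) ` (?X \<times> ?Y)"
  have "linear_extension \<mu> (f \<otimes>\<^bsub>monoid_algebra M\<^esub> g) = (\<Sum>z\<in>?Z. (f \<otimes>\<^bsub>monoid_algebra M\<^esub> g) z *\<^sub>s \<mu> z)"
    using fin monoid_algebra_mult_support[of M f g] by (intro linear_extension_eq) auto
  also have "\<dots> = (\<Sum>x\<in>?X. \<Sum>y\<in>?Y. (f x * g y) *\<^sub>s \<mu> (x \<otimes>\<^bsub>M\<^esub> y))"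
    using fin by (intro linear_extension_mult[where \<mu> = "\<lambda>z c. c *\<^sub>s \<mu> z"]) (auto simp: scl_simps)
  also have "\<dots> = (\<Sum>x\<in>?X. \<Sum>y\<in>?Y. (f x *\<^sub>s \<mu> x) * (g y *\<^sub>s \<mu> y))"
    using car by (intro sum.cong refl) (auto simp: assms(2) subset_iff mult.commute)
  also have "\<dots> = linear_extension \<mu> f * linear_extension \<mu> g"
    by (simp add: linear_extension_def sum_product)
  finally show "linear_extension \<mu> (f \<otimes>\<^bsub>monoid_algebra M\<^esub> g) = linear_extension \<mu> f * linear_extension \<mu> g" .
next
  fix c and f :: "'m \<Rightarrow> 'f" assume f: "f \<in> carrier (monoid_algebra M)"
  then have "linear_extension \<mu> (\<lambda>x. c * f x) = (\<Sum>x | f x \<noteq> 0. (c * f x) *\<^sub>s \<mu> x)"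
    by (intro linear_extension_eq) (auto simp: monoid_algebra_simps)
  then show "linear_extension \<mu> (c \<odot>\<^bsub>monoid_algebra M\<^esub> f) = c *\<^sub>s linear_extension \<mu> f"
    by (simp add: monoid_algebra_simps linear_extension_def endo.scale_sum_right)
qed (simp add: monoid_algebra_simps)

subsection \<open>Quotients\<close>

locale quotient_alg = falgebra A + ideal J A for A :: "('f::field, 'a) module" (structure) and J
begin

text \<open>A ring ideal is automatically a subspace, because scalars act through multiplication by
  \<open>c \<odot> \<one>\<close>.\<close>

lemma smult_ideal: "j \<in> J \<Longrightarrow> c \<odot> j \<in> J"
  using I_l_closed[of j "c \<odot> \<one>"] a_Hcarr[of j] by (simp add: smult_mult_left)

lemma quotient_simps:
  "carrier (quotient_algebra A J) = (+>) J ` carrier A"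
  "\<one>\<^bsub>quotient_algebra A J\<^esub> = J +> \<one>"
  "x \<in> carrier A \<Longrightarrow> y \<in> carrier A \<Longrightarrow> (J +> x) \<oplus>\<^bsub>quotient_algebra A J\<^esub> (J +> y) = J +> (x \<oplus> y)"
  "x \<in> carrier A \<Longrightarrow> y \<in> carrier A \<Longrightarrow> (J +> x) \<otimes>\<^bsub>quotient_algebra A J\<^esub> (J +> y) = J +> (x \<otimes> y)"
  by (auto simp: quotient_algebra_def FactRing_simps rcoset_mult_add a_rcos_sum)

lemma quotient_smult:
  assumes x: "x \<in> carrier A"
  shows "c \<odot>\<^bsub>quotient_algebra A J\<^esub> (J +> x) = J +> (c \<odot> x)"
proof -
  have "J +> (c \<odot> y) = J +> (c \<odot> x)" if y: "y \<in> J +> x" for y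
  proof -
    obtain j where j: "j \<in> J" "y = j \<oplus> x"
      using y by (auto simp: a_r_coset_def r_coset_def)
    have "c \<odot> y = (c \<odot> j) \<oplus> (c \<odot> x)"
      using j x a_Hcarr[of j] by (simp add: smult_r_distr)
    then have "c \<odot> y \<in> J +> (c \<odot> x)"
      using smult_ideal[OF j(1)] by (auto simp: a_r_coset_def r_coset_def)
    then show ?thesis
      using x by (intro a_repr_independence[symmetric]) (auto intro: a_subgroup)
  qed
  moreover have "x \<in> J +> x" using x by (rule a_rcos_self)
  ultimately have "(\<Union>y\<in>J +> x. J +> (c \<odot> y)) = J +> (c \<odot> x)"
    by (intro UN_constant_eq) blast+
  then show ?thesis by (simp add: quotient_algebra_def)
qed

lemma falgebra_quotient: "falgebra (quotient_algebra A J)"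
proof -
  let ?Q = "quotient_algebra A J"
  interpret R: ring "A Quot J" by (rule quotient_is_ring)
  have sel: "carrier ?Q = carrier (A Quot J)" "\<one>\<^bsub>?Q\<^esub> = \<one>\<^bsub>A Quot J\<^esub>" "\<zero>\<^bsub>?Q\<^esub> = \<zero>\<^bsub>A Quot J\<^esub>"
    "(\<otimes>\<^bsub>?Q\<^esub>) = (\<otimes>\<^bsub>A Quot J\<^esub>)" "(\<oplus>\<^bsub>?Q\<^esub>) = (\<oplus>\<^bsub>A Quot J\<^esub>)"
    by (simp_all add: quotient_algebra_def)
  have "abelian_group ?Q"
  proof (rule abelian_groupI)
    fix x assume "x \<in> carrier ?Q"
    then show "\<exists>y\<in>carrier ?Q. y \<oplus>\<^bsub>?Q\<^esub> x = \<zero>\<^bsub>?Q\<^esub>"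
      using R.a_inv_closed[of x] R.l_neg[of x] by (auto simp: sel)
  qed (simp_all add: sel R.a_assoc, simp add: R.a_comm)
  moreover have "Group.monoid ?Q"
    by (rule monoidI) (simp_all add: sel R.m_assoc)
  ultimately have "ring ?Q"
    by (rule ringI) (simp_all add: sel R.l_distr R.r_distr)
  then interpret Q: ring ?Q .
  show ?thesis
    by standard
      (auto simp: quotient_simps quotient_smult smult_l_distr smult_r_distr smult_smult smult_one
        smult_mult_left smult_mult_right)
qed

lemma coset_eq_zero: "j \<in> J \<Longrightarrow> J +> j = \<zero>\<^bsub>quotient_algebra A J\<^esub>"
  using a_coset_join2[of j J] a_subgroup a_Hcarr by (simp add: quotient_algebra_def FactRing_def)

lemma alg_rep_coset:
  assumes "alg_rep (quotient_algebra A J) p h"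
  shows "alg_rep A p (\<lambda>x. h (J +> x))" "\<And>j. j \<in> J \<Longrightarrow> h (J +> j) = 0"
proof -
  interpret Q: representation "quotient_algebra A J" p h
    using falgebra_quotient assms by (simp add: representation_def representation_axioms_def)
  show "\<And>j. j \<in> J \<Longrightarrow> h (J +> j) = 0"
    by (simp add: coset_eq_zero)
  have car: "J +> x \<in> carrier (quotient_algebra A J)" if "x \<in> carrier A" for x
    using that by (simp add: quotient_simps)
  show "alg_rep A p (\<lambda>x. h (J +> x))"
    unfolding alg_rep_def
    by (simp add: quotient_simps(3,4)[symmetric] quotient_smult[symmetric] car
        quotient_simps(2)[symmetric])
qed

text \<open>Choosing a representative of each coset is harmless: two of them differ by an element of
  \<open>J\<close>, which \<open>h\<close> kills.\<close>

lemma alg_rep_quotient: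
  assumes "alg_rep A p h" "\<And>j. j \<in> J \<Longrightarrow> h j = 0"
  obtains h' where "alg_rep (quotient_algebra A J) p h'" "\<And>x. x \<in> carrier A \<Longrightarrow> h' (J +> x) = h x"
proof -
  interpret A: representation A p h
    using falgebra_axioms assms by (simp add: representation_def representation_axioms_def)
  define h' where "h' X = h (SOME x. x \<in> X)" for X
  have h': "h' (J +> x) = h x" if "x \<in> carrier A" for x
  proof -
    have "(SOME y. y \<in> J +> x) \<in> J +> x"
      by (rule someI[of _ x]) (rule a_rcos_self[OF that])
    then obtain j where "j \<in> J" "(SOME y. y \<in> J +> x) = j \<oplus> x"
      by (auto simp: a_r_coset_def r_coset_def)
    then show ?thesis using that assms(2)[of j] a_Hcarr[of j] by (simp add: h'_def)
  qed
  have "alg_rep (quotient_algebra A J) p h'"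
    unfolding alg_rep_def quotient_simps(1,2) using h'
    by (auto simp: quotient_simps quotient_smult)
  with h' that show ?thesis by blast
qed

end

lemma (in representation) kernel_ideal: "ideal {x \<in> carrier A. h x = 0} A"
proof (rule idealI)
  show "subgroup {x \<in> carrier A. h x = 0} (add_monoid A)"
    by (rule add.subgroupI) (auto simp: a_inv_def[symmetric] intro!: exI[of _ \<zero>])
qed (auto intro: ring_axioms)

text \<open>Reduces the test on a generated ideal to the relations themselves.\<close>

lemma (in representation) kernel_genideal:
  assumes "R \<subseteq> carrier A" "\<And>r. r \<in> R \<Longrightarrow> h r = 0" "x \<in> Idl R"
  shows "h x = 0"
  using genideal_minimal[OF kernel_ideal, of R] assms by auto

subsection \<open>Presented algebras\<close>

lemma monoid_word_monoid: "Group.monoid (word_monoid G)"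
  by (rule monoidI) (auto simp: word_monoid_def)

lemma falgebra_free: "falgebra (free_algebra G)"
  by (rule falgebra_monoid_algebra[OF monoid_word_monoid])

lemma word_monoid_simps [simp]:
  "carrier (word_monoid G) = lists G" "x \<otimes>\<^bsub>word_monoid G\<^esub> y = x @ y" "\<one>\<^bsub>word_monoid G\<^esub> = []"
  by (auto simp: word_monoid_def)

definition presented_gen :: "'g set \<Rightarrow> ('g list \<Rightarrow> 'f::field) set \<Rightarrow> 'g \<Rightarrow> ('g list \<Rightarrow> 'f) set" where
  "presented_gen G R g = Idl\<^bsub>free_algebra G\<^esub> R +>\<^bsub>free_algebra G\<^esub> basis_vector [g]"

lemma quotient_alg_genideal:
  "falgebra A \<Longrightarrow> R \<subseteq> carrier A \<Longrightarrow> quotient_alg A (Idl\<^bsub>A\<^esub> R)"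
  by (simp add: quotient_alg_def falgebra_def ring.genideal_ideal)

lemma falgebra_presented:
  assumes "R \<subseteq> carrier (free_algebra G)"
  shows "falgebra (presented_algebra G R)"
  unfolding presented_algebra_def
  using quotient_alg.falgebra_quotient[OF quotient_alg_genideal[OF falgebra_free assms]] .

text \<open>The images of the generators absorb \<open>p\<close> on both sides, so a leading factor
  \<open>p\<close> makes the empty word act as \<open>p\<close> and changes no other word.\<close>

lemma alg_rep_free:
  assumes "p * p = p" "\<And>g. g \<in> G \<Longrightarrow> p * \<phi> g = \<phi> g" "\<And>g. g \<in> G \<Longrightarrow> \<phi> g * p = \<phi> g"
  obtains h where "alg_rep (free_algebra G) p h" "\<And>g. g \<in> G \<Longrightarrow> h (basis_vector [g]) = \<phi> g"
proof -
  let ?\<mu> = "\<lambda>w. p * prod_list (map \<phi> w)"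
  have Cons: "?\<mu> (g # w) = \<phi> g * ?\<mu> w" if "g \<in> G" for g w
    using that by (simp add: assms(2,3) flip: mult.assoc)
  have absorb: "?\<mu> w * p = ?\<mu> w" if "w \<in> lists G" for w
    using that
  proof (induction w)
    case (Cons g w)
    then show ?case using \<open>\<And>w g. g \<in> G \<Longrightarrow> ?\<mu> (g # w) = \<phi> g * ?\<mu> w\<close>[of g w] by (simp only: mult.assoc)
  qed (simp add: assms)
  have "alg_rep (free_algebra G) (?\<mu> \<one>\<^bsub>word_monoid G\<^esub>) (linear_extension ?\<mu>)"
  proof (rule alg_rep_linear_extension[OF monoid_word_monoid])
    fix x y assume "x \<in> carrier (word_monoid G)" "y \<in> carrier (word_monoid G)"
    then show "?\<mu> (x \<otimes>\<^bsub>word_monoid G\<^esub> y) = ?\<mu> x * ?\<mu> y"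
      using absorb[of x] by (simp flip: mult.assoc)
  qed
  then show ?thesis by (intro that[of "linear_extension ?\<mu>"]) (simp_all add: assms)
qed

lemma presented_universal:
  assumes R: "R \<subseteq> carrier (free_algebra G)" and h: "alg_rep (free_algebra G) p h" and "\<And>r. r \<in> R \<Longrightarrow> h r = 0"
  obtains h' where "alg_rep (presented_algebra G R) p h'" "\<And>g. g \<in> G \<Longrightarrow> h' (presented_gen G R g) = h (basis_vector [g])"
proof -
  interpret F: representation "free_algebra G" p h
    using falgebra_free h by (simp add: representation_def representation_axioms_def)
  interpret quotient_alg "free_algebra G" "Idl\<^bsub>free_algebra G\<^esub> R"
    by (rule quotient_alg_genideal[OF falgebra_free R])
  obtain h' where "alg_rep (presented_algebra G R) p h'"
    "\<And>x. x \<in> carrier (free_algebra G) \<Longrightarrow> h' (Idl\<^bsub>free_algebra G\<^esub> R +>\<^bsub>free_algebra G\<^esub> x) = h x"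
    using alg_rep_quotient[OF h F.kernel_genideal[OF R assms(3)]] unfolding presented_algebra_def by blast
  then show ?thesis using that[of h'] by (simp add: presented_gen_def)
qed

text \<open>The converse of \<open>presented_universal\<close>: pulled back to the free algebra, a
  representation exhibits images of the generators that satisfy the relations.\<close>

lemma presented_relations:
  assumes R: "R \<subseteq> carrier (free_algebra G)" and h: "alg_rep (presented_algebra G R) p h"
  obtains h' where "alg_rep (free_algebra G) p h'" "\<And>r. r \<in> R \<Longrightarrow> h' r = 0"
    "\<And>g. h' (basis_vector [g]) = h (presented_gen G R g)"
proof -
  interpret falgebra "free_algebra G" by (rule falgebra_free)
  interpret quotient_alg "free_algebra G" "Idl\<^bsub>free_algebra G\<^esub> R"
    by (rule quotient_alg_genideal[OF falgebra_free R])
  show ?thesis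
    using alg_rep_coset[OF h[unfolded presented_algebra_def]] genideal_self[OF R]
    by (intro that) (auto simp: presented_gen_def)
qed

lemma presented_gen_closed:
  assumes "R \<subseteq> carrier (free_algebra G)" "g \<in> G"
  shows "presented_gen G R g \<in> carrier (presented_algebra G R)"
proof -
  interpret quotient_alg "free_algebra G" "Idl\<^bsub>free_algebra G\<^esub> R"
    by (rule quotient_alg_genideal[OF falgebra_free assms(1)])
  show ?thesis using assms by (simp add: presented_algebra_def presented_gen_def quotient_simps)
qed

lemma presented_induct [consumes 2, case_names one gen add mult smult]:
  assumes R: "R \<subseteq> carrier (free_algebra G)" and X: "X \<in> carrier (presented_algebra G R)"
    and one: "P \<one>\<^bsub>presented_algebra G R\<^esub>" and gen: "\<And>g. g \<in> G \<Longrightarrow> P (presented_gen G R g)"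
    and add: "\<And>x y. x \<in> carrier (presented_algebra G R) \<Longrightarrow> y \<in> carrier (presented_algebra G R) \<Longrightarrow>
        P x \<Longrightarrow> P y \<Longrightarrow> P (x \<oplus>\<^bsub>presented_algebra G R\<^esub> y)"
    and mult: "\<And>x y. x \<in> carrier (presented_algebra G R) \<Longrightarrow> y \<in> carrier (presented_algebra G R) \<Longrightarrow>
        P x \<Longrightarrow> P y \<Longrightarrow> P (x \<otimes>\<^bsub>presented_algebra G R\<^esub> y)"
    and smult: "\<And>c x. x \<in> carrier (presented_algebra G R) \<Longrightarrow> P x \<Longrightarrow> P (c \<odot>\<^bsub>presented_algebra G R\<^esub> x)"
  shows "P X"
proof -
  let ?F = "free_algebra G" and ?J = "Idl\<^bsub>free_algebra G\<^esub> R"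
  interpret quotient_alg ?F ?J
    by (rule quotient_alg_genideal[OF falgebra_free R])
  note simps = quotient_simps[folded presented_algebra_def] quotient_smult[folded presented_algebra_def]
  obtain f where f: "f \<in> carrier ?F" "X = ?J +>\<^bsub>?F\<^esub> f" using X unfolding simps by blast
  have word: "P (?J +>\<^bsub>?F\<^esub> basis_vector w)" if "w \<in> lists G" for w
    using that
  proof (induction w)
    case Nil
    then show ?case using one by (simp add: simps monoid_algebra_simps)
  next
    case (Cons g w)
    have "P ((?J +>\<^bsub>?F\<^esub> basis_vector [g]) \<otimes>\<^bsub>presented_algebra G R\<^esub> (?J +>\<^bsub>?F\<^esub> basis_vector w))"
      using Cons gen[of g] by (intro mult) (auto simp: simps presented_gen_def)
    then show ?case using Cons by (simp add: simps)
  qed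
  have "P (?J +>\<^bsub>?F\<^esub> f)"
    using f(1)
  proof (induction f rule: monoid_algebra_induct)
    case (basis w)
    then show ?case using word by simp
  next
    case (add f g)
    then have "P ((?J +>\<^bsub>?F\<^esub> f) \<oplus>\<^bsub>presented_algebra G R\<^esub> (?J +>\<^bsub>?F\<^esub> g))"
      by (intro assms(5)) (auto simp: simps)
    then show ?case using add by (simp add: simps monoid_algebra_simps(2))
  next
    case (smult c f)
    then have "P (c \<odot>\<^bsub>presented_algebra G R\<^esub> (?J +>\<^bsub>?F\<^esub> f))"
      by (intro assms(7)) (auto simp: simps)
    then show ?case using smult by (simp add: simps monoid_algebra_simps(5))
  next
    case zero
    have "P (0 \<odot>\<^bsub>presented_algebra G R\<^esub> \<one>\<^bsub>presented_algebra G R\<^esub>)"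
      using one by (intro assms(7)) (auto simp: simps)
    then show ?case by (simp add: simps monoid_algebra_simps(5))
  qed
  then show ?thesis using f by simp
qed

subsection \<open>Tensor products\<close>

lemma product_monoid_simps [simp]:
  "carrier (product_monoid K M) = (\<Pi>\<^sub>E k\<in>K. carrier (M k))"
  "x \<otimes>\<^bsub>product_monoid K M\<^esub> y = (\<lambda>k\<in>K. x k \<otimes>\<^bsub>M k\<^esub> y k)"
  "\<one>\<^bsub>product_monoid K M\<^esub> = (\<lambda>k\<in>K. \<one>\<^bsub>M k\<^esub>)"
  by (auto simp: product_monoid_def)

text \<open>The canonical map from the factor \<open>A k\<close>. These images generate the tensor
  product, and images from different factors commute; everything below uses the tensor product only
  through these facts.\<close>

definition tensor_gen :: "'i set \<Rightarrow> ('i \<Rightarrow> ('f::field, 'a) module) \<Rightarrow> 'i \<Rightarrow> 'a \<Rightarrow> (('i \<Rightarrow> 'a) \<Rightarrow> 'f) set" where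
  "tensor_gen K A k a = Idl\<^bsub>monoid_algebra (product_monoid K A)\<^esub> (multilinear_relations K A)
     +>\<^bsub>monoid_algebra (product_monoid K A)\<^esub> basis_vector ((\<lambda>l\<in>K. \<one>\<^bsub>A l\<^esub>)(k := a))"

locale tensor_factors =
  fixes K :: "'i set" and A :: "'i \<Rightarrow> ('f::field, 'a) module"
  assumes finite_K: "finite K" and falg: "k \<in> K \<Longrightarrow> falgebra (A k)"
begin

abbreviation "M \<equiv> product_monoid K A"
abbreviation "F \<equiv> monoid_algebra M :: ('f, ('i \<Rightarrow> 'a) \<Rightarrow> 'f) module"
abbreviation "J \<equiv> Idl\<^bsub>F\<^esub> (multilinear_relations K A)"
abbreviation "C \<equiv> tensor_algebra K A"

lemma ring: "k \<in> K \<Longrightarrow> ring (A k)"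
  using falg by (simp add: falgebra_def)

lemma monoid_A: "k \<in> K \<Longrightarrow> Group.monoid (A k)"
  using ring ring_def by blast

lemma monoid_M: "Group.monoid M"
proof (rule monoidI)
  fix x assume "x \<in> carrier M"
  then have x: "x \<in> (\<Pi>\<^sub>E k\<in>K. carrier (A k))" by simp
  show "\<one>\<^bsub>M\<^esub> \<otimes>\<^bsub>M\<^esub> x = x" "x \<otimes>\<^bsub>M\<^esub> \<one>\<^bsub>M\<^esub> = x"
    using x monoid.l_one[OF monoid_A] monoid.r_one[OF monoid_A]
    by (auto simp: PiE_iff extensional_def intro!: ext)
qed (auto simp: PiE_iff monoid.m_closed[OF monoid_A] monoid.one_closed[OF monoid_A] monoid.m_assoc[OF monoid_A] intro!: restrict_ext)

lemma falgebra_F: "falgebra F"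
  by (rule falgebra_monoid_algebra[OF monoid_M])

lemma upd_M: "x \<in> carrier M \<Longrightarrow> k \<in> K \<Longrightarrow> a \<in> carrier (A k) \<Longrightarrow> x(k := a) \<in> carrier M"
  by (auto simp: PiE_iff extensional_def)

lemma upd_basis: "x \<in> (\<Pi>\<^sub>E k\<in>K. carrier (A k)) \<Longrightarrow> k \<in> K \<Longrightarrow> a \<in> carrier (A k) \<Longrightarrow> basis_vector (x(k := a)) \<in> carrier F"
  using upd_M[of x k a] by (intro basis_vector_carrier) simp

lemma relations_carrier: "multilinear_relations K A \<subseteq> carrier F"
proof -
  interpret falgebra F by (rule falgebra_F)
  have "a \<oplus>\<^bsub>A k\<^esub> b \<in> carrier (A k)" "c \<odot>\<^bsub>A k\<^esub> a \<in> carrier (A k)"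
    if "k \<in> K" "a \<in> carrier (A k)" "b \<in> carrier (A k)" for k a b c
  proof -
    interpret A: falgebra "A k" by (rule falg) fact
    show "a \<oplus>\<^bsub>A k\<^esub> b \<in> carrier (A k)" "c \<odot>\<^bsub>A k\<^esub> a \<in> carrier (A k)" using that by auto
  qed
  then show ?thesis
    by (auto simp: multilinear_relations_def Let_def upd_basis simp del: product_monoid_simps)
qed

sublocale Q: quotient_alg F J
  by (rule quotient_alg_genideal[OF falgebra_F relations_carrier])

lemma falgebra_tensor: "falgebra C"
  unfolding tensor_algebra_def by (rule Q.falgebra_quotient)

lemma one_M: "(\<lambda>k\<in>K. \<one>\<^bsub>A k\<^esub>) \<in> carrier M"
  by (auto simp: monoid.one_closed[OF monoid_A])

lemma tensor_gen_closed: "k \<in> K \<Longrightarrow> a \<in> carrier (A k) \<Longrightarrow> tensor_gen K A k a \<in> carrier C"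
  using upd_M[OF one_M, of k a]
  by (auto simp: tensor_gen_def tensor_algebra_def Q.quotient_simps simp del: product_monoid_simps)

text \<open>A pure tensor is the product of the canonical images of its entries, and pure tensors
  span.\<close>

lemma tensor_induct [consumes 1, case_names one gen add mult smult]:
  assumes X: "X \<in> carrier C" and one: "P \<one>\<^bsub>C\<^esub>"
    and gen: "\<And>k a. k \<in> K \<Longrightarrow> a \<in> carrier (A k) \<Longrightarrow> P (tensor_gen K A k a)"
    and add: "\<And>x y. x \<in> carrier C \<Longrightarrow> y \<in> carrier C \<Longrightarrow> P x \<Longrightarrow> P y \<Longrightarrow> P (x \<oplus>\<^bsub>C\<^esub> y)"
    and mult: "\<And>x y. x \<in> carrier C \<Longrightarrow> y \<in> carrier C \<Longrightarrow> P x \<Longrightarrow> P y \<Longrightarrow> P (x \<otimes>\<^bsub>C\<^esub> y)"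
    and smult: "\<And>c x. x \<in> carrier C \<Longrightarrow> P x \<Longrightarrow> P (c \<odot>\<^bsub>C\<^esub> x)"
  shows "P X"
proof -
  note simps = Q.quotient_simps[folded tensor_algebra_def] Q.quotient_smult[folded tensor_algebra_def]
  obtain f where f: "f \<in> carrier F" "X = J +>\<^bsub>F\<^esub> f" using X unfolding simps by blast
  have tuple: "P (J +>\<^bsub>F\<^esub> basis_vector x)" if x: "x \<in> carrier M" for x
  proof -
    \<comment> \<open>The tuple \<open>x\<close> with the entries outside \<open>L\<close> replaced
      by units; enlarging \<open>L\<close> by \<open>k\<close> multiplies by one canonical
      image.\<close>
    define y where "y L = (\<lambda>k\<in>K. if k \<in> L then x k else \<one>\<^bsub>A k\<^esub>)" for L
    define u where "u = (\<lambda>l\<in>K. \<one>\<^bsub>A l\<^esub>)"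
    have "P (J +>\<^bsub>F\<^esub> basis_vector (y L))" if "L \<subseteq> K" for L
      using finite_subset[OF that finite_K] that
    proof (induction L rule: finite_induct)
      case empty
      show ?case using one by (simp only: simps monoid_algebra_simps product_monoid_simps y_def empty_iff if_False)
    next
      case (insert k L)
      have k: "k \<in> K" "x k \<in> carrier (A k)" using insert x by auto
      have y: "y L \<in> carrier M" using x by (auto simp: y_def monoid.one_closed[OF monoid_A])
      have z: "u(k := x k) \<in> carrier M" using upd_M[OF one_M k] by (simp add: u_def)
      have yz: "y L \<otimes>\<^bsub>M\<^esub> u(k := x k) = y (insert k L)"
      proof (rule ext)
        fix l
        show "(y L \<otimes>\<^bsub>M\<^esub> u(k := x k)) l = y (insert k L) l"
          using insert.hyps k x[unfolded product_monoid_simps PiE_iff]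
          by (auto simp: y_def u_def monoid.l_one[OF monoid_A] monoid.r_one[OF monoid_A] monoid.one_closed[OF monoid_A])
      qed
      have "P ((J +>\<^bsub>F\<^esub> basis_vector (y L)) \<otimes>\<^bsub>C\<^esub> (J +>\<^bsub>F\<^esub> basis_vector (u(k := x k))))"
        using insert gen[OF k] y z
        by (intro mult) (auto simp: simps tensor_gen_def u_def[symmetric] simp del: product_monoid_simps)
      then show ?case
        using y z yz by (simp add: simps del: product_monoid_simps)
    qed
    from this[OF subset_refl] show ?thesis
    proof (rule back_subst[of P])
      have "y K l = x l" for l using x by (cases "l \<in> K") (auto simp: y_def PiE_iff extensional_def)
      then show "J +>\<^bsub>F\<^esub> basis_vector (y K) = J +>\<^bsub>F\<^esub> basis_vector x" by (metis ext)
    qed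
  qed
  have "P (J +>\<^bsub>F\<^esub> f)"
    using f(1)
  proof (induction f rule: monoid_algebra_induct)
    case (basis w)
    then show ?case by (rule tuple)
  next
    case (add f g)
    then have "P ((J +>\<^bsub>F\<^esub> f) \<oplus>\<^bsub>C\<^esub> (J +>\<^bsub>F\<^esub> g))"
      by (intro assms(4)) (auto simp: simps)
    then show ?case using add by (simp add: simps monoid_algebra_simps(2))
  next
    case (smult c f)
    then have "P (c \<odot>\<^bsub>C\<^esub> (J +>\<^bsub>F\<^esub> f))"
      by (intro assms(6)) (auto simp: simps)
    then show ?case using smult by (simp add: simps monoid_algebra_simps(5))
  next
    case zero
    have "P (0 \<odot>\<^bsub>C\<^esub> \<one>\<^bsub>C\<^esub>)"
      using one by (intro assms(6)) (auto simp: simps)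
    then show ?case by (simp add: simps monoid_algebra_simps(5))
  qed
  then show ?thesis using f by simp
qed

text \<open>Commuting representations of the factors with a common unit \<open>p\<close> combine by
  multiplying the images of the entries of a tuple.\<close>

lemma tensor_universal:
  assumes "p * p = p" and h: "\<And>k. k \<in> K \<Longrightarrow> alg_rep (A k) p (h k)"
    and comm: "\<And>k l a b. k \<in> K \<Longrightarrow> l \<in> K \<Longrightarrow> k \<noteq> l \<Longrightarrow> a \<in> carrier (A k) \<Longrightarrow> b \<in> carrier (A l) \<Longrightarrow>
        h k a * h l b = h l b * h k a"
  obtains \<tau> where "alg_rep C p \<tau>" "\<And>k a. k \<in> K \<Longrightarrow> a \<in> carrier (A k) \<Longrightarrow> \<tau> (tensor_gen K A k a) = h k a"
proof -
  have hk: "representation (A k) p (h k)" if "k \<in> K" for k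
    using that h falg by (simp add: representation_def representation_axioms_def)
  note unit = representation.unit_left[OF hk] representation.unit_right[OF hk]
  \<comment> \<open>Products of endomorphisms need an order, so one enumeration of \<open>K\<close>
    is fixed; that the factors commute makes the ordered product multiplicative.\<close>
  obtain ks where ks: "distinct ks" "set ks = K" using finite_distinct_list[OF finite_K] by blast
  define pr where "pr ks x = p * prod_list (map (\<lambda>k. h k (x k)) ks)" for ks x
  have pr_Nil: "pr [] x = p" for x by (simp add: pr_def)
  have pr_Cons: "pr (k # ks) x = h k (x k) * pr ks x" if "k \<in> K" "x k \<in> carrier (A k)" for k ks x
    using that by (simp add: pr_def unit flip: mult.assoc)
  have pr_comm: "h k a * pr ks x = pr ks x * h k a"
    if "k \<in> K" "a \<in> carrier (A k)" "set ks \<subseteq> K - {k}" "\<And>l. l \<in> set ks \<Longrightarrow> x l \<in> carrier (A l)" for k a ks x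
    using that(3,4)
  proof (induction ks)
    case Nil
    then show ?case using that by (simp add: pr_Nil unit)
  next
    case (Cons l ks)
    have "h k a * pr (l # ks) x = h k a * h l (x l) * pr ks x"
      using Cons.prems by (simp add: pr_Cons mult.assoc)
    also have "\<dots> = h l (x l) * (h k a * pr ks x)"
      using Cons.prems that by (subst comm) (auto simp: mult.assoc)
    also have "\<dots> = pr (l # ks) x * h k a"
      using Cons by (simp add: pr_Cons mult.assoc)
    finally show ?case .
  qed
  have pr_mult: "pr ks (\<lambda>k. x k \<otimes>\<^bsub>A k\<^esub> y k) = pr ks x * pr ks y"
    if "distinct ks" "set ks \<subseteq> K" "\<And>l. l \<in> set ks \<Longrightarrow> x l \<in> carrier (A l)" "\<And>l. l \<in> set ks \<Longrightarrow> y l \<in> carrier (A l)" for ks x y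
    using that
  proof (induction ks)
    case (Cons k ks)
    have k: "k \<in> K" "x k \<in> carrier (A k)" "y k \<in> carrier (A k)" using Cons.prems by auto
    then interpret K: representation "A k" p "h k" by (intro hk)
    have "pr (k # ks) (\<lambda>k. x k \<otimes>\<^bsub>A k\<^esub> y k) = h k (x k) * (h k (y k) * pr ks x) * pr ks y"
      using k Cons by (simp add: pr_Cons mult.assoc)
    also have "h k (y k) * pr ks x = pr ks x * h k (y k)"
      using k Cons.prems by (intro pr_comm) auto
    finally show ?case using k by (simp add: pr_Cons mult.assoc)
  qed (simp add: pr_Nil assms)
  have pr_cong: "pr ks x = pr ks y" if "\<And>k. k \<in> set ks \<Longrightarrow> x k = y k" for ks x y
  proof -
    have "map (\<lambda>k. h k (x k)) ks = map (\<lambda>k. h k (y k)) ks" using that by (intro map_cong) auto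
    then show ?thesis by (simp only: pr_def)
  qed
  have "alg_rep F (pr ks \<one>\<^bsub>M\<^esub>) (linear_extension (pr ks))"
  proof (rule alg_rep_linear_extension[OF monoid_M])
    fix x y assume "x \<in> carrier M" "y \<in> carrier M"
    then show "pr ks (x \<otimes>\<^bsub>M\<^esub> y) = pr ks x * pr ks y"
      using ks by (subst pr_mult[symmetric]) (auto intro!: pr_cong)
  qed
  moreover have pr_one: "pr ks (\<lambda>k\<in>K. \<one>\<^bsub>A k\<^esub>) = p" if "set ks \<subseteq> K" for ks
    using that
  proof (induction ks)
    case (Cons k ks)
    interpret K: representation "A k" p "h k" using Cons by (intro hk) auto
    show ?case using Cons assms(1) by (subst pr_Cons) (auto simp del: restrict_apply simp add: restrict_apply')
  qed (simp add: pr_Nil)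
  ultimately have rep: "alg_rep F p (linear_extension (pr ks))" using ks by simp
  \<comment> \<open>With the other entries fixed, the ordered product has the form
    \<open>u * h k c * v\<close>, which is linear in the entry \<open>c\<close>. Hence the
    multilinear relations are killed.\<close>
  have split: "\<exists>u v. \<forall>c\<in>carrier (A k). pr ks (x(k := c)) = u * h k c * v"
    if "k \<in> K" "x \<in> (\<Pi>\<^sub>E k\<in>K. carrier (A k))" for k x
  proof -
    obtain us vs where uv: "ks = us @ k # vs" using \<open>k \<in> K\<close> ks by (meson split_list)
    then have "k \<notin> set us" "k \<notin> set vs" using ks by auto
    then have "map (\<lambda>l. h l ((x(k := c)) l)) us = map (\<lambda>l. h l (x l)) us"
       "map (\<lambda>l. h l ((x(k := c)) l)) vs = map (\<lambda>l. h l (x l)) vs" for c by auto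
    then have "pr ks (x(k := c)) = pr us x * h k c * prod_list (map (\<lambda>l. h l (x l)) vs)" for c
      unfolding uv pr_def
      by (simp only: map_append list.map prod_list.append prod_list.Cons mult.assoc fun_upd_same)
    then show ?thesis by blast
  qed
  interpret rF: representation F p "linear_extension (pr ks)"
    using rep falgebra_F by (simp add: representation_def representation_axioms_def)
  have kill: "linear_extension (pr ks) r = 0" if "r \<in> multilinear_relations K A" for r
  proof -
    from that consider x k a b where "r = basis_vector (x(k := a \<oplus>\<^bsub>A k\<^esub> b))
          \<ominus>\<^bsub>F\<^esub> (basis_vector (x(k := a)) \<oplus>\<^bsub>F\<^esub> basis_vector (x(k := b)))"
          "x \<in> (\<Pi>\<^sub>E l\<in>K. carrier (A l))" "k \<in> K" "a \<in> carrier (A k)" "b \<in> carrier (A k)"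
      | x k a c where "r = basis_vector (x(k := c \<odot>\<^bsub>A k\<^esub> a)) \<ominus>\<^bsub>F\<^esub> c \<odot>\<^bsub>F\<^esub> basis_vector (x(k := a))"
          "x \<in> (\<Pi>\<^sub>E l\<in>K. carrier (A l))" "k \<in> K" "a \<in> carrier (A k)"
      unfolding multilinear_relations_def Let_def by blast
    then show ?thesis
    proof cases
      case (1 x k a b)
      interpret K: representation "A k" p "h k" using 1 by (intro hk) auto
      obtain u v where "\<forall>c\<in>carrier (A k). pr ks (x(k := c)) = u * h k c * v"
        using split[OF 1(3,2)] by blast
      with 1 show ?thesis by (simp add: upd_basis algebra_simps del: product_monoid_simps)
    next
      case (2 x k a c)
      interpret K: representation "A k" p "h k" using 2 by (intro hk) auto
      obtain u v where "\<forall>c\<in>carrier (A k). pr ks (x(k := c)) = u * h k c * v"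
        using split[OF 2(3,2)] by blast
      with 2 show ?thesis by (simp add: upd_basis algebra_simps del: product_monoid_simps)
    qed
  qed
  obtain \<tau> where \<tau>: "alg_rep C p \<tau>" "\<And>x. x \<in> carrier F \<Longrightarrow> \<tau> (J +>\<^bsub>F\<^esub> x) = linear_extension (pr ks) x"
    using Q.alg_rep_quotient[OF rep rF.kernel_genideal[OF relations_carrier kill]]
    unfolding tensor_algebra_def by blast
  have gen: "pr ks ((\<lambda>k\<in>K. \<one>\<^bsub>A k\<^esub>)(k := a)) = h k a" if "k \<in> K" "a \<in> carrier (A k)" for k a
  proof -
    obtain us vs where uv: "ks = us @ k # vs" using \<open>k \<in> K\<close> ks by (meson split_list)
    then have uv': "set us \<subseteq> K - {k}" "set vs \<subseteq> K - {k}" using ks by auto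
    interpret K: representation "A k" p "h k" using that by (intro hk)
    have "map (\<lambda>l. h l (((\<lambda>k\<in>K. \<one>\<^bsub>A k\<^esub>)(k := a)) l)) ls = map (\<lambda>l. h l ((\<lambda>k\<in>K. \<one>\<^bsub>A k\<^esub>) l)) ls"
      if "set ls \<subseteq> K - {k}" for ls
      using that by (intro map_cong) auto
    then have "pr ks ((\<lambda>k\<in>K. \<one>\<^bsub>A k\<^esub>)(k := a)) =
        pr us (\<lambda>k\<in>K. \<one>\<^bsub>A k\<^esub>) * (h k a * prod_list (map (\<lambda>l. h l ((\<lambda>k\<in>K. \<one>\<^bsub>A k\<^esub>) l)) vs))"
      using uv' unfolding uv pr_def
      by (simp only: map_append list.map prod_list.append prod_list.Cons mult.assoc fun_upd_same)
    also have "h k a * prod_list (map (\<lambda>l. h l ((\<lambda>k\<in>K. \<one>\<^bsub>A k\<^esub>) l)) vs) = h k a * pr vs (\<lambda>k\<in>K. \<one>\<^bsub>A k\<^esub>)"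
      using that by (simp add: pr_def flip: mult.assoc)
    finally have "pr ks ((\<lambda>k\<in>K. \<one>\<^bsub>A k\<^esub>)(k := a)) = pr us (\<lambda>k\<in>K. \<one>\<^bsub>A k\<^esub>) * (h k a * pr vs (\<lambda>k\<in>K. \<one>\<^bsub>A k\<^esub>))" .
    moreover have "pr us (\<lambda>k\<in>K. \<one>\<^bsub>A k\<^esub>) = p" "pr vs (\<lambda>k\<in>K. \<one>\<^bsub>A k\<^esub>) = p"
      using uv' by (auto intro!: pr_one)
    ultimately show ?thesis using that by (simp only: K.unit_left K.unit_right)
  qed
  show ?thesis
  proof (rule that[OF \<tau>(1)])
    fix k a assume "k \<in> K" "a \<in> carrier (A k)"
    then show "\<tau> (tensor_gen K A k a) = h k a"
      unfolding tensor_gen_def using upd_M[OF one_M]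
      by (subst \<tau>(2)) (auto simp: gen simp del: product_monoid_simps)
  qed
qed

text \<open>The converse of \<open>tensor_universal\<close>: a representation of the tensor product
  restricts to commuting representations of the factors.\<close>

lemma tensor_components:
  assumes "alg_rep C p \<tau>"
  shows "k \<in> K \<Longrightarrow> alg_rep (A k) p (\<lambda>a. \<tau> (tensor_gen K A k a))"
    and "k \<in> K \<Longrightarrow> l \<in> K \<Longrightarrow> k \<noteq> l \<Longrightarrow> a \<in> carrier (A k) \<Longrightarrow> b \<in> carrier (A l) \<Longrightarrow>
        \<tau> (tensor_gen K A k a) * \<tau> (tensor_gen K A l b) = \<tau> (tensor_gen K A l b) * \<tau> (tensor_gen K A k a)"
proof -
  define g where "g x = \<tau> (J +>\<^bsub>F\<^esub> x)" for x
  have rep: "alg_rep F p g" and kill: "\<And>r. r \<in> J \<Longrightarrow> g r = 0"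
    using Q.alg_rep_coset[OF assms[unfolded tensor_algebra_def]] unfolding g_def by blast+
  interpret g: representation F p g
    using rep falgebra_F by (simp add: representation_def representation_axioms_def)
  let ?u = "\<lambda>k\<in>K. \<one>\<^bsub>A k\<^esub>"
  let ?b = "\<lambda>k a. basis_vector (?u(k := a)) :: ('i \<Rightarrow> 'a) \<Rightarrow> 'f"
  have \<tau>_gen: "\<tau> (tensor_gen K A k a) = g (?b k a)" for k a
    by (simp add: tensor_gen_def g_def)
  have u: "?u \<in> (\<Pi>\<^sub>E k\<in>K. carrier (A k))" using one_M by simp
  note ub = upd_basis[OF u]
  have relJ: "r \<in> J" if "r \<in> multilinear_relations K A" for r
    using Q.genideal_self[OF relations_carrier] that by blast
  show "alg_rep (A k) p (\<lambda>a. \<tau> (tensor_gen K A k a))" if k: "k \<in> K"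
  proof -
    interpret K: falgebra "A k" using k by (rule falg)
    show ?thesis
      unfolding alg_rep_def \<tau>_gen
    proof (intro conjI ballI allI)
      fix a b assume ab: "a \<in> carrier (A k)" "b \<in> carrier (A k)"
      have "?b k (a \<oplus>\<^bsub>A k\<^esub> b) \<ominus>\<^bsub>F\<^esub> (?b k a \<oplus>\<^bsub>F\<^esub> ?b k b) \<in> multilinear_relations K A"
        unfolding multilinear_relations_def Let_def using u k ab by blast
      from kill[OF relJ[OF this]] show "g (?b k (a \<oplus>\<^bsub>A k\<^esub> b)) = g (?b k a) + g (?b k b)"
        using k ab by (simp add: ub del: product_monoid_simps)
      have "?u(k := a \<otimes>\<^bsub>A k\<^esub> b) = ?u(k := a) \<otimes>\<^bsub>M\<^esub> ?u(k := b)"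
        using k ab by (auto simp: fun_eq_iff monoid.l_one[OF monoid_A] monoid.one_closed[OF monoid_A])
      then have "?b k (a \<otimes>\<^bsub>A k\<^esub> b) = ?b k a \<otimes>\<^bsub>F\<^esub> ?b k b" by simp
      then show "g (?b k (a \<otimes>\<^bsub>A k\<^esub> b)) = g (?b k a) * g (?b k b)"
        using k ab by (simp add: ub del: product_monoid_simps basis_vector_mult)
    next
      fix c a assume a: "a \<in> carrier (A k)"
      have "?b k (c \<odot>\<^bsub>A k\<^esub> a) \<ominus>\<^bsub>F\<^esub> c \<odot>\<^bsub>F\<^esub> ?b k a \<in> multilinear_relations K A"
        unfolding multilinear_relations_def Let_def using u k a by blast
      from kill[OF relJ[OF this]] show "g (?b k (c \<odot>\<^bsub>A k\<^esub> a)) = c *\<^sub>s g (?b k a)"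
        using k a by (simp add: ub del: product_monoid_simps)
    next
      have "?u(k := \<one>\<^bsub>A k\<^esub>) = ?u" using k by auto
      then show "g (?b k \<one>\<^bsub>A k\<^esub>) = p"
        using g.hom_one by (simp add: monoid_algebra_simps)
    qed
  qed
  show "\<tau> (tensor_gen K A k a) * \<tau> (tensor_gen K A l b) = \<tau> (tensor_gen K A l b) * \<tau> (tensor_gen K A k a)"
    if kl: "k \<in> K" "l \<in> K" "k \<noteq> l" "a \<in> carrier (A k)" "b \<in> carrier (A l)"
  proof -
    have "?u(k := a) \<otimes>\<^bsub>M\<^esub> ?u(l := b) = ?u(l := b) \<otimes>\<^bsub>M\<^esub> ?u(k := a)"
      using kl by (auto simp: fun_eq_iff monoid.l_one[OF monoid_A] monoid.r_one[OF monoid_A] monoid.one_closed[OF monoid_A])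
    then have "?b k a \<otimes>\<^bsub>F\<^esub> ?b l b = ?b l b \<otimes>\<^bsub>F\<^esub> ?b k a" by simp
    then have "g (?b k a \<otimes>\<^bsub>F\<^esub> ?b l b) = g (?b l b \<otimes>\<^bsub>F\<^esub> ?b k a)" by (rule arg_cong)
    then show ?thesis
      unfolding \<tau>_gen using kl by (simp add: ub del: product_monoid_simps basis_vector_mult)
  qed
qed

end

section \<open>Polynomial calculus in corners: comaximal root polynomials, inverses and growing root
  multisets\<close>

section \<open>Evaluation of polynomials\<close>

definition in_corner :: "('x, 'f::field) endo \<Rightarrow> ('x, 'f) endo \<Rightarrow> bool" where
  "in_corner p x \<longleftrightarrow> p * x = x \<and> x * p = x"

text \<open>Evaluation in the algebra with unit \<open>p\<close>: the constant coefficient is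
  multiplied by \<open>p\<close>. It is the image of \<open>poly_eval_algebra\<close> under a
  representation with unit \<open>p\<close>.\<close>

definition peval :: "('x, 'f::field) endo \<Rightarrow> 'f poly \<Rightarrow> ('x, 'f) endo \<Rightarrow> ('x, 'f) endo" where
  "peval p P x = (\<Sum>k\<le>degree P. coeff P k *\<^sub>s (p * x ^ k))"

lemma peval_eq: "degree P \<le> N \<Longrightarrow> peval p P x = (\<Sum>k\<le>N. coeff P k *\<^sub>s (p * x ^ k))"
  unfolding peval_def by (intro sum.mono_neutral_left) (auto simp: coeff_eq_0)

lemma peval_0 [simp]: "peval p 0 x = 0"
  by (simp add: peval_def)

lemma peval_1 [simp]: "peval p 1 x = p"
  by (simp add: peval_def)

lemma peval_add [simp]: "peval p (P + Q) x = peval p P x + peval p Q x"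
proof -
  let ?N = "max (degree P) (degree Q)"
  have "degree (P + Q) \<le> ?N" by (simp add: degree_add_le_max)
  then show ?thesis
    by (simp add: peval_eq[of P ?N] peval_eq[of Q ?N] peval_eq[of "P + Q" ?N] scl_simps sum.distrib)
qed

lemma peval_smult [simp]: "peval p (smult c P) x = c *\<^sub>s peval p P x"
proof -
  have "degree (smult c P) \<le> degree P" by (rule degree_smult_le)
  then show ?thesis
    by (simp add: peval_eq[of "smult c P" "degree P"] peval_def endo.scale_sum_right)
qed

lemma peval_uminus [simp]: "peval p (- P) x = - peval p P x"
  using peval_smult[of p "-1" P x] by (simp del: peval_smult add: endo.scale_minus_left)

lemma peval_diff [simp]: "peval p (P - Q) x = peval p P x - peval p Q x"
  using peval_add[of p P "- Q" x] by simp

lemma peval_sum: "peval p (\<Sum>i\<in>I. P i) x = (\<Sum>i\<in>I. peval p (P i) x)"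
  by (induction I rule: infinite_finite_induct) simp_all

lemma peval_pCons:
  assumes "in_corner p x"
  shows "peval p (pCons a P) x = a *\<^sub>s p + x * peval p P x"
proof -
  have "peval p (pCons a P) x = (\<Sum>k\<le>Suc (degree P). coeff (pCons a P) k *\<^sub>s (p * x ^ k))"
    by (intro peval_eq) (simp add: degree_pCons_eq_if)
  also have "\<dots> = a *\<^sub>s p + (\<Sum>k\<le>degree P. coeff P k *\<^sub>s (p * x ^ Suc k))"
    by (subst sum.atMost_Suc_shift) simp
  also have "(\<Sum>k\<le>degree P. coeff P k *\<^sub>s (p * x ^ Suc k)) = (\<Sum>k\<le>degree P. x * (coeff P k *\<^sub>s (p * x ^ k)))"
  proof (intro sum.cong refl)
    fix k
    have "p * x ^ Suc k = x * (p * x ^ k)"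
      using assms by (simp add: in_corner_def flip: mult.assoc)
    then show "coeff P k *\<^sub>s (p * x ^ Suc k) = x * (coeff P k *\<^sub>s (p * x ^ k))" by simp
  qed
  finally show ?thesis by (simp add: peval_def sum_distrib_left)
qed

text \<open>The units \<open>p\<close> and \<open>p'\<close> may differ, so besides commutation this
  moves evaluations from one corner to another, for instance along a crossing or along some
  \<open>u t\<close>.\<close>

lemma peval_intertwine:
  assumes "z * p = p' * z" "z * x = y * z"
  shows "z * peval p P x = peval p' P y * z"
proof -
  have "z * x ^ k = y ^ k * z" for k
  proof (induction k)
    case (Suc k)
    have "z * x ^ Suc k = (z * x ^ k) * x" by (simp only: power_Suc2 mult.assoc)
    also have "\<dots> = y ^ k * (z * x)" by (simp only: Suc mult.assoc)
    also have "\<dots> = y ^ Suc k * z" by (simp only: assms power_Suc2 mult.assoc)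
    finally show ?case .
  qed simp
  then have "z * (p * x ^ k) = p' * y ^ k * z" for k
    using assms by (metis mult.assoc)
  then show ?thesis
    by (simp add: peval_def sum_distrib_left sum_distrib_right)
qed

lemma peval_corner [simp]:
  assumes "p * p = p" "in_corner p x"
  shows "p * peval p P x = peval p P x" "peval p P x * p = peval p P x"
proof -
  have eq: "p * peval p P x = peval p P x * p"
    using assms by (intro peval_intertwine) (auto simp: in_corner_def)
  show "p * peval p P x = peval p P x"
    using assms by (simp add: peval_def sum_distrib_left flip: mult.assoc)
  with eq show "peval p P x * p = peval p P x" by simp
qed

lemma peval_mult:
  assumes "p * p = p" "in_corner p x"
  shows "peval p (P * Q) x = peval p P x * peval p Q x"
proof (induction P)
  case (pCons a P)
  then show ?case
    using assms by (simp add: peval_pCons mult.assoc distrib_right)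
qed simp

lemma commute_mult:
  fixes a b c :: "'r::ring"
  shows "a * c = c * a \<Longrightarrow> b * c = c * b \<Longrightarrow> a * b * c = c * (a * b)"
    and "c * a = a * c \<Longrightarrow> c * b = b * c \<Longrightarrow> c * (a * b) = a * b * c"
  by (metis mult.assoc)+

lemma peval_commute:
  assumes "z * p = p * z" "z * x = x * z"
  shows "z * peval p P x = peval p P x * z"
  using peval_intertwine[OF assms] .

lemma peval_linear: "in_corner p x \<Longrightarrow> peval p [:- \<omega>, 1:] x = x - \<omega> *\<^sub>s p"
  by (simp add: peval_pCons in_corner_def endo.scale_minus_left)

lemma peval_dvd:
  assumes "p * p = p" "in_corner p x" "P dvd Q" "peval p P x = 0"
  shows "peval p Q x = 0"
  using assms by (auto simp: peval_mult elim!: dvdE)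

lemma peval_cong:
  assumes "p * p = p" "in_corner p x" "R dvd P - Q" "peval p R x = 0"
  shows "peval p P x = peval p Q x"
  using peval_dvd[OF assms(1,2,3,4)] by simp

subsection \<open>Polynomials given by their roots\<close>

text \<open>Multisets of roots rather than sets, because the exponents \<open>\<Lambda> i j\<close>
  may exceed one and the \<open>X a\<close> need not be diagonalisable.\<close>

definition root_poly :: "'f::field multiset \<Rightarrow> 'f poly" where
  "root_poly M = (\<Prod>\<omega>\<in>#M. [:- \<omega>, 1:])"

lemma root_poly_simps [simp]:
  "root_poly {#} = 1" "root_poly (add_mset \<omega> M) = [:- \<omega>, 1:] * root_poly M"
  "root_poly (M + N) = root_poly M * root_poly N"
  by (simp_all add: root_poly_def)

lemma root_poly_replicate: "root_poly (replicate_mset k \<omega>) = [:- \<omega>, 1:] ^ k"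
  by (induction k) simp_all

lemma root_poly_sum: "root_poly (\<Sum>i\<in>I. M i) = (\<Prod>i\<in>I. root_poly (M i))"
  by (induction I rule: infinite_finite_induct) simp_all

lemma poly_root_poly: "poly (root_poly M) c = 0 \<longleftrightarrow> c \<in># M"
  by (induction M) auto

text \<open>Bezout for split polynomials without common roots, by removing one root of
  \<open>M\<close> at a time.\<close>

lemma root_poly_comaximal:
  assumes "set_mset M \<inter> set_mset N = {}"
  obtains u v where "u * root_poly M + v * root_poly N = 1"
proof -
  have "\<exists>u v. u * root_poly M + v * root_poly N = 1"
    using assms
  proof (induction M)
    case empty
    show ?case by (rule exI[of _ 1], rule exI[of _ 0]) simp
  next
    case (add \<omega> M)
    then obtain u v where uv: "u * root_poly M + v * root_poly N = 1" by auto
    \<comment> \<open>Division of the second polynomial by the linear factor \<open>L\<close> leaves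
      the constant \<open>c\<close>, its value at \<open>\<omega>\<close>, which is nonzero by
      disjointness. Substituting \<open>1 = (N - L t) / c\<close>, with \<open>N\<close> the second
      polynomial, into the first summand of the old identity yields the new one.\<close>
    define L c t where "L = [:- \<omega>, 1:]" and "c = poly (root_poly N) \<omega>" and "t = synthetic_div (root_poly N) \<omega>"
    define i where "i = [:1 / c:]"
    have "c \<noteq> 0" using add.prems by (simp add: poly_root_poly c_def)
    then have ic: "i * [:c:] = 1" by (simp add: one_pCons i_def)
    have N: "root_poly N = L * t + [:c:]"
      using synthetic_div_correct'[of \<omega> "root_poly N"] by (simp add: L_def c_def t_def)
    have "(- u * i * t) * (L * root_poly M) + (u * root_poly M * i + v) * root_poly N
        = u * root_poly M * (i * root_poly N - i * (L * t)) + v * root_poly N"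
      by (simp add: algebra_simps)
    also have "i * root_poly N - i * (L * t) = 1"
      unfolding N by (simp only: distrib_left ic) simp
    finally have "(- u * i * t) * (L * root_poly M) + (u * root_poly M * i + v) * root_poly N = 1"
      using uv by simp
    then show ?case unfolding root_poly_simps L_def[symmetric] by (intro exI)
  qed
  with that show ?thesis by blast
qed

text \<open>Multiplying a Bezout identity by \<open>f\<close> exhibits the product of two comaximal
  divisors as a divisor of \<open>f\<close>.\<close>

lemma root_poly_sum_dvd:
  assumes "finite J" "\<And>j. j \<in> J \<Longrightarrow> root_poly (M j) dvd f"
    "\<And>j k. j \<in> J \<Longrightarrow> k \<in> J \<Longrightarrow> j \<noteq> k \<Longrightarrow> set_mset (M j) \<inter> set_mset (M k) = {}"
  shows "root_poly (\<Sum>j\<in>J. M j) dvd f"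
  using assms
proof (induction J rule: finite_induct)
  case (insert j J)
  have "set_mset (M j) \<inter> set_mset (\<Sum>j\<in>J. M j) = {}"
    using insert.prems(2)[of j] insert.hyps by (auto simp: set_mset_sum)
  then obtain u v where uv: "u * root_poly (M j) + v * root_poly (\<Sum>j\<in>J. M j) = 1"
    by (rule root_poly_comaximal)
  obtain a where a: "f = root_poly (M j) * a" using insert.prems(1)[of j] by (auto elim: dvdE)
  obtain b where b: "f = root_poly (\<Sum>j\<in>J. M j) * b" using insert by (auto elim: dvdE)
  have "f = f * (u * root_poly (M j)) + f * (v * root_poly (\<Sum>j\<in>J. M j))"
    using uv by (metis distrib_left mult.right_neutral)
  also have "\<dots> = (root_poly (\<Sum>j\<in>J. M j) * b) * (u * root_poly (M j)) + (root_poly (M j) * a) * (v * root_poly (\<Sum>j\<in>J. M j))"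
    using a b by metis
  also have "\<dots> = root_poly (M j) * root_poly (\<Sum>j\<in>J. M j) * (b * u + a * v)"
    by (simp only: ring_distribs mult_ac)
  finally have "root_poly (M j) * root_poly (\<Sum>j\<in>J. M j) dvd f" by (metis dvd_triv_left)
  then show ?case using insert.hyps by simp
qed simp

text \<open>Chinese remainder theorem: \<open>\<epsilon> j\<close> is the summand divisible by all
  other root polynomials in a Bezout identity for colour \<open>j\<close>.\<close>

lemma root_poly_crt:
  assumes "finite J"
    "\<And>j k. j \<in> J \<Longrightarrow> k \<in> J \<Longrightarrow> j \<noteq> k \<Longrightarrow> set_mset (M j) \<inter> set_mset (M k) = {}"
  obtains \<epsilon> where "\<And>j. j \<in> J \<Longrightarrow> root_poly (M j) dvd 1 - \<epsilon> j"
    "\<And>j k. j \<in> J \<Longrightarrow> k \<in> J \<Longrightarrow> j \<noteq> k \<Longrightarrow> root_poly (M k) dvd \<epsilon> j"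
proof -
  have "\<exists>\<epsilon>. root_poly (M j) dvd 1 - \<epsilon> \<and> (\<forall>k\<in>J - {j}. root_poly (M k) dvd \<epsilon>)" if j: "j \<in> J" for j
  proof -
    let ?N = "\<Sum>k\<in>J - {j}. M k"
    have "set_mset (M j) \<inter> set_mset ?N = {}"
      using assms j by (auto simp: set_mset_sum)
    then obtain u v where uv: "u * root_poly (M j) + v * root_poly ?N = 1"
      by (rule root_poly_comaximal)
    have "root_poly (M k) dvd v * root_poly ?N" if "k \<in> J - {j}" for k
      unfolding root_poly_sum using that assms(1) by (intro dvd_mult dvd_prodI) auto
    moreover have "1 - v * root_poly ?N = u * root_poly (M j)" using uv by (simp add: algebra_simps)
    ultimately show ?thesis by (intro exI[of _ "v * root_poly ?N"]) auto
  qed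
  then obtain \<epsilon> where "\<And>j. j \<in> J \<Longrightarrow> root_poly (M j) dvd 1 - \<epsilon> j \<and> (\<forall>k\<in>J - {j}. root_poly (M k) dvd \<epsilon> j)"
    by metis
  then show ?thesis by (intro that[of \<epsilon>]) auto
qed

subsection \<open>Inverses in corners\<close>

text \<open>Inverse relative to the unit \<open>p\<close>. Normalising \<open>d\<close> to the
  corner makes it unique, so \<open>inverse_in\<close> may be a choice.\<close>

definition is_inverse :: "('x, 'f::field) endo \<Rightarrow> ('x, 'f) endo \<Rightarrow> ('x, 'f) endo \<Rightarrow> bool" where
  "is_inverse p w d \<longleftrightarrow> d * w = p \<and> w * d = p \<and> p * d = d \<and> d * p = d"

definition inverse_in :: "('x, 'f::field) endo \<Rightarrow> ('x, 'f) endo \<Rightarrow> ('x, 'f) endo" where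
  "inverse_in p w = (SOME d. is_inverse p w d)"

lemma is_inverse_unique: "is_inverse p w d \<Longrightarrow> is_inverse p w d' \<Longrightarrow> d = d'"
  unfolding is_inverse_def by (metis mult.assoc)

lemma inverse_in_eq: "is_inverse p w d \<Longrightarrow> inverse_in p w = d"
  unfolding inverse_in_def by (metis someI is_inverse_unique)

lemma is_inverse_inverse_in: "is_inverse p w d \<Longrightarrow> is_inverse p w (inverse_in p w)"
  using inverse_in_eq by metis

text \<open>Anything that intertwines \<open>w\<close> with \<open>w'\<close> intertwines their
  inverses. In this way crossings and the \<open>u t\<close> pass denominators.\<close>

lemma is_inverse_intertwine:
  assumes "is_inverse p w d" "is_inverse p' w' d'" "z * w = w' * z" "z * p = z" "p' * z = z"
  shows "z * d = d' * z"
proof -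
  have "z * d = d' * w' * z * d" using assms by (simp only: is_inverse_def)
  also have "\<dots> = d' * (z * w) * d" by (simp only: assms(3) mult.assoc)
  also have "\<dots> = d' * (z * (w * d))" by (simp only: mult.assoc)
  also have "\<dots> = d' * z" using assms by (simp only: is_inverse_def)
  finally show ?thesis .
qed

lemma is_inverse_uminus: "is_inverse p w d \<Longrightarrow> is_inverse p (- w) (- d)"
  by (simp add: is_inverse_def)

text \<open>No unit is demanded, since the units in play are various idempotents. Membership is
  recorded so that all constructed elements stay in the image of the Hecke algebra, and later in
  that of a tensor product.\<close>

definition subalg :: "('x, 'f::field) endo set \<Rightarrow> bool" where
  "subalg K \<longleftrightarrow> (\<forall>x\<in>K. \<forall>y\<in>K. x + y \<in> K \<and> x * y \<in> K) \<and> (\<forall>c. \<forall>x\<in>K. c *\<^sub>s x \<in> K)"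

lemma subalg_closed:
  assumes "subalg K"
  shows "x \<in> K \<Longrightarrow> y \<in> K \<Longrightarrow> x + y \<in> K" "x \<in> K \<Longrightarrow> y \<in> K \<Longrightarrow> x * y \<in> K"
    "x \<in> K \<Longrightarrow> c *\<^sub>s x \<in> K" "x \<in> K \<Longrightarrow> - x \<in> K" "x \<in> K \<Longrightarrow> y \<in> K \<Longrightarrow> x - y \<in> K"
proof -
  show "x \<in> K \<Longrightarrow> y \<in> K \<Longrightarrow> x + y \<in> K" "x \<in> K \<Longrightarrow> y \<in> K \<Longrightarrow> x * y \<in> K" "x \<in> K \<Longrightarrow> c *\<^sub>s x \<in> K" for x y c
    using assms by (auto simp: subalg_def)
  then have neg: "x \<in> K \<Longrightarrow> - x \<in> K" for x by (metis endo.scale_minus_left endo.scale_one)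
  then show "x \<in> K \<Longrightarrow> - x \<in> K" .
  show "x \<in> K \<Longrightarrow> y \<in> K \<Longrightarrow> x - y \<in> K"
    using neg[of y] assms by (metis add_uminus_conv_diff subalg_def)
qed

lemma subalg_peval:
  assumes "subalg K" "p \<in> K" "x \<in> K" "in_corner p x"
  shows "peval p P x \<in> K"
proof (induction P)
  case 0
  have "0 *\<^sub>s p \<in> K" using assms by (intro subalg_closed)
  then show ?case by simp
next
  case (pCons a P)
  then show ?case using assms by (simp add: peval_pCons subalg_closed)
qed

text \<open>Let \<open>R\<close> be the root polynomial of \<open>N\<close>. Since \<open>R\<close>
  kills \<open>y\<close>, evaluation at \<open>x\<close> gives \<open>(x - y) g\<close> with a
  divided difference \<open>g\<close>; on the other hand this value is invertible by comaximality.
  The inverse so found is a polynomial in \<open>x\<close> and \<open>y\<close>, hence lies in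
  \<open>K\<close>.\<close>

lemma difference_inverse:
  assumes p: "p * p = p" and x: "in_corner p x" and y: "in_corner p y" and xy: "x * y = y * x"
    and M: "peval p (root_poly M) x = 0" and N: "peval p (root_poly N) y = 0"
    and disj: "set_mset M \<inter> set_mset N = {}"
    and K: "subalg K" "p \<in> K" "x \<in> K" "y \<in> K"
  obtains d where "d \<in> K" "is_inverse p (y - x) d"
proof -
  \<comment> \<open>The divided difference of \<open>P\<close>. Passing from \<open>P\<close> to
    \<open>pCons a P\<close> replaces \<open>g\<close> by \<open>P(x) + y g\<close>.\<close>
  have "\<exists>g\<in>K. peval p P x - peval p P y = (x - y) * g \<and> p * g = g \<and> g * x = x * g \<and> g * y = y * g" for P
  proof (induction P)
    case 0
    have "0 *\<^sub>s p \<in> K" using K by (intro subalg_closed)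
    then show ?case by (intro bexI[of _ 0]) auto
  next
    case (pCons a P)
    then obtain g where g: "g \<in> K" "peval p P x - peval p P y = (x - y) * g" "p * g = g"
      "g * x = x * g" "g * y = y * g" by blast
    let ?h = "peval p P x + y * g"
    have px: "peval p P x * x = x * peval p P x" "peval p P x * y = y * peval p P x"
      using x y xy by (auto simp: in_corner_def intro!: peval_commute[symmetric])
    have "peval p (pCons a P) x - peval p (pCons a P) y = x * peval p P x - y * peval p P y"
      using x y by (simp add: peval_pCons)
    also have "\<dots> = (x - y) * peval p P x + y * (peval p P x - peval p P y)"
      by (simp add: algebra_simps)
    also have "\<dots> = (x - y) * ?h"
      unfolding g(2) by (simp add: algebra_simps flip: mult.assoc) (simp add: xy)
    finally have "peval p (pCons a P) x - peval p (pCons a P) y = (x - y) * ?h" .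
    moreover have "?h \<in> K" using g K x by (simp add: subalg_closed subalg_peval)
    moreover have "p * ?h = ?h" using g p x y by (simp add: distrib_left in_corner_def flip: mult.assoc)
    moreover have "y * g * x = x * (y * g)" "y * g * y = y * (y * g)" using g xy by (metis mult.assoc)+
    ultimately show ?case using px by (intro bexI[of _ ?h]) (simp_all add: distrib_left distrib_right)
  qed
  then obtain g where g: "g \<in> K" "peval p (root_poly N) x - peval p (root_poly N) y = (x - y) * g"
      "p * g = g" "g * x = x * g" "g * y = y * g" by blast
  obtain u v where "u * root_poly M + v * root_poly N = 1"
    using root_poly_comaximal[OF disj] .
  then have "peval p (u * root_poly M + v * root_poly N) x = p" by simp
  then have v: "peval p v x * peval p (root_poly N) x = p"
    using p x M by (simp add: peval_mult)
  let ?v = "peval p v x"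
  have v_comm: "?v * x = x * ?v" "?v * y = y * ?v"
    using x y xy by (auto simp: in_corner_def intro!: peval_commute[symmetric])
  \<comment> \<open>The sign converts the inverse of \<open>x - y\<close> into that of
    \<open>y - x\<close>.\<close>
  define d where "d = - (?v * g)"
  have 1: "?v * ((x - y) * g) = p" using v g(2) N by simp
  have 2: "(x - y) * (?v * g) = ?v * ((x - y) * g)"
    using v_comm by (simp add: left_diff_distrib right_diff_distrib flip: mult.assoc)
  have 3: "(?v * g) * (x - y) = ?v * ((x - y) * g)"
    using g by (simp add: left_diff_distrib right_diff_distrib mult.assoc)
  have "p * (?v * g) = ?v * g" using p x by (simp flip: mult.assoc)
  moreover have "?v * g * p = ?v * g"
  proof -
    have "?v * g = (?v * g) * ((x - y) * (?v * g))"
      using 1 2 3 by (metis \<open>p * (?v * g) = ?v * g\<close> mult.assoc)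
    also have "\<dots> * p = (?v * g) * ((x - y) * (?v * g)) "
      using 1 2 p by (simp add: mult.assoc)
    finally show ?thesis by (metis 1 2 p mult.assoc)
  qed
  ultimately have "is_inverse p (y - x) d"
    using 1 2 3 unfolding is_inverse_def d_def
    by (simp add: algebra_simps)
  moreover have "d \<in> K"
    unfolding d_def using K g x by (simp add: subalg_closed subalg_peval)
  ultimately show ?thesis using that by blast
qed

subsection \<open>Enlarging multisets of roots\<close>

text \<open>If \<open>M\<close> contains the eigenvalues of one Jucys-Murphy element, these are the
  possible ones of the next: the intertwiner either transports an eigenvalue or degenerates, and
  then the ratio is \<open>q\<close> or \<open>1 / q\<close>.\<close>

definition grow :: "'f::field \<Rightarrow> 'f multiset \<Rightarrow> 'f multiset" where
  "grow q M = M + (image_mset (\<lambda>\<omega>. q * \<omega>) M + image_mset (\<lambda>\<omega>. \<omega> / q) M)"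

lemma grow_sum: "grow q (\<Sum>j\<in>J. M j) = (\<Sum>j\<in>J. grow q (M j))"
proof (induction J rule: infinite_finite_induct)
  case (insert j J)
  then show ?case by (simp add: grow_def ac_simps)
qed (simp_all add: grow_def)

lemma grow_funpow_sum: "(grow q ^^ k) (\<Sum>j\<in>J. M j) = (\<Sum>j\<in>J. (grow q ^^ k) (M j))"
  by (induction k) (simp_all add: grow_sum)

lemma root_poly_dvd_grow: "k \<le> l \<Longrightarrow> root_poly ((grow q ^^ k) M) dvd root_poly ((grow q ^^ l) M)"
proof (induction l)
  case (Suc l)
  have "root_poly ((grow q ^^ l) M) dvd root_poly ((grow q ^^ Suc l) M)"
    by (simp add: grow_def)
  with Suc show ?case by (cases "k = Suc l") (auto intro: dvd_trans simp del: funpow.simps)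
qed simp

text \<open>If \<open>x\<close> is a root \<open>\<omega>\<close>, then \<open>(y - q x)(y - x / q) = 0\<close> forces \<open>y\<close> to be \<open>q \<omega>\<close> or \<open>\<omega> / q\<close>.\<close>

lemma peval_grow:
  assumes p: "p * p = p" and x: "in_corner p x" and y: "in_corner p y" and xy: "x * y = y * x"
    and q: "q \<noteq> 0" and M: "peval p (root_poly M) x = 0"
    and h: "peval p (root_poly M) y * ((y - q *\<^sub>s x) * (y - (1 / q) *\<^sub>s x)) = 0"
  shows "peval p (root_poly (grow q M)) y = 0"
proof -
  let ?h = "(y - q *\<^sub>s x) * (y - (1 / q) *\<^sub>s x)"
  have step: "z * peval p (root_poly (image_mset (\<lambda>\<omega>. q * \<omega>) M + image_mset (\<lambda>\<omega>. \<omega> / q) M)) y = 0"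
    if "z * ?h = 0" "z * peval p (root_poly M) x = 0" "z * p = z" for z M
    using that
  proof (induction M arbitrary: z)
    case empty
    then show ?case by simp
  next
    case (add \<omega> M)
    \<comment> \<open>\<open>?h\<omega>\<close> is \<open>?h\<close> with \<open>x\<close> replaced
      by the scalar \<open>\<omega>\<close>; their difference is divisible by
      \<open>x - \<omega>\<close>, and \<open>?k\<close> is the quotient. The induction thus trades
      one factor of the polynomial in \<open>x\<close> for two linear factors in \<open>y\<close>,
      collected in \<open>z\<close>.\<close>
    let ?k = "\<omega> *\<^sub>s p + x - (q + 1 / q) *\<^sub>s y"
    let ?h\<omega> = "(y - (q * \<omega>) *\<^sub>s p) * (y - (\<omega> / q) *\<^sub>s p)"
    have yp: "y * p = y" "p * y = y" "x * p = x" "p * x = x" using x y by (auto simp: in_corner_def)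
    have h\<omega>: "?h\<omega> = ?h - (x - \<omega> *\<^sub>s p) * ?k"
      using q p by (simp add: algebra_simps yp scl_simps xy)
    have comm: "?h\<omega> * ?h = ?h * ?h\<omega>"
    proof -
      have c: "(y - b *\<^sub>s p) * (y - c *\<^sub>s x) = (y - c *\<^sub>s x) * (y - b *\<^sub>s p)" for b c
        by (simp add: algebra_simps yp xy)
      show ?thesis by (rule commute_mult(1)[OF commute_mult(2)[OF c c] commute_mult(2)[OF c c]])
    qed
    have "z * ?h\<omega> * ?h = z * (?h * ?h\<omega>)" unfolding comm[symmetric] by (rule mult.assoc)
    also have "\<dots> = z * ?h * ?h\<omega>" by (rule mult.assoc[symmetric])
    finally have z1: "z * ?h\<omega> * ?h = 0" using add.prems(1) by simp
    have "z * ?h\<omega> = z * ?h - z * ((x - \<omega> *\<^sub>s p) * ?k)"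
      unfolding h\<omega> by (simp only: right_diff_distrib)
    then have "z * ?h\<omega> = - (z * ((x - \<omega> *\<^sub>s p) * ?k))" using add.prems(1) by simp
    then have "z * ?h\<omega> * peval p (root_poly M) x = - (z * ((x - \<omega> *\<^sub>s p) * (?k * peval p (root_poly M) x)))"
      by (simp add: mult.assoc)
    also have "?k * peval p (root_poly M) x = peval p (root_poly M) x * ?k"
      using yp p xy by (intro peval_commute) (simp_all add: algebra_simps)
    also have "z * ((x - \<omega> *\<^sub>s p) * (peval p (root_poly M) x * ?k)) = z * peval p (root_poly (add_mset \<omega> M)) x * ?k"
      using p x by (simp only: root_poly_simps peval_mult peval_linear mult.assoc)
    also have "\<dots> = 0" using add.prems(2) by simp
    finally have z2: "z * ?h\<omega> * peval p (root_poly M) x = 0" by simp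
    have "z * ?h\<omega> * p = z * ?h\<omega>" using yp p by (simp add: mult.assoc left_diff_distrib)
    from add.IH[OF z1 z2 this]
    have "z * (?h\<omega> * peval p (root_poly (image_mset (\<lambda>\<omega>. q * \<omega>) M + image_mset (\<lambda>\<omega>. \<omega> / q) M)) y) = 0"
      by (simp only: mult.assoc)
    moreover have "?h\<omega> * peval p (root_poly (image_mset (\<lambda>\<omega>. q * \<omega>) M + image_mset (\<lambda>\<omega>. \<omega> / q) M)) y
        = peval p (root_poly (image_mset (\<lambda>\<omega>. q * \<omega>) (add_mset \<omega> M) + image_mset (\<lambda>\<omega>. \<omega> / q) (add_mset \<omega> M))) y"
    proof -
      have "root_poly (image_mset (\<lambda>\<omega>. q * \<omega>) (add_mset \<omega> M) + image_mset (\<lambda>\<omega>. \<omega> / q) (add_mset \<omega> M))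
          = [:- (q * \<omega>), 1:] * ([:- (\<omega> / q), 1:] *
             root_poly (image_mset (\<lambda>\<omega>. q * \<omega>) M + image_mset (\<lambda>\<omega>. \<omega> / q) M))"
        by (simp only: image_mset_add_mset root_poly_simps mult_ac)
      then show ?thesis using p y by (simp only: peval_mult peval_linear mult.assoc)
    qed
    ultimately show ?case by simp
  qed
  have "peval p (root_poly M) y * peval p (root_poly M) x = 0" using M by simp
  from step[OF h this] show ?thesis
    unfolding grow_def root_poly_simps(3)[of M] using p y by (simp add: peval_mult)
qed

section \<open>From the presentation to Jucys-Murphy elements, intertwiners and scattering\<close>

section \<open>Hecke algebras\<close>

text \<open>The defining relations for endomorphisms in the corner of \<open>p\<close>. For
  \<open>n = 0\<close> only the idempotent remains, in accordance with the convention that the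
  algebra is then the ground field.\<close>

definition hecke_tuple ::
    "('x, 'f::field) endo \<Rightarrow> 'f \<Rightarrow> 'f poly \<Rightarrow> nat \<Rightarrow> ('x, 'f) endo \<Rightarrow> (nat \<Rightarrow> ('x, 'f) endo) \<Rightarrow> bool" where
  "hecke_tuple p q P n S T \<longleftrightarrow> p * p = p \<and>
     (0 < n \<longrightarrow> in_corner p S \<and> peval p P S = 0) \<and>
     (\<forall>a\<in>{1..<n}. in_corner p (T a) \<and> (T a + p) * (T a - q *\<^sub>s p) = 0) \<and>
     (1 < n \<longrightarrow> S * T 1 * S * T 1 = T 1 * S * T 1 * S) \<and>
     (\<forall>a\<in>{1..<n}. 1 < a \<longrightarrow> S * T a = T a * S) \<and>
     (\<forall>a\<in>{1..<n}. \<forall>b\<in>{1..<n}. a + 1 < b \<longrightarrow> T a * T b = T b * T a) \<and>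
     (\<forall>a. 1 \<le> a \<and> a + 1 < n \<longrightarrow> T a * T (a + 1) * T a = T (a + 1) * T a * T (a + 1))"

definition hecke_gen :: "'f::field \<Rightarrow> 'f poly \<Rightarrow> nat \<Rightarrow> hecke_generator \<Rightarrow> (hecke_generator list \<Rightarrow> 'f) set" where
  "hecke_gen q P n = (if n = 0 then presented_gen {} {}
     else presented_gen (hecke_generators n) (hecke_relations q P n))"

lemma hecke_generators_closed:
  assumes "0 < n"
  shows "basis_vector [GenS] \<in> carrier (free_algebra (hecke_generators n))"
    "a \<in> {1..<n} \<Longrightarrow> basis_vector [GenT a] \<in> carrier (free_algebra (hecke_generators n))"
  by (auto simp: hecke_generators_def intro!: basis_vector_carrier)

lemma poly_eval_closed:
  assumes "falgebra A" "x \<in> carrier A"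
  shows "poly_eval_algebra A P x \<in> carrier A"
proof -
  interpret falgebra A by fact
  show ?thesis unfolding poly_eval_algebra_def using assms(2) by (auto intro!: finsum_closed)
qed

lemma (in representation) hom_poly_eval:
  assumes "x \<in> carrier A"
  shows "h (poly_eval_algebra A P x) = peval p P (h x)"
  unfolding poly_eval_algebra_def peval_def
  using assms by (subst hom_finsum) (auto simp: hom_pow intro!: sum.cong)

lemma hecke_relations_closed:
  fixes q :: "'f::field"
  assumes "0 < n"
  shows "hecke_relations q P n \<subseteq> carrier (free_algebra (hecke_generators n))"
proof -
  interpret falgebra "free_algebra (hecke_generators n) :: ('f, _) module" by (rule falgebra_free)
  note cl = hecke_generators_closed[OF assms]
  show ?thesis
    unfolding hecke_relations_def Let_def
    using cl poly_eval_closed[OF falgebra_axioms cl(1)]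
    by (auto simp del: basis_vector_mult intro!: minus_closed)
qed

text \<open>Translates the relations in the free algebra into equations between endomorphisms;
  \<open>hecke_universal\<close> and \<open>hecke_tuple_rep\<close> are its two directions.\<close>

lemma hecke_relations_iff:
  fixes q :: "'f::field" and p :: "('x, 'f) endo"
  assumes n: "0 < n" and h: "alg_rep (free_algebra (hecke_generators n)) p h"
  shows "(\<forall>r\<in>hecke_relations q P n. h r = 0) \<longleftrightarrow>
    hecke_tuple p q P n (h (basis_vector [GenS])) (\<lambda>a. h (basis_vector [GenT a]))"
proof -
  interpret representation "free_algebra (hecke_generators n)" p h
    using h falgebra_free by (simp add: representation_def representation_axioms_def)
  have pp: "p * p = p" using hom_mult[of "\<one>\<^bsub>free_algebra (hecke_generators n)\<^esub>" "\<one>\<^bsub>free_algebra (hecke_generators n)\<^esub>"] by simp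
  have far: "(\<forall>a\<in>{1..<n}. \<forall>b\<in>{1..<n}. \<bar>int a - int b\<bar> > 1 \<longrightarrow> T a * T b - T b * T a = 0) \<longleftrightarrow>
      (\<forall>a\<in>{1..<n}. \<forall>b\<in>{1..<n}. a + 1 < b \<longrightarrow> T a * T b = T b * T a)" for T :: "nat \<Rightarrow> ('x, 'f) endo"
  proof (intro iffI ballI impI)
    fix a b assume *: "\<forall>a\<in>{1..<n}. \<forall>b\<in>{1..<n}. a + 1 < b \<longrightarrow> T a * T b = T b * T a"
      "a \<in> {1..<n}" "b \<in> {1..<n}" "\<bar>int a - int b\<bar> > 1"
    then have "a + 1 < b \<or> b + 1 < a" by linarith
    then have "T a * T b = T b * T a" using *(1-3) by metis
    then show "T a * T b - T b * T a = 0" by simp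
  next
    fix a b assume *: "\<forall>a\<in>{1..<n}. \<forall>b\<in>{1..<n}. \<bar>int a - int b\<bar> > 1 \<longrightarrow> T a * T b - T b * T a = 0"
      "a \<in> {1..<n}" "b \<in> {1..<n}" "a + 1 < b"
    then have "\<bar>int a - int b\<bar> > 1" by linarith
    then have "T a * T b - T b * T a = 0" using * by blast
    then show "T a * T b = T b * T a" by simp
  qed
  let ?F = "free_algebra (hecke_generators n) :: ('f, _) module"
  let ?S = "basis_vector [GenS] :: hecke_generator list \<Rightarrow> 'f" and ?T = "\<lambda>a. basis_vector [GenT a] :: hecke_generator list \<Rightarrow> 'f"
  have cl: "?S \<in> carrier ?F" "\<And>a. a \<in> {1..<n} \<Longrightarrow> ?T a \<in> carrier ?F"
    using hecke_generators_closed[OF n] by auto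
  define s t where "s = h ?S" and "t a = h (?T a)" for a
  note st = s_def[symmetric] t_def[symmetric]
  have ball1: "(\<forall>r\<in>{f a | a. A a}. h r = 0) \<longleftrightarrow> (\<forall>a. A a \<longrightarrow> g a = 0)"
    if "\<And>a. A a \<Longrightarrow> h (f a) = g a" for f :: "nat \<Rightarrow> hecke_generator list \<Rightarrow> 'f" and A g
    using that by fastforce
  have ball2: "(\<forall>r\<in>{f a b | a b. A a b}. h r = 0) \<longleftrightarrow> (\<forall>a b. A a b \<longrightarrow> g a b = 0)"
    if "\<And>a b. A a b \<Longrightarrow> h (f a b) = g a b" for f :: "nat \<Rightarrow> nat \<Rightarrow> hecke_generator list \<Rightarrow> 'f" and A g
    using that by fastforce
  have ev: "h (poly_eval_algebra ?F P ?S) = peval p P s"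
    "a \<in> {1..<n} \<Longrightarrow> h ((?T a \<oplus>\<^bsub>?F\<^esub> \<one>\<^bsub>?F\<^esub>) \<otimes>\<^bsub>?F\<^esub> (?T a \<ominus>\<^bsub>?F\<^esub> q \<odot>\<^bsub>?F\<^esub> \<one>\<^bsub>?F\<^esub>)) = (t a + p) * (t a - q *\<^sub>s p)"
    "a \<in> {1..<n} \<Longrightarrow> h (?S \<otimes>\<^bsub>?F\<^esub> ?T a \<otimes>\<^bsub>?F\<^esub> ?S \<otimes>\<^bsub>?F\<^esub> ?T a \<ominus>\<^bsub>?F\<^esub> ?T a \<otimes>\<^bsub>?F\<^esub> ?S \<otimes>\<^bsub>?F\<^esub> ?T a \<otimes>\<^bsub>?F\<^esub> ?S) =
       s * t a * s * t a - t a * s * t a * s"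
    "a \<in> {1..<n} \<Longrightarrow> h (?S \<otimes>\<^bsub>?F\<^esub> ?T a \<ominus>\<^bsub>?F\<^esub> ?T a \<otimes>\<^bsub>?F\<^esub> ?S) = s * t a - t a * s"
    "a \<in> {1..<n} \<Longrightarrow> b \<in> {1..<n} \<Longrightarrow> h (?T a \<otimes>\<^bsub>?F\<^esub> ?T b \<ominus>\<^bsub>?F\<^esub> ?T b \<otimes>\<^bsub>?F\<^esub> ?T a) = t a * t b - t b * t a"
    "a \<in> {1..<n} \<Longrightarrow> a + 1 \<in> {1..<n} \<Longrightarrow>
       h (?T a \<otimes>\<^bsub>?F\<^esub> ?T (a + 1) \<otimes>\<^bsub>?F\<^esub> ?T a \<ominus>\<^bsub>?F\<^esub> ?T (a + 1) \<otimes>\<^bsub>?F\<^esub> ?T a \<otimes>\<^bsub>?F\<^esub> ?T (a + 1)) =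
       t a * t (a + 1) * t a - t (a + 1) * t a * t (a + 1)" for a b
    using cl by (simp_all only: hom_poly_eval st hom_add hom_mult hom_minus hom_smult hom_one
        m_closed a_closed minus_closed one_closed smult_closed)
  have corner: "in_corner p s" "\<And>a. a \<in> {1..<n} \<Longrightarrow> in_corner p (t a)"
    using cl by (simp_all add: in_corner_def s_def t_def)
  have "(\<forall>r\<in>hecke_relations q P n. h r = 0) \<longleftrightarrow>
    (((((\<forall>r\<in>{poly_eval_algebra ?F P ?S}. h r = 0) \<and>
    (\<forall>a. a \<in> {1..<n} \<longrightarrow> (t a + p) * (t a - q *\<^sub>s p) = 0)) \<and>
    (\<forall>a. a \<in> {1..<n} \<and> a = 1 \<longrightarrow> s * t a * s * t a - t a * s * t a * s = 0)) \<and>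
    (\<forall>a. a \<in> {1..<n} \<and> a > 1 \<longrightarrow> s * t a - t a * s = 0)) \<and>
    (\<forall>a b. a \<in> {1..<n} \<and> b \<in> {1..<n} \<and> \<bar>int a - int b\<bar> > 1 \<longrightarrow> t a * t b - t b * t a = 0)) \<and>
    (\<forall>a. a \<in> {1..<n} \<and> a + 1 \<in> {1..<n} \<longrightarrow> t a * t (a + 1) * t a - t (a + 1) * t a * t (a + 1) = 0)"
    unfolding hecke_relations_def Let_def ball_Un
    by (intro arg_cong2[where f = "(\<and>)"] ball1 ball2 refl) ((erule conjE | rule ev | assumption)+)
  also have "\<dots> \<longleftrightarrow> hecke_tuple p q P n s t"
  proof -
    have "(\<forall>a b. a \<in> {1..<n} \<and> b \<in> {1..<n} \<and> \<bar>int a - int b\<bar> > 1 \<longrightarrow> t a * t b - t b * t a = 0) \<longleftrightarrow>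
      (\<forall>a\<in>{1..<n}. \<forall>b\<in>{1..<n}. a + 1 < b \<longrightarrow> t a * t b = t b * t a)"
      unfolding far[symmetric] by blast
    moreover have "(\<forall>a. a \<in> {1..<n} \<and> a + 1 \<in> {1..<n} \<longrightarrow> t a * t (a + 1) * t a - t (a + 1) * t a * t (a + 1) = 0)
      \<longleftrightarrow> (\<forall>a. 1 \<le> a \<and> a + 1 < n \<longrightarrow> t a * t (a + 1) * t a = t (a + 1) * t a * t (a + 1))"
      by auto
    moreover have "(\<forall>a. a \<in> {1..<n} \<and> a = 1 \<longrightarrow> s * t a * s * t a - t a * s * t a * s = 0) \<longleftrightarrow>
      (1 < n \<longrightarrow> s * t 1 * s * t 1 = t 1 * s * t 1 * s)"
      by auto
    ultimately show ?thesis
      using n corner unfolding hecke_tuple_def ball_simps ev(1) by (simp only: pp) auto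
  qed
  finally show ?thesis unfolding s_def t_def[abs_def] .
qed

lemma hecke_algebra_presented:
  "hecke_algebra q P n = presented_algebra (if n = 0 then {} else hecke_generators n) (if n = 0 then {} else hecke_relations q P n)"
  by (simp add: hecke_algebra_def)

lemma hecke_rels_carrier:
  "(if n = 0 then {} else hecke_relations q P n) \<subseteq> carrier (free_algebra (if n = 0 then {} else hecke_generators n))"
  using hecke_relations_closed[of n q P] by auto

lemma falgebra_hecke: "falgebra (hecke_algebra q P n)"
  unfolding hecke_algebra_presented by (rule falgebra_presented[OF hecke_rels_carrier])

lemma hecke_gen_closed:
  "0 < n \<Longrightarrow> hecke_gen q P n GenS \<in> carrier (hecke_algebra q P n)"
  "a \<in> {1..<n} \<Longrightarrow> hecke_gen q P n (GenT a) \<in> carrier (hecke_algebra q P n)"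
  using presented_gen_closed[OF hecke_relations_closed[of n q P]]
  by (auto simp: hecke_algebra_def hecke_gen_def hecke_generators_def)

lemma hecke_universal:
  assumes T: "hecke_tuple p q P n S T"
  obtains h where "alg_rep (hecke_algebra q P n) p h" "0 < n \<Longrightarrow> h (hecke_gen q P n GenS) = S"
    "\<And>a. a \<in> {1..<n} \<Longrightarrow> h (hecke_gen q P n (GenT a)) = T a"
proof (cases "n = 0")
  case True
  have "p * p = p" using T by (simp add: hecke_tuple_def)
  then obtain h where h: "alg_rep (free_algebra ({} :: hecke_generator set)) p h"
    using alg_rep_free[of p "{} :: hecke_generator set" "\<lambda>_. p"] by auto
  obtain h' where "alg_rep (presented_algebra ({} :: hecke_generator set) {}) p h'"
    using presented_universal[of "{}" "{} :: hecke_generator set" p h] h by blast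
  then show ?thesis using that[of h'] True by (simp add: hecke_algebra_def)
next
  case False
  then have n: "0 < n" by simp
  define \<phi> where "\<phi> g = (case g of GenS \<Rightarrow> S | GenT a \<Rightarrow> T a)" for g
  have "p * p = p" "\<And>g. g \<in> hecke_generators n \<Longrightarrow> p * \<phi> g = \<phi> g"
     "\<And>g. g \<in> hecke_generators n \<Longrightarrow> \<phi> g * p = \<phi> g"
    using T n by (auto simp: hecke_tuple_def \<phi>_def hecke_generators_def in_corner_def)
  then obtain h where h: "alg_rep (free_algebra (hecke_generators n)) p h"
      "\<And>g. g \<in> hecke_generators n \<Longrightarrow> h (basis_vector [g]) = \<phi> g"
    using alg_rep_free by metis
  have hS: "h (basis_vector [GenS]) = S" and hT: "\<And>a. a \<in> {1..<n} \<Longrightarrow> h (basis_vector [GenT a]) = T a"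
    using h(2) by (auto simp: \<phi>_def hecke_generators_def)
  have "hecke_tuple p q P n (h (basis_vector [GenS])) (\<lambda>a. h (basis_vector [GenT a]))"
    using T n hT unfolding hecke_tuple_def hS by auto
  then have "\<And>r. r \<in> hecke_relations q P n \<Longrightarrow> h r = 0"
    using hecke_relations_iff[OF n h(1)] by blast
  from presented_universal[OF hecke_relations_closed[OF n] h(1) this]
  obtain h' where h': "alg_rep (presented_algebra (hecke_generators n) (hecke_relations q P n)) p h'"
      "\<And>g. g \<in> hecke_generators n \<Longrightarrow> h' (presented_gen (hecke_generators n) (hecke_relations q P n) g) = h (basis_vector [g])"
    by blast
  show ?thesis
  proof (rule that[of h'])
    show "alg_rep (hecke_algebra q P n) p h'" using n h'(1) by (simp add: hecke_algebra_def)
  qed (use n h'(2) hS hT in \<open>auto simp: hecke_gen_def hecke_generators_def\<close>)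
qed

lemma hecke_tuple_rep:
  assumes h: "alg_rep (hecke_algebra q P n) p h"
  shows "hecke_tuple p q P n (h (hecke_gen q P n GenS)) (\<lambda>a. h (hecke_gen q P n (GenT a)))"
proof (cases "n = 0")
  case True
  interpret representation "hecke_algebra q P n" p h
    using h falgebra_hecke by (simp add: representation_def representation_axioms_def)
  have "p * p = p" using hom_mult[of "\<one>\<^bsub>hecke_algebra q P n\<^esub>" "\<one>\<^bsub>hecke_algebra q P n\<^esub>"] by simp
  then show ?thesis using True by (simp add: hecke_tuple_def)
next
  case False
  then have n: "0 < n" by simp
  have h': "alg_rep (presented_algebra (hecke_generators n) (hecke_relations q P n)) p h"
    using h n by (simp add: hecke_algebra_def)
  obtain k where k: "alg_rep (free_algebra (hecke_generators n)) p k" "\<And>r. r \<in> hecke_relations q P n \<Longrightarrow> k r = 0"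
    "\<And>g. k (basis_vector [g]) = h (presented_gen (hecke_generators n) (hecke_relations q P n) g)"
    using presented_relations[OF hecke_relations_closed[OF n] h'] by metis
  show ?thesis
    using hecke_relations_iff[OF n k(1), of q P] k(2,3) n by (simp add: hecke_gen_def)
qed

lemma hecke_induct [consumes 1, case_names one S T add mult smult]:
  assumes X: "X \<in> carrier (hecke_algebra q P n)"
    and one: "Q \<one>\<^bsub>hecke_algebra q P n\<^esub>"
    and S: "0 < n \<Longrightarrow> Q (hecke_gen q P n GenS)" and T: "\<And>a. a \<in> {1..<n} \<Longrightarrow> Q (hecke_gen q P n (GenT a))"
    and add: "\<And>x y. x \<in> carrier (hecke_algebra q P n) \<Longrightarrow> y \<in> carrier (hecke_algebra q P n) \<Longrightarrow>
        Q x \<Longrightarrow> Q y \<Longrightarrow> Q (x \<oplus>\<^bsub>hecke_algebra q P n\<^esub> y)"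
    and mult: "\<And>x y. x \<in> carrier (hecke_algebra q P n) \<Longrightarrow> y \<in> carrier (hecke_algebra q P n) \<Longrightarrow>
        Q x \<Longrightarrow> Q y \<Longrightarrow> Q (x \<otimes>\<^bsub>hecke_algebra q P n\<^esub> y)"
    and smult: "\<And>c x. x \<in> carrier (hecke_algebra q P n) \<Longrightarrow> Q x \<Longrightarrow> Q (c \<odot>\<^bsub>hecke_algebra q P n\<^esub> x)"
  shows "Q X"
proof (rule presented_induct[OF hecke_rels_carrier[of n q P], where P = Q])
  show "Q (presented_gen (if n = 0 then {} else hecke_generators n) (if n = 0 then {} else hecke_relations q P n) g)"
    if "g \<in> (if n = 0 then {} else hecke_generators n)" for g
    using that S T by (auto simp: hecke_generators_def hecke_gen_def split: if_splits)
qed (use assms in \<open>simp_all add: hecke_algebra_presented[symmetric]\<close>)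

subsection \<open>Pairs of neighbouring Jucys-Murphy elements\<close>

text \<open>Rank one affine Hecke relations. With \<open>y = T x T / q\<close> the two straightening
  rules are forms of the fact that \<open>q\<close> times the inverse of \<open>T\<close> is
  \<open>T - (q - 1)\<close>.\<close>

locale affine_pair =
  fixes p :: "('x, 'f::field) endo" and q :: 'f and T x y
  assumes pp: "p * p = p" and corner: "in_corner p T" "in_corner p x" "in_corner p y"
    and TT: "T * T = (q - 1) *\<^sub>s T + q *\<^sub>s p"
    and Tx: "T * x = y * T - (q - 1) *\<^sub>s y"
    and Ty: "T * y = x * T + (q - 1) *\<^sub>s y"
    and yx: "y * x = x * y"
begin

lemma unit [simp]: "p * T = T" "T * p = T" "p * x = x" "x * p = x" "p * y = y" "y * p = y"
  using corner by (auto simp: in_corner_def)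

lemma unit' [simp]: "p * (T * w) = T * w" "T * (p * w) = T * w" "p * (x * w) = x * w" "x * (p * w) = x * w"
   "p * (y * w) = y * w" "y * (p * w) = y * w" "p * (p * w) = p * w"
  by (simp_all add: pp flip: mult.assoc)

lemma straighten: "T * (T * w) = (q - 1) *\<^sub>s (T * w) + q *\<^sub>s (p * w)"
  "T * (x * w) = y * (T * w) - (q - 1) *\<^sub>s (y * w)"
  "T * (y * w) = x * (T * w) + (q - 1) *\<^sub>s (y * w)"
  "y * (x * w) = x * (y * w)"
  by (simp_all only: mult.assoc[symmetric] TT Tx Ty yx distrib_right left_diff_distrib scl_mult_left)

lemmas normalize = TT Tx Ty yx straighten

text \<open>The Bernstein intertwiner; the summand \<open>(q - 1) y\<close> compensates the
  correction terms in the straightening rules.\<close>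

definition \<phi> where "\<phi> = T * (x - y) + (q - 1) *\<^sub>s y"

lemma \<phi>_x: "\<phi> * x = y * \<phi>" and \<phi>_y: "\<phi> * y = x * \<phi>"
  unfolding \<phi>_def by (simp_all add: algebra_simps normalize)

text \<open>The two factors are the denominators that have to be inverted to normalise a
  crossing.\<close>

lemma \<phi>_square: "\<phi> * \<phi> = (q *\<^sub>s x - y) * (q *\<^sub>s y - x)"
proof -
  have "\<phi> * \<phi> = \<phi> * T * (x - y) + (q - 1) *\<^sub>s (\<phi> * y)"
    by (subst (2) \<phi>_def) (simp only: distrib_left mult.assoc scl_mult_right)
  also have "\<phi> * y = x * \<phi>" by (rule \<phi>_y)
  also have "\<phi> * T * (x - y) + (q - 1) *\<^sub>s (x * \<phi>) = (q *\<^sub>s x - y) * (q *\<^sub>s y - x)"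
    by (simp add: \<phi>_def algebra_simps normalize scl_simps)
  finally show ?thesis .
qed

lemma \<phi>_corner: "in_corner p \<phi>"
  unfolding in_corner_def \<phi>_def by (simp add: algebra_simps)

text \<open>With \<open>f\<close> the root polynomial of \<open>M\<close>, intertwining turns
  \<open>f(x) = 0\<close> into \<open>f(y) \<phi> \<phi> = 0\<close>, and the square of
  \<open>\<phi>\<close> is \<open>- q\<close> times \<open>(y - q x) (y - x / q)\<close>.\<close>

lemma kill_next:
  assumes "q \<noteq> 0" "peval p (root_poly M) x = 0"
  shows "peval p (root_poly (grow q M)) y = 0"
proof -
  have "\<phi> * peval p (root_poly M) x = peval p (root_poly M) y * \<phi>"
    using \<phi>_corner by (intro peval_intertwine \<phi>_x) (simp add: in_corner_def)
  then have "peval p (root_poly M) y * \<phi> * \<phi> = 0" using assms by simp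
  then have *: "peval p (root_poly M) y * ((q *\<^sub>s x - y) * (q *\<^sub>s y - x)) = 0"
    by (simp only: mult.assoc \<phi>_square)
  have "(q *\<^sub>s x - y) * (q *\<^sub>s y - x) = (- q) *\<^sub>s ((y - q *\<^sub>s x) * (y - (1 / q) *\<^sub>s x))"
    using assms(1) by (simp add: algebra_simps scl_simps normalize)
  then have "(- q) *\<^sub>s (peval p (root_poly M) y * ((y - q *\<^sub>s x) * (y - (1 / q) *\<^sub>s x))) = 0"
    using * by (simp only: scl_mult_right)
  then have "peval p (root_poly M) y * ((y - q *\<^sub>s x) * (y - (1 / q) *\<^sub>s x)) = 0"
    using assms(1) by simp
  then show ?thesis
    using pp corner yx assms by (intro peval_grow) simp_all
qed

text \<open>\<open>D\<close> is the Demazure operator of \<open>f\<close>.\<close>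

lemma T_peval:
  obtains D where "T * peval p f x = peval p f y * T - y * D" "T * peval p f y = peval p f x * T + y * D"
    "(y - x) * D = (q - 1) *\<^sub>s (peval p f y - peval p f x)" "D * x = x * D" "D * y = y * D" "D * p = p * D"
proof -
  have "\<exists>D. T * peval p f x = peval p f y * T - y * D \<and> T * peval p f y = peval p f x * T + y * D \<and>
    (y - x) * D = (q - 1) *\<^sub>s (peval p f y - peval p f x) \<and> D * x = x * D \<and> D * y = y * D \<and> D * p = p * D"
  proof (induction f)
    case 0
    show ?case by (rule exI[of _ 0]) simp
  next
    case (pCons a f)
    then obtain D where D: "T * peval p f x = peval p f y * T - y * D" "T * peval p f y = peval p f x * T + y * D"
      "(y - x) * D = (q - 1) *\<^sub>s (peval p f y - peval p f x)" "D * x = x * D" "D * y = y * D" "D * p = p * D"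
      by blast
    define u v where "u = peval p f x" and "v = peval p f y"
    note D = D[folded u_def v_def]
    have c: "u * x = x * u" "u * y = y * u" "v * x = x * v" "v * y = y * v"
      using yx by (auto simp: u_def v_def intro!: peval_commute[symmetric])
    have pu: "p * u = u * p" "p * v = v * p"
      using pp corner by (simp_all add: u_def v_def)
    have ev: "peval p (pCons a f) x = a *\<^sub>s p + x * u" "peval p (pCons a f) y = a *\<^sub>s p + y * v"
      using corner by (simp_all add: peval_pCons u_def v_def)
    have D3: "y * D = x * D + (q - 1) *\<^sub>s v - (q - 1) *\<^sub>s u"
      using D(3) by (simp add: algebra_simps)
    \<comment> \<open>The twisted Leibniz rule for multiplying \<open>f\<close> by the variable. The
      form with \<open>x * D\<close> is equal by the third property, and it is the one that appears
      when \<open>T\<close> meets \<open>y\<close>.\<close>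
    let ?D = "y * D + (q - 1) *\<^sub>s u"
    have D': "?D = x * D + (q - 1) *\<^sub>s v" unfolding D3 by simp
    have "T * (x * u) = y * (T * u) - (q - 1) *\<^sub>s (y * u)" by (rule straighten)
    then have 1: "T * (a *\<^sub>s p + x * u) = (a *\<^sub>s p + y * v) * T - y * ?D"
      unfolding D(1) by (simp add: algebra_simps)
    have "T * (y * v) = x * (T * v) + (q - 1) *\<^sub>s (y * v)" by (rule straighten)
    then have "T * (a *\<^sub>s p + y * v) = (a *\<^sub>s p + x * u) * T + y * (x * D + (q - 1) *\<^sub>s v)"
      unfolding D(2) by (simp add: algebra_simps straighten(4))
    then have 2: "T * (a *\<^sub>s p + y * v) = (a *\<^sub>s p + x * u) * T + y * ?D" unfolding D' .
    have "(y - x) * ?D = y * ((y - x) * D) + (q - 1) *\<^sub>s ((y - x) * u)"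
      by (simp add: algebra_simps normalize)
    also have "\<dots> = (q - 1) *\<^sub>s ((a *\<^sub>s p + y * v) - (a *\<^sub>s p + x * u))"
      unfolding D(3) by (simp add: algebra_simps)
    finally have 3: "(y - x) * ?D = (q - 1) *\<^sub>s ((a *\<^sub>s p + y * v) - (a *\<^sub>s p + x * u))" .
    have 4: "?D * x = x * ?D" "?D * y = y * ?D" "?D * p = p * ?D"
      using D c pu by (simp_all add: distrib_left distrib_right mult.assoc normalize)
    show ?case unfolding ev using 1 2 3 4 by blast
  qed
  with that show ?thesis by blast
qed

text \<open>The Demazure corrections cancel on an expression symmetric in \<open>x\<close> and
  \<open>y\<close>. Applied to the colour polynomials this lets \<open>T\<close> commute with the
  idempotents in which both strands have the same colour.\<close>

lemma T_symmetric: "T * (peval p f x * peval p f y) = peval p f x * peval p f y * T"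
proof -
  obtain D where D: "T * peval p f x = peval p f y * T - y * D" "T * peval p f y = peval p f x * T + y * D"
      "D * x = x * D" "D * y = y * D" "D * p = p * D"
    using T_peval[of f] by metis
  define u v where "u = peval p f x" and "v = peval p f y"
  have ux: "z * u = u * z" "z * v = v * z" if "z * p = p * z" "z * x = x * z" "z * y = y * z" for z
    using that by (auto simp: u_def v_def intro!: peval_commute)
  have "u * y = y * u" "v * y = y * v" "u * x = x * u" "v * x = x * v" using ux[of y] ux[of x] yx by auto
  moreover have "u * p = p * u" "v * p = p * v" using pp corner by (simp_all add: u_def v_def)
  ultimately have c: "v * y = y * v" "u * v = v * u" "D * v = v * D"
    using ux[of u] ux[of D] D by auto
  have "T * (u * v) = (T * u) * v" by (simp only: mult.assoc)
  also have "\<dots> = v * (T * v) - y * (D * v)"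
    using D(1)[folded u_def v_def] by (simp only: left_diff_distrib mult.assoc)
  also have "\<dots> = v * (u * T) + (v * y * D - y * (D * v))"
    using D(2)[folded u_def v_def] by (simp add: distrib_left mult.assoc)
  also have "v * y * D - y * (D * v) = 0" using c by (simp add: mult.assoc)
  also have "v * (u * T) + 0 = u * v * T" using c by (simp flip: mult.assoc)
  finally show ?thesis by (simp only: u_def v_def)
qed

text \<open>Here \<open>b\<^sub>1\<close> and \<open>b\<^sub>2\<close> are the scattering coefficients of \<open>x\<close> and of \<open>y\<close> with a third element \<open>z\<close>.\<close>

lemma T_scatter:
  assumes e: "T * e = e * T" and z: "T * z = z * T"
    and d1: "is_inverse e ((z - x) * e) d1" and d2: "is_inverse e ((z - y) * e) d2"
  defines "b1 \<equiv> (q - 1) *\<^sub>s (z * d1)" and "b2 \<equiv> (q - 1) *\<^sub>s (z * d2)"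
  shows "T * b2 = b1 * T + b1 * b2 - (q - 1) *\<^sub>s b1"
proof -
  have d1': "d1 * ((z - x) * e) = e" "d1 * e = d1" and d2': "(z - y) * e * d2 = e" "e * d2 = d2" "d2 * e = d2"
    using d1 d2 by (auto simp: is_inverse_def)
  have "T * (z - y) = (z - x) * T - (q - 1) *\<^sub>s y"
    by (simp add: algebra_simps Ty z)
  then have "T * (z - y) * e = ((z - x) * T - (q - 1) *\<^sub>s y) * e" by (rule arg_cong)
  then have "T * ((z - y) * e) = (z - x) * (T * e) - (q - 1) *\<^sub>s (y * e)"
    by (simp only: left_diff_distrib mult.assoc scl_mult_left)
  then have "d1 * (T * ((z - y) * e)) * d2 = d1 * ((z - x) * (e * T) - (q - 1) *\<^sub>s (y * e)) * d2"
    by (simp only: e)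
  also have "\<dots> = (d1 * ((z - x) * e)) * (T * d2) - (q - 1) *\<^sub>s (d1 * (y * (e * d2)))"
    by (simp only: right_diff_distrib left_diff_distrib mult.assoc scl_mult_left scl_mult_right)
  also have "\<dots> = (e * T) * d2 - (q - 1) *\<^sub>s (d1 * (y * d2))"
    by (simp only: d1' d2' mult.assoc)
  also have "(e * T) * d2 = T * d2"
    by (simp only: e[symmetric] mult.assoc d2')
  finally have "d1 * (T * ((z - y) * e)) * d2 = T * d2 - (q - 1) *\<^sub>s (d1 * (y * d2))" .
  moreover have "d1 * (T * ((z - y) * e)) * d2 = d1 * (T * ((z - y) * e * d2))" by (simp only: mult.assoc)
  moreover have "d1 * (T * ((z - y) * e * d2)) = (d1 * e) * T" unfolding d2'(1) e by (simp only: mult.assoc)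
  ultimately have Td2: "T * d2 = d1 * T + d1 * ((q - 1) *\<^sub>s (y * d2))" by (simp add: d1' algebra_simps)
  have "z * d2 - y * d2 = (z - y) * e * d2" by (simp only: mult.assoc d2' left_diff_distrib)
  then have "(q - 1) *\<^sub>s (z * d2 - y * d2) = (q - 1) *\<^sub>s e" by (simp only: d2')
  then have y: "(q - 1) *\<^sub>s (y * d2) = b2 - (q - 1) *\<^sub>s e"
    by (simp add: b2_def endo.scale_right_diff_distrib algebra_simps)
  have "T * b2 = (q - 1) *\<^sub>s (z * (T * d2))"
    unfolding b2_def by (simp only: scl_mult_right mult.assoc[symmetric] z)
  also have "\<dots> = b1 * T + b1 * ((q - 1) *\<^sub>s (y * d2))"
    unfolding Td2 b1_def by (simp only: distrib_left endo.scale_right_distrib scl_mult_left mult.assoc)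
  also have "\<dots> = b1 * T + b1 * b2 - (q - 1) *\<^sub>s (b1 * e)"
    unfolding y by (simp add: right_diff_distrib)
  also have "b1 * e = b1" by (simp add: b1_def d1' mult.assoc)
  finally show ?thesis .
qed

text \<open>Obtained as in \<open>T_scatter\<close>, starting from \<open>T * (z - x)\<close>. When
  \<open>b1\<close> and \<open>b2\<close> commute the correction is opposite to the one there, in
  accordance with the symmetry of \<open>b1 + b2\<close> in \<open>x\<close> and
  \<open>y\<close>.\<close>

lemma T_scatter':
  assumes e: "T * e = e * T" and z: "T * z = z * T"
    and d1: "is_inverse e ((z - x) * e) d1" and d2: "is_inverse e ((z - y) * e) d2"
  defines "b1 \<equiv> (q - 1) *\<^sub>s (z * d1)" and "b2 \<equiv> (q - 1) *\<^sub>s (z * d2)"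
  shows "T * b1 = b2 * T - b2 * b1 + (q - 1) *\<^sub>s b1"
proof -
  have d1': "(z - x) * e * d1 = e" "e * d1 = d1" "d1 * e = d1" and d2': "d2 * ((z - y) * e) = e" "e * d2 = d2" "d2 * e = d2"
     "(z - y) * e * d2 = e"
    using d1 d2 by (auto simp: is_inverse_def)
  have "T * (z - x) = (z - y) * T + (q - 1) *\<^sub>s y"
    by (simp add: algebra_simps Tx z)
  then have "T * (z - x) * e = ((z - y) * T + (q - 1) *\<^sub>s y) * e" by (rule arg_cong)
  then have "T * ((z - x) * e) = (z - y) * (T * e) + (q - 1) *\<^sub>s (y * e)"
    by (simp only: distrib_right left_diff_distrib mult.assoc scl_mult_left)
  then have "d2 * (T * ((z - x) * e)) * d1 = d2 * ((z - y) * (e * T) + (q - 1) *\<^sub>s (y * e)) * d1"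
    by (simp only: e)
  also have "\<dots> = (d2 * ((z - y) * e)) * (T * d1) + (q - 1) *\<^sub>s (d2 * (y * (e * d1)))"
    by (simp only: right_diff_distrib left_diff_distrib distrib_left distrib_right mult.assoc scl_mult_left scl_mult_right)
  also have "\<dots> = (e * T) * d1 + (q - 1) *\<^sub>s (d2 * (y * d1))"
    by (simp only: d1' d2' mult.assoc)
  also have "(e * T) * d1 = T * d1"
    by (simp only: e[symmetric] mult.assoc d1')
  finally have "d2 * (T * ((z - x) * e)) * d1 = T * d1 + (q - 1) *\<^sub>s (d2 * (y * d1))" .
  moreover have "d2 * (T * ((z - x) * e)) * d1 = d2 * (T * ((z - x) * e * d1))" by (simp only: mult.assoc)
  moreover have "d2 * (T * ((z - x) * e * d1)) = (d2 * e) * T" unfolding d1'(1) e by (simp only: mult.assoc)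
  ultimately have Td1: "T * d1 = d2 * T - (q - 1) *\<^sub>s (d2 * (y * d1))" by (simp add: d2' algebra_simps)
  have "d2 * (z * d1) - d2 * (y * d1) = d2 * ((z - y) * e) * d1"
    using d1' by (simp add: right_diff_distrib left_diff_distrib mult.assoc)
  then have "d2 * (z * d1) - d2 * (y * d1) = d1" unfolding d2'(1) d1'(2) .
  then have y: "d2 * (y * d1) = d2 * (z * d1) - d1" by (simp add: algebra_simps)
  have "T * b1 = (q - 1) *\<^sub>s (z * (T * d1))"
    unfolding b1_def by (simp only: scl_mult_right mult.assoc[symmetric] z)
  also have "\<dots> = b2 * T - b2 * b1 + (q - 1) *\<^sub>s b1"
    unfolding Td1 y b1_def b2_def
    by (simp add: right_diff_distrib endo.scale_right_diff_distrib mult.assoc algebra_simps)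
  finally show ?thesis .
qed

end

subsection \<open>Jucys-Murphy elements\<close>

text \<open>Extends a relation by a remaining factor \<open>w\<close>, so that it can rewrite the
  interior of a right-nested word.\<close>

lemma mult_right_cong:
  fixes a :: "'r::semigroup_mult"
  shows "a * b = c * d \<Longrightarrow> a * (b * w) = c * (d * w)"
    and "a * (b * e) = c * (d * f) \<Longrightarrow> a * (b * (e * w)) = c * (d * (f * w))"
    and "a * (b * (e * g)) = c * (d * (f * h)) \<Longrightarrow> a * (b * (e * (g * w))) = c * (d * (f * (h * w)))"
  by (simp_all only: mult.assoc[symmetric])

text \<open>Positions are numbered from one, and the value at zero is a dummy.\<close>

primrec jm :: "'f::field \<Rightarrow> ('x, 'f) endo \<Rightarrow> (nat \<Rightarrow> ('x, 'f) endo) \<Rightarrow> nat \<Rightarrow> ('x, 'f) endo" where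
  "jm q S T 0 = S"
| "jm q S T (Suc a) = (if a = 0 then S else (1 / q) *\<^sub>s (T a * jm q S T a * T a))"

locale hecke =
  fixes p :: "('x, 'f::field) endo" and q :: 'f and P n S T
  assumes tuple: "hecke_tuple p q P n S T" and q0: "q \<noteq> 0"
begin

abbreviation "X \<equiv> jm q S T"

lemma pp [simp]: "p * p = p"
  using tuple by (simp add: hecke_tuple_def)

lemma S_corner: "0 < n \<Longrightarrow> in_corner p S" and S_kill: "0 < n \<Longrightarrow> peval p P S = 0"
  and T_corner: "a \<in> {1..<n} \<Longrightarrow> in_corner p (T a)"
  and STST: "1 < n \<Longrightarrow> S * T 1 * S * T 1 = T 1 * S * T 1 * S"
  and S_T: "a \<in> {1..<n} \<Longrightarrow> 1 < a \<Longrightarrow> S * T a = T a * S"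
  and T_T: "a \<in> {1..<n} \<Longrightarrow> b \<in> {1..<n} \<Longrightarrow> a + 1 < b \<Longrightarrow> T a * T b = T b * T a"
  and braid: "1 \<le> a \<Longrightarrow> a + 1 < n \<Longrightarrow> T a * T (a + 1) * T a = T (a + 1) * T a * T (a + 1)"
  using tuple unfolding hecke_tuple_def by blast+

lemma TT: assumes "a \<in> {1..<n}" shows "T a * T a = (q - 1) *\<^sub>s T a + q *\<^sub>s p"
proof -
  have "(T a + p) * (T a - q *\<^sub>s p) = 0" using tuple assms unfolding hecke_tuple_def by blast
  then show ?thesis using T_corner[OF assms] by (simp add: algebra_simps in_corner_def scl_simps)
qed

lemma X_Suc: "1 \<le> a \<Longrightarrow> X (a + 1) = (1 / q) *\<^sub>s (T a * X a * T a)" by simp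

lemma TXT: "1 \<le> a \<Longrightarrow> T a * X a * T a = q *\<^sub>s X (a + 1)"
  using q0 by simp

lemma X_corner: "1 \<le> a \<Longrightarrow> a \<le> n \<Longrightarrow> in_corner p (X a)"
proof (induction a rule: nat_induct_at_least)
  case base
  then show ?case using S_corner by simp
next
  case (Suc a)
  then show ?case using T_corner[of a] by (auto simp: in_corner_def mult.assoc simp flip: mult.assoc[of p])
qed

lemma T_X_less:
  assumes a: "a \<in> {1..<n}" and "1 \<le> b" "b < a"
  shows "T a * X b = X b * T a"
  using assms(2,3)
proof (induction b rule: nat_induct_at_least)
  case base
  then show ?case using S_T[OF a] by simp
next
  case (Suc b)
  have "T b * T a = T a * T b" using Suc a by (intro T_T) auto
  then have "T a * (T b * X b * T b) = T b * X b * T b * T a"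
    using Suc by (intro commute_mult) auto
  then show ?case using Suc.hyps by simp
qed

text \<open>The relation between \<open>S\<close> and \<open>T 1\<close> propagates along the
  strands. The next element is \<open>t x t\<close> up to a scalar, and the claim becomes an
  identity of words that uses the braid relation for \<open>t\<close> and \<open>t'\<close>, the
  relation for \<open>x\<close> and \<open>t\<close>, and that \<open>t'\<close> commutes with
  \<open>x\<close>.\<close>

lemma X_T_X_T:
  assumes "1 \<le> a" "a < n"
  shows "X a * T a * X a * T a = T a * X a * T a * X a"
  using assms
proof (induction a rule: nat_induct_at_least)
  case base
  then show ?case using STST by simp
next
  case (Suc a)
  define x t t' where "x = X a" and "t = T a" and "t' = T (a + 1)"
  have h1: "t' * x = x * t'" unfolding x_def t'_def using Suc by (intro T_X_less) auto
  have h2: "t * (t' * t) = t' * (t * t')" using Suc braid[of a] by (simp add: t_def t'_def mult.assoc)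
  have h3: "x * (t * (x * t)) = t * (x * (t * x))" using Suc by (simp add: x_def t_def mult.assoc)
  have h1': "t' * (x * w) = x * (t' * w)" for w using h1 by (rule mult_right_cong)
  have h2': "t * (t' * (t * w)) = t' * (t * (t' * w))" for w using h2 by (rule mult_right_cong)
  have h3': "x * (t * (x * (t * w))) = t * (x * (t * (x * w)))" for w using h3 by (rule mult_right_cong)
  have "(t * x * t) * t' * (t * x * t) * t' = t * x * (t * t' * t) * x * t * t'" by (simp only: mult.assoc)
  also have "\<dots> = t * x * (t' * t * t') * x * t * t'" by (simp only: mult.assoc h2 h2')
  also have "\<dots> = t * t' * x * t * x * (t' * t * t')" by (simp only: mult.assoc h1 h1')
  also have "\<dots> = t * t' * x * t * x * (t * t' * t)" by (simp only: mult.assoc h2 h2')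
  also have "\<dots> = t * t' * (x * t * x * t) * t' * t" by (simp only: mult.assoc)
  also have "\<dots> = t * t' * (t * x * t * x) * t' * t" by (simp only: mult.assoc h3 h3')
  also have "\<dots> = (t * t' * t) * x * t * x * t' * t" by (simp only: mult.assoc)
  also have "\<dots> = (t' * t * t') * x * t * x * t' * t" by (simp only: mult.assoc h2 h2')
  also have "\<dots> = t' * t * x * (t' * t * t') * x * t" by (simp only: mult.assoc h1 h1')
  also have "\<dots> = t' * t * x * (t * t' * t) * x * t" by (simp only: mult.assoc h2 h2')
  also have "\<dots> = t' * (t * x * t) * t' * (t * x * t)" by (simp only: mult.assoc)
  finally have "(t * x * t) * t' * (t * x * t) * t' = t' * (t * x * t) * t' * (t * x * t)" .
  then show ?case using Suc.hyps by (simp add: x_def t_def t'_def mult.assoc)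
qed

text \<open>At distance two the braid relation moves \<open>T a\<close> through
  \<open>T (a + 1) * T a\<close> and turns it into \<open>T (a + 1)\<close>, which commutes with
  \<open>X a\<close>; beyond that only distant generators are added.\<close>

lemma T_X_greater:
  assumes "1 \<le> a" "a + 2 \<le> b" "b \<le> n"
  shows "T a * X b = X b * T a"
  using assms(2,3)
proof (induction b rule: nat_induct_at_least)
  case base
  define x t t' where "x = X a" and "t = T a" and "t' = T (a + 1)"
  have h1: "t' * x = x * t'" unfolding x_def t'_def using base assms by (intro T_X_less) auto
  have h2: "t * (t' * t) = t' * (t * t')" using base assms braid[of a] by (simp add: t_def t'_def mult.assoc)
  have h1': "t' * (x * w) = x * (t' * w)" for w using h1 by (rule mult_right_cong)
  have h2': "t * (t' * (t * w)) = t' * (t * (t' * w))" for w using h2 by (rule mult_right_cong)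
  have "t * (t' * (t * x * t) * t') = (t * t' * t) * x * t * t'" by (simp only: mult.assoc)
  also have "\<dots> = (t' * t * t') * x * t * t'" by (simp only: mult.assoc h2 h2')
  also have "\<dots> = t' * t * x * (t' * t * t')" by (simp only: mult.assoc h1 h1')
  also have "\<dots> = t' * t * x * (t * t' * t)" by (simp only: mult.assoc h2 h2')
  also have "\<dots> = t' * (t * x * t) * t' * t" by (simp only: mult.assoc)
  finally have "t * (t' * (t * x * t) * t') = t' * (t * x * t) * t' * t" .
  then show ?case using assms by (simp add: x_def t_def t'_def numeral_2_eq_2)
next
  case (Suc b)
  have "T a * T b = T b * T a" using Suc assms by (intro T_T) auto
  then have "T a * (T b * X b * T b) = T b * X b * T b * T a"
    using Suc by (intro commute_mult) auto
  then show ?case using Suc.hyps by simp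
qed

lemma T_X: "a \<in> {1..<n} \<Longrightarrow> b \<in> {1..n} \<Longrightarrow> b \<noteq> a \<Longrightarrow> b \<noteq> a + 1 \<Longrightarrow> T a * X b = X b * T a"
  using T_X_less[of a b] T_X_greater[of a b] by (cases "b < a") auto

text \<open>For neighbours this is \<open>X_T_X_T\<close>; afterwards the larger element only
  acquires factors that commute with the smaller one.\<close>

lemma X_X_less: "1 \<le> a \<Longrightarrow> a < b \<Longrightarrow> b \<le> n \<Longrightarrow> X a * X b = X b * X a"
proof (induction b)
  case (Suc b)
  show ?case
  proof (cases "a = b")
    case True
    then show ?thesis using X_T_X_T[of a] Suc.prems by (simp add: mult.assoc)
  next
    case False
    have "T b * X a = X a * T b" using Suc.prems False by (intro T_X_less) auto
    then have "X a * (T b * X b * T b) = T b * X b * T b * X a"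
      using Suc False by (intro commute_mult) auto
    then show ?thesis using False Suc.prems by simp
  qed
qed simp

lemma X_X: "a \<in> {1..n} \<Longrightarrow> b \<in> {1..n} \<Longrightarrow> X a * X b = X b * X a"
  using X_X_less[of a b] X_X_less[of b a] by (cases a b rule: linorder_cases) auto

lemma T_X_eq:
  assumes a: "a \<in> {1..<n}"
  shows "T a * X a = X (a + 1) * T a - (q - 1) *\<^sub>s X (a + 1)"
    "T a * X (a + 1) = X a * T a + (q - 1) *\<^sub>s X (a + 1)"
proof -
  have u: "X a * p = X a" "p * X a = X a" using X_corner[of a] a by (auto simp: in_corner_def)
  have TXT': "T a * (X a * T a) = q *\<^sub>s X (a + 1)" using TXT[of a] a by (simp add: mult.assoc del: jm.simps)
  have "q *\<^sub>s (X (a + 1) * T a) = T a * X a * T a * T a" using TXT[of a] a by (simp del: jm.simps)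
  also have "\<dots> = T a * X a * (T a * T a)" by (simp only: mult.assoc)
  also have "\<dots> = (q - 1) *\<^sub>s (T a * (X a * T a)) + q *\<^sub>s (T a * X a)"
    unfolding TT[OF a] by (simp add: distrib_left mult.assoc u del: jm.simps)
  also have "\<dots> = q *\<^sub>s ((q - 1) *\<^sub>s X (a + 1) + T a * X a)"
    unfolding TXT' by (simp add: endo.scale_right_distrib mult.commute del: jm.simps)
  finally show "T a * X a = X (a + 1) * T a - (q - 1) *\<^sub>s X (a + 1)" using q0 by (simp del: jm.simps)
  have "q *\<^sub>s (T a * X (a + 1)) = T a * (T a * (X a * T a))" using TXT' by (simp del: jm.simps)
  also have "\<dots> = (T a * T a) * (X a * T a)" by (simp only: mult.assoc)
  also have "\<dots> = (q - 1) *\<^sub>s (T a * (X a * T a)) + q *\<^sub>s (X a * T a)"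
    unfolding TT[OF a] by (simp add: distrib_right mult.assoc u del: jm.simps flip: mult.assoc[of p])
  also have "\<dots> = q *\<^sub>s ((q - 1) *\<^sub>s X (a + 1) + X a * T a)"
    unfolding TXT' by (simp add: endo.scale_right_distrib mult.commute del: jm.simps)
  finally show "T a * X (a + 1) = X a * T a + (q - 1) *\<^sub>s X (a + 1)" using q0 by (simp del: jm.simps add: add.commute)
qed

lemma pair: "a \<in> {1..<n} \<Longrightarrow> affine_pair p q (T a) (X a) (X (a + 1))"
  using T_corner X_corner[of a] X_corner[of "a + 1"] TT T_X_eq X_X[of "a + 1" a]
  by unfold_locales (auto simp del: jm.simps)

text \<open>Position \<open>a\<close> needs only \<open>a - 1\<close> steps of growth;
  \<open>n\<close> steps give one multiset valid for all positions.\<close>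

lemma X_kill:
  assumes "0 < n" "P = root_poly M" "a \<in> {1..n}"
  shows "peval p (root_poly ((grow q ^^ n) M)) (X a) = 0"
proof -
  have "peval p (root_poly ((grow q ^^ (a - 1)) M)) (X a) = 0" if "1 \<le> a" "a \<le> n" for a
    using that
  proof (induction a rule: nat_induct_at_least)
    case base
    then show ?case using S_kill assms by simp
  next
    case (Suc a)
    then interpret affine_pair p q "T a" "X a" "X (a + 1)" by (intro pair) auto
    have "peval p (root_poly (grow q ((grow q ^^ (a - 1)) M))) (X (a + 1)) = 0"
      using Suc q0 by (intro kill_next) auto
    moreover have "grow q ((grow q ^^ (a - 1)) M) = (grow q ^^ (Suc a - 1)) M"
      using Suc.hyps by (cases a) auto
    ultimately show ?case by simp
  qed
  with assms(3) have kill: "peval p (root_poly ((grow q ^^ (a - 1)) M)) (X a) = 0" by simp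
  have "a - 1 \<le> n" "in_corner p (X a)" using assms(3) X_corner[of a] by auto
  then show ?thesis using kill root_poly_dvd_grow peval_dvd[OF pp] by metis
qed

end

subsection \<open>Scattering coefficients\<close>

text \<open>The quotient \<open>(q - 1) y / (y - x)\<close> in the corner of \<open>e\<close>; the
  choice in \<open>inverse_in\<close> is meaningful once \<open>y - x\<close> is invertible
  there.\<close>

definition scatter :: "'f::field \<Rightarrow> ('x, 'f) endo \<Rightarrow> ('x, 'f) endo \<Rightarrow> ('x, 'f) endo \<Rightarrow> ('x, 'f) endo" where
  "scatter q e x y = (q - 1) *\<^sub>s (y * inverse_in e ((y - x) * e))"

lemma inverse_commute:
  assumes "is_inverse e w d" "z * w = w * z" "z * e = e * z"
  shows "z * d = d * z"
proof -
  have d: "e * d = d" "d * e = d" "d * w = e" "w * d = e" using assms(1) by (auto simp: is_inverse_def)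
  have "z * d = (z * e) * d" by (simp only: d mult.assoc)
  also have "\<dots> = e * (z * d)" by (simp only: assms(3) mult.assoc)
  also have "\<dots> = d * (w * z) * d" by (simp only: d(3)[symmetric] mult.assoc)
  also have "\<dots> = d * (z * (w * d))" by (simp only: assms(2)[symmetric] mult.assoc)
  also have "\<dots> = d * e * z" by (simp only: d(4) assms(3) mult.assoc)
  finally show ?thesis by (simp only: d(2))
qed

locale scatter_pair =
  fixes q :: "'f::field" and e x y :: "('x, 'f) endo" and d
  assumes ee: "e * e = e" and xe: "x * e = e * x" and ye: "y * e = e * y" and xy: "x * y = y * x"
    and d: "is_inverse e ((y - x) * e) d"
begin

lemma d': "e * d = d" "d * e = d" "d * ((y - x) * e) = e" "(y - x) * e * d = e" "(y - x) * d = e" "d * (y - x) = e"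
proof -
  show *: "e * d = d" "d * e = d" "d * ((y - x) * e) = e" "(y - x) * e * d = e"
    using d by (auto simp: is_inverse_def)
  show "(y - x) * d = e" using * by (simp add: mult.assoc)
  have "d * (y - x) = d * e * (y - x)" by (simp only: *)
  also have "\<dots> = d * ((y - x) * e)" using xe ye by (simp only: mult.assoc right_diff_distrib left_diff_distrib)
  finally show "d * (y - x) = e" by (simp only: *)
qed

lemma d_commute: "z * x = x * z \<Longrightarrow> z * y = y * z \<Longrightarrow> z * e = e * z \<Longrightarrow> z * d = d * z"
  by (rule inverse_commute[OF d], rule commute_mult(2)) (simp_all add: left_diff_distrib right_diff_distrib)

lemma scatter_eq: "scatter q e x y = (q - 1) *\<^sub>s (y * d)"
  using inverse_in_eq[OF d] by (simp add: scatter_def)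

lemma scatter_swap_eq: "scatter q e y x = - ((q - 1) *\<^sub>s (x * d))"
proof -
  have "is_inverse e ((x - y) * e) (- d)"
    using is_inverse_uminus[OF d] by (simp add: left_diff_distrib)
  from inverse_in_eq[OF this] show ?thesis
    unfolding scatter_def by simp
qed

text \<open>\<open>y / (y - x) + x / (x - y) = 1\<close>.\<close>

lemma scatter_swap: "scatter q e x y + scatter q e y x = (q - 1) *\<^sub>s e"
proof -
  have "scatter q e x y + scatter q e y x = (q - 1) *\<^sub>s ((y - x) * d)"
    unfolding scatter_eq scatter_swap_eq
    by (simp add: left_diff_distrib endo.scale_right_diff_distrib endo.scale_minus_left)
  then show ?thesis by (simp only: d')
qed

lemma scatter_corner: "e * scatter q e x y = scatter q e x y" "scatter q e x y * e = scatter q e x y"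
proof -
  have "e * (y * d) = (e * y) * d" by (simp only: mult.assoc)
  also have "\<dots> = y * (e * d)" by (simp only: ye[symmetric] mult.assoc)
  finally have "e * (y * d) = y * d" by (simp only: d')
  then show "e * scatter q e x y = scatter q e x y" unfolding scatter_eq by simp
  show "scatter q e x y * e = scatter q e x y" unfolding scatter_eq using d' by (simp add: mult.assoc)
qed

lemma scatter_commute:
  assumes "z * x = x * z" "z * y = y * z" "z * e = e * z"
  shows "z * scatter q e x y = scatter q e x y * z"
proof -
  have "z * (y * d) = y * d * z" using assms(2) d_commute[OF assms] by (rule commute_mult(2))
  then show ?thesis unfolding scatter_eq by simp
qed

text \<open>\<open>q - b = (y - q x) / (y - x)\<close> for the scattering coefficient \<open>b\<close> of \<open>x\<close> and \<open>y\<close>.\<close>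

lemma scatter_inverse:
  assumes "is_inverse e ((y - q *\<^sub>s x) * e) f"
  shows "is_inverse e (q *\<^sub>s e - scatter q e x y) ((y - x) * f)"
    "q *\<^sub>s e - scatter q e x y = (y - q *\<^sub>s x) * d"
proof -
  have f: "e * f = f" "f * e = f" "f * ((y - q *\<^sub>s x) * e) = e" "(y - q *\<^sub>s x) * e * f = e"
    using assms by (auto simp: is_inverse_def)
  have "q *\<^sub>s e = q *\<^sub>s ((y - x) * d)" by (simp only: d')
  then show *: "q *\<^sub>s e - scatter q e x y = (y - q *\<^sub>s x) * d"
    unfolding scatter_eq by (simp add: left_diff_distrib endo.scale_right_diff_distrib endo.scale_left_diff_distrib)
  have fc: "z * f = f * z" if "z * x = x * z" "z * y = y * z" "z * e = e * z" for z
    using that by (intro inverse_commute[OF assms] commute_mult(2)) (simp_all add: left_diff_distrib right_diff_distrib)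
  have ww: "(y - q *\<^sub>s x) * (y - x) = (y - x) * (y - q *\<^sub>s x)"
    by (simp add: algebra_simps xy)
  have "(y - x) * f = f * (y - x)" using xe ye xy by (intro fc) (simp_all add: algebra_simps)
  moreover have "(y - q *\<^sub>s x) * d = d * (y - q *\<^sub>s x)"
    using xe ye xy by (intro d_commute) (simp_all add: algebra_simps)
  moreover have "d * f = f * d" using fc[of d] d_commute[of x] d_commute[of y] d_commute[of e] xe ye xy ee by auto
  ultimately have "(y - x) * f * ((y - q *\<^sub>s x) * d) = f * ((y - x) * ((y - q *\<^sub>s x) * d))" by (simp only: mult.assoc)
  also have "\<dots> = f * ((y - q *\<^sub>s x) * ((y - x) * d))" by (simp only: mult.assoc[symmetric] ww)
  also have "\<dots> = e" by (simp only: d' f mult.assoc)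
  finally have 1: "(y - x) * f * ((y - q *\<^sub>s x) * d) = e" .
  have "((y - q *\<^sub>s x) * d) * ((y - x) * f) = (y - q *\<^sub>s x) * (d * (y - x)) * f" by (simp only: mult.assoc)
  also have "\<dots> = e" by (simp only: d' f)
  finally have 2: "((y - q *\<^sub>s x) * d) * ((y - x) * f) = e" .
  have 3: "(y - x) * f * e = (y - x) * f" by (simp only: f mult.assoc)
  have "e * (y - x) = (y - x) * e" using xe ye by (simp add: left_diff_distrib right_diff_distrib)
  then have "e * ((y - x) * f) = (y - x) * (e * f)" by (simp only: mult.assoc[symmetric])
  then have 4: "e * ((y - x) * f) = (y - x) * f" by (simp only: f)
  show "is_inverse e (q *\<^sub>s e - scatter q e x y) ((y - x) * f)"
    unfolding is_inverse_def * using 1 2 3 4 by blast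
qed

end

text \<open>With the common factor \<open>(q - 1)\<^sup>2\<close> removed, this is the partial fraction identity
  \<open>d\<^sub>1\<^sub>2 d\<^sub>2\<^sub>3 = (d\<^sub>1\<^sub>2 + d\<^sub>2\<^sub>3) d\<^sub>1\<^sub>3\<close> for \<open>d\<^sub>1\<^sub>2 = 1 / (y - x)\<close>, \<open>d\<^sub>2\<^sub>3 = 1 / (z - y)\<close> and \<open>d\<^sub>1\<^sub>3 = 1 / (z - x)\<close>.\<close>

lemma scatter_triple:
  fixes q :: "'f::field" and e x y z :: "('x, 'f) endo"
  assumes "scatter_pair e x y d12" "scatter_pair e y z d23" "scatter_pair e x z d13"
  defines "b12 \<equiv> scatter q e x y" and "b23 \<equiv> scatter q e y z" and "b13 \<equiv> scatter q e x z"
  shows "(q - 1) *\<^sub>s b13 - b12 * b13 + b12 * b23 - b23 * b13 = 0"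
proof -
  interpret p12: scatter_pair q e x y d12 by fact
  interpret p23: scatter_pair q e y z d23 by fact
  interpret p13: scatter_pair q e x z d13 by fact
  have cx: "d12 * x = x * d12" "d23 * x = x * d23" "d13 * x = x * d13"
    and cy: "d12 * y = y * d12" "d23 * y = y * d23" "d13 * y = y * d13"
    and cz: "d12 * z = z * d12" "d23 * z = z * d23" "d13 * z = z * d13"
    using p12.d_commute[of x] p23.d_commute[of x] p13.d_commute[of x]
      p12.d_commute[of y] p23.d_commute[of y] p13.d_commute[of y]
      p12.d_commute[of z] p23.d_commute[of z] p13.d_commute[of z]
      p12.xe p12.ye p23.ye p12.xy p23.xy p13.xy by auto
  have "d12 * d23 = d23 * d12" using p23.d_commute[of d12] cy cz p12.d' by auto
  have "d12 * d23 = d12 * d23 * ((z - x) * d13)" by (simp only: p13.d' p23.d' mult.assoc)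
  also have "(z - x) * d13 = (z - y) * d13 + (y - x) * d13" by (simp add: algebra_simps)
  also have "d12 * d23 * ((z - y) * d13 + (y - x) * d13) =
      d12 * (d23 * (z - y)) * d13 + (d12 * d23) * (y - x) * d13" by (simp only: distrib_left mult.assoc)
  also have "\<dots> = d12 * d13 + d23 * (d12 * (y - x)) * d13"
    by (simp only: p23.d' p12.d' \<open>d12 * d23 = d23 * d12\<close> mult.assoc)
  also have "\<dots> = d12 * d13 + d23 * d13" by (simp only: p23.d' p12.d')
  finally have frac: "d12 * d23 = d12 * d13 + d23 * d13" .
  have "b12 * b13 = ((q - 1) * (q - 1)) *\<^sub>s (z * (y * (d12 * d13)))"
    unfolding b12_def b13_def p12.scatter_eq p13.scatter_eq
    by (simp add: mult.assoc mult_right_cong(1)[OF cz(1)]) (simp add: mult_right_cong(1)[OF p23.xy])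
  moreover have "b12 * b23 = ((q - 1) * (q - 1)) *\<^sub>s (z * (y * (d12 * d23)))"
    unfolding b12_def b23_def p12.scatter_eq p23.scatter_eq
    by (simp add: mult.assoc mult_right_cong(1)[OF cz(1)]) (simp add: mult_right_cong(1)[OF p23.xy])
  moreover have "b23 * b13 = ((q - 1) * (q - 1)) *\<^sub>s (z * (z * (d23 * d13)))"
    unfolding b13_def b23_def p13.scatter_eq p23.scatter_eq
    by (simp add: mult.assoc mult_right_cong(1)[OF cz(2)])
  moreover have "(q - 1) *\<^sub>s b13 = ((q - 1) * (q - 1)) *\<^sub>s (z * ((z - y) * (d23 * d13)))"
  proof -
    have "(z - y) * (d23 * d13) = d13" by (simp only: p23.d' p13.d' mult.assoc[symmetric])
    then show ?thesis unfolding b13_def p13.scatter_eq by simp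
  qed
  ultimately have "(q - 1) *\<^sub>s b13 - b12 * b13 + b12 * b23 - b23 * b13 = ((q - 1) * (q - 1)) *\<^sub>s
      (z * ((z - y) * (d23 * d13)) - z * (y * (d12 * d13)) + z * (y * (d12 * d23)) - z * (z * (d23 * d13)))"
    by (simp only: endo.scale_right_distrib endo.scale_right_diff_distrib)
  also have "z * ((z - y) * (d23 * d13)) - z * (y * (d12 * d13)) + z * (y * (d12 * d23)) - z * (z * (d23 * d13)) = 0"
    unfolding frac by (simp add: algebra_simps)
  finally show ?thesis by simp
qed

subsection \<open>Braid relations of crossings and of generators\<close>

text \<open>Bookkeeping for three colours: the summands are grouped by the crossing word that they
  start with. The words of length two match as they stand, the hypotheses match those of length one
  and zero, and only the longest words survive.\<close>

lemma assemble_distinct: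
  fixes u :: "'g::ab_group_add"
  assumes "x1 + x2 = x" "s = y1 + y2" "c1 + c2 = c3 + c4"
  shows "(u + a + (c1 + x1) + (d + s + (x2 + c2))) - (v + d + (c3 + y1) + (a + x + (y2 + c4))) = u - v"
proof -
  have "c4 = c1 + c2 - c3" using assms(3) by (simp add: algebra_simps)
  then show ?thesis unfolding assms(1)[symmetric] assms(2) by (simp add: algebra_simps)
qed

lemma assemble_mixed:
  fixes u :: "'g::ab_group_add"
  assumes "s = y1 + y2" "c = c3 + c4"
  shows "(u + s + c) - (v + (c3 + y1) + (y2 + c4)) = u - v"
  unfolding assms by (simp add: algebra_simps)

text \<open>Three strands of different colours: the braid relation for the \<open>T\<^sub>a\<close> is equivalent to the
  one for the crossings of colours, because the lower order terms cancel.\<close>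

lemma braid_defect_distinct:
  fixes e :: "('x, 'f::field) endo"
  assumes ee: "e * e = e"
    and corner: "e * b12 = b12" "b12 * e = b12" "e * b13 = b13" "b13 * e = b13" "e * b23 = b23" "b23 * e = b23"
    and comm: "b13 * b12 = b12 * b13" "b23 * b12 = b12 * b23" "b23 * b13 = b13 * b23"
    and R: "(q - 1) *\<^sub>s b13 - b12 * b13 + b12 * b23 - b23 * b13 = 0"
    and T1: "T1 * e = s1 * (q *\<^sub>s e - b12) + b12" and T2: "T2 * e = s2 * (q *\<^sub>s e - b23) + b23"
    and T2s1: "T2 * s1 = s21 * (q *\<^sub>s e - b13) + s1 * b13"
    and T1s2: "T1 * s2 = s12 * (q *\<^sub>s e - b13) + s2 * b13"
    and T1s1: "T1 * s1 = e + b12 + s1 * ((q - 1) *\<^sub>s e - b12)"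
    and T2s2: "T2 * s2 = e + b23 + s2 * ((q - 1) *\<^sub>s e - b23)"
    and T1s21: "T1 * s21 = w1 * (q *\<^sub>s e - b23) + s21 * b23"
    and T2s12: "T2 * s12 = w2 * (q *\<^sub>s e - b12) + s12 * b12"
    and e: "s1 * e = s1" "s2 * e = s2" "s12 * e = s12" "s21 * e = s21" "w1 * e = w1" "w2 * e = w2"
  shows "(T1 * T2 * T1 - T2 * T1 * T2) * e =
    (w1 - w2) * ((q *\<^sub>s e - b12) * (q *\<^sub>s e - b13) * (q *\<^sub>s e - b23))"
proof -
  have corner': "e * (b12 * w) = b12 * w" "e * (b13 * w) = b13 * w" "e * (b23 * w) = b23 * w" for w
    by (simp_all only: corner mult.assoc[symmetric])
  have comm': "b13 * (b12 * w) = b12 * (b13 * w)" "b23 * (b12 * w) = b12 * (b23 * w)" "b23 * (b13 * w) = b13 * (b23 * w)" for w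
    by (simp_all only: comm mult.assoc[symmetric])
  have b: "T1 * b = s1 * ((q *\<^sub>s e - b12) * b) + b12 * b" "T2 * b = s2 * ((q *\<^sub>s e - b23) * b) + b23 * b"
    if "e * b = b" for b
    using arg_cong[OF T1, of "\<lambda>z. z * b"] arg_cong[OF T2, of "\<lambda>z. z * b"] that
    by (simp_all only: mult.assoc distrib_right)
  have m: "T2 * (s1 * w) = s21 * ((q *\<^sub>s e - b13) * w) + s1 * (b13 * w)"
    "T1 * (s2 * w) = s12 * ((q *\<^sub>s e - b13) * w) + s2 * (b13 * w)"
    "T1 * (s1 * w) = (e + b12) * w + s1 * (((q - 1) *\<^sub>s e - b12) * w)"
    "T2 * (s2 * w) = (e + b23) * w + s2 * (((q - 1) *\<^sub>s e - b23) * w)"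
    "T1 * (s21 * w) = w1 * ((q *\<^sub>s e - b23) * w) + s21 * (b23 * w)"
    "T2 * (s12 * w) = w2 * ((q *\<^sub>s e - b12) * w) + s12 * (b12 * w)" for w
    by (simp_all only: mult.assoc[symmetric] T2s1 T1s2 T1s1 T2s2 T1s21 T2s12 distrib_right)
  let ?a12 = "q *\<^sub>s e - b12" and ?a13 = "q *\<^sub>s e - b13" and ?a23 = "q *\<^sub>s e - b23"
  \<comment> \<open>Partial fractions, oriented so that the product \<open>b13 * b23\<close> is
    eliminated.\<close>
  have r: "b13 * b23 = (q - 1) *\<^sub>s b13 - b12 * b13 + b12 * b23" using R comm(3) by (simp add: algebra_simps)
  have r': "b13 * (b23 * w) = (q - 1) *\<^sub>s (b13 * w) - b12 * (b13 * w) + b12 * (b23 * w)" for w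
  proof -
    have "b13 * (b23 * w) = (b13 * b23) * w" by (simp only: mult.assoc)
    then show ?thesis unfolding r by (simp add: left_diff_distrib distrib_right mult.assoc)
  qed
  have "T2 * (T1 * e) = s21 * (?a13 * ?a12) + s1 * (b13 * ?a12) + (s2 * (?a23 * b12) + b23 * b12)"
    unfolding T1 by (simp only: distrib_left m b(2)[OF corner(1)])
  then have E1: "T1 * (T2 * (T1 * e)) = w1 * (?a23 * (?a13 * ?a12)) + s21 * (b23 * (?a13 * ?a12))
    + ((e + b12) * (b13 * ?a12) + s1 * (((q - 1) *\<^sub>s e - b12) * (b13 * ?a12)))
    + (s12 * (?a13 * (?a23 * b12)) + s2 * (b13 * (?a23 * b12)) + (s1 * (?a12 * (b23 * b12)) + b12 * (b23 * b12)))"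
    by (simp only: distrib_left m b(1)[OF corner'(3)])
  have "T1 * (T2 * e) = s12 * (?a13 * ?a23) + s2 * (b13 * ?a23) + (s1 * (?a12 * b23) + b12 * b23)"
    unfolding T2 by (simp only: distrib_left m b(1)[OF corner(5)])
  then have E2: "T2 * (T1 * (T2 * e)) = w2 * (?a12 * (?a13 * ?a23)) + s12 * (b12 * (?a13 * ?a23))
    + ((e + b23) * (b13 * ?a23) + s2 * (((q - 1) *\<^sub>s e - b23) * (b13 * ?a23)))
    + (s21 * (?a13 * (?a12 * b23)) + s1 * (b13 * (?a12 * b23)) + (s2 * (?a23 * (b12 * b23)) + b23 * (b12 * b23)))"
    by (simp only: distrib_left m b(2)[OF corner'(1)])
  have u: "?a23 * (?a13 * ?a12) = ?a12 * ?a13 * ?a23" "?a12 * (?a13 * ?a23) = ?a12 * ?a13 * ?a23"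
    by (simp_all add: algebra_simps corner corner' comm comm' ee)
  have v: "b23 * (?a13 * ?a12) = ?a13 * (?a12 * b23)" "?a13 * (?a23 * b12) = b12 * (?a13 * ?a23)"
    by (simp_all add: algebra_simps corner corner' comm comm' ee)
  \<comment> \<open>\<open>s1\<close>, \<open>s2\<close> and \<open>c\<close> compare the
    coefficients of the two short crossings and of the empty word; besides commutation they need the
    partial fraction relation.\<close>
  have s1: "((q - 1) *\<^sub>s e - b12) * (b13 * ?a12) + ?a12 * (b23 * b12) = b13 * (?a12 * b23)"
    by (simp add: algebra_simps corner corner' comm comm' ee scl_simps r r')
  have s2: "b13 * (?a23 * b12) = ((q - 1) *\<^sub>s e - b23) * (b13 * ?a23) + ?a23 * (b12 * b23)"
    by (simp add: algebra_simps corner corner' comm comm' ee scl_simps r r')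
  have c: "(e + b12) * (b13 * ?a12) + b12 * (b23 * b12) = (e + b23) * (b13 * ?a23) + b23 * (b12 * b23)"
    by (simp add: algebra_simps corner corner' comm comm' ee scl_simps r r')
  have "(T1 * T2 * T1 - T2 * T1 * T2) * e = T1 * (T2 * (T1 * e)) - T2 * (T1 * (T2 * e))"
    by (simp only: left_diff_distrib mult.assoc)
  also have "\<dots> = w1 * (?a12 * ?a13 * ?a23) - w2 * (?a12 * ?a13 * ?a23)"
    unfolding E1[unfolded u v] E2[unfolded u]
    by (rule assemble_distinct) (simp_all only: s1 s2 c distrib_left[symmetric])
  finally show ?thesis by (simp only: left_diff_distrib)
qed

text \<open>Strands one and two have the same colour and the third a different one. After the
  scattering relations for \<open>T1\<close> have removed the lower order terms, what remains is
  whether the double crossing carries \<open>T1\<close> to \<open>T2\<close>.\<close>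

lemma braid_defect_mixed:
  fixes e :: "('x, 'f::field) endo"
  assumes ee: "e * e = e" and Te: "T1 * e = e * T1"
    and corner: "e * b13 = b13" "b13 * e = b13" "e * b23 = b23" "b23 * e = b23"
    and comm: "b23 * b13 = b13 * b23"
    and quad: "T1 * T1 * e = (q - 1) *\<^sub>s (T1 * e) + q *\<^sub>s e"
    and M1: "T1 * b23 = b13 * T1 + b13 * b23 - (q - 1) *\<^sub>s b13"
    and M2: "T1 * b13 = b23 * T1 - b23 * b13 + (q - 1) *\<^sub>s b13"
    and T2: "T2 * e = s2 * (q *\<^sub>s e - b23) + b23"
    and T1s2: "T1 * s2 = s12 * (q *\<^sub>s e - b13) + s2 * b13"
    and T2s2: "T2 * s2 = e + b23 + s2 * ((q - 1) *\<^sub>s e - b23)"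
    and e: "s2 * e = s2" "s12 * e = s12"
  shows "(T1 * T2 * T1 - T2 * T1 * T2) * e =
    (s12 * T1 - T2 * s12) * ((q *\<^sub>s e - b13) * (q *\<^sub>s e - b23))"
proof -
  define T where "T = T1 * e"
  have T: "e * T = T" "T * e = T" unfolding T_def by (simp_all only: Te mult.assoc[symmetric] ee) (simp only: Te[symmetric] mult.assoc ee)
  have T1b: "T1 * b = T * b" if "e * b = b" for b
    using that by (simp add: T_def mult.assoc)
  have bT: "b * T1 = b * T" if "b * e = b" for b
  proof -
    have "b * T = b * (e * T1)" by (simp only: T_def Te)
    also have "\<dots> = b * T1" using that by (simp only: mult.assoc[symmetric])
    finally show ?thesis by simp
  qed
  have TT: "T * T = (q - 1) *\<^sub>s T + q *\<^sub>s e"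
  proof -
    have "T * T = T1 * (e * (T1 * e))" by (simp only: T_def mult.assoc)
    also have "e * (T1 * e) = T1 * e" using T by (simp only: T_def)
    finally show ?thesis using quad by (simp only: T_def mult.assoc)
  qed
  have m1: "T * b23 = b13 * T + b13 * b23 - (q - 1) *\<^sub>s b13"
    using M1 T1b[OF corner(3)] bT[OF corner(2)] by simp
  have m2: "T * b13 = b23 * T - b13 * b23 + (q - 1) *\<^sub>s b13"
    using M2 T1b[OF corner(1)] bT[OF corner(4)] comm by simp
  have corner': "e * (b13 * w) = b13 * w" "e * (b23 * w) = b23 * w" "e * (T * w) = T * w" for w
    by (simp_all only: corner T mult.assoc[symmetric])
  have corner'': "b13 * (e * w) = b13 * w" "b23 * (e * w) = b23 * w" "T * (e * w) = T * w" for w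
    by (simp_all only: corner T mult.assoc[symmetric])
  have comm': "b23 * (b13 * w) = b13 * (b23 * w)" for w
    by (simp only: comm mult.assoc[symmetric])
  have m1': "T * (b23 * w) = b13 * (T * w) + b13 * (b23 * w) - (q - 1) *\<^sub>s (b13 * w)"
    and m2': "T * (b13 * w) = b23 * (T * w) - b13 * (b23 * w) + (q - 1) *\<^sub>s (b13 * w)"
    and TT': "T * (T * w) = (q - 1) *\<^sub>s (T * w) + q *\<^sub>s (e * w)" for w
    by (simp_all only: mult.assoc[symmetric] m1 m2 TT left_diff_distrib distrib_right scl_mult_left)
  note norm = algebra_simps corner corner' corner'' comm comm' ee scl_simps m1 m1' m2 m2' TT TT' T
  let ?a13 = "q *\<^sub>s e - b13" and ?a23 = "q *\<^sub>s e - b23"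
  have b: "T2 * b = s2 * (?a23 * b) + b23 * b" if "e * b = b" for b
    using arg_cong[OF T2, of "\<lambda>z. z * b"] that by (simp only: mult.assoc distrib_right)
  have m: "T1 * (s2 * w) = s12 * (?a13 * w) + s2 * (b13 * w)"
    "T2 * (s2 * w) = (e + b23) * w + s2 * (((q - 1) *\<^sub>s e - b23) * w)" for w
    by (simp_all only: mult.assoc[symmetric] T1s2 T2s2 distrib_right)
  have "T2 * (T1 * e) = s2 * (?a23 * T) + b23 * T" using b[OF T(1)] by (simp only: T_def)
  then have E1: "T1 * (T2 * (T1 * e)) = s12 * (?a13 * (?a23 * T)) + s2 * (b13 * (?a23 * T)) + T * (b23 * T)"
    using T1b[of "b23 * T"] by (simp only: distrib_left m corner')
  have "T1 * (T2 * e) = s12 * (?a13 * ?a23) + s2 * (b13 * ?a23) + T * b23"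
    unfolding T2 using T1b[OF corner(3)] by (simp only: distrib_left m)
  then have E2: "T2 * (T1 * (T2 * e)) = T2 * (s12 * (?a13 * ?a23))
      + ((e + b23) * (b13 * ?a23) + s2 * (((q - 1) *\<^sub>s e - b23) * (b13 * ?a23)))
      + (s2 * (?a23 * (T * b23)) + b23 * (T * b23))"
    using b[of "T * b23"] by (simp only: distrib_left m corner')
  have u: "?a13 * (?a23 * T) = T * (?a13 * ?a23)"
    by (simp add: norm)
  have s: "b13 * (?a23 * T) = ((q - 1) *\<^sub>s e - b23) * (b13 * ?a23) + ?a23 * (T * b23)"
    by (simp add: norm)
  have c: "T * (b23 * T) = (e + b23) * (b13 * ?a23) + b23 * (T * b23)"
    by (simp add: norm)
  have "e * (?a13 * ?a23) = ?a13 * ?a23" by (simp add: norm)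
  from T1b[OF this] have w: "s12 * T1 * (?a13 * ?a23) = s12 * (T * (?a13 * ?a23))" by (simp only: mult.assoc)
  have "(T1 * T2 * T1 - T2 * T1 * T2) * e = T1 * (T2 * (T1 * e)) - T2 * (T1 * (T2 * e))"
    by (simp only: left_diff_distrib mult.assoc)
  also have "\<dots> = s12 * (T * (?a13 * ?a23)) - T2 * (s12 * (?a13 * ?a23))"
    unfolding E1[unfolded u] E2
    by (rule assemble_mixed) (simp_all only: s c distrib_left)
  also have "\<dots> = (s12 * T1 - T2 * s12) * (?a13 * ?a23)"
    unfolding w[symmetric] by (simp only: left_diff_distrib mult.assoc)
  finally show ?thesis .
qed

section \<open>Crossings indexed by colour sequences, and the equivalence of the two braid
  relations\<close>

abbreviation sw :: "nat \<Rightarrow> nat \<Rightarrow> nat" where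
  "sw a \<equiv> Transposition.transpose a (Suc a)"

lemma sw_other: "c \<noteq> a \<Longrightarrow> c \<noteq> Suc a \<Longrightarrow> sw a c = c"
  by (simp add: transpose_apply_other)

lemma sw_range: "a \<in> {1..<n} \<Longrightarrow> sw a c \<in> {1..n} \<longleftrightarrow> c \<in> {1..n}"
  by (auto simp: Transposition.transpose_def)

lemma comp_sw_sw [simp]: "(t \<circ> sw a) \<circ> sw a = t"
  by (simp add: comp_assoc)

text \<open>Isolates what relates the braid relations of the \<open>T a\<close> to those of the
  crossings, because there are two instances: in the Hecke algebra the relations of the
  \<open>T a\<close> are known, in the induced module those of the crossings. \<open>b c d t\<close>
  is the scattering coefficient of the strands at \<open>c\<close> and \<open>d\<close> on the
  summand \<open>t\<close>.\<close>

locale braid_system =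
  fixes q :: "'f::field" and n :: nat and \<T> :: "(nat \<Rightarrow> nat) set"
    and e :: "(nat \<Rightarrow> nat) \<Rightarrow> ('x, 'f) endo"
    and \<sigma> :: "nat \<Rightarrow> (nat \<Rightarrow> nat) \<Rightarrow> ('x, 'f) endo"
    and b :: "nat \<Rightarrow> nat \<Rightarrow> (nat \<Rightarrow> nat) \<Rightarrow> ('x, 'f) endo"
    and T :: "nat \<Rightarrow> ('x, 'f) endo"
  assumes closed: "t \<in> \<T> \<Longrightarrow> a \<in> {1..<n} \<Longrightarrow> t \<circ> sw a \<in> \<T>"
    and ee: "t \<in> \<T> \<Longrightarrow> e t * e t = e t"
    and \<sigma>_left: "t \<in> \<T> \<Longrightarrow> a \<in> {1..<n} \<Longrightarrow> t a \<noteq> t (Suc a) \<Longrightarrow> e (t \<circ> sw a) * \<sigma> a t = \<sigma> a t"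
    and \<sigma>_right: "t \<in> \<T> \<Longrightarrow> a \<in> {1..<n} \<Longrightarrow> t a \<noteq> t (Suc a) \<Longrightarrow> \<sigma> a t * e t = \<sigma> a t"
    and \<sigma>\<sigma>: "t \<in> \<T> \<Longrightarrow> a \<in> {1..<n} \<Longrightarrow> t a \<noteq> t (Suc a) \<Longrightarrow> \<sigma> a (t \<circ> sw a) * \<sigma> a t = e t"
    and T_diff: "t \<in> \<T> \<Longrightarrow> a \<in> {1..<n} \<Longrightarrow> t a \<noteq> t (Suc a) \<Longrightarrow>
      T a * e t = \<sigma> a t * (q *\<^sub>s e t - b a (Suc a) t) + b a (Suc a) t"
    and T_same: "t \<in> \<T> \<Longrightarrow> a \<in> {1..<n} \<Longrightarrow> t a = t (Suc a) \<Longrightarrow> T a * e t = e t * T a"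
    and T_quad: "t \<in> \<T> \<Longrightarrow> a \<in> {1..<n} \<Longrightarrow> t a = t (Suc a) \<Longrightarrow>
      T a * T a * e t = (q - 1) *\<^sub>s (T a * e t) + q *\<^sub>s e t"
    and b_corner: "t \<in> \<T> \<Longrightarrow> c \<in> {1..n} \<Longrightarrow> d \<in> {1..n} \<Longrightarrow> t c \<noteq> t d \<Longrightarrow>
      e t * b c d t = b c d t \<and> b c d t * e t = b c d t"
    and b_comm: "t \<in> \<T> \<Longrightarrow> c \<in> {1..n} \<Longrightarrow> d \<in> {1..n} \<Longrightarrow> t c \<noteq> t d \<Longrightarrow> c' \<in> {1..n} \<Longrightarrow> d' \<in> {1..n} \<Longrightarrow>
      t c' \<noteq> t d' \<Longrightarrow> b c d t * b c' d' t = b c' d' t * b c d t"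
    and b_swap: "t \<in> \<T> \<Longrightarrow> c \<in> {1..n} \<Longrightarrow> d \<in> {1..n} \<Longrightarrow> t c \<noteq> t d \<Longrightarrow> b c d t + b d c t = (q - 1) *\<^sub>s e t"
    and b_triple: "t \<in> \<T> \<Longrightarrow> c \<in> {1..n} \<Longrightarrow> d \<in> {1..n} \<Longrightarrow> f \<in> {1..n} \<Longrightarrow> t c \<noteq> t d \<Longrightarrow> t c \<noteq> t f \<Longrightarrow> t d \<noteq> t f \<Longrightarrow>
      (q - 1) *\<^sub>s b c f t - b c d t * b c f t + b c d t * b d f t - b d f t * b c f t = 0"
    and b_\<sigma>: "t \<in> \<T> \<Longrightarrow> a \<in> {1..<n} \<Longrightarrow> t a \<noteq> t (Suc a) \<Longrightarrow> c \<in> {1..n} \<Longrightarrow> d \<in> {1..n} \<Longrightarrow> t (sw a c) \<noteq> t (sw a d) \<Longrightarrow>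
      b c d (t \<circ> sw a) * \<sigma> a t = \<sigma> a t * b (sw a c) (sw a d) t"
    and b_T: "t \<in> \<T> \<Longrightarrow> a \<in> {1..<n} \<Longrightarrow> t a = t (Suc a) \<Longrightarrow> c \<in> {1..n} \<Longrightarrow> t c \<noteq> t a \<Longrightarrow>
      T a * b (Suc a) c t = b a c t * T a + b a c t * b (Suc a) c t - (q - 1) *\<^sub>s b a c t"
      "t \<in> \<T> \<Longrightarrow> a \<in> {1..<n} \<Longrightarrow> t a = t (Suc a) \<Longrightarrow> c \<in> {1..n} \<Longrightarrow> t c \<noteq> t a \<Longrightarrow>
      T a * b a c t = b (Suc a) c t * T a - b (Suc a) c t * b a c t + (q - 1) *\<^sub>s b a c t"
    and b_inv: "t \<in> \<T> \<Longrightarrow> c \<in> {1..n} \<Longrightarrow> d \<in> {1..n} \<Longrightarrow> t c \<noteq> t d \<Longrightarrow> \<exists>w. is_inverse (e t) (q *\<^sub>s e t - b c d t) w"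
begin

definition defect :: "nat \<Rightarrow> ('x, 'f) endo" where
  "defect a = T a * T (Suc a) * T a - T (Suc a) * T a * T (Suc a)"

text \<open>The formula \<open>T_diff\<close> at the swapped sequence, with its coefficients moved
  to the right of the crossing, where they refer to the positions before the swap.\<close>

lemma T_\<sigma>:
  assumes t: "t \<in> \<T>" and a: "a \<in> {1..<n}" and c: "c \<in> {1..<n}" and ta: "t a \<noteq> t (Suc a)"
    and tc: "t (sw a c) \<noteq> t (sw a (Suc c))"
  shows "T c * \<sigma> a t = \<sigma> c (t \<circ> sw a) * \<sigma> a t * (q *\<^sub>s e t - b (sw a c) (sw a (Suc c)) t) +
    \<sigma> a t * b (sw a c) (sw a (Suc c)) t"
proof -
  have "T c * \<sigma> a t = T c * e (t \<circ> sw a) * \<sigma> a t"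
    using \<sigma>_left[OF t a ta] by (simp only: mult.assoc)
  also have "T c * e (t \<circ> sw a) = \<sigma> c (t \<circ> sw a) * (q *\<^sub>s e (t \<circ> sw a) - b c (Suc c) (t \<circ> sw a)) + b c (Suc c) (t \<circ> sw a)"
    using closed[OF t a] c tc by (intro T_diff) auto
  also have "\<dots> * \<sigma> a t = \<sigma> c (t \<circ> sw a) * (q *\<^sub>s (e (t \<circ> sw a) * \<sigma> a t) - b c (Suc c) (t \<circ> sw a) * \<sigma> a t) + b c (Suc c) (t \<circ> sw a) * \<sigma> a t"
    by (simp only: distrib_right left_diff_distrib mult.assoc scl_mult_left)
  also have "b c (Suc c) (t \<circ> sw a) * \<sigma> a t = \<sigma> a t * b (sw a c) (sw a (Suc c)) t"
    using c tc by (intro b_\<sigma>[OF t a ta]) auto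
  also have "e (t \<circ> sw a) * \<sigma> a t = \<sigma> a t * e t"
    using \<sigma>_left[OF t a ta] \<sigma>_right[OF t a ta] by simp
  finally show ?thesis
    by (simp only: right_diff_distrib left_diff_distrib mult.assoc scl_mult_right)
qed

lemma T_\<sigma>_same:
  assumes t: "t \<in> \<T>" and a: "a \<in> {1..<n}" and ta: "t a \<noteq> t (Suc a)"
  shows "T a * \<sigma> a t = e t + b a (Suc a) t + \<sigma> a t * ((q - 1) *\<^sub>s e t - b a (Suc a) t)"
proof -
  have sw: "b (Suc a) a t = (q - 1) *\<^sub>s e t - b a (Suc a) t"
    using b_swap[OF t _ _ ta] a by (simp add: algebra_simps)
  have "T a * \<sigma> a t = \<sigma> a (t \<circ> sw a) * \<sigma> a t * (q *\<^sub>s e t - b (Suc a) a t) + \<sigma> a t * b (Suc a) a t"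
    using T_\<sigma>[OF t a a ta] ta by simp
  also have "\<dots> = e t * (q *\<^sub>s e t - b (Suc a) a t) + \<sigma> a t * b (Suc a) a t"
    by (simp only: \<sigma>\<sigma>[OF t a ta])
  also have "e t * (q *\<^sub>s e t - b (Suc a) a t) = e t + b a (Suc a) t"
    unfolding sw using ee[OF t] b_corner[OF t _ _ ta] a by (simp add: algebra_simps)
  finally show ?thesis unfolding sw .
qed

lemma unit_product_inverse:
  assumes "is_inverse u x x'" "is_inverse u y y'"
  shows "is_inverse u (x * y) (y' * x')"
proof -
  have d: "x' * x = u" "x * x' = u" "u * x' = x'" "x' * u = x'" "y' * y = u" "y * y' = u" "u * y' = y'" "y' * u = y'"
    using assms by (auto simp: is_inverse_def)
  have "y' * x' * (x * y) = y' * (x' * x) * y" by (simp only: mult.assoc)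
  also have "\<dots> = u" by (simp only: d)
  finally have 1: "y' * x' * (x * y) = u" .
  have "x * y * (y' * x') = x * ((y * y') * x')" by (simp only: mult.assoc)
  also have "\<dots> = u" by (simp only: d)
  finally have 2: "x * y * (y' * x') = u" .
  have "u * (y' * x') = (u * y') * x'" "y' * x' * u = y' * (x' * u)" by (simp_all only: mult.assoc)
  with 1 2 show ?thesis unfolding is_inverse_def by (simp only: d)
qed

lemma mult_invertible_eq_0:
  assumes "is_inverse u x x'" "z * u = z"
  shows "z * x = 0 \<longleftrightarrow> z = 0"
proof
  assume "z * x = 0"
  then have "z * (x * x') = 0" by (simp flip: mult.assoc)
  then show "z = 0" using assms by (simp add: is_inverse_def)
qed simp

text \<open>The defect is the difference of the two crossing words times three factors
  \<open>q - b\<close>, which are invertible in the corner of \<open>e t\<close>.\<close>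

lemma defect_distinct:
  assumes t: "t \<in> \<T>" and a: "1 \<le> a" "Suc a < n"
    and d: "t a \<noteq> t (Suc a)" "t a \<noteq> t (Suc (Suc a))" "t (Suc a) \<noteq> t (Suc (Suc a))"
  shows "defect a * e t = 0 \<longleftrightarrow>
    \<sigma> a (t \<circ> sw a \<circ> sw (Suc a)) * (\<sigma> (Suc a) (t \<circ> sw a) * \<sigma> a t) =
    \<sigma> (Suc a) (t \<circ> sw (Suc a) \<circ> sw a) * (\<sigma> a (t \<circ> sw (Suc a)) * \<sigma> (Suc a) t)"
proof -
  let ?a = "Suc a" and ?c = "Suc (Suc a)"
  let ?t1 = "t \<circ> sw a" and ?t2 = "t \<circ> sw (Suc a)"
  let ?b12 = "b a ?a t" and ?b13 = "b a ?c t" and ?b23 = "b ?a ?c t"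
  let ?s1 = "\<sigma> a t" and ?s2 = "\<sigma> ?a t"
  let ?s21 = "\<sigma> ?a ?t1 * ?s1" and ?s12 = "\<sigma> a ?t2 * ?s2"
  let ?w1 = "\<sigma> a (?t1 \<circ> sw ?a) * ?s21" and ?w2 = "\<sigma> ?a (?t2 \<circ> sw a) * ?s12"
  have r: "a \<in> {1..<n}" "?a \<in> {1..<n}" "a \<in> {1..n}" "?a \<in> {1..n}" "?c \<in> {1..n}" using a by auto
  have t1: "?t1 \<in> \<T>" and t2: "?t2 \<in> \<T>" using closed t r by auto
  note [simp] = sw_other
  have T1s21: "T a * ?s21 = ?w1 * (q *\<^sub>s e t - ?b23) + ?s21 * ?b23"
  proof -
    have "T a * \<sigma> ?a ?t1 = \<sigma> a (?t1 \<circ> sw ?a) * \<sigma> ?a ?t1 * (q *\<^sub>s e ?t1 - b a ?c ?t1) + \<sigma> ?a ?t1 * b a ?c ?t1"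
      using T_\<sigma>[OF t1 r(2) r(1)] d by simp
    then have "T a * ?s21 = \<sigma> a (?t1 \<circ> sw ?a) * \<sigma> ?a ?t1 * (q *\<^sub>s (e ?t1 * ?s1) - b a ?c ?t1 * ?s1) + \<sigma> ?a ?t1 * (b a ?c ?t1 * ?s1)"
      by (simp only: mult.assoc[symmetric] distrib_right left_diff_distrib right_diff_distrib scl_mult_left scl_mult_right)
    also have "b a ?c ?t1 * ?s1 = ?s1 * ?b23" using b_\<sigma>[OF t r(1) d(1) r(3) r(5)] d by simp
    also have "e ?t1 * ?s1 = ?s1 * e t" using \<sigma>_left[OF t r(1) d(1)] \<sigma>_right[OF t r(1) d(1)] by simp
    finally show ?thesis
      by (simp only: mult.assoc right_diff_distrib scl_mult_right)
  qed
  have T2s12: "T ?a * ?s12 = ?w2 * (q *\<^sub>s e t - ?b12) + ?s12 * ?b12"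
  proof -
    have "T ?a * \<sigma> a ?t2 = \<sigma> ?a (?t2 \<circ> sw a) * \<sigma> a ?t2 * (q *\<^sub>s e ?t2 - b a ?c ?t2) + \<sigma> a ?t2 * b a ?c ?t2"
      using T_\<sigma>[OF t2 r(1) r(2)] d by simp
    then have "T ?a * ?s12 = \<sigma> ?a (?t2 \<circ> sw a) * \<sigma> a ?t2 * (q *\<^sub>s (e ?t2 * ?s2) - b a ?c ?t2 * ?s2) + \<sigma> a ?t2 * (b a ?c ?t2 * ?s2)"
      by (simp only: mult.assoc[symmetric] distrib_right left_diff_distrib right_diff_distrib scl_mult_left scl_mult_right)
    also have "b a ?c ?t2 * ?s2 = ?s2 * ?b12" using b_\<sigma>[OF t r(2) d(3) r(3) r(5)] d by simp
    also have "e ?t2 * ?s2 = ?s2 * e t" using \<sigma>_left[OF t r(2) d(3)] \<sigma>_right[OF t r(2) d(3)] by simp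
    finally show ?thesis
      by (simp only: mult.assoc right_diff_distrib scl_mult_right)
  qed
  have s_e: "?s1 * e t = ?s1" "?s2 * e t = ?s2"
    using \<sigma>_right[OF t r(1) d(1)] \<sigma>_right[OF t r(2) d(3)] by auto
  have w_e: "?s12 * e t = ?s12" "?s21 * e t = ?s21" "?w1 * e t = ?w1" "?w2 * e t = ?w2"
    by (simp_all only: mult.assoc s_e)
  have eq: "defect a * e t = (?w1 - ?w2) * ((q *\<^sub>s e t - ?b12) * (q *\<^sub>s e t - ?b13) * (q *\<^sub>s e t - ?b23))"
    unfolding defect_def
  proof (rule braid_defect_distinct)
    show "T ?a * ?s1 = ?s21 * (q *\<^sub>s e t - ?b13) + ?s1 * ?b13"
      using T_\<sigma>[OF t r(1) r(2) d(1)] d by simp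
    show "T a * ?s2 = ?s12 * (q *\<^sub>s e t - ?b13) + ?s2 * ?b13"
      using T_\<sigma>[OF t r(2) r(1) d(3)] d by simp
  qed (use T1s21 T2s12 s_e w_e ee[OF t] b_corner[OF t] b_comm[OF t] b_triple[OF t r(3-5) d] d r
      T_diff[OF t r(1) d(1)] T_diff[OF t r(2) d(3)] T_\<sigma>_same[OF t r(1) d(1)] T_\<sigma>_same[OF t r(2) d(3)] in \<open>auto simp del: transpose_apply_other\<close>)
  obtain x12 x13 x23 where "is_inverse (e t) (q *\<^sub>s e t - ?b12) x12" "is_inverse (e t) (q *\<^sub>s e t - ?b13) x13"
    "is_inverse (e t) (q *\<^sub>s e t - ?b23) x23"
    using b_inv[OF t r(3,4) d(1)] b_inv[OF t r(3,5) d(2)] b_inv[OF t r(4,5) d(3)] by blast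
  then have "is_inverse (e t) ((q *\<^sub>s e t - ?b12) * (q *\<^sub>s e t - ?b13) * (q *\<^sub>s e t - ?b23)) (x23 * (x13 * x12))"
    by (intro unit_product_inverse)
  from mult_invertible_eq_0[OF this, of "?w1 - ?w2"] show ?thesis
    unfolding eq using w_e by (simp add: left_diff_distrib)
qed

text \<open>As for three colours, with two invertible factors; the crossing word now has to
  intertwine \<open>T a\<close> with \<open>T (Suc a)\<close>.\<close>

lemma defect_mixed:
  assumes t: "t \<in> \<T>" and a: "1 \<le> a" "Suc a < n"
    and d: "t a = t (Suc a)" "t (Suc a) \<noteq> t (Suc (Suc a))"
  shows "defect a * e t = 0 \<longleftrightarrow>
    \<sigma> a (t \<circ> sw (Suc a)) * \<sigma> (Suc a) t * T a * e t = T (Suc a) * (\<sigma> a (t \<circ> sw (Suc a)) * \<sigma> (Suc a) t)"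
proof -
  let ?a = "Suc a" and ?c = "Suc (Suc a)"
  let ?t2 = "t \<circ> sw (Suc a)"
  let ?b13 = "b a ?c t" and ?b23 = "b ?a ?c t"
  let ?s2 = "\<sigma> ?a t" let ?s12 = "\<sigma> a ?t2 * ?s2"
  have r: "a \<in> {1..<n}" "?a \<in> {1..<n}" "a \<in> {1..n}" "?a \<in> {1..n}" "?c \<in> {1..n}" using a by auto
  note [simp] = sw_other
  have d': "t a \<noteq> t ?c" using d by simp
  have s_e: "?s2 * e t = ?s2" using \<sigma>_right[OF t r(2) d(2)] .
  then have w_e: "?s12 * e t = ?s12" by (simp only: mult.assoc)
  have eq: "defect a * e t = (?s12 * T a - T ?a * ?s12) * ((q *\<^sub>s e t - ?b13) * (q *\<^sub>s e t - ?b23))"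
    unfolding defect_def
  proof (rule braid_defect_mixed)
    show "T a * ?s2 = ?s12 * (q *\<^sub>s e t - ?b13) + ?s2 * ?b13"
      using T_\<sigma>[OF t r(2) r(1) d(2)] d' by simp
  qed (use s_e w_e ee[OF t] b_corner[OF t] b_comm[OF t] d d' r T_same[OF t r(1) d(1)] T_quad[OF t r(1) d(1)]
      b_T[OF t r(1) d(1) r(5)] T_diff[OF t r(2) d(2)] T_\<sigma>_same[OF t r(2) d(2)] in \<open>auto simp del: transpose_apply_other\<close>)
  obtain x13 x23 where "is_inverse (e t) (q *\<^sub>s e t - ?b13) x13" "is_inverse (e t) (q *\<^sub>s e t - ?b23) x23"
    using b_inv[OF t r(3,5) d'] b_inv[OF t r(4,5) d(2)] by blast
  then have i: "is_inverse (e t) ((q *\<^sub>s e t - ?b13) * (q *\<^sub>s e t - ?b23)) (x23 * x13)"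
    by (intro unit_product_inverse)
  have eu: "(q *\<^sub>s e t - ?b13) * (q *\<^sub>s e t - ?b23) = e t * ((q *\<^sub>s e t - ?b13) * (q *\<^sub>s e t - ?b23))"
    using ee[OF t] b_corner[OF t r(3,5) d'] by (simp add: right_diff_distrib flip: mult.assoc)
  have "defect a * e t = (?s12 * T a * e t - T ?a * ?s12) * ((q *\<^sub>s e t - ?b13) * (q *\<^sub>s e t - ?b23))"
  proof -
    have "?s12 * T a * ((q *\<^sub>s e t - ?b13) * (q *\<^sub>s e t - ?b23)) = ?s12 * T a * e t * ((q *\<^sub>s e t - ?b13) * (q *\<^sub>s e t - ?b23))"
      by (subst eu) (simp only: mult.assoc)
    then show ?thesis unfolding eq by (simp only: left_diff_distrib)
  qed
  moreover have "(?s12 * T a * e t - T ?a * ?s12) * e t = ?s12 * T a * e t - T ?a * ?s12"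
    using w_e ee[OF t] by (simp only: left_diff_distrib mult.assoc)
  ultimately show ?thesis
    using mult_invertible_eq_0[OF i, of "?s12 * T a * e t - T ?a * ?s12"] by simp
qed

text \<open>The quadratic relations give \<open>T\<^sub>a \<Delta> + \<Delta> T\<^sub>a\<^sub>+\<^sub>1 = (q - 1) \<Delta>\<close> for the defect \<open>\<Delta>\<close>, which
  transports its vanishing from one arrangement of the colours to the others.\<close>

lemma defect_transport:
  assumes quad: "\<And>c. c \<in> {a, Suc a} \<Longrightarrow> T c * T c = (q - 1) *\<^sub>s T c + q *\<^sub>s p"
    and unit: "\<And>c. c \<in> {a, Suc a} \<Longrightarrow> p * T c = T c \<and> T c * p = T c"
  shows "T a * defect a + defect a * T (Suc a) = (q - 1) *\<^sub>s defect a"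
    "T (Suc a) * defect a + defect a * T a = (q - 1) *\<^sub>s defect a"
proof -
  have q1: "T a * T a = (q - 1) *\<^sub>s T a + q *\<^sub>s p" "T (Suc a) * T (Suc a) = (q - 1) *\<^sub>s T (Suc a) + q *\<^sub>s p"
    using quad by auto
  have q2: "T a * (T a * w) = (q - 1) *\<^sub>s (T a * w) + q *\<^sub>s (p * w)"
     "T (Suc a) * (T (Suc a) * w) = (q - 1) *\<^sub>s (T (Suc a) * w) + q *\<^sub>s (p * w)" for w
    by (simp_all only: mult.assoc[symmetric] q1 distrib_right scl_mult_left)
  have u: "p * T a = T a" "T a * p = T a" "p * T (Suc a) = T (Suc a)" "T (Suc a) * p = T (Suc a)"
    using unit by auto
  have u': "p * (T a * w) = T a * w" "p * (T (Suc a) * w) = T (Suc a) * w" for w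
    by (simp_all only: mult.assoc[symmetric] u)
  show "T a * defect a + defect a * T (Suc a) = (q - 1) *\<^sub>s defect a"
    "T (Suc a) * defect a + defect a * T a = (q - 1) *\<^sub>s defect a"
    unfolding defect_def by (simp_all add: algebra_simps q1 q2 u u' scl_simps)
qed

text \<open>By \<open>rel\<close>, a defect that vanishes on \<open>e t\<close> vanishes on
  \<open>T c * e t\<close>, hence on \<open>\<sigma> c t\<close> after cancelling the invertible
  factor \<open>q - b\<close>, and composing with the reverse crossing reaches the swapped
  idempotent.\<close>

lemma defect_move:
  assumes t: "t \<in> \<T>" and c: "c \<in> {1..<n}" and d: "t c \<noteq> t (Suc c)"
    and rel: "y * defect a + defect a * T c = (q - 1) *\<^sub>s defect a" and zero: "defect a * e t = 0"
  shows "defect a * e (t \<circ> sw c) = 0"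
proof -
  have r: "c \<in> {1..n}" "Suc c \<in> {1..n}" using c by auto
  let ?b = "b c (Suc c) t"
  have zb: "defect a * ?b = 0"
    using b_corner[OF t r d] zero by (metis mult.assoc mult_zero_left)
  have "(y * defect a + defect a * T c) * e t = (q - 1) *\<^sub>s defect a * e t" by (simp only: rel)
  then have "defect a * (T c * e t) = 0" using zero by (simp add: distrib_right mult.assoc)
  then have "(defect a * \<sigma> c t) * (q *\<^sub>s e t - ?b) = 0"
    unfolding T_diff[OF t c d] using zb by (simp add: distrib_left mult.assoc)
  moreover obtain w where "is_inverse (e t) (q *\<^sub>s e t - ?b) w" using b_inv[OF t r d] by blast
  ultimately have "defect a * \<sigma> c t = 0"
    using mult_invertible_eq_0[of "e t" "q *\<^sub>s e t - ?b" w "defect a * \<sigma> c t"] \<sigma>_right[OF t c d]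
    by (simp add: mult.assoc)
  then have "defect a * (\<sigma> c t * \<sigma> c (t \<circ> sw c)) = 0" by (simp flip: mult.assoc)
  also have "\<sigma> c t * \<sigma> c (t \<circ> sw c) = e (t \<circ> sw c)"
    using \<sigma>\<sigma>[OF closed[OF t c] c] d by simp
  finally show ?thesis .
qed

end

section \<open>Colour idempotents and normalised crossings in a Hecke algebra\<close>

section \<open>Decomposition by colours\<close>

text \<open>The first inequality makes differences of Jucys-Murphy elements of different colours
  invertible, the second the factors \<open>y - q x\<close> in the square of the intertwiner. It is
  asked after \<open>n\<close> steps of growth, which covers all positions.\<close>

definition separated :: "'f::field \<Rightarrow> nat \<Rightarrow> nat set \<Rightarrow> (nat \<Rightarrow> 'f multiset) \<Rightarrow> bool" where
  "separated q n J M \<longleftrightarrow> (\<forall>j\<in>J. \<forall>k\<in>J. j \<noteq> k \<longrightarrow>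
     (\<forall>\<omega>. \<omega> \<in># (grow q ^^ n) (M j) \<longrightarrow> (\<forall>\<omega>'. \<omega>' \<in># (grow q ^^ n) (M k) \<longrightarrow> \<omega> \<noteq> \<omega>' \<and> q * \<omega> \<noteq> \<omega>')))"

text \<open>The interpolating idempotent for colour \<open>j\<close>. It is chosen from the root
  data alone, so the same polynomial serves in every representation; the comparison with the induced
  module depends on this.\<close>

definition colour_poly :: "'f::field \<Rightarrow> nat \<Rightarrow> nat set \<Rightarrow> (nat \<Rightarrow> 'f multiset) \<Rightarrow> nat \<Rightarrow> 'f poly" where
  "colour_poly q n J M = (SOME \<epsilon>. (\<forall>j\<in>J. root_poly ((grow q ^^ n) (M j)) dvd 1 - \<epsilon> j) \<and>
     (\<forall>j\<in>J. \<forall>k\<in>J. j \<noteq> k \<longrightarrow> root_poly ((grow q ^^ n) (M k)) dvd \<epsilon> j))"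

lemma colour_poly:
  assumes "finite J" "separated q n J M" "j \<in> J"
  shows "root_poly ((grow q ^^ n) (M j)) dvd 1 - colour_poly q n J M j"
    "k \<in> J \<Longrightarrow> j \<noteq> k \<Longrightarrow> root_poly ((grow q ^^ n) (M k)) dvd colour_poly q n J M j"
proof -
  define Q where "Q \<epsilon> \<longleftrightarrow> (\<forall>j\<in>J. root_poly ((grow q ^^ n) (M j)) dvd 1 - \<epsilon> j) \<and>
     (\<forall>j\<in>J. \<forall>k\<in>J. j \<noteq> k \<longrightarrow> root_poly ((grow q ^^ n) (M k)) dvd \<epsilon> j)" for \<epsilon>
  have "\<exists>\<epsilon>. Q \<epsilon>"
  proof (rule root_poly_crt[OF assms(1), of "\<lambda>j. (grow q ^^ n) (M j)"])
    show "set_mset ((grow q ^^ n) (M j)) \<inter> set_mset ((grow q ^^ n) (M k)) = {}"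
      if "j \<in> J" "k \<in> J" "j \<noteq> k" for j k
      using assms(2) that unfolding separated_def by blast
  next
    fix \<epsilon> assume "\<And>j. j \<in> J \<Longrightarrow> root_poly ((grow q ^^ n) (M j)) dvd 1 - \<epsilon> j"
      "\<And>j k. j \<in> J \<Longrightarrow> k \<in> J \<Longrightarrow> j \<noteq> k \<Longrightarrow> root_poly ((grow q ^^ n) (M k)) dvd \<epsilon> j"
    then show "\<exists>\<epsilon>. Q \<epsilon>" unfolding Q_def by blast
  qed
  moreover have "colour_poly q n J M = (SOME \<epsilon>. Q \<epsilon>)" by (simp add: colour_poly_def Q_def)
  ultimately have *: "Q (colour_poly q n J M)" by (metis someI_ex)
  show "root_poly ((grow q ^^ n) (M j)) dvd 1 - colour_poly q n J M j"
    "k \<in> J \<Longrightarrow> j \<noteq> k \<Longrightarrow> root_poly ((grow q ^^ n) (M k)) dvd colour_poly q n J M j"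
    using * assms(3) by (auto simp: Q_def)
qed

lemma in_corner_mult:
  assumes "e * e = e" "x * e = e * x"
  shows "in_corner e (x * e)"
proof -
  have "e * (x * e) = (e * e) * x" by (simp only: assms(2) mult.assoc)
  moreover have "x * e * e = x * (e * e)" by (simp only: mult.assoc)
  ultimately show ?thesis by (simp only: assms in_corner_def)
qed

lemma intertwine_mult:
  assumes "x * a = a * y" "y * b = b * z"
  shows "x * (a * b) = a * b * (z :: 'r::semigroup_mult)"
proof -
  have "x * (a * b) = (x * a) * b" by (simp only: mult.assoc)
  also have "\<dots> = a * (y * b)" by (simp only: assms(1) mult.assoc)
  finally show ?thesis by (simp only: assms(2) mult.assoc)
qed

lemma is_inverse_strip: "is_inverse e (u * e) d \<Longrightarrow> u * d = e"
proof -
  assume "is_inverse e (u * e) d"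
  then have d: "(u * e) * d = e" "e * d = d" by (auto simp: is_inverse_def)
  have "u * (e * d) = e" using d(1) by (simp only: mult.assoc)
  then show "u * d = e" by (simp only: d(2))
qed

lemma peval_corner_change:
  assumes "e * e = e" "e * p = e" "x * e = e * x"
  shows "e * peval p f x * e = peval e f (x * e)" "e * peval p f x = peval e f (x * e)"
proof -
  have "(x * e) * e = x * (e * e)" by (rule mult.assoc)
  then have "e * x = (x * e) * e" by (simp only: assms)
  then have 1: "e * peval p f x = peval e f (x * e) * e"
    using assms by (intro peval_intertwine) simp_all
  have "in_corner e (x * e)" using assms by (intro in_corner_mult)
  then have "peval e f (x * e) * e = peval e f (x * e)" using assms by simp
  with 1 show "e * peval p f x = peval e f (x * e)" "e * peval p f x * e = peval e f (x * e)" by simp_all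
qed

text \<open>The second inverse is an instance of the same principle for \<open>q x\<close>, whose
  roots are those of \<open>x\<close> multiplied by \<open>q\<close>.\<close>

lemma separated_inverses:
  fixes e x y :: "('x, 'f::field) endo"
  assumes ee: "e * e = e" and xe: "x * e = e * x" and ye: "y * e = e * y" and xy: "x * y = y * x" and q: "q \<noteq> 0"
    and kx: "peval e (root_poly M) (x * e) = 0" and ky: "peval e (root_poly N) (y * e) = 0"
    and disj: "\<And>\<omega> \<omega>'. \<omega> \<in># M \<Longrightarrow> \<omega>' \<in># N \<Longrightarrow> \<omega> \<noteq> \<omega>' \<and> q * \<omega> \<noteq> \<omega>'"
    and K: "subalg K" "e \<in> K" "x * e \<in> K" "y * e \<in> K"
  shows "\<exists>d\<in>K. is_inverse e ((y - x) * e) d" "\<exists>d\<in>K. is_inverse e ((y - q *\<^sub>s x) * e) d"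
proof -
  have corner: "in_corner e (x * e)" "in_corner e (y * e)" "in_corner e (q *\<^sub>s (x * e))"
    using in_corner_mult[OF ee xe] in_corner_mult[OF ee ye] by (simp_all add: in_corner_def)
  have "(x * e) * (y * e) = x * y * e"
    using ee by (simp add: mult.assoc) (simp add: mult.assoc[symmetric] ye[symmetric], simp add: mult.assoc ee)
  moreover have "(y * e) * (x * e) = y * x * e"
    using ee by (simp add: mult.assoc) (simp add: mult.assoc[symmetric] xe[symmetric], simp add: mult.assoc ee)
  ultimately have comm: "(x * e) * (y * e) = (y * e) * (x * e)" using xy by simp
  obtain d where "d \<in> K" "is_inverse e (y * e - x * e) d"
    by (rule difference_inverse[OF ee corner(1,2) comm kx ky _ K]) (use disj in auto)
  then show "\<exists>d\<in>K. is_inverse e ((y - x) * e) d" by (auto simp: left_diff_distrib)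
  have "peval e (root_poly (image_mset (\<lambda>\<omega>. q * \<omega>) M)) (q *\<^sub>s (x * e)) = q ^ size M *\<^sub>s peval e (root_poly M) (x * e)" for M
  proof (induction M)
    case (add \<omega> M)
    have "peval e (root_poly (image_mset (\<lambda>\<omega>. q * \<omega>) (add_mset \<omega> M))) (q *\<^sub>s (x * e)) =
        (q *\<^sub>s (x * e) - (q * \<omega>) *\<^sub>s e) * (q ^ size M *\<^sub>s peval e (root_poly M) (x * e))"
      by (simp only: image_mset_add_mset root_poly_simps peval_mult[OF ee corner(3)] peval_linear[OF corner(3)] add)
    also have "\<dots> = q ^ size (add_mset \<omega> M) *\<^sub>s ((x * e - \<omega> *\<^sub>s e) * peval e (root_poly M) (x * e))"
      by (simp add: left_diff_distrib endo.scale_right_diff_distrib mult_ac)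
    finally show ?case
      by (simp only: root_poly_simps peval_mult[OF ee corner(1)] peval_linear[OF corner(1)])
  qed simp
  then have kqx: "peval e (root_poly (image_mset (\<lambda>\<omega>. q * \<omega>) M)) (q *\<^sub>s (x * e)) = 0" using kx by simp
  have "set_mset (image_mset (\<lambda>\<omega>. q * \<omega>) M) \<inter> set_mset N = {}" using disj by auto
  moreover have "(q *\<^sub>s (x * e)) * (y * e) = (y * e) * (q *\<^sub>s (x * e))" using comm by simp
  ultimately obtain d where "d \<in> K" "is_inverse e (y * e - q *\<^sub>s (x * e)) d"
    using difference_inverse[OF ee corner(3,2) _ kqx ky _ K(1,2) subalg_closed(3)[OF K(1,3)] K(4)] by blast
  then show "\<exists>d\<in>K. is_inverse e ((y - q *\<^sub>s x) * e) d" by (auto simp: left_diff_distrib)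
qed

text \<open>\<open>K\<close> stands for the image of the Hecke algebra in a faithful representation;
  all idempotents, inverses and crossings constructed here are shown to lie in it.\<close>

locale coloured_hecke = hecke p q P n S T
  for p :: "('x, 'f::field) endo" and q :: 'f and P n S T +
  fixes J :: "nat set" and M :: "nat \<Rightarrow> 'f multiset" and K :: "('x, 'f) endo set"
  assumes n_pos: "0 < n" and finite_J: "finite J" and P_eq: "P = root_poly (\<Sum>j\<in>J. M j)"
    and separated: "separated q n J M"
    and subalg: "subalg K" and p_K: "p \<in> K" and S_K: "S \<in> K" and T_K: "a \<in> {1..<n} \<Longrightarrow> T a \<in> K"
begin

declare jm.simps [simp del]

definition N where "N j = (grow q ^^ n) (M j)"

text \<open>Projection to the generalised eigenspaces of \<open>X a\<close> with eigenvalues of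
  colour \<open>j\<close>.\<close>

definition E where "E j a = peval p (colour_poly q n J M j) (X a)"

definition Seq where "Seq = {1..n} \<rightarrow>\<^sub>E J"

lemma X_in_corner: "a \<in> {1..n} \<Longrightarrow> in_corner p (X a)"
  using X_corner by simp

lemma X_K: "a \<in> {1..n} \<Longrightarrow> X a \<in> K"
proof (induction a)
  case (Suc a)
  then show ?case
    using S_K T_K[of a] by (cases "a = 0") (simp_all add: jm.simps subalg_closed[OF subalg])
qed simp

text \<open>The product of the root polynomials of all colours kills each \<open>X a\<close>, so
  polynomials may be compared modulo one colour at a time.\<close>

lemma peval_eqI:
  assumes "\<And>k. k \<in> J \<Longrightarrow> root_poly (N k) dvd f - g" "a \<in> {1..n}"
  shows "peval p f (X a) = peval p g (X a)"
proof (rule peval_cong[OF pp X_in_corner[OF assms(2)]])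
  show "peval p (root_poly (\<Sum>j\<in>J. N j)) (X a) = 0"
    using X_kill[OF n_pos P_eq assms(2)] by (simp only: grow_funpow_sum N_def)
  show "root_poly (\<Sum>j\<in>J. N j) dvd f - g"
    using separated by (intro root_poly_sum_dvd finite_J assms(1)) (auto simp: separated_def N_def)
qed

lemma colour: "j \<in> J \<Longrightarrow> root_poly (N j) dvd 1 - colour_poly q n J M j"
  "j \<in> J \<Longrightarrow> k \<in> J \<Longrightarrow> j \<noteq> k \<Longrightarrow> root_poly (N k) dvd colour_poly q n J M j"
  using colour_poly[OF finite_J separated] by (auto simp: N_def)

lemma E_E:
  assumes "j \<in> J" "k \<in> J" "a \<in> {1..n}"
  shows "E j a * E k a = (if j = k then E j a else 0)"
proof -
  let ?\<epsilon> = "colour_poly q n J M"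
  have "E j a * E k a = peval p (?\<epsilon> j * ?\<epsilon> k) (X a)"
    using X_in_corner[OF assms(3)] by (simp add: E_def peval_mult)
  also have "\<dots> = peval p (if j = k then ?\<epsilon> j else 0) (X a)"
  proof (rule peval_eqI[OF _ assms(3)])
    fix l assume l: "l \<in> J"
    show "root_poly (N l) dvd ?\<epsilon> j * ?\<epsilon> k - (if j = k then ?\<epsilon> j else 0)"
    proof (cases "j = k")
      case True
      have "?\<epsilon> j * ?\<epsilon> j - ?\<epsilon> j = - (?\<epsilon> j * (1 - ?\<epsilon> j))" by (simp add: algebra_simps)
      moreover have "root_poly (N l) dvd ?\<epsilon> j * (1 - ?\<epsilon> j)"
        using colour[OF assms(1)] l by (cases "l = j") (auto intro: dvd_mult dvd_mult2)
      ultimately show ?thesis using True by simp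
    next
      case False
      then show ?thesis
        using colour(2)[OF assms(1) l] colour(2)[OF assms(2) l]
        by (cases "l = j") (auto intro: dvd_mult dvd_mult2)
    qed
  qed
  finally show ?thesis by (simp add: E_def)
qed

lemma E_sum: "a \<in> {1..n} \<Longrightarrow> (\<Sum>j\<in>J. E j a) = p"
proof -
  assume a: "a \<in> {1..n}"
  let ?\<epsilon> = "colour_poly q n J M"
  have "peval p (\<Sum>j\<in>J. ?\<epsilon> j) (X a) = peval p 1 (X a)"
  proof (rule peval_eqI[OF _ a])
    fix k assume k: "k \<in> J"
    have "(\<Sum>j\<in>J. ?\<epsilon> j) - 1 = (\<Sum>j\<in>J - {k}. ?\<epsilon> j) - (1 - ?\<epsilon> k)"
      using finite_J k by (simp add: sum.remove)
    moreover have "root_poly (N k) dvd (\<Sum>j\<in>J - {k}. ?\<epsilon> j)"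
      using colour(2)[OF _ k] by (intro dvd_sum) auto
    ultimately show "root_poly (N k) dvd (\<Sum>j\<in>J. ?\<epsilon> j) - 1"
      using colour(1)[OF k] by (metis dvd_diff)
  qed
  then show ?thesis by (simp add: E_def peval_sum)
qed

lemma E_kill:
  assumes "j \<in> J" "a \<in> {1..n}"
  shows "peval p (root_poly (N j)) (X a) * E j a = 0"
proof -
  have "peval p (root_poly (N j) * colour_poly q n J M j) (X a) = peval p 0 (X a)"
  proof (rule peval_eqI[OF _ assms(2)])
    fix k assume "k \<in> J"
    then show "root_poly (N k) dvd root_poly (N j) * colour_poly q n J M j - 0"
      using colour(2)[OF assms(1)] by (cases "k = j") (auto intro: dvd_mult)
  qed
  then show ?thesis using X_in_corner[OF assms(2)] by (simp add: E_def peval_mult)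
qed

lemma E_corner: "a \<in> {1..n} \<Longrightarrow> p * E j a = E j a" "a \<in> {1..n} \<Longrightarrow> E j a * p = E j a"
  using X_in_corner[of a] by (simp_all add: E_def)

lemma E_commute: "z * p = p * z \<Longrightarrow> z * X a = X a * z \<Longrightarrow> z * E j a = E j a * z"
  unfolding E_def by (rule peval_commute)

lemma X_p: "a \<in> {1..n} \<Longrightarrow> X a * p = p * X a"
  using X_in_corner[of a] by (simp add: in_corner_def)

lemma X_E: "a \<in> {1..n} \<Longrightarrow> b \<in> {1..n} \<Longrightarrow> X b * E j a = E j a * X b"
  using X_p[of b] X_X[of b a] by (intro E_commute) auto

lemma E_E_commute: "a \<in> {1..n} \<Longrightarrow> b \<in> {1..n} \<Longrightarrow> E k b * E j a = E j a * E k b"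
  using X_E[of b a] E_corner by (intro E_commute) auto

lemma E_K: "a \<in> {1..n} \<Longrightarrow> E j a \<in> K"
  unfolding E_def using X_K X_in_corner p_K by (intro subalg_peval subalg) auto

text \<open>An ordered product, since the ring \<open>endo\<close> is not commutative; the leading
  \<open>p\<close> is the empty product of the corner.\<close>

primrec eprod :: "(nat \<Rightarrow> nat) \<Rightarrow> nat \<Rightarrow> ('x, 'f) endo" where
  "eprod t 0 = p"
| "eprod t (Suc k) = eprod t k * E (t (Suc k)) (Suc k)"

definition e where "e t = eprod t n"

lemma e_commute:
  assumes "z * p = p * z" "\<And>a. a \<in> {1..n} \<Longrightarrow> z * E (t a) a = E (t a) a * z"
  shows "z * e t = e t * z"
proof -
  have "z * eprod t k = eprod t k * z" if "k \<le> n" for k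
    using that assms by (induction k) (auto intro: commute_mult)
  then show ?thesis by (simp add: e_def)
qed

lemma X_e: "a \<in> {1..n} \<Longrightarrow> X a * e t = e t * X a"
  using X_p X_E by (intro e_commute) auto

lemma E_e: "a \<in> {1..n} \<Longrightarrow> E j a * e t = e t * E j a"
  using E_corner E_E_commute by (intro e_commute) auto

lemma e_K: "e t \<in> K"
proof -
  have "eprod t k \<in> K" if "k \<le> n" for k
    using that p_K E_K by (induction k) (auto intro: subalg_closed[OF subalg])
  then show ?thesis by (simp add: e_def)
qed

lemma e_corner: "p * e t = e t" "e t * p = e t"
proof -
  have "p * eprod t k = eprod t k" if "k \<le> n" for k
    using that by (induction k) (auto simp flip: mult.assoc)
  then show "p * e t = e t" by (simp add: e_def)
  then show "e t * p = e t" using e_commute[of p t] E_corner by simp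
qed

lemma e_left:
  assumes "p * z = z" "\<And>b. b \<in> {1..n} \<Longrightarrow> E (t b) b * z = z"
  shows "e t * z = z"
proof -
  have "eprod t k * z = z" if "k \<le> n" for k
    using that assms by (induction k) (auto simp: mult.assoc)
  then show ?thesis by (simp add: e_def)
qed

lemma e_right:
  assumes "z * p = z" "\<And>b. b \<in> {1..n} \<Longrightarrow> z * E (t b) b = z"
  shows "z * e t = z"
proof -
  have "z * eprod t k = z" if "k \<le> n" for k
    using that assms by (induction k) (auto simp flip: mult.assoc)
  then show ?thesis by (simp add: e_def)
qed

lemma e_E:
  assumes t: "t \<in> Seq" and a: "a \<in> {1..n}" and j: "j \<in> J"
  shows "e t * E j a = (if t a = j then e t else 0)"
proof -
  have "eprod t k * E j a = (if t a = j then eprod t k else 0)" if "a \<le> k" "k \<le> n" for k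
    using that
  proof (induction k)
    case (Suc k)
    have tk: "t (Suc k) \<in> J" using t Suc.prems by (auto simp: Seq_def)
    show ?case
    proof (cases "a = Suc k")
      case True
      then show ?thesis using E_E[OF tk j a] by (simp add: mult.assoc)
    next
      case False
      have "eprod t (Suc k) * E j a = eprod t k * (E (t (Suc k)) (Suc k) * E j a)"
        by (simp add: mult.assoc)
      also have "\<dots> = eprod t k * E j a * E (t (Suc k)) (Suc k)"
        using E_E_commute[of a "Suc k"] a Suc.prems by (simp add: mult.assoc)
      finally show ?thesis using Suc False by simp
    qed
  qed (use a in simp)
  then show ?thesis using a by (simp add: e_def)
qed

lemma E_e': "t \<in> Seq \<Longrightarrow> a \<in> {1..n} \<Longrightarrow> j \<in> J \<Longrightarrow> E j a * e t = (if t a = j then e t else 0)"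
  using e_E E_e by simp

lemma Seq_J: "t \<in> Seq \<Longrightarrow> a \<in> {1..n} \<Longrightarrow> t a \<in> J"
  by (auto simp: Seq_def)

lemma ee: "t \<in> Seq \<Longrightarrow> e t * e t = e t"
  using e_corner E_e' Seq_J by (intro e_left) auto

lemma e_orth:
  assumes "t \<in> Seq" "t' \<in> Seq" "t \<noteq> t'"
  shows "e t * e t' = 0"
proof -
  obtain a where a: "a \<in> {1..n}" "t a \<noteq> t' a"
    using assms unfolding Seq_def by (metis PiE_ext)
  have "e t * e t' = e t * E (t a) a * e t'" using e_E[OF assms(1) a(1) Seq_J] assms a by simp
  also have "\<dots> = e t * (E (t a) a * e t')" by (simp only: mult.assoc)
  also have "E (t a) a * e t' = 0" using E_e'[OF assms(2) a(1) Seq_J] assms a by auto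
  finally show ?thesis by simp
qed

lemma finite_Seq: "finite Seq"
  unfolding Seq_def using finite_J by (intro finite_PiE) auto

text \<open>Expansion of the product over all positions of
  \<open>p = (\<Sum>j\<in>J. E j a)\<close>.\<close>

lemma e_sum: "(\<Sum>t\<in>Seq. e t) = p"
proof -
  have "(\<Sum>t\<in>{1..k} \<rightarrow>\<^sub>E J. eprod t k) = p" if "k \<le> n" for k
    using that
  proof (induction k)
    case 0
    then show ?case by simp
  next
    case (Suc k)
    have set: "{1..Suc k} = insert (Suc k) {1..k}" by auto
    have inj: "inj_on (\<lambda>(y, g). g(Suc k := y)) (J \<times> ({1..k} \<rightarrow>\<^sub>E J))"
      by (rule inj_combinator) simp
    have cong: "eprod (g(Suc k := y)) k = eprod g k" for g y
    proof -
      have "eprod (g(Suc k := y)) l = eprod g l" if "l \<le> k" for l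
        using that by (induction l) auto
      then show ?thesis by simp
    qed
    have "(\<Sum>t\<in>{1..Suc k} \<rightarrow>\<^sub>E J. eprod t (Suc k)) =
        (\<Sum>(y, g)\<in>J \<times> ({1..k} \<rightarrow>\<^sub>E J). eprod (g(Suc k := y)) (Suc k))"
      unfolding set PiE_insert_eq
      by (subst sum.reindex[OF inj]) (simp add: case_prod_unfold comp_def del: eprod.simps)
    also have "\<dots> = (\<Sum>y\<in>J. \<Sum>g\<in>{1..k} \<rightarrow>\<^sub>E J. eprod g k * E y (Suc k))"
      by (subst sum.cartesian_product[symmetric]) (simp add: cong)
    also have "\<dots> = (\<Sum>g\<in>{1..k} \<rightarrow>\<^sub>E J. eprod g k) * (\<Sum>y\<in>J. E y (Suc k))"
      by (subst sum.swap) (simp only: sum_product)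
    also have "\<dots> = p" using Suc E_sum[of "Suc k"] by simp
    finally show ?case .
  qed
  then show ?thesis by (simp add: e_def Seq_def)
qed

lemma Seq_sw: "t \<in> Seq \<Longrightarrow> a \<in> {1..<n} \<Longrightarrow> t \<circ> sw a \<in> Seq"
  unfolding Seq_def using sw_range[of a n] by (auto simp: PiE_iff extensional_def)

subsection \<open>Crossings of strands of different colours\<close>

lemma pair': "a \<in> {1..<n} \<Longrightarrow> affine_pair p q (T a) (X a) (X (Suc a))"
  using pair[of a] by simp

definition phi where "phi a = affine_pair.\<phi> q (T a) (X a) (X (Suc a))"

lemma phi_eq: "a \<in> {1..<n} \<Longrightarrow> phi a = T a * (X a - X (Suc a)) + (q - 1) *\<^sub>s X (Suc a)"
  unfolding phi_def by (rule affine_pair.\<phi>_def[OF pair'])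

lemma phi_corner: "a \<in> {1..<n} \<Longrightarrow> phi a * p = phi a \<and> p * phi a = phi a"
  using affine_pair.\<phi>_corner[OF pair'] by (simp add: phi_def in_corner_def)

lemma phi_K: "a \<in> {1..<n} \<Longrightarrow> phi a \<in> K"
  using phi_eq[of a] T_K X_K[of a] X_K[of "Suc a"] by (simp add: subalg_closed[OF subalg])

lemma T_X': "a \<in> {1..<n} \<Longrightarrow> b \<in> {1..n} \<Longrightarrow> b \<noteq> a \<Longrightarrow> b \<noteq> Suc a \<Longrightarrow> T a * X b = X b * T a"
  using T_X[of a b] by simp

lemma phi_commute:
  assumes a: "a \<in> {1..<n}" and z: "z * T a = T a * z" "z * X a = X a * z" "z * X (Suc a) = X (Suc a) * z"
  shows "z * phi a = phi a * z"
proof -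
  have "z * (T a * (X a - X (Suc a))) = T a * (X a - X (Suc a)) * z"
    using z by (intro commute_mult) (simp_all add: left_diff_distrib right_diff_distrib)
  then show ?thesis unfolding phi_eq[OF a] using z by (simp add: distrib_left distrib_right)
qed

lemma phi_X:
  assumes a: "a \<in> {1..<n}" and c: "c \<in> {1..n}"
  shows "phi a * X c = X (sw a c) * phi a"
proof -
  consider "c = a" | "c = Suc a" | "c \<noteq> a" "c \<noteq> Suc a" by blast
  then show ?thesis
  proof cases
    case 3
    have "X c * phi a = phi a * X c"
      using 3 a c T_X'[of a c] X_X[of c a] X_X[of c "Suc a"] by (intro phi_commute) auto
    then show ?thesis using 3 by (simp add: sw_other)
  qed (use affine_pair.\<phi>_x[OF pair'[OF a]] affine_pair.\<phi>_y[OF pair'[OF a]] in \<open>auto simp: phi_def\<close>)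
qed

lemma phi_E:
  assumes "a \<in> {1..<n}" "c \<in> {1..n}"
  shows "phi a * E j c = E j (sw a c) * phi a"
  unfolding E_def using phi_X[OF assms] phi_corner[OF assms(1)] by (intro peval_intertwine) auto

text \<open>\<open>e (t \<circ> sw a) * phi a * e t\<close> is evaluated twice: the left idempotent
  is absorbed by what follows it, the right one by what precedes it.\<close>

lemma phi_e:
  assumes t: "t \<in> Seq" and a: "a \<in> {1..<n}"
  shows "phi a * e t = e (t \<circ> sw a) * phi a"
proof -
  let ?s = "t \<circ> sw a"
  have s: "?s \<in> Seq" using Seq_sw[OF t a] .
  have "e ?s * (phi a * e t) = phi a * e t"
  proof (rule e_left)
    show "p * (phi a * e t) = phi a * e t" using phi_corner[OF a] by (simp flip: mult.assoc)
    fix b assume b: "b \<in> {1..n}"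
    then have c: "sw a b \<in> {1..n}" using sw_range[OF a] by blast
    have "E (?s b) b * phi a = phi a * E (?s b) (sw a b)" using phi_E[OF a c] by simp
    then have "E (?s b) b * (phi a * e t) = phi a * (E (?s b) (sw a b) * e t)" by (simp flip: mult.assoc)
    also have "E (?s b) (sw a b) * e t = e t" using E_e'[OF t c] Seq_J[OF t c] by simp
    finally show "E (?s b) b * (phi a * e t) = phi a * e t" .
  qed
  moreover have "(e ?s * phi a) * e t = e ?s * phi a"
  proof (rule e_right)
    show "e ?s * phi a * p = e ?s * phi a" using phi_corner[OF a] by (simp add: mult.assoc)
    fix b assume b: "b \<in> {1..n}"
    then have c: "sw a b \<in> {1..n}" using sw_range[OF a] by blast
    have "e ?s * phi a * E (t b) b = e ?s * E (t b) (sw a b) * phi a"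
      using phi_E[OF a b] by (simp add: mult.assoc)
    also have "e ?s * E (t b) (sw a b) = e ?s" using e_E[OF s c Seq_J[OF t b]] by simp
    finally show "e ?s * phi a * E (t b) b = e ?s * phi a" .
  qed
  ultimately show ?thesis by (simp add: mult.assoc)
qed

text \<open>\<open>T a\<close> need not commute with the single factor \<open>E i a\<close>, but it
  commutes with the symmetric product \<open>E i a * E i (Suc a)\<close>; the other factors belong
  to distant positions.\<close>

lemma T_e_same:
  assumes t: "t \<in> Seq" and a: "a \<in> {1..<n}" and same: "t a = t (Suc a)"
  shows "T a * e t = e t * T a"
proof -
  interpret affine_pair p q "T a" "X a" "X (Suc a)" by (rule pair'[OF a])
  have r: "a \<in> {1..n}" "Suc a \<in> {1..n}" using a by auto
  define i where "i = t a"
  have i: "i \<in> J" "t a = i" "t (Suc a) = i" using Seq_J[OF t r(1)] same by (auto simp: i_def)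
  have sym: "T a * (E i a * E i (Suc a)) = E i a * E i (Suc a) * T a"
    unfolding E_def by (rule T_symmetric)
  have com: "E i (Suc a) * E i a = E i a * E i (Suc a)" using E_E_commute[OF r] .
  have Te: "T a * E j b = E j b * T a" if "b \<in> {1..n}" "b \<noteq> a" "b \<noteq> Suc a" for b j
    using T_X'[OF a that] T_corner[OF a] by (intro E_commute) (auto simp: in_corner_def)
  have "e t * (T a * e t) = T a * e t"
  proof (rule e_left)
    show "p * (T a * e t) = T a * e t" using T_corner[OF a] by (simp add: in_corner_def flip: mult.assoc)
    have eq: "T a * e t = E i a * E i (Suc a) * (T a * e t)"
    proof -
      have "e t = E i a * E i (Suc a) * e t"
        using E_e'[OF t r(1) i(1)] E_e'[OF t r(2) i(1)] i by (simp add: mult.assoc)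
      then have "T a * e t = T a * (E i a * E i (Suc a)) * e t" by (simp only: mult.assoc)
      then show ?thesis unfolding sym by (simp only: mult.assoc)
    qed
    have aa: "E i a * (E i a * E i (Suc a)) = E i a * E i (Suc a)" "E i (Suc a) * (E i a * E i (Suc a)) = E i a * E i (Suc a)"
      using E_E[OF i(1) i(1) r(1)] E_E[OF i(1) i(1) r(2)] com by (simp_all flip: mult.assoc) (simp add: mult.assoc)
    have z: "E i a * (T a * e t) = T a * e t" "E i (Suc a) * (T a * e t) = T a * e t"
      by (subst eq, subst mult.assoc[symmetric], subst aa, subst eq[symmetric], rule refl)+
    fix b assume b: "b \<in> {1..n}"
    show "E (t b) b * (T a * e t) = T a * e t"
    proof (cases "b = a \<or> b = Suc a")
      case True
      then show ?thesis using z i by auto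
    next
      case False
      then have "E (t b) b * (T a * e t) = T a * (E (t b) b * e t)" using Te[OF b] by (simp flip: mult.assoc)
      also have "E (t b) b * e t = e t" using E_e'[OF t b Seq_J[OF t b]] by simp
      finally show ?thesis .
    qed
  qed
  moreover have "(e t * T a) * e t = e t * T a"
  proof (rule e_right)
    show "e t * T a * p = e t * T a" using T_corner[OF a] by (simp add: in_corner_def mult.assoc)
    have eq: "e t * T a = (e t * T a) * (E i a * E i (Suc a))"
    proof -
      have "e t = e t * (E i a * E i (Suc a))"
        using e_E[OF t r(1) i(1)] e_E[OF t r(2) i(1)] i by (simp flip: mult.assoc)
      then have "e t * T a = e t * (E i a * E i (Suc a)) * T a" by (rule arg_cong)
      also have "\<dots> = e t * (E i a * E i (Suc a) * T a)" by (rule mult.assoc)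
      also have "\<dots> = e t * T a * (E i a * E i (Suc a))" unfolding sym[symmetric] by (rule mult.assoc[symmetric])
      finally show ?thesis .
    qed
    have aa: "(E i a * E i (Suc a)) * E i a = E i a * E i (Suc a)" "(E i a * E i (Suc a)) * E i (Suc a) = E i a * E i (Suc a)"
      using E_E[OF i(1) i(1) r(1)] E_E[OF i(1) i(1) r(2)] com by (simp_all add: mult.assoc) (simp flip: mult.assoc)
    have z: "(e t * T a) * E i a = e t * T a" "(e t * T a) * E i (Suc a) = e t * T a"
      by (subst eq, subst mult.assoc, subst aa, subst eq[symmetric], rule refl)+
    fix b assume b: "b \<in> {1..n}"
    show "e t * T a * E (t b) b = e t * T a"
    proof (cases "b = a \<or> b = Suc a")
      case True
      then show ?thesis using z i by auto
    next
      case False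
      then have "e t * T a * E (t b) b = e t * E (t b) b * T a" using Te[OF b] by (simp add: mult.assoc)
      also have "e t * E (t b) b = e t" using e_E[OF t b Seq_J[OF t b]] by simp
      finally show ?thesis .
    qed
  qed
  ultimately show ?thesis by (simp add: mult.assoc)
qed

lemma e_kill:
  assumes t: "t \<in> Seq" and a: "a \<in> {1..n}"
  shows "peval (e t) (root_poly (N (t a))) (X a * e t) = 0"
proof -
  have "peval (e t) (root_poly (N (t a))) (X a * e t) = e t * peval p (root_poly (N (t a))) (X a)"
    using ee[OF t] e_corner X_e[OF a] by (intro peval_corner_change(2)[symmetric]) auto
  also have "\<dots> = e t * E (t a) a * peval p (root_poly (N (t a))) (X a)"
    using e_E[OF t a Seq_J[OF t a]] by simp
  also have "\<dots> = e t * (peval p (root_poly (N (t a))) (X a) * E (t a) a)"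
    using X_E[OF a a] E_corner[OF a] by (simp add: mult.assoc, subst peval_commute) auto
  also have "\<dots> = 0" using E_kill[OF Seq_J[OF t a] a] by simp
  finally show ?thesis .
qed

lemma inverses:
  assumes t: "t \<in> Seq" and c: "c \<in> {1..n}" and d: "d \<in> {1..n}" and cd: "t c \<noteq> t d"
  shows "\<exists>w\<in>K. is_inverse (e t) ((X d - X c) * e t) w" "\<exists>w\<in>K. is_inverse (e t) ((X d - q *\<^sub>s X c) * e t) w"
proof -
  have "\<omega> \<noteq> \<omega>' \<and> q * \<omega> \<noteq> \<omega>'" if "\<omega> \<in># N (t c)" "\<omega>' \<in># N (t d)" for \<omega> \<omega>'
    using separated that Seq_J[OF t c] Seq_J[OF t d] cd unfolding separated_def N_def by blast
  note * = separated_inverses[OF ee[OF t] X_e[OF c] X_e[OF d] X_X[OF c d] q0 e_kill[OF t c] e_kill[OF t d] this subalg e_K]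
  show "\<exists>w\<in>K. is_inverse (e t) ((X d - X c) * e t) w" "\<exists>w\<in>K. is_inverse (e t) ((X d - q *\<^sub>s X c) * e t) w"
    using * subalg_closed(2)[OF subalg X_K e_K] c d by blast+
qed

definition b where "b c d t = scatter q (e t) (X c) (X d)"

definition f where "f a t = inverse_in (e t) ((q *\<^sub>s X a - X (Suc a)) * e t)"

text \<open>On \<open>e t\<close>, \<open>f\<close> inverts one of the two factors of the square of
  \<open>phi a\<close>. For the swapped sequence, \<open>f\<close> moved across \<open>phi a\<close>
  becomes the inverse of the other factor, so that crossing back and forth is the identity.\<close>

definition \<sigma> where "\<sigma> a t = phi a * f a t"

lemma scatter_pair:
  assumes "t \<in> Seq" "c \<in> {1..n}" "d \<in> {1..n}" "t c \<noteq> t d"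
  shows "scatter_pair (e t) (X c) (X d) (inverse_in (e t) ((X d - X c) * e t))"
  using ee[OF assms(1)] X_e[OF assms(2)] X_e[OF assms(3)] X_X[OF assms(2,3)] inverses(1)[OF assms]
  by unfold_locales (auto intro: is_inverse_inverse_in)

lemma f_inverse:
  assumes "t \<in> Seq" "a \<in> {1..<n}" "t a \<noteq> t (Suc a)"
  shows "is_inverse (e t) ((q *\<^sub>s X a - X (Suc a)) * e t) (f a t)" "f a t \<in> K"
proof -
  obtain w where w: "w \<in> K" "is_inverse (e t) ((X (Suc a) - q *\<^sub>s X a) * e t) w"
    using inverses(2)[OF assms(1) _ _ assms(3)] assms(2) by auto
  have "is_inverse (e t) ((q *\<^sub>s X a - X (Suc a)) * e t) (- w)"
    using is_inverse_uminus[OF w(2)] by (simp add: left_diff_distrib)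
  then show "is_inverse (e t) ((q *\<^sub>s X a - X (Suc a)) * e t) (f a t)" "f a t \<in> K"
    unfolding f_def using is_inverse_inverse_in inverse_in_eq subalg_closed(4)[OF subalg w(1)] by metis+
qed

lemma \<sigma>_K: "t \<in> Seq \<Longrightarrow> a \<in> {1..<n} \<Longrightarrow> t a \<noteq> t (Suc a) \<Longrightarrow> \<sigma> a t \<in> K"
  unfolding \<sigma>_def using phi_K f_inverse(2) by (intro subalg_closed[OF subalg]) auto

lemma f_commute:
  assumes "t \<in> Seq" "a \<in> {1..<n}" "t a \<noteq> t (Suc a)"
    and "z * X a = X a * z" "z * X (Suc a) = X (Suc a) * z" "z * e t = e t * z"
  shows "z * f a t = f a t * z"
  by (rule inverse_commute[OF f_inverse(1)[OF assms(1-3)] _ assms(6)], rule commute_mult(2))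
    (use assms in \<open>simp_all add: left_diff_distrib right_diff_distrib\<close>)

lemma f_e: "t \<in> Seq \<Longrightarrow> a \<in> {1..<n} \<Longrightarrow> t a \<noteq> t (Suc a) \<Longrightarrow> e t * f a t = f a t \<and> f a t * e t = f a t"
  using f_inverse(1) by (simp add: is_inverse_def)

lemma \<sigma>_corner:
  assumes "t \<in> Seq" "a \<in> {1..<n}" "t a \<noteq> t (Suc a)"
  shows "e (t \<circ> sw a) * \<sigma> a t = \<sigma> a t" "\<sigma> a t * e t = \<sigma> a t"
proof -
  have "e (t \<circ> sw a) * (phi a * f a t) = (e (t \<circ> sw a) * phi a) * f a t" by (simp only: mult.assoc)
  also have "\<dots> = phi a * (e t * f a t)" by (simp only: phi_e[OF assms(1,2), symmetric] mult.assoc)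
  finally show "e (t \<circ> sw a) * \<sigma> a t = \<sigma> a t" using f_e[OF assms] by (simp add: \<sigma>_def)
  show "\<sigma> a t * e t = \<sigma> a t" using f_e[OF assms] by (simp add: \<sigma>_def mult.assoc)
qed

lemma X_\<sigma>:
  assumes "t \<in> Seq" "a \<in> {1..<n}" "t a \<noteq> t (Suc a)" "c \<in> {1..n}"
  shows "X c * \<sigma> a t = \<sigma> a t * X (sw a c)"
proof -
  have c: "sw a c \<in> {1..n}" using sw_range[OF assms(2)] assms(4) by blast
  have r: "a \<in> {1..n}" "Suc a \<in> {1..n}" using assms(2) by auto
  have "X c * phi a = phi a * X (sw a c)" using phi_X[OF assms(2) c] by simp
  moreover have "X (sw a c) * f a t = f a t * X (sw a c)"
    by (rule f_commute[OF assms(1-3) X_X[OF c r(1)] X_X[OF c r(2)] X_e[OF c]])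
  ultimately show ?thesis unfolding \<sigma>_def by (rule intertwine_mult)
qed

text \<open>Gathering the two intertwiners produces their square, and the two normalising factors
  cancel it.\<close>

lemma \<sigma>\<sigma>:
  assumes t: "t \<in> Seq" and a: "a \<in> {1..<n}" and d: "t a \<noteq> t (Suc a)"
  shows "\<sigma> a (t \<circ> sw a) * \<sigma> a t = e t"
proof -
  let ?s = "t \<circ> sw a"
  have r: "a \<in> {1..n}" "Suc a \<in> {1..n}" using a by auto
  have s: "?s \<in> Seq" "?s a \<noteq> ?s (Suc a)" using Seq_sw[OF t a] d by auto
  interpret affine_pair p q "T a" "X a" "X (Suc a)" by (rule pair'[OF a])
  obtain w where w: "is_inverse (e t) ((X a - q *\<^sub>s X (Suc a)) * e t) w"
    using inverses(2)[OF t r(2,1)] d by auto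
  \<comment> \<open>The inverse of the second factor of the square; \<open>phi a\<close> carries it
    to \<open>f a ?s\<close>.\<close>
  have g: "is_inverse (e t) ((q *\<^sub>s X (Suc a) - X a) * e t) (- w)"
    using is_inverse_uminus[OF w] by (simp add: left_diff_distrib)
  let ?z = "phi a * e t"
  have z: "?z = e ?s * phi a" by (rule phi_e[OF t a])
  have "?z * ((q *\<^sub>s X (Suc a) - X a) * e t) = phi a * (q *\<^sub>s X (Suc a) - X a) * e t"
  proof -
    have "e t * (q *\<^sub>s X (Suc a) - X a) = (q *\<^sub>s X (Suc a) - X a) * e t"
      using X_e[OF r(1)] X_e[OF r(2)] by (simp add: left_diff_distrib right_diff_distrib)
    then have "phi a * (e t * (q *\<^sub>s X (Suc a) - X a)) * e t = phi a * (q *\<^sub>s X (Suc a) - X a) * (e t * e t)"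
      by (simp only: mult.assoc)
    then show ?thesis by (simp only: ee[OF t] mult.assoc)
  qed
  also have "phi a * (q *\<^sub>s X (Suc a) - X a) = (q *\<^sub>s X a - X (Suc a)) * phi a"
    using phi_X[OF a r(1)] phi_X[OF a r(2)] by (simp add: left_diff_distrib right_diff_distrib)
  also have "(q *\<^sub>s X a - X (Suc a)) * phi a * e t = ((q *\<^sub>s X a - X (Suc a)) * e ?s) * ?z"
    unfolding mult.assoc z using ee[OF s(1)] by (simp flip: mult.assoc)
  finally have "?z * (- w) = f a ?s * ?z"
  proof (rule is_inverse_intertwine[OF g f_inverse(1)[OF s(1) a s(2)]])
    show "?z * e t = ?z" using ee[OF t] by (simp add: mult.assoc)
    show "e ?s * ?z = ?z" unfolding z using ee[OF s(1)] by (simp flip: mult.assoc)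
  qed
  have "\<sigma> a ?s * \<sigma> a t = phi a * (f a ?s * ?z) * f a t"
    using f_e[OF t a d] by (simp add: \<sigma>_def mult.assoc)
  also have "f a ?s * ?z = phi a * (- w)"
    unfolding \<open>?z * (- w) = f a ?s * ?z\<close>[symmetric] using g by (simp add: is_inverse_def mult.assoc)
  also have "phi a * (phi a * (- w)) * f a t = (q *\<^sub>s X a - X (Suc a)) * (((q *\<^sub>s X (Suc a) - X a) * (- w)) * f a t)"
    using \<phi>_square by (simp only: phi_def mult.assoc[symmetric])
  also have "(q *\<^sub>s X (Suc a) - X a) * (- w) = e t"
    by (rule is_inverse_strip[OF g])
  also have "(q *\<^sub>s X a - X (Suc a)) * (e t * f a t) = e t"
    using is_inverse_strip[OF f_inverse(1)[OF t a d]] f_e[OF t a d] by simp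
  finally show ?thesis .
qed

text \<open>Solves the definition of the intertwiner for \<open>T a\<close>. Since
  \<open>q - b\<close> is \<open>X (Suc a) - q X a\<close> times \<open>w\<close>, the factor
  \<open>f\<close> cancels its numerator up to sign, and \<open>\<sigma> (q - b)\<close> is
  \<open>- phi a * w\<close>.\<close>

lemma T_diff:
  assumes t: "t \<in> Seq" and a: "a \<in> {1..<n}" and ne: "t a \<noteq> t (Suc a)"
  shows "T a * e t = \<sigma> a t * (q *\<^sub>s e t - b a (Suc a) t) + b a (Suc a) t"
proof -
  have r: "a \<in> {1..n}" "Suc a \<in> {1..n}" using a by auto
  define w where "w = inverse_in (e t) ((X (Suc a) - X a) * e t)"
  interpret scatter_pair q "e t" "X a" "X (Suc a)" w
    unfolding w_def by (rule scatter_pair[OF t r ne])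
  obtain g where g: "is_inverse (e t) ((X (Suc a) - q *\<^sub>s X a) * e t) g"
    using inverses(2)[OF t r ne] by blast
  have b: "b a (Suc a) t = (q - 1) *\<^sub>s (X (Suc a) * w)" unfolding b_def by (rule scatter_eq)
  have qb: "q *\<^sub>s e t - b a (Suc a) t = (X (Suc a) - q *\<^sub>s X a) * w"
    unfolding b_def by (rule scatter_inverse(2)[OF g])
  have f: "f a t * ((q *\<^sub>s X a - X (Suc a)) * e t) = e t" using f_inverse(1)[OF t a ne] by (simp add: is_inverse_def)
  have "f a t * ((X (Suc a) - q *\<^sub>s X a) * w) = - (f a t * ((q *\<^sub>s X a - X (Suc a)) * (e t * w)))"
    by (simp only: d'(1)) (simp add: algebra_simps)
  also have "\<dots> = - (f a t * ((q *\<^sub>s X a - X (Suc a)) * e t) * w)" by (simp only: mult.assoc)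
  also have "\<dots> = - w" unfolding f by (simp add: d')
  finally have "\<sigma> a t * (q *\<^sub>s e t - b a (Suc a) t) = - (phi a * w)"
    unfolding \<sigma>_def qb by (simp add: mult.assoc)
  also have "phi a * w = - (T a * ((X (Suc a) - X a) * w)) + (q - 1) *\<^sub>s (X (Suc a) * w)"
    unfolding phi_eq[OF a] by (simp add: algebra_simps)
  also have "(X (Suc a) - X a) * w = e t" by (rule d')
  finally show ?thesis unfolding b by simp
qed

lemma b_\<sigma>:
  assumes t: "t \<in> Seq" and a: "a \<in> {1..<n}" and d: "t a \<noteq> t (Suc a)" and c: "c \<in> {1..n}" "c' \<in> {1..n}"
    and cc: "t (sw a c) \<noteq> t (sw a c')"
  shows "b c c' (t \<circ> sw a) * \<sigma> a t = \<sigma> a t * b (sw a c) (sw a c') t"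
proof -
  let ?s = "t \<circ> sw a" and ?z = "\<sigma> a t"
  have s: "?s \<in> Seq" "?s c \<noteq> ?s c'" using Seq_sw[OF t a] cc by auto
  have r: "sw a c \<in> {1..n}" "sw a c' \<in> {1..n}" using sw_range[OF a] c by auto
  obtain w where w: "is_inverse (e ?s) ((X c' - X c) * e ?s) w" using inverses(1)[OF s(1) c s(2)] by blast
  obtain v where v: "is_inverse (e t) ((X (sw a c') - X (sw a c)) * e t) v" using inverses(1)[OF t r cc] by blast
  have zv: "?z * v = w * ?z"
  proof (rule is_inverse_intertwine[OF v w])
    show "?z * e t = ?z" "e ?s * ?z = ?z" using \<sigma>_corner[OF t a d] by auto
    have "?z * ((X (sw a c') - X (sw a c)) * e t) = ?z * (e t * (X (sw a c') - X (sw a c)))"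
      using X_e[OF r(1)] X_e[OF r(2)] by (simp add: left_diff_distrib right_diff_distrib)
    also have "\<dots> = ?z * (X (sw a c') - X (sw a c))"
      using \<sigma>_corner[OF t a d] by (simp flip: mult.assoc)
    also have "\<dots> = (X c' - X c) * ?z"
      using X_\<sigma>[OF t a d c(1)] X_\<sigma>[OF t a d c(2)] by (simp add: left_diff_distrib right_diff_distrib)
    also have "\<dots> = ((X c' - X c) * e ?s) * ?z"
      using \<sigma>_corner[OF t a d] by (simp add: mult.assoc)
    finally show "?z * ((X (sw a c') - X (sw a c)) * e t) = ((X c' - X c) * e ?s) * ?z" .
  qed
  show ?thesis
    unfolding b_def scatter_def inverse_in_eq[OF w] inverse_in_eq[OF v]
  proof -
    have "X c' * w * ?z = X c' * ?z * v" by (simp only: mult.assoc zv[symmetric])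
    also have "\<dots> = ?z * (X (sw a c') * v)" by (simp only: X_\<sigma>[OF t a d c(2)] mult.assoc)
    finally show "(q - 1) *\<^sub>s (X c' * w) * ?z = ?z * (q - 1) *\<^sub>s (X (sw a c') * v)" by simp
  qed
qed

sublocale braid_system q n Seq e \<sigma> b T
proof
  fix t a assume t: "t \<in> Seq" and a: "a \<in> {1..<n}"
  show "t \<circ> sw a \<in> Seq" using Seq_sw[OF t a] .
  show "T a * T a * e t = (q - 1) *\<^sub>s (T a * e t) + q *\<^sub>s e t"
    unfolding TT[OF a] using e_corner by (simp add: distrib_right)
  fix c assume same: "t a = t (Suc a)" and c: "c \<in> {1..n}" and ca: "t c \<noteq> t a"
  have r: "a \<in> {1..n}" "Suc a \<in> {1..n}" using a by auto
  interpret affine_pair p q "T a" "X a" "X (Suc a)" by (rule pair'[OF a])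
  have "c \<noteq> a" "c \<noteq> Suc a" using same ca by auto
  then have z: "T a * X c = X c * T a" using T_X'[OF a c] by simp
  have ca': "t a \<noteq> t c" "t (Suc a) \<noteq> t c" using ca same by auto
  obtain d1 where d1: "is_inverse (e t) ((X c - X a) * e t) d1" using inverses(1)[OF t r(1) c ca'(1)] by blast
  obtain d2 where d2: "is_inverse (e t) ((X c - X (Suc a)) * e t) d2" using inverses(1)[OF t r(2) c ca'(2)] by blast
  show "T a * b (Suc a) c t = b a c t * T a + b a c t * b (Suc a) c t - (q - 1) *\<^sub>s b a c t"
    "T a * b a c t = b (Suc a) c t * T a - b (Suc a) c t * b a c t + (q - 1) *\<^sub>s b a c t"
    unfolding b_def scatter_def inverse_in_eq[OF d1] inverse_in_eq[OF d2]
    using T_scatter[OF T_e_same[OF t a same] z d1 d2] T_scatter'[OF T_e_same[OF t a same] z d1 d2] by auto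
next
  fix t c d assume t: "t \<in> Seq" and cd: "c \<in> {1..n}" "d \<in> {1..n}" "t c \<noteq> t d"
  interpret scatter_pair q "e t" "X c" "X d" "inverse_in (e t) ((X d - X c) * e t)"
    by (rule scatter_pair[OF t cd])
  show "e t * b c d t = b c d t \<and> b c d t * e t = b c d t"
    unfolding b_def using scatter_corner by simp
  show "b c d t + b d c t = (q - 1) *\<^sub>s e t" unfolding b_def by (rule scatter_swap)
  obtain g where g: "is_inverse (e t) ((X d - q *\<^sub>s X c) * e t) g"
    using inverses(2)[OF t cd] by blast
  then show "\<exists>w. is_inverse (e t) (q *\<^sub>s e t - b c d t) w"
    unfolding b_def using scatter_inverse(1) by blast
  fix c' d' assume cd': "c' \<in> {1..n}" "d' \<in> {1..n}" "t c' \<noteq> t d'"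
  interpret s': scatter_pair q "e t" "X c'" "X d'" "inverse_in (e t) ((X d' - X c') * e t)"
    by (rule scatter_pair[OF t cd'])
  have "X z * b c' d' t = b c' d' t * X z" if "z \<in> {1..n}" for z
    unfolding b_def using X_X[OF that] X_e[OF that] cd' by (intro s'.scatter_commute) auto
  then show "b c d t * b c' d' t = b c' d' t * b c d t"
    using cd s'.scatter_corner unfolding b_def[of c d] by (intro scatter_commute[symmetric]) (auto simp: b_def)
next
  fix t c d f assume "t \<in> Seq" "c \<in> {1..n}" "d \<in> {1..n}" "f \<in> {1..n}" "t c \<noteq> t d" "t c \<noteq> t f" "t d \<noteq> t f"
  then show "(q - 1) *\<^sub>s b c f t - b c d t * b c f t + b c d t * b d f t - b d f t * b c f t = 0"
    unfolding b_def by (intro scatter_triple[OF scatter_pair scatter_pair scatter_pair])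
qed (use ee \<sigma>_corner \<sigma>\<sigma> T_diff T_e_same b_\<sigma> in auto)

lemma defect_0: "1 \<le> a \<Longrightarrow> Suc a < n \<Longrightarrow> defect a = 0"
  using braid[of a] by (simp add: defect_def)

text \<open>Apart from the intertwiners, the normalising factor of one crossing has to pass the
  other intertwiner, on whose far side it belongs to a different colour sequence.\<close>

lemma \<sigma>_far:
  assumes t: "t \<in> Seq" and a: "a \<in> {1..<n}" and c: "c \<in> {1..<n}" and far: "Suc a < c"
    and d: "t a \<noteq> t (Suc a)" "t c \<noteq> t (Suc c)"
  shows "\<sigma> a (t \<circ> sw c) * \<sigma> c t = \<sigma> c (t \<circ> sw a) * \<sigma> a t"
proof -
  have ra: "a \<in> {1..n}" "Suc a \<in> {1..n}" and rc: "c \<in> {1..n}" "Suc c \<in> {1..n}" using a c by auto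
  have phi_T: "T c * phi a = phi a * T c"
    using T_T[OF a c] far T_X'[OF c ra(1)] T_X'[OF c ra(2)] by (intro phi_commute[OF a]) auto
  have phi_phi: "phi a * phi c = phi c * phi a"
    using phi_T phi_X[OF a rc(1)] phi_X[OF a rc(2)] far by (intro phi_commute[OF c]) (auto simp: sw_other)
  have *: "f x (t \<circ> sw y) * (phi y * e t) = phi y * f x t"
    if x: "x \<in> {1..<n}" "t x \<noteq> t (Suc x)" and y: "y \<in> {1..<n}" "x \<noteq> y" "x \<noteq> Suc y" "Suc x \<noteq> y" for x y
  proof -
    let ?s = "t \<circ> sw y" and ?z = "phi y * e t" and ?u = "q *\<^sub>s X x - X (Suc x)"
    have s: "?s \<in> Seq" "?s x \<noteq> ?s (Suc x)" using Seq_sw[OF t y(1)] x y by (auto simp: sw_other)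
    have z: "?z = e ?s * phi y" by (rule phi_e[OF t y(1)])
    have r: "x \<in> {1..n}" "Suc x \<in> {1..n}" using x by auto
    have u: "phi y * ?u = ?u * phi y"
      using phi_X[OF y(1) r(1)] phi_X[OF y(1) r(2)] y by (simp add: sw_other left_diff_distrib right_diff_distrib)
    have ue: "e t' * ?u = ?u * e t'" for t'
      using X_e[OF r(1)] X_e[OF r(2)] by (simp add: left_diff_distrib right_diff_distrib)
    have "?z * f x t = f x ?s * ?z"
    proof (rule is_inverse_intertwine[OF f_inverse(1)[OF t x] f_inverse(1)[OF s(1) x(1) s(2)]])
      show ze: "?z * e t = ?z" using ee[OF t] by (simp add: mult.assoc)
      show ez: "e ?s * ?z = ?z" unfolding z using ee[OF s(1)] by (simp flip: mult.assoc)
      have "?z * (?u * e t) = phi y * (e t * ?u) * e t" by (simp only: mult.assoc)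
      also have "\<dots> = phi y * ?u * (e t * e t)" by (simp only: ue mult.assoc)
      also have "\<dots> = ?u * ?z" by (simp only: u ee[OF t] mult.assoc)
      also have "\<dots> = ?u * (e ?s * ?z)" by (simp only: ez)
      finally show "?z * (?u * e t) = (?u * e ?s) * ?z" by (simp only: mult.assoc)
    qed
    then show ?thesis using f_e[OF t x] by (simp add: mult.assoc)
  qed
  have ff: "f a t * f c t = f c t * f a t"
  proof (rule f_commute[OF t c d(2)])
    have "X z * f a t = f a t * X z" if "z \<in> {1..n}" for z
      using X_X[OF that] X_e[OF that] ra by (intro f_commute[OF t a d(1)]) auto
    then show "f a t * X c = X c * f a t" "f a t * X (Suc c) = X (Suc c) * f a t" using rc by auto
    show "f a t * e t = e t * f a t" using f_e[OF t a d(1)] by simp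
  qed
  have "\<sigma> a (t \<circ> sw c) * \<sigma> c t = phi a * (f a (t \<circ> sw c) * (phi c * e t)) * f c t"
    using f_e[OF t c d(2)] by (simp add: \<sigma>_def mult.assoc)
  also have "\<dots> = phi a * phi c * (f a t * f c t)"
    using *[OF a d(1) c] far by (simp add: mult.assoc)
  also have "\<dots> = phi c * (phi a * f c t) * f a t" unfolding ff phi_phi by (simp only: mult.assoc)
  also have "\<dots> = phi c * (f c (t \<circ> sw a) * (phi a * e t)) * f a t"
    using *[OF c d(2) a] far by simp
  also have "\<dots> = \<sigma> c (t \<circ> sw a) * \<sigma> a t"
    using f_e[OF t a d(1)] by (simp add: \<sigma>_def mult.assoc)
  finally show ?thesis .
qed

lemma T_\<sigma>_far:
  assumes t: "t \<in> Seq" and a: "a \<in> {1..<n}" and c: "c \<in> {1..<n}" and far: "Suc a < c \<or> Suc c < a"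
    and d: "t a \<noteq> t (Suc a)" "t c = t (Suc c)"
  shows "T c * \<sigma> a t = \<sigma> a t * T c"
proof -
  have ra: "a \<in> {1..n}" "Suc a \<in> {1..n}" using a by auto
  have X: "T c * X a = X a * T c" "T c * X (Suc a) = X (Suc a) * T c"
    using T_X'[OF c ra(1)] T_X'[OF c ra(2)] far by auto
  have "T c * phi a = phi a * T c"
    using T_T[OF a c] T_T[OF c a] far X by (intro phi_commute[OF a]) auto
  moreover have "T c * f a t = f a t * T c"
    using X T_e_same[OF t c d(2)] by (intro f_commute[OF t a d(1)])
  ultimately show ?thesis unfolding \<sigma>_def by (rule commute_mult(2))
qed

lemma \<sigma>_braid:
  assumes "t \<in> Seq" "1 \<le> a" "Suc a < n" "t a \<noteq> t (Suc a)" "t a \<noteq> t (Suc (Suc a))" "t (Suc a) \<noteq> t (Suc (Suc a))"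
  shows "\<sigma> a (t \<circ> sw a \<circ> sw (Suc a)) * (\<sigma> (Suc a) (t \<circ> sw a) * \<sigma> a t) =
    \<sigma> (Suc a) (t \<circ> sw (Suc a) \<circ> sw a) * (\<sigma> a (t \<circ> sw (Suc a)) * \<sigma> (Suc a) t)"
  using defect_distinct[OF assms] defect_0[OF assms(2,3)] by simp

lemma T_\<sigma>_\<sigma>:
  assumes "t \<in> Seq" "1 \<le> a" "Suc a < n" "t a = t (Suc a)" "t (Suc a) \<noteq> t (Suc (Suc a))"
  shows "T (Suc a) * (\<sigma> a (t \<circ> sw (Suc a)) * \<sigma> (Suc a) t) = \<sigma> a (t \<circ> sw (Suc a)) * \<sigma> (Suc a) t * T a"
proof -
  have "\<sigma> (Suc a) t * (T a * e t) = \<sigma> (Suc a) t * T a"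
    using T_e_same[OF assms(1) _ assms(4)] \<sigma>_right[OF assms(1) _ assms(5)] assms(2,3) by (simp flip: mult.assoc)
  then show ?thesis
    using defect_mixed[OF assms] defect_0[OF assms(2,3)] by (simp add: mult.assoc)
qed

text \<open>The mirror case needs no second defect computation: the two double crossings
  \<open>?V\<close> and \<open>?W\<close> are mutually inverse, so the relation for
  \<open>?W\<close> is conjugated into one for \<open>?V\<close>.\<close>

lemma T_\<sigma>_\<sigma>':
  assumes t: "t \<in> Seq" and a: "1 \<le> a" "Suc a < n" and d: "t (Suc a) = t (Suc (Suc a))" "t a \<noteq> t (Suc a)"
  shows "T a * (\<sigma> (Suc a) (t \<circ> sw a) * \<sigma> a t) = \<sigma> (Suc a) (t \<circ> sw a) * \<sigma> a t * T (Suc a)"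
proof -
  have ra: "a \<in> {1..<n}" "Suc a \<in> {1..<n}" using a by auto
  note [simp] = sw_other
  let ?m = "t \<circ> sw a" let ?s = "?m \<circ> sw (Suc a)"
  have m: "?m \<in> Seq" and s: "?s \<in> Seq" using Seq_sw t ra by auto
  let ?V = "\<sigma> (Suc a) ?m * \<sigma> a t" and ?W = "\<sigma> a ?m * \<sigma> (Suc a) ?s"
  have W: "T (Suc a) * ?W = ?W * T a"
    using T_\<sigma>_\<sigma>[OF s a] d by (simp add: comp_assoc)
  have "?V * ?W = \<sigma> (Suc a) ?m * (\<sigma> a t * \<sigma> a ?m) * \<sigma> (Suc a) ?s" by (simp only: mult.assoc)
  also have "\<sigma> a t * \<sigma> a ?m = e ?m" using \<sigma>\<sigma>[OF m ra(1)] d by simp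
  also have "\<sigma> (Suc a) ?m * e ?m = \<sigma> (Suc a) ?m" using \<sigma>_right[OF m ra(2)] d by simp
  also have "\<sigma> (Suc a) ?m * \<sigma> (Suc a) ?s = e ?s" using \<sigma>\<sigma>[OF s ra(2)] d by (simp add: comp_assoc)
  finally have VW: "?V * ?W = e ?s" .
  have "?W * ?V = \<sigma> a ?m * (\<sigma> (Suc a) ?s * \<sigma> (Suc a) ?m) * \<sigma> a t" by (simp only: mult.assoc)
  also have "\<sigma> (Suc a) ?s * \<sigma> (Suc a) ?m = e ?m" using \<sigma>\<sigma>[OF m ra(2)] d by simp
  also have "\<sigma> a ?m * e ?m = \<sigma> a ?m" using \<sigma>_right[OF m ra(1)] d by simp
  also have "\<sigma> a ?m * \<sigma> a t = e t" using \<sigma>\<sigma>[OF t ra(1) d(2)] .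
  finally have WV: "?W * ?V = e t" .
  have Vl: "e ?s * ?V = ?V" using \<sigma>_left[OF m ra(2)] d by (simp flip: mult.assoc)
  have Vr: "?V * e t = ?V" using \<sigma>_right[OF t ra(1) d(2)] by (simp add: mult.assoc)
  have "T a * ?V = T a * (e ?s * ?V)" by (simp only: Vl)
  also have "\<dots> = e ?s * T a * ?V" using T_e_same[OF s ra(1)] d by (simp flip: mult.assoc)
  also have "\<dots> = ?V * ?W * T a * ?V" by (simp only: VW)
  also have "\<dots> = ?V * (?W * T a) * ?V" by (simp only: mult.assoc)
  also have "\<dots> = ?V * (T (Suc a) * ?W) * ?V" by (simp only: W)
  also have "\<dots> = ?V * (T (Suc a) * (?W * ?V))" by (simp only: mult.assoc)
  also have "\<dots> = ?V * (T (Suc a) * e t)" by (simp only: WV)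
  also have "T (Suc a) * e t = e t * T (Suc a)" using T_e_same[OF t ra(2) d(1)] .
  also have "?V * (e t * T (Suc a)) = ?V * T (Suc a)" by (simp only: Vr mult.assoc[symmetric])
  finally show ?thesis .
qed

end

section \<open>Combinatorics of stable sorting\<close>

section \<open>Sorting colour sequences\<close>

definition content :: "nat \<Rightarrow> (nat \<Rightarrow> nat) \<Rightarrow> nat \<Rightarrow> nat" where
  "content n t j = card {c \<in> {1..n}. t c = j}"

definition off :: "nat \<Rightarrow> (nat \<Rightarrow> nat) \<Rightarrow> nat \<Rightarrow> nat" where
  "off n t j = card {c \<in> {1..n}. t c < j}"

text \<open>The position of strand \<open>a\<close> after stable sorting: colours become ascending,
  and equal colours keep their order. \<open>off\<close> is the offset of a colour block, whose
  positions are \<open>off + 1\<close> up to \<open>off + content\<close>.\<close>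

definition pos :: "nat \<Rightarrow> (nat \<Rightarrow> nat) \<Rightarrow> nat \<Rightarrow> nat" where
  "pos n t a = off n t (t a) + card {c \<in> {1..a}. t c = t a}"

definition ascending :: "nat \<Rightarrow> (nat \<Rightarrow> nat) \<Rightarrow> bool" where
  "ascending n t \<longleftrightarrow> (\<forall>a\<in>{1..<n}. t a \<le> t (Suc a))"

text \<open>A termination measure: removing a descent moves the larger colour one place to the
  right, where its weight is smaller.\<close>

definition disorder :: "nat \<Rightarrow> (nat \<Rightarrow> nat) \<Rightarrow> nat" where
  "disorder n t = (\<Sum>a\<in>{1..n}. (n - a) * t a)"

lemma card_comp_permutation:
  assumes "bij_betw g C C"
  shows "card {c \<in> C. Q (g c)} = card {c \<in> C. Q c}"
proof -
  have "g ` {c \<in> C. Q (g c)} = {c \<in> C. Q c}"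
    using assms unfolding bij_betw_def by (auto simp: image_iff)
  moreover have "inj_on g {c \<in> C. Q (g c)}"
    using assms unfolding bij_betw_def by (auto intro: inj_on_subset)
  ultimately show ?thesis using card_image[of g "{c \<in> C. Q (g c)}"] by simp
qed

lemma bij_transpose_on:
  assumes "a \<in> C" "b \<in> C"
  shows "bij_betw (Transposition.transpose a b) C C"
proof (rule bij_betw_byWitness[of _ "Transposition.transpose a b"])
  show "Transposition.transpose a b ` C \<subseteq> C" "Transposition.transpose a b ` C \<subseteq> C"
    using assms by (auto simp: Transposition.transpose_def)
qed auto

lemma content_transpose:
  assumes "a \<in> {1..n}" "b \<in> {1..n}"
  shows "content n (t \<circ> Transposition.transpose a b) = content n t"
  using card_comp_permutation[OF bij_transpose_on[OF assms], of "\<lambda>c. t c = j" for j]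
  by (auto simp: content_def fun_eq_iff)

lemma off_transpose:
  assumes "a \<in> {1..n}" "b \<in> {1..n}"
  shows "off n (t \<circ> Transposition.transpose a b) = off n t"
  using card_comp_permutation[OF bij_transpose_on[OF assms], of "\<lambda>c. t c < j" for j]
  by (auto simp: off_def fun_eq_iff)

lemma off_content:
  assumes "\<And>c. c \<in> {1..n} \<Longrightarrow> t c \<in> J" "finite J"
  shows "off n t j = (\<Sum>i\<in>{i \<in> J. i < j}. content n t i)"
proof -
  have "{c \<in> {1..n}. t c < j} = (\<Union>i\<in>{i \<in> J. i < j}. {c \<in> {1..n}. t c = i})"
    using assms by auto
  then have "off n t j = card (\<Union>i\<in>{i \<in> J. i < j}. {c \<in> {1..n}. t c = i})"
    by (simp only: off_def)
  also have "\<dots> = (\<Sum>i\<in>{i \<in> J. i < j}. card {c \<in> {1..n}. t c = i})"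
    using assms by (intro card_UN_disjoint) auto
  finally show ?thesis by (simp add: content_def)
qed

lemma rank_sw:
  assumes "a \<in> {1..<n}" "t a \<noteq> t (Suc a)" "c \<in> {1..n}"
  shows "card {x \<in> {1..c}. (t \<circ> sw a) x = (t \<circ> sw a) c} = card {x \<in> {1..sw a c}. t x = t (sw a c)}"
proof -
  consider "c < a" | "c = a" | "c = Suc a" | "c > Suc a" by linarith
  then show ?thesis
  proof cases
    case 1
    then have "{x \<in> {1..c}. (t \<circ> sw a) x = (t \<circ> sw a) c} = {x \<in> {1..sw a c}. t x = t (sw a c)}"
      by (auto simp: sw_other)
    then show ?thesis by simp
  next
    case 2
    have "{x \<in> {1..c}. (t \<circ> sw a) x = (t \<circ> sw a) c} = insert a {x \<in> {1..<a}. t x = t (Suc a)}"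
      using 2 assms by (auto simp: Transposition.transpose_def)
    moreover have "{x \<in> {1..sw a c}. t x = t (sw a c)} = insert (Suc a) {x \<in> {1..<a}. t x = t (Suc a)}"
      using 2 assms by (auto simp: le_Suc_eq) (metis le_neq_implies_less)
    ultimately show ?thesis by simp
  next
    case 3
    have "{x \<in> {1..c}. (t \<circ> sw a) x = (t \<circ> sw a) c} = insert (Suc a) {x \<in> {1..<a}. t x = t a}"
      using 3 assms by (auto simp: Transposition.transpose_def)
    moreover have "{x \<in> {1..sw a c}. t x = t (sw a c)} = insert a {x \<in> {1..<a}. t x = t a}"
      using 3 assms by auto
    ultimately show ?thesis by simp
  next
    case 4
    have "card {x \<in> {1..c}. t (sw a x) = t c} = card {x \<in> {1..c}. t x = t c}"
      using 4 assms by (intro card_comp_permutation bij_transpose_on) auto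
    then show ?thesis using 4 by (simp add: sw_other)
  qed
qed

lemma pos_sw:
  assumes "a \<in> {1..<n}" "t a \<noteq> t (Suc a)" "c \<in> {1..n}"
  shows "pos n (t \<circ> sw a) c = pos n t (sw a c)"
  using rank_sw[OF assms] off_transpose[of a n "Suc a" t] assms by (simp add: pos_def)

lemma pos_Suc: "t a = t (Suc a) \<Longrightarrow> pos n t (Suc a) = Suc (pos n t a)"
proof -
  assume eq: "t a = t (Suc a)"
  have "{c \<in> {1..Suc a}. t c = t (Suc a)} = insert (Suc a) {c \<in> {1..a}. t c = t a}"
    using eq by (auto simp: le_Suc_eq)
  then show ?thesis by (simp add: pos_def eq)
qed

lemma ascending_mono:
  assumes "ascending n t" "1 \<le> a" "a \<le> c" "c \<le> n"
  shows "t a \<le> t c"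
  using assms(3,4)
proof (induction c rule: dec_induct)
  case (step c)
  then have "t c \<le> t (Suc c)" using assms by (auto simp: ascending_def)
  with step show ?case by simp
qed simp

lemma pos_ascending:
  assumes "ascending n t" "a \<in> {1..n}"
  shows "pos n t a = a"
proof -
  have "{1..a} = {c \<in> {1..n}. t c < t a} \<union> {c \<in> {1..a}. t c = t a}" (is "_ = ?A \<union> ?B")
  proof (intro equalityI subsetI)
    fix c assume "c \<in> {1..a}"
    then show "c \<in> ?A \<union> ?B" using ascending_mono[OF assms(1), of c a] assms(2) by fastforce
  next
    fix c assume "c \<in> ?A \<union> ?B"
    then show "c \<in> {1..a}"
      using ascending_mono[OF assms(1), of a c] assms(2) by (cases "a \<le> c") auto
  qed
  then have "a = card (?A \<union> ?B)" by (metis card_atLeastAtMost diff_Suc_1)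
  also have "\<dots> = card ?A + card ?B" by (rule card_Un_disjoint) auto
  finally show ?thesis by (simp only: pos_def off_def)
qed

text \<open>A smaller or larger colour at this position would force too many or too few entries
  below it.\<close>

lemma ascending_block:
  assumes "ascending n t" "1 \<le> k" "k \<le> content n t j"
  shows "off n t j + k \<in> {1..n}" "t (off n t j + k) = j"
proof -
  let ?L = "{c \<in> {1..n}. t c < j}" and ?E = "{c \<in> {1..n}. t c = j}"
  have le: "card (?L \<union> ?E) = off n t j + content n t j"
    unfolding off_def content_def by (rule card_Un_disjoint) auto
  have "card (?L \<union> ?E) \<le> card {1..n}" by (rule card_mono) auto
  then show r: "off n t j + k \<in> {1..n}" using assms le by auto
  let ?a = "off n t j + k"
  have "\<not> t ?a < j"
  proof
    assume "t ?a < j"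
    then have "{1..?a} \<subseteq> ?L"
      using r ascending_mono[OF assms(1), of _ ?a] by fastforce
    then have "card {1..?a} \<le> card ?L" by (intro card_mono) auto
    then show False using assms(2) by (simp add: off_def)
  qed
  moreover have "\<not> j < t ?a"
  proof
    assume j: "j < t ?a"
    have "?L \<union> ?E \<subseteq> {1..<?a}"
    proof
      fix c assume "c \<in> ?L \<union> ?E"
      then show "c \<in> {1..<?a}" using r j ascending_mono[OF assms(1), of ?a c] by (cases "?a \<le> c") auto
    qed
    then have "card (?L \<union> ?E) \<le> card {1..<?a}" by (intro card_mono) auto
    then show False using le assms by simp
  qed
  ultimately show "t ?a = j" by simp
qed

lemma ascending_unique:
  assumes "ascending n t" "ascending n t'" "content n t = content n t'" "a \<in> {1..n}"
    and J: "\<And>c. c \<in> {1..n} \<Longrightarrow> t c \<in> J" "\<And>c. c \<in> {1..n} \<Longrightarrow> t' c \<in> J" "finite J"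
  shows "t a = t' a"
proof -
  have off: "off n t = off n t'"
    using off_content[of n t J] off_content[of n t' J] J assms(3) by (simp add: fun_eq_iff)
  let ?k = "card {c \<in> {1..a}. t c = t a}"
  have "a \<in> {c \<in> {1..a}. t c = t a}" using assms(4) by auto
  then have "0 < ?k" by (subst card_gt_0_iff) auto
  moreover have "?k \<le> content n t (t a)"
    using assms(4) unfolding content_def by (intro card_mono) auto
  ultimately have k: "1 \<le> ?k" "?k \<le> content n t (t a)" by simp_all
  have "t' (off n t' (t a) + ?k) = t a"
    using k assms(3) by (intro ascending_block(2)[OF assms(2)]) auto
  moreover have "off n t' (t a) + ?k = a"
    using pos_ascending[OF assms(1,4)] off by (simp add: pos_def)
  ultimately show ?thesis by simp
qed

lemma disorder_sw:
  assumes "a \<in> {1..<n}" "t (Suc a) < t a"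
  shows "disorder n (t \<circ> sw a) < disorder n t"
proof -
  have set: "{1..n} = insert a (insert (Suc a) ({1..n} - {a, Suc a}))" using assms by auto
  have "(\<Sum>c\<in>{1..n} - {a, Suc a}. (n - c) * (t \<circ> sw a) c) = (\<Sum>c\<in>{1..n} - {a, Suc a}. (n - c) * t c)"
    by (intro sum.cong) (auto simp: sw_other)
  moreover have "disorder n f = (n - a) * f a + ((n - Suc a) * f (Suc a) + (\<Sum>c\<in>{1..n} - {a, Suc a}. (n - c) * f c))" for f
    unfolding disorder_def by (subst set) simp
  moreover have "(n - a) * t (Suc a) + (n - Suc a) * t a < (n - a) * t a + (n - Suc a) * t (Suc a)"
  proof -
    obtain m where m: "n - a = Suc m" "n - Suc a = m" using assms by (metis Suc_diff_Suc atLeastLessThan_iff)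
    show ?thesis unfolding m using assms(2) by simp
  qed
  ultimately show ?thesis by simp
qed

lemma sw_braid: "sw a \<circ> sw (Suc a) \<circ> sw a = sw (Suc a) \<circ> sw a \<circ> sw (Suc a)"
  by (auto simp: fun_eq_iff Transposition.transpose_def)

lemma sw_far: "Suc a < b \<Longrightarrow> sw a \<circ> sw b = sw b \<circ> sw a"
  by (auto simp: fun_eq_iff Transposition.transpose_def)

definition first_descent :: "nat \<Rightarrow> (nat \<Rightarrow> nat) \<Rightarrow> nat" where
  "first_descent n t = (LEAST a. a \<in> {1..<n} \<and> t (Suc a) < t a)"

lemma first_descent:
  assumes "\<not> ascending n t"
  shows "first_descent n t \<in> {1..<n}" "t (Suc (first_descent n t)) < t (first_descent n t)"
proof -
  obtain a where "a \<in> {1..<n} \<and> t (Suc a) < t a" using assms by (auto simp: ascending_def not_le)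
  then have "first_descent n t \<in> {1..<n} \<and> t (Suc (first_descent n t)) < t (first_descent n t)"
    unfolding first_descent_def by (rule LeastI)
  then show "first_descent n t \<in> {1..<n}" "t (Suc (first_descent n t)) < t (first_descent n t)" by auto
qed

section \<open>Products of crossings that sort a colour sequence\<close>

context coloured_hecke
begin

text \<open>The product of the crossings that lead from the ascending rearrangement of \<open>t\<close> to \<open>t\<close>.\<close>

function u :: "(nat \<Rightarrow> nat) \<Rightarrow> ('x, 'f) endo" where
  "u t = (if ascending n t then e t
    else \<sigma> (first_descent n t) (t \<circ> sw (first_descent n t)) * u (t \<circ> sw (first_descent n t)))"
  by auto
termination
  by (relation "measure (disorder n)") (auto intro: disorder_sw first_descent)

declare u.simps [simp del]

text \<open>The recursion for \<open>u\<close> uses the leftmost descent; any other gives the same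
  element. Two descents are completed to a diamond, of the commuting or of the braid type, and the
  induction on the disorder covers its lower part.\<close>

lemma u_descent:
  assumes "t \<in> Seq" "c \<in> {1..<n}" "t (Suc c) < t c"
  shows "u t = \<sigma> c (t \<circ> sw c) * u (t \<circ> sw c)"
  using assms
proof (induction "disorder n t" arbitrary: t c rule: less_induct)
  case less
  have diamond: "\<sigma> a (t \<circ> sw a) * u (t \<circ> sw a) = \<sigma> b (t \<circ> sw b) * u (t \<circ> sw b)"
    if a: "a \<in> {1..<n}" "t (Suc a) < t a" and b: "b \<in> {1..<n}" "t (Suc b) < t b" and ab: "a < b" for a b
  proof -
    define ta tb where "ta = t \<circ> sw a" and "tb = t \<circ> sw b"
    have ta: "ta \<in> Seq" and tb: "tb \<in> Seq" using less.prems(1) Seq_sw a b by (auto simp: ta_def tb_def)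
    have da: "disorder n ta < disorder n t" and db: "disorder n tb < disorder n t"
      using disorder_sw a b by (auto simp: ta_def tb_def)
    have "\<sigma> a ta * u ta = \<sigma> b tb * u tb"
    proof (cases "b = Suc a")
      case False
      then have far: "Suc a < b" using ab by simp
      \<comment> \<open>Distant descents: removing both, in either order, leads to the common
        sequence \<open>w\<close>.\<close>
      define w where "w = ta \<circ> sw b"
      have w: "w = tb \<circ> sw a" using sw_far[OF far] by (simp add: comp_assoc w_def ta_def tb_def)
      have wS: "w \<in> Seq" unfolding w_def using Seq_sw[OF ta b(1)] .
      have "ta (Suc b) < ta b" "tb (Suc a) < tb a" using a b far by (auto simp: sw_other ta_def tb_def)
      then have uu: "u ta = \<sigma> b w * u w" "u tb = \<sigma> a w * u w"
        using less.hyps[OF da ta b(1)] less.hyps[OF db tb a(1)] by (simp_all only: w[symmetric] w_def[symmetric])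
      have "w a \<noteq> w (Suc a)" "w b \<noteq> w (Suc b)" using a b far by (auto simp: sw_other w_def ta_def)
      then have "\<sigma> a (w \<circ> sw b) * \<sigma> b w = \<sigma> b (w \<circ> sw a) * \<sigma> a w"
        by (rule \<sigma>_far[OF wS a(1) b(1) far])
      moreover have "w \<circ> sw b = ta" "w \<circ> sw a = tb" unfolding w_def by simp (simp add: w flip: w_def)
      ultimately have "\<sigma> a ta * \<sigma> b w = \<sigma> b tb * \<sigma> a w" by simp
      then show ?thesis unfolding uu by (simp only: mult.assoc[symmetric])
    next
      case True
      \<comment> \<open>Adjacent descents: three strictly descending colours, sorted along the two
        sides of a hexagon. All three are distinct, so the braid relation of crossings
        applies.\<close>
      define ta' tb' where "ta' = ta \<circ> sw b" and "tb' = tb \<circ> sw a"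
      define w where "w = ta' \<circ> sw a"
      note [simp] = sw_other and defs = ta_def tb_def ta'_def tb'_def w_def
      have r: "Suc a < n" "1 \<le> a" using b True a by auto
      have w: "w = tb' \<circ> sw b" using sw_braid[of a] True by (simp add: comp_assoc defs)
      have S: "ta' \<in> Seq" "tb' \<in> Seq" "w \<in> Seq" using Seq_sw ta tb a b by (simp_all add: ta'_def tb'_def w_def)
      have d1: "ta (Suc b) < ta b" "tb (Suc a) < tb a" "ta' (Suc a) < ta' a" "tb' (Suc b) < tb' b"
        using a b True by (simp_all add: defs)
      have "disorder n ta' < disorder n ta" "disorder n tb' < disorder n tb"
        unfolding ta'_def tb'_def by (rule disorder_sw b a d1)+
      then have dd: "disorder n ta' < disorder n t" "disorder n tb' < disorder n t" using da db by auto
      have u1: "u ta' = \<sigma> a w * u w" "u tb' = \<sigma> b w * u w"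
        using less.hyps[OF dd(1) S(1) a(1) d1(3)] less.hyps[OF dd(2) S(2) b(1) d1(4)] by (simp_all only: w[symmetric] w_def[symmetric])
      have u2: "u ta = \<sigma> b ta' * u ta'" "u tb = \<sigma> a tb' * u tb'"
        using less.hyps[OF da ta b(1) d1(1)] less.hyps[OF db tb a(1) d1(2)] by (simp_all only: ta'_def tb'_def)
      have "w a \<noteq> w (Suc a)" "w a \<noteq> w (Suc (Suc a))" "w (Suc a) \<noteq> w (Suc (Suc a))"
        using a b True by (simp_all add: defs)
      then have br: "\<sigma> a (w \<circ> sw a \<circ> sw (Suc a)) * (\<sigma> (Suc a) (w \<circ> sw a) * \<sigma> a w) =
          \<sigma> (Suc a) (w \<circ> sw (Suc a) \<circ> sw a) * (\<sigma> a (w \<circ> sw (Suc a)) * \<sigma> (Suc a) w)"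
        by (rule \<sigma>_braid[OF S(3) r(2,1)])
      have "w \<circ> sw a = ta'" "ta' \<circ> sw b = ta" "tb' \<circ> sw a = tb" by (simp_all only: w_def ta'_def tb'_def comp_sw_sw)
      moreover have "w \<circ> sw b = tb'" by (simp only: w comp_sw_sw)
      ultimately have "\<sigma> a ta * (\<sigma> b ta' * \<sigma> a w) = \<sigma> b tb * (\<sigma> a tb' * \<sigma> b w)"
        using br True by simp
      then have "\<sigma> a ta * (\<sigma> b ta' * \<sigma> a w) * u w = \<sigma> b tb * (\<sigma> a tb' * \<sigma> b w) * u w" by simp
      then show ?thesis unfolding u2 u1 by (simp only: mult.assoc)
    qed
    then show ?thesis by (simp only: ta_def tb_def)
  qed
  have nasc: "\<not> ascending n t" using less.prems unfolding ascending_def by (meson not_le)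
  define a where "a = first_descent n t"
  have a: "a \<in> {1..<n}" "t (Suc a) < t a" using first_descent[OF nasc] by (auto simp: a_def)
  have "u t = \<sigma> a (t \<circ> sw a) * u (t \<circ> sw a)" using nasc by (subst u.simps) (simp add: a_def)
  also have "\<sigma> a (t \<circ> sw a) * u (t \<circ> sw a) = \<sigma> c (t \<circ> sw c) * u (t \<circ> sw c)"
  proof (cases a c rule: linorder_cases)
    case less
    then show ?thesis by (rule diamond[OF a \<open>c \<in> {1..<n}\<close> \<open>t (Suc c) < t c\<close>])
  next
    case greater
    then show ?thesis by (rule diamond[OF \<open>c \<in> {1..<n}\<close> \<open>t (Suc c) < t c\<close> a, symmetric])
  qed simp
  finally show ?case .
qed

lemma Seq_induct [consumes 1, case_names ascending descent]:
  assumes "t \<in> Seq"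
    and asc: "\<And>t. t \<in> Seq \<Longrightarrow> ascending n t \<Longrightarrow> Q t"
    and desc: "\<And>t a. t \<in> Seq \<Longrightarrow> a \<in> {1..<n} \<Longrightarrow> t (Suc a) < t a \<Longrightarrow>
      (\<And>s. s \<in> Seq \<Longrightarrow> disorder n s < disorder n t \<Longrightarrow> Q s) \<Longrightarrow> Q t"
  shows "Q t"
  using assms(1)
proof (induction "disorder n t" arbitrary: t rule: less_induct)
  case less
  show ?case
  proof (cases "ascending n t")
    case False
    show ?thesis
      using first_descent[OF False] less by (intro desc[of t "first_descent n t"]) auto
  qed (use asc less in auto)
qed

lemma content_sw: "a \<in> {1..<n} \<Longrightarrow> content n (t \<circ> sw a) = content n t"
  by (rule content_transpose) auto

lemma u_X:
  assumes "t \<in> Seq" "c \<in> {1..n}"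
  shows "X c * u t = u t * X (pos n t c)"
  using assms
proof (induction t arbitrary: c rule: Seq_induct)
  case (ascending t)
  then show ?case using X_e by (simp add: u.simps pos_ascending)
next
  case (descent t a)
  define s where "s = t \<circ> sw a"
  have s: "s \<in> Seq" "disorder n s < disorder n t" "s a \<noteq> s (Suc a)"
    using descent Seq_sw disorder_sw by (auto simp: s_def)
  have c: "sw a c \<in> {1..n}" using sw_range[of a n c] descent by blast
  have "X c * (\<sigma> a s * u s) = \<sigma> a s * u s * X (pos n s (sw a c))"
    using X_\<sigma>[OF s(1) descent(2) s(3) descent.prems] descent.IH[OF s(1,2) c] by (rule intertwine_mult)
  moreover have "pos n s (sw a c) = pos n t c"
    using pos_sw[of a n t "sw a c"] descent c by (simp add: s_def)
  ultimately show ?case using u_descent[OF descent(1-3), folded s_def] by simp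
qed

lemma u_left: "t \<in> Seq \<Longrightarrow> e t * u t = u t"
proof (induction t rule: Seq_induct)
  case (ascending t)
  then show ?case by (simp add: u.simps ee)
next
  case (descent t a)
  define s where "s = t \<circ> sw a"
  have st: "s \<circ> sw a = t" "s a = t (Suc a)" "s (Suc a) = t a" by (simp_all add: s_def)
  have s: "s \<in> Seq" "s a \<noteq> s (Suc a)" using descent Seq_sw by (auto simp: s_def)
  have "e t * \<sigma> a s = \<sigma> a s" using \<sigma>_left[OF s(1) descent(2) s(2)] by (simp only: st)
  then show ?case using u_descent[OF descent(1-3), folded s_def] by (simp flip: mult.assoc)
qed

lemma u_K: "t \<in> Seq \<Longrightarrow> u t \<in> K"
proof (induction t rule: Seq_induct)
  case (ascending t)
  then show ?case using e_K by (simp add: u.simps)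
next
  case (descent t a)
  define s where "s = t \<circ> sw a"
  have s: "s \<in> Seq" "disorder n s < disorder n t" "s a \<noteq> s (Suc a)"
    using descent Seq_sw disorder_sw by (auto simp: s_def)
  then show ?case
    using u_descent[OF descent(1-3), folded s_def] \<sigma>_K[OF s(1) descent(2) s(3)] descent.IH[OF s(1,2)]
    by (simp add: subalg_closed[OF subalg])
qed

text \<open>A crossing next to a pair of equal colours cannot be treated alone: both strands of the
  pair cross the third one, and the double crossing shifts the index of \<open>T\<close>.\<close>

lemma u_T:
  assumes "t \<in> Seq" "a \<in> {1..<n}" "t a = t (Suc a)"
  shows "T a * u t = u t * T (pos n t a)"
  using assms
proof (induction t arbitrary: a rule: Seq_induct)
  case (ascending t)
  then show ?case using T_e_same[of t a] by (simp add: u.simps pos_ascending)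
next
  case (descent t b)
  define s where "s = t \<circ> sw b"
  note [simp] = sw_other
  have s: "s \<in> Seq" "disorder n s < disorder n t" "s b \<noteq> s (Suc b)"
    using descent Seq_sw disorder_sw by (auto simp: s_def)
  have ut: "u t = \<sigma> b s * u s" using u_descent[OF descent(1-3), folded s_def] .
  have ra: "a \<in> {1..n}" "Suc a \<in> {1..n}" using descent.prems by auto
  consider "Suc a < b \<or> Suc b < a" | "b = Suc a" | "a = Suc b" | "a = b" by linarith
  then show ?case
  proof cases
    case 1
    have sa: "s a = s (Suc a)" using 1 descent.prems by (auto simp: s_def)
    have "T a * \<sigma> b s = \<sigma> b s * T a"
      using 1 by (intro T_\<sigma>_far[OF s(1) descent(2) descent.prems(1) _ s(3) sa]) auto
    moreover have "T a * u s = u s * T (pos n s a)"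
      by (rule descent.IH[OF s(1,2) descent.prems(1) sa])
    moreover have "pos n s a = pos n t a"
      using pos_sw[of b n t a] descent ra 1 by (auto simp: s_def)
    ultimately show ?thesis unfolding ut by (simp only: intertwine_mult)
  next
    case 2
    \<comment> \<open>The colours at \<open>a\<close> and \<open>a + 1\<close> are equal and larger
      than the one at \<open>a + 2\<close>; removing the descent at \<open>b\<close> creates a
      second one at \<open>a\<close>.\<close>
    define r where "r = s \<circ> sw a"
    have d: "s (Suc a) < s a" using 2 descent by (auto simp: s_def)
    have r: "r \<in> Seq" "disorder n r < disorder n t" "r \<circ> sw a = s"
      using Seq_sw[OF s(1) descent.prems(1)] disorder_sw[OF descent.prems(1) d] s by (auto simp: r_def)
    have us: "u s = \<sigma> a r * u r" unfolding r_def using u_descent[OF s(1) descent.prems(1) d] .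
    have rd: "r (Suc a) = r (Suc (Suc a))" "r a \<noteq> r (Suc a)" and a: "1 \<le> a" "Suc a < n"
      using 2 descent by (auto simp: r_def s_def)
    have "T a * (\<sigma> b s * \<sigma> a r) = \<sigma> b s * \<sigma> a r * T b"
      using T_\<sigma>_\<sigma>'[OF r(1) a rd] 2 r(3) by simp
    moreover have "T b * u r = u r * T (pos n r b)"
      using rd 2 descent by (intro descent.IH[OF r(1,2)]) auto
    moreover have "pos n r b = pos n t a"
      using pos_sw[of a n s "Suc a"] pos_sw[of b n t a] 2 d descent ra by (auto simp: r_def s_def)
    ultimately have "T a * (\<sigma> b s * \<sigma> a r * u r) = \<sigma> b s * \<sigma> a r * u r * T (pos n t a)"
      by (simp only: intertwine_mult)
    then show ?thesis unfolding ut us by (simp only: mult.assoc)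
  next
    case 3
    define r where "r = s \<circ> sw a"
    have d: "s (Suc a) < s a" using 3 descent by (auto simp: s_def)
    have r: "r \<in> Seq" "disorder n r < disorder n t" "r \<circ> sw a = s"
      using Seq_sw[OF s(1) descent.prems(1)] disorder_sw[OF descent.prems(1) d] s by (auto simp: r_def)
    have us: "u s = \<sigma> a r * u r" unfolding r_def using u_descent[OF s(1) descent.prems(1) d] .
    have rd: "r b = r (Suc b)" "r (Suc b) \<noteq> r (Suc (Suc b))" and a: "1 \<le> b" "Suc b < n"
      using 3 descent by (auto simp: r_def s_def)
    have "T a * (\<sigma> b s * \<sigma> a r) = \<sigma> b s * \<sigma> a r * T b"
      using T_\<sigma>_\<sigma>[OF r(1) a rd] 3 r(3) by simp
    moreover have "T b * u r = u r * T (pos n r b)"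
      using rd 3 descent by (intro descent.IH[OF r(1,2)]) auto
    moreover have "pos n r b = pos n t a"
    proof -
      have "pos n r b = pos n s b" using pos_sw[of a n s b] 3 d descent ra by (auto simp: r_def)
      also have "\<dots> = pos n t (Suc b)" using pos_sw[of b n t b] descent by (auto simp: s_def)
      finally show ?thesis using 3 by simp
    qed
    ultimately have "T a * (\<sigma> b s * \<sigma> a r * u r) = \<sigma> b s * \<sigma> a r * u r * T (pos n t a)"
      by (simp only: intertwine_mult)
    then show ?thesis unfolding ut us by (simp only: mult.assoc)
  next
    case 4
    then show ?thesis using descent by simp
  qed
qed

text \<open>For an ascent this is \<open>u_descent\<close>; for a descent the crossing cancels
  against the leading factor of \<open>u t\<close>.\<close>

lemma \<sigma>_u:
  assumes t: "t \<in> Seq" and a: "a \<in> {1..<n}" and d: "t a \<noteq> t (Suc a)"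
  shows "\<sigma> a t * u t = u (t \<circ> sw a)"
proof (cases "t a < t (Suc a)")
  case True
  then show ?thesis using u_descent[OF Seq_sw[OF t a] a] by simp
next
  case False
  define s where "s = t \<circ> sw a"
  have st: "s \<circ> sw a = t" "s a = t (Suc a)" "s (Suc a) = t a" by (simp_all add: s_def)
  have s: "s \<in> Seq" "s a \<noteq> s (Suc a)" using Seq_sw[OF t a] d by (auto simp: s_def)
  have "u t = \<sigma> a s * u s" unfolding s_def using False d by (intro u_descent[OF t a]) auto
  moreover have "\<sigma> a t * \<sigma> a s = e s" using \<sigma>\<sigma>[OF s(1) a s(2)] by (simp only: st)
  ultimately show ?thesis using u_left[OF s(1)] unfolding s_def[symmetric] by (simp flip: mult.assoc)
qed

lemma ascending_Seq_unique:
  assumes "t \<in> Seq" "t' \<in> Seq" "ascending n t" "ascending n t'" "content n t = content n t'"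
  shows "t = t'"
proof (rule PiE_ext[OF assms(1,2)[unfolded Seq_def]])
  fix a assume "a \<in> {1..n}"
  then show "t a = t' a"
    using ascending_unique[OF assms(3,4,5) _ Seq_J[OF assms(1)] Seq_J[OF assms(2)] finite_J] by blast
qed

text \<open>The inverse is the product of the reversed crossings; building it along the same
  recursion shows that it lies in \<open>K\<close>.\<close>

lemma u_inverse:
  assumes "t \<in> Seq" "t0 \<in> Seq" "ascending n t0" "content n t = content n t0"
  shows "u t * e t0 = u t \<and> (\<exists>z\<in>K. e t0 * z = z \<and> z * e t = z \<and> z * u t = e t0 \<and> u t * z = e t)"
  using assms
proof (induction t rule: Seq_induct)
  case (ascending t)
  then have "t = t0" using ascending_Seq_unique by metis
  then show ?case using ascending by (auto simp: u.simps ee intro!: bexI[of _ "e t0"] e_K)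
next
  case (descent t a)
  define s where "s = t \<circ> sw a"
  have st: "s \<circ> sw a = t" "s a = t (Suc a)" "s (Suc a) = t a" by (simp_all add: s_def)
  have s: "s \<in> Seq" "disorder n s < disorder n t" "s a \<noteq> s (Suc a)"
    using descent Seq_sw disorder_sw by (auto simp: s_def)
  have d: "t a \<noteq> t (Suc a)" using descent by auto
  have IH: "u s * e t0 = u s \<and> (\<exists>z\<in>K. e t0 * z = z \<and> z * e s = z \<and> z * u s = e t0 \<and> u s * z = e s)"
    using descent.IH[OF s(1,2)] descent.prems content_sw[OF descent(2), of t] unfolding s_def[symmetric] by simp
  then obtain z where z: "z \<in> K" "e t0 * z = z" "z * e s = z" "z * u s = e t0" "u s * z = e s" by blast
  have ut: "u t = \<sigma> a s * u s" using u_descent[OF descent(1-3), folded s_def] .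
  have ss: "\<sigma> a t * \<sigma> a s = e s" "\<sigma> a s * \<sigma> a t = e t" "\<sigma> a s * e s = \<sigma> a s" "\<sigma> a t * e t = \<sigma> a t"
    using \<sigma>\<sigma>[OF s(1) descent(2) s(3)] \<sigma>\<sigma>[OF descent(1,2) d] \<sigma>_right[OF s(1) descent(2) s(3)] \<sigma>_right[OF descent(1,2) d]
    by (simp_all only: st s_def[symmetric])
  have "u t * e t0 = u t" unfolding ut using IH by (simp add: mult.assoc)
  moreover have "e t0 * (z * \<sigma> a t) = z * \<sigma> a t" using z(2) by (simp flip: mult.assoc)
  moreover have "z * \<sigma> a t * e t = z * \<sigma> a t" using ss(4) by (simp add: mult.assoc)
  moreover have "z * \<sigma> a t * u t = e t0"
  proof -
    have "z * \<sigma> a t * u t = z * (\<sigma> a t * \<sigma> a s) * u s" unfolding ut by (simp only: mult.assoc)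
    then show ?thesis by (simp only: ss z)
  qed
  moreover have "u t * (z * \<sigma> a t) = e t"
  proof -
    have "u t * (z * \<sigma> a t) = \<sigma> a s * (u s * z) * \<sigma> a t" unfolding ut by (simp only: mult.assoc)
    then show ?thesis by (simp only: ss z)
  qed
  moreover have "z * \<sigma> a t \<in> K" using z(1) \<sigma>_K[OF descent(1,2) d] by (rule subalg_closed[OF subalg])
  ultimately show ?case by blast
qed

lemma b_u:
  assumes t: "t \<in> Seq" and t0: "t0 \<in> Seq" "ascending n t0" "content n t = content n t0"
    and c: "c \<in> {1..n}" "d \<in> {1..n}" "t c \<noteq> t d"
    and c0: "pos n t c \<in> {1..n}" "pos n t d \<in> {1..n}" "t0 (pos n t c) \<noteq> t0 (pos n t d)"
  shows "b c d t * u t = u t * b (pos n t c) (pos n t d) t0"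
proof -
  let ?c = "pos n t c" and ?d = "pos n t d"
  obtain w where w: "is_inverse (e t) ((X d - X c) * e t) w" using inverses(1)[OF t c] by blast
  obtain v where v: "is_inverse (e t0) ((X ?d - X ?c) * e t0) v" using inverses(1)[OF t0(1) c0] by blast
  have ue: "u t * e t0 = u t" "e t * u t = u t" using u_inverse[OF t t0] u_left[OF t] by auto
  have Xe0: "e t0 * (X ?d - X ?c) = (X ?d - X ?c) * e t0"
    using X_e[OF c0(1)] X_e[OF c0(2)] by (simp add: left_diff_distrib right_diff_distrib)
  have zv: "u t * v = w * u t"
  proof (rule is_inverse_intertwine[OF v w _ ue])
    have "u t * ((X ?d - X ?c) * e t0) = u t * e t0 * (X ?d - X ?c)" by (simp only: Xe0[symmetric] mult.assoc)
    also have "\<dots> = (X d - X c) * u t"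
      unfolding ue using u_X[OF t c(1)] u_X[OF t c(2)] by (simp add: left_diff_distrib right_diff_distrib)
    also have "\<dots> = (X d - X c) * e t * u t" using ue by (simp add: mult.assoc)
    finally show "u t * ((X ?d - X ?c) * e t0) = (X d - X c) * e t * u t" .
  qed
  have "X d * w * u t = X d * u t * v" by (simp only: mult.assoc zv[symmetric])
  also have "\<dots> = u t * (X ?d * v)" by (simp only: u_X[OF t c(2)] mult.assoc)
  finally show ?thesis
    unfolding b_def scatter_def inverse_in_eq[OF w] inverse_in_eq[OF v] by simp
qed

end

section \<open>The corner of an ascending sequence: its generators, relations and matrix
  coefficients\<close>

section \<open>Blocks\<close>

lemma peval_scale_roots:
  assumes "e * e = e" "in_corner e x"
  shows "peval e (root_poly (image_mset (\<lambda>\<omega>. c * \<omega>) M)) (c *\<^sub>s x) = c ^ size M *\<^sub>s peval e (root_poly M) x"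
proof (induction M)
  case (add \<omega> M)
  have cx: "in_corner e (c *\<^sub>s x)" using assms(2) by (simp add: in_corner_def)
  have "peval e (root_poly (image_mset (\<lambda>\<omega>. c * \<omega>) (add_mset \<omega> M))) (c *\<^sub>s x) =
      (c *\<^sub>s x - (c * \<omega>) *\<^sub>s e) * (c ^ size M *\<^sub>s peval e (root_poly M) x)"
    by (simp only: image_mset_add_mset root_poly_simps peval_mult[OF assms(1) cx] peval_linear[OF cx] add)
  also have "\<dots> = c ^ size (add_mset \<omega> M) *\<^sub>s ((x - \<omega> *\<^sub>s e) * peval e (root_poly M) x)"
    by (simp add: left_diff_distrib endo.scale_right_diff_distrib mult_ac)
  finally show ?case
    by (simp only: root_poly_simps peval_mult[OF assms] peval_linear[OF assms(2)])
qed simp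

lemma corner_mult:
  fixes e :: "'r::semigroup_mult"
  assumes "e * e = e" "y * e = e * y"
  shows "(x * e) * (y * e) = x * y * e"
proof -
  have "(x * e) * (y * e) = x * (e * y) * e" by (simp only: mult.assoc)
  also have "\<dots> = x * y * (e * e)" by (simp only: assms(2)[symmetric] mult.assoc)
  finally show ?thesis by (simp only: assms(1))
qed

lemma off_eq:
  assumes "content n t = content n t0"
  shows "off n t = off n t0"
  using off_content[of n t "t ` {1..n} \<union> t0 ` {1..n}"] off_content[of n t0 "t ` {1..n} \<union> t0 ` {1..n}"] assms
  by (simp add: fun_eq_iff)

lemma pos_in_block:
  assumes asc: "ascending n t0" and ct: "content n t = content n t0" and c: "c \<in> {1..n}"
  shows "pos n t c \<in> {1..n}" "t0 (pos n t c) = t c"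
proof -
  let ?k = "card {x \<in> {1..c}. t x = t c}"
  have "c \<in> {x \<in> {1..c}. t x = t c}" using c by auto
  then have "0 < ?k" by (subst card_gt_0_iff) auto
  moreover have "?k \<le> content n t (t c)"
    using c unfolding content_def by (intro card_mono) auto
  ultimately have "1 \<le> ?k" "?k \<le> content n t0 (t c)" using ct by simp_all
  from ascending_block[OF asc this] show "pos n t c \<in> {1..n}" "t0 (pos n t c) = t c"
    by (simp_all add: pos_def off_eq[OF ct])
qed

lemma pos_inject:
  assumes asc: "ascending n t0" and ct: "content n t = content n t0"
    and c: "c \<in> {1..n}" "d \<in> {1..n}" "c \<noteq> d"
  shows "pos n t c \<noteq> pos n t d"
proof (cases "t c = t d")
  case True
  have "pos n t c < pos n t d" if "c < d" "d \<in> {1..n}" "t c = t d" for c d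
  proof -
    have "d \<in> {x \<in> {1..d}. t x = t d}" "d \<notin> {x \<in> {1..c}. t x = t c}" using that by auto
    then have "{x \<in> {1..c}. t x = t c} \<subset> {x \<in> {1..d}. t x = t d}" using that by fastforce
    then show ?thesis using that(3) by (auto simp: pos_def intro!: psubset_card_mono)
  qed
  then show ?thesis using c True by (metis linorder_neqE_nat less_irrefl)
next
  case False
  then show ?thesis using pos_in_block(2)[OF asc ct] c by metis
qed

text \<open>One block per content, represented by its unique ascending sequence \<open>t0\<close>; a
  matrix entry is moved into the corner of \<open>e t0\<close> by the \<open>u t\<close> and their
  inverses \<open>w t\<close>.\<close>

locale block = coloured_hecke p q P n S T J M K
  for p :: "('x, 'f::field) endo" and q :: 'f and P n S T J M K +
  fixes t0 :: "nat \<Rightarrow> nat"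
  assumes t0: "t0 \<in> Seq" and asc: "ascending n t0"
begin

abbreviation "e0 \<equiv> e t0"

definition Cl where "Cl = {t \<in> Seq. content n t = content n t0}"

definition w where "w t = (SOME z. z \<in> K \<and> e0 * z = z \<and> z * e t = z \<and> z * u t = e0 \<and> u t * z = e t)"

lemma w:
  assumes "t \<in> Cl"
  shows "w t \<in> K" "e0 * w t = w t" "w t * e t = w t" "w t * u t = e0" "u t * w t = e t"
proof -
  have "\<exists>z. z \<in> K \<and> e0 * z = z \<and> z * e t = z \<and> z * u t = e0 \<and> u t * z = e t"
    using u_inverse[of t t0] assms t0 asc unfolding Cl_def by blast
  from someI_ex[OF this]
  show "w t \<in> K" "e0 * w t = w t" "w t * e t = w t" "w t * u t = e0" "u t * w t = e t"
    unfolding w_def by blast+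
qed

lemma Cl_Seq: "t \<in> Cl \<Longrightarrow> t \<in> Seq"
  by (simp add: Cl_def)

lemma u_e0: "t \<in> Cl \<Longrightarrow> u t * e0 = u t"
  using u_inverse[of t t0] t0 asc unfolding Cl_def by blast

lemma w_e: "t \<in> Cl \<Longrightarrow> s \<in> Seq \<Longrightarrow> t \<noteq> s \<Longrightarrow> w t * e s = 0"
proof -
  assume t: "t \<in> Cl" "s \<in> Seq" "t \<noteq> s"
  have "w t * e s = w t * (e t * e s)" by (simp only: mult.assoc[symmetric] w(3)[OF t(1)])
  then show ?thesis using e_orth[of t s] t Cl_Seq by simp
qed

lemma w_u: "t \<in> Cl \<Longrightarrow> s \<in> Cl \<Longrightarrow> w t * u s = (if t = s then e0 else 0)"
proof -
  assume t: "t \<in> Cl" "s \<in> Cl"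
  have "w t * u s = w t * e s * u s" by (simp only: mult.assoc u_left[OF Cl_Seq[OF t(2)]])
  then show ?thesis using w(4)[OF t(1)] w_e[OF t(1) Cl_Seq[OF t(2)]] by auto
qed

lemma e0e0: "e0 * e0 = e0"
  using ee[OF t0] .

lemma pos_range:
  assumes "t \<in> Cl" "c \<in> {1..n}"
  shows "pos n t c \<in> {1..n}" "t0 (pos n t c) = t c"
  using pos_in_block[OF asc _ assms(2), of t] assms(1) by (auto simp: Cl_def)

abbreviation "size_block j \<equiv> content n t0 j"
abbreviation "start j \<equiv> off n t0 j"

lemma in_block:
  assumes "1 \<le> k" "k \<le> size_block j"
  shows "start j + k \<in> {1..n}" "t0 (start j + k) = j"
  using ascending_block[OF asc assms] by auto

lemma in_block_T:
  assumes "a \<in> {1..<size_block j}"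
  shows "start j + a \<in> {1..<n}" "t0 (start j + a) = j" "t0 (Suc (start j + a)) = j"
    "T (start j + a) * e0 = e0 * T (start j + a)"
proof -
  show "start j + a \<in> {1..<n}" "t0 (start j + a) = j" "t0 (Suc (start j + a)) = j"
    using in_block[of a j] in_block[of "Suc a" j] assms by auto
  then show "T (start j + a) * e0 = e0 * T (start j + a)"
    by (intro T_e_same t0) auto
qed

lemma every_position:
  assumes "c \<in> {1..n}"
  obtains k where "1 \<le> k" "k \<le> size_block (t0 c)" "c = start (t0 c) + k"
proof -
  let ?k = "card {x \<in> {1..c}. t0 x = t0 c}"
  have "c \<in> {x \<in> {1..c}. t0 x = t0 c}" using assms by auto
  then have "0 < ?k" by (subst card_gt_0_iff) auto
  moreover have "?k \<le> size_block (t0 c)"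
    using assms unfolding content_def by (intro card_mono) auto
  moreover have "c = start (t0 c) + ?k" using pos_ascending[OF asc assms] by (simp add: pos_def)
  ultimately show ?thesis using that[of ?k] by simp
qed

text \<open>The first Jucys-Murphy element of the colour block. Division by \<open>v\<close>
  normalises its eigenvalues to those of the small Hecke algebra.\<close>

definition S_block where "S_block v j = (1 / v) *\<^sub>s (X (start j + 1) * e0)"
definition T_block where "T_block j a = T (start j + a) * e0"

text \<open>The growth bound only yields \<open>N j\<close>, whereas the small algebra requires
  exactly \<open>M j\<close>. Moving the block's first strand to the front identifies its
  \<open>X\<close> with \<open>S\<close>; there the relation \<open>P\<close> holds, and the factors
  of \<open>P\<close> of the other colours are invertible.\<close>

lemma block_kill:
  assumes j: "j \<in> J" and pos: "0 < size_block j"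
  shows "peval e0 (root_poly (M j)) (X (start j + 1) * e0) = 0"
proof -
  let ?k = "start j + 1"
  have k: "?k \<in> {1..n}" "t0 ?k = j" using in_block[of 1 j] pos by auto
  \<comment> \<open>Any rearrangement that starts with colour \<open>j\<close> would do. Its first
    strand has no predecessor of that colour, so stable sorting sends it to the start of the
    block.\<close>
  define t where "t = t0 \<circ> Transposition.transpose 1 ?k"
  have r: "1 \<in> {1..n}" using n_pos by auto
  have tS: "t \<in> Seq"
  proof -
    have "Transposition.transpose 1 ?k c \<in> {1..n} \<longleftrightarrow> c \<in> {1..n}" for c
      using k(1) r by (auto simp: Transposition.transpose_def)
    moreover have "t0 \<in> {1..n} \<rightarrow>\<^sub>E J" using t0 by (simp add: Seq_def)
    ultimately show ?thesis unfolding Seq_def t_def by (auto simp: PiE_iff extensional_def)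
  qed
  have t: "t \<in> Cl" using tS content_transpose[OF r k(1), of t0] by (simp add: Cl_def t_def)
  have t1: "t 1 = j" using k by (simp add: t_def)
  have "off n t = off n t0" unfolding t_def by (rule off_transpose[OF r k(1)])
  moreover have "{x \<in> {1..1::nat}. t x = t 1} = {1}" by auto
  ultimately have "pos n t 1 = ?k" using t1 by (simp add: pos_def)
  then have Xu: "X 1 * u t = u t * X ?k" using u_X[OF tS r] by simp
  let ?R = "root_poly (\<Sum>k\<in>J - {j}. M k)"
  have sub: "\<omega> \<in># (grow q ^^ m) (M k)" if "\<omega> \<in># M k" for \<omega> k m
    using that by (induction m) (auto simp: grow_def)
  \<comment> \<open>On \<open>e t\<close> the eigenvalues of \<open>X 1\<close> are of colour
    \<open>j\<close>, hence in \<open>N j\<close>; comaximality with \<open>N j\<close> inverts the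
    product of the other factors of \<open>P\<close>.\<close>
  have "set_mset (\<Sum>k\<in>J - {j}. M k) \<inter> set_mset (N j) = {}"
    using separated sub j finite_J unfolding separated_def N_def by (fastforce simp: set_mset_sum)
  then obtain a b where ab: "a * ?R + b * root_poly (N j) = 1"
    by (rule root_poly_comaximal)
  let ?x = "X 1 * e t"
  have xc: "in_corner (e t) ?x" using ee[OF tS] X_e[OF r] by (intro in_corner_mult)
  have "peval (e t) (a * ?R + b * root_poly (N j)) ?x = e t" unfolding ab by simp
  then have inv: "peval (e t) a ?x * peval (e t) ?R ?x = e t"
    using e_kill[OF tS r] t1 by (simp add: peval_add peval_mult[OF ee[OF tS] xc] del: One_nat_def)
  have "(\<Sum>k\<in>J. M k) = (\<Sum>k\<in>J - {j}. M k) + M j"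
    using finite_J j by (simp add: sum.remove[of J j] add.commute)
  then have "P = ?R * root_poly (M j)" using P_eq by simp
  moreover have "peval p P (X 1) = 0" using S_kill[OF n_pos] by (simp add: jm.simps)
  moreover have "peval (e t) P ?x = e t * peval p P (X 1)"
    using ee[OF tS] e_corner X_e[OF r] by (intro peval_corner_change(2)[symmetric]) auto
  ultimately have "peval (e t) ?R ?x * peval (e t) (root_poly (M j)) ?x = 0"
    by (simp add: peval_mult[OF ee[OF tS] xc] del: One_nat_def)
  then have "peval (e t) a ?x * peval (e t) ?R ?x * peval (e t) (root_poly (M j)) ?x = 0"
    by (simp add: mult.assoc)
  then have kill: "peval (e t) (root_poly (M j)) ?x = 0"
    unfolding inv peval_corner(1)[OF ee[OF tS] xc] .
  have "peval (e t) (root_poly (M j)) ?x * u t = u t * peval e0 (root_poly (M j)) (X ?k * e0)"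
  proof (rule peval_intertwine[symmetric])
    show "u t * e0 = e t * u t" using u_e0[OF t] u_left[OF tS] by simp
    have "u t * (X ?k * e0) = X 1 * (u t * e0)" by (simp only: Xu[symmetric] mult.assoc[symmetric])
    then show "u t * (X ?k * e0) = X 1 * e t * u t" by (simp only: u_e0[OF t] u_left[OF tS] mult.assoc)
  qed
  then have "u t * peval e0 (root_poly (M j)) (X ?k * e0) = 0" using kill by simp
  then have "w t * u t * peval e0 (root_poly (M j)) (X ?k * e0) = 0" by (simp add: mult.assoc)
  moreover have "in_corner e0 (X ?k * e0)" using e0e0 X_e[OF k(1)] by (intro in_corner_mult)
  ultimately show ?thesis by (simp add: w(4)[OF t] peval_corner(1)[OF e0e0])
qed

lemma e0_commute_mult: "y * e0 = e0 * y \<Longrightarrow> (x * e0) * (y * e0) = x * y * e0"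
  using corner_mult[OF e0e0] by blast

lemma e0_commute: "x * y = y * x \<Longrightarrow> x * e0 = e0 * x \<Longrightarrow> y * e0 = e0 * y \<Longrightarrow> (x * e0) * (y * e0) = (y * e0) * (x * e0)"
  using e0_commute_mult[of y x] e0_commute_mult[of x y] by metis

lemma e0_commute_mult3:
  assumes "y * e0 = e0 * y" "z * e0 = e0 * z"
  shows "(x * e0) * (y * e0) * (z * e0) = x * y * z * e0"
  unfolding corner_mult[OF e0e0 assms(1)] by (rule corner_mult[OF e0e0 assms(2)])

lemma block_tuple:
  assumes j: "j \<in> J" and v: "v \<noteq> 0" and M: "M j = image_mset (\<lambda>\<omega>. v * \<omega>) M'"
  shows "hecke_tuple e0 q (root_poly M') (size_block j) (S_block v j) (T_block j)"
proof -
  let ?m = "size_block j" and ?o = "start j"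
  have X1: "?o + 1 \<in> {1..n}" "X (?o + 1) * e0 = e0 * X (?o + 1)" if "0 < ?m"
    using in_block[of 1 j] X_e that by auto
  have corner_S: "in_corner e0 (X (?o + 1) * e0)" if "0 < ?m" using in_corner_mult[OF e0e0 X1(2)[OF that]] .
  have S: "in_corner e0 (S_block v j) \<and> peval e0 (root_poly M') (S_block v j) = 0" if "0 < ?m"
  proof -
    have c: "in_corner e0 (S_block v j)" using corner_S[OF that] by (simp add: S_block_def in_corner_def)
    have vS: "v *\<^sub>s S_block v j = X (?o + 1) * e0" using v by (simp add: S_block_def)
    have "peval e0 (root_poly (image_mset (\<lambda>\<omega>. v * \<omega>) M')) (v *\<^sub>s S_block v j) =
        v ^ size M' *\<^sub>s peval e0 (root_poly M') (S_block v j)"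
      by (rule peval_scale_roots[OF e0e0 c])
    then have "v ^ size M' *\<^sub>s peval e0 (root_poly M') (S_block v j) = 0"
      unfolding vS M[symmetric] block_kill[OF j that] by simp
    then show ?thesis using c v by simp
  qed
  have T: "in_corner e0 (T_block j a) \<and> (T_block j a + e0) * (T_block j a - q *\<^sub>s e0) = 0"
    if a: "a \<in> {1..<?m}" for a
  proof -
    note b = in_block_T[OF a]
    have c: "in_corner e0 (T_block j a)" unfolding T_block_def by (rule in_corner_mult[OF e0e0 b(4)])
    have "T_block j a * T_block j a = T (?o + a) * T (?o + a) * e0"
      unfolding T_block_def by (rule e0_commute_mult[OF b(4)])
    also have "\<dots> = (q - 1) *\<^sub>s T_block j a + q *\<^sub>s e0"
      unfolding TT[OF b(1)] T_block_def using e_corner by (simp add: distrib_right)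
    finally show ?thesis using c e0e0 by (simp add: in_corner_def algebra_simps scl_simps)
  qed
  have STST: "S_block v j * T_block j 1 * S_block v j * T_block j 1 = T_block j 1 * S_block v j * T_block j 1 * S_block v j"
    if m: "1 < ?m"
  proof -
    have b: "?o + 1 \<in> {1..<n}" "T (?o + 1) * e0 = e0 * T (?o + 1)" using in_block_T[of 1 j] m by auto
    have x: "X (?o + 1) * e0 = e0 * X (?o + 1)" using X1(2) m by simp
    have "(X (?o + 1) * e0) * (T (?o + 1) * e0) * (X (?o + 1) * e0) * (T (?o + 1) * e0) =
        X (?o + 1) * T (?o + 1) * X (?o + 1) * T (?o + 1) * e0"
      unfolding e0_commute_mult3[OF b(2) x] by (rule e0_commute_mult[OF b(2)])
    moreover have "(T (?o + 1) * e0) * (X (?o + 1) * e0) * (T (?o + 1) * e0) * (X (?o + 1) * e0) =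
        T (?o + 1) * X (?o + 1) * T (?o + 1) * X (?o + 1) * e0"
      unfolding e0_commute_mult3[OF x b(2)] by (rule e0_commute_mult[OF x])
    moreover have "X (?o + 1) * T (?o + 1) * X (?o + 1) * T (?o + 1) = T (?o + 1) * X (?o + 1) * T (?o + 1) * X (?o + 1)"
      using b by (intro X_T_X_T) auto
    ultimately show ?thesis unfolding S_block_def T_block_def by simp
  qed
  have ST: "S_block v j * T_block j a = T_block j a * S_block v j" if a: "a \<in> {1..<?m}" "1 < a" for a
  proof -
    note b = in_block_T[OF a(1)]
    have m: "0 < ?m" using a by auto
    have "T (?o + a) * X (?o + 1) = X (?o + 1) * T (?o + a)"
      using a by (intro T_X'[OF b(1) X1(1)[OF m]]) auto
    from e0_commute[OF this[symmetric] X1(2)[OF m] b(4)] show ?thesis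
      unfolding S_block_def T_block_def by simp
  qed
  have TT: "T_block j a * T_block j c = T_block j c * T_block j a"
    if a: "a \<in> {1..<?m}" "c \<in> {1..<?m}" "a + 1 < c" for a c
    unfolding T_block_def using a in_block_T[OF a(1)] in_block_T[OF a(2)]
    by (intro e0_commute T_T) auto
  have TTT: "T_block j a * T_block j (a + 1) * T_block j a = T_block j (a + 1) * T_block j a * T_block j (a + 1)"
    if a: "1 \<le> a" "a + 1 < ?m" for a
  proof -
    have r: "a \<in> {1..<?m}" "a + 1 \<in> {1..<?m}" using a by auto
    note b = in_block_T[OF r(1)] in_block_T[OF r(2)]
    have "T (?o + a) * T (?o + (a + 1)) * T (?o + a) = T (?o + (a + 1)) * T (?o + a) * T (?o + (a + 1))"
      using braid[of "?o + a"] b by simp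
    then show ?thesis unfolding T_block_def e0_commute_mult3[OF b(8) b(4)] e0_commute_mult3[OF b(4) b(8)] by (rule arg_cong)
  qed
  show ?thesis
    unfolding hecke_tuple_def using e0e0 S T STST ST TT TTT by blast
qed

lemma block_jm:
  assumes "v \<noteq> 0" "1 \<le> k" "k \<le> size_block j"
  shows "jm q (S_block v j) (T_block j) k = (1 / v) *\<^sub>s (X (start j + k) * e0)"
  using assms(2,3)
proof (induction k rule: nat_induct_at_least)
  case base
  then show ?case by (simp add: jm.simps S_block_def)
next
  case (Suc k)
  let ?o = "start j"
  have k: "k \<in> {1..<size_block j}" using Suc by auto
  note b = in_block_T[OF k]
  have x: "X (?o + k) * e0 = e0 * X (?o + k)" using X_e b(1) by auto
  have X: "X (?o + Suc k) = (1 / q) *\<^sub>s (T (?o + k) * X (?o + k) * T (?o + k))"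
    using X_Suc[of "?o + k"] b(1) by simp
  have "T_block j k * (X (?o + k) * e0) * T_block j k = T (?o + k) * X (?o + k) * T (?o + k) * e0"
    unfolding T_block_def by (rule e0_commute_mult3[OF x b(4)])
  then show ?case using Suc by (simp add: jm.simps(2) X mult.commute)
qed

lemma blocks_commute:
  assumes jk: "j \<noteq> k"
  shows "0 < size_block j \<Longrightarrow> 0 < size_block k \<Longrightarrow> S_block v j * S_block v' k = S_block v' k * S_block v j"
    "0 < size_block j \<Longrightarrow> a \<in> {1..<size_block k} \<Longrightarrow> S_block v j * T_block k a = T_block k a * S_block v j"
    "c \<in> {1..<size_block j} \<Longrightarrow> a \<in> {1..<size_block k} \<Longrightarrow> T_block j c * T_block k a = T_block k a * T_block j c"
proof -
  assume j: "0 < size_block j"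
  have xj: "start j + 1 \<in> {1..n}" "t0 (start j + 1) = j" using in_block[of 1 j] j by auto
  show "S_block v j * S_block v' k = S_block v' k * S_block v j" if "0 < size_block k"
  proof -
    have xk: "start k + 1 \<in> {1..n}" using in_block[of 1 k] that by auto
    from e0_commute[OF X_X[OF xj(1) xk] X_e[OF xj(1)] X_e[OF xk]] show ?thesis
      unfolding S_block_def by (simp add: mult.commute)
  qed
  show "S_block v j * T_block k a = T_block k a * S_block v j" if a: "a \<in> {1..<size_block k}"
  proof -
    note b = in_block_T[OF a]
    have "T (start k + a) * X (start j + 1) = X (start j + 1) * T (start k + a)"
      using jk b(2,3) xj(2) by (intro T_X'[OF b(1) xj(1)]) metis+
    from e0_commute[OF this[symmetric] X_e[OF xj(1)] b(4)] show ?thesis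
      unfolding S_block_def T_block_def by simp
  qed
next
  assume c: "c \<in> {1..<size_block j}" and a: "a \<in> {1..<size_block k}"
  note b = in_block_T[OF a] and d = in_block_T[OF c]
  \<comment> \<open>Each generator acts on two neighbouring positions of one colour, so generators
    of different blocks involve disjoint pairs.\<close>
  have "start j + c \<noteq> start k + a" "start j + c \<noteq> Suc (start k + a)" "Suc (start j + c) \<noteq> start k + a"
    using b(2,3) d(2,3) jk by metis+
  then have "start j + c + 1 < start k + a \<or> start k + a + 1 < start j + c" by linarith
  then have "T (start j + c) * T (start k + a) = T (start k + a) * T (start j + c)"
    using T_T[OF d(1) b(1)] T_T[OF b(1) d(1)] by auto
  from e0_commute[OF this d(4) b(4)] show "T_block j c * T_block k a = T_block k a * T_block j c"
    unfolding T_block_def .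
qed

text \<open>The matrix coefficients of \<open>S\<close> and of the \<open>T\<^sub>a\<close> with respect to the \<open>u\<^sub>t\<close> lie in every subalgebra
  that contains the generators of the block.\<close>

definition coefficients_in :: "('x, 'f) endo set \<Rightarrow> ('x, 'f) endo \<Rightarrow> bool" where
  "coefficients_in L x \<longleftrightarrow> p * x = x \<and> x * p = x \<and> (\<forall>t\<in>Cl. \<forall>s\<in>Cl. w t * x * u s \<in> L) \<and>
     (\<forall>t\<in>Cl. \<forall>s\<in>Seq - Cl. w t * x * e s = 0)"

text \<open>The product is the only case with content: inserting the sum of all idempotents, with
  \<open>e r = u r * w r\<close> inside the class, turns it into matrix multiplication, and summands
  outside the class vanish.\<close>

lemma coefficients_closed:
  assumes L: "subalg L" "e0 \<in> L"
  shows "coefficients_in L p" "coefficients_in L x \<Longrightarrow> coefficients_in L y \<Longrightarrow> coefficients_in L (x + y)"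
    "coefficients_in L x \<Longrightarrow> coefficients_in L y \<Longrightarrow> coefficients_in L (x * y)"
    "coefficients_in L x \<Longrightarrow> coefficients_in L (c *\<^sub>s x)"
proof -
  have "0 *\<^sub>s e0 \<in> L" using L by (intro subalg_closed)
  then have 0: "0 \<in> L" by simp
  have wp: "w t * p = w t" if "t \<in> Cl" for t
    using w(3)[OF that] e_corner(2)[of t] by (metis mult.assoc)
  show "coefficients_in L p"
    unfolding coefficients_in_def using L 0 wp w_u w_e by (auto simp: w_u)
  show "coefficients_in L (x + y)" if "coefficients_in L x" "coefficients_in L y"
    using that L unfolding coefficients_in_def by (simp add: distrib_left distrib_right subalg_closed)
  show "coefficients_in L (c *\<^sub>s x)" if "coefficients_in L x"
    using that L unfolding coefficients_in_def by (simp add: subalg_closed)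
  show "coefficients_in L (x * y)" if x: "coefficients_in L x" and y: "coefficients_in L y"
  proof -
    have xp: "x = x * (\<Sum>t\<in>Seq. e t)" using x e_sum unfolding coefficients_in_def by simp
    \<comment> \<open>Matrix multiplication. The factor \<open>z\<close> is \<open>u s\<close> for a
      coefficient inside the class and \<open>e s\<close> for one that has to vanish.\<close>
    have split: "w t * (x * y) * z = (\<Sum>r\<in>Cl. (w t * x * u r) * (w r * y * z))" if t: "t \<in> Cl" for t z
    proof -
      have "w t * (x * y) * z = (\<Sum>r\<in>Seq. w t * x * e r * (y * z))"
        by (subst xp) (simp add: sum_distrib_left sum_distrib_right mult.assoc)
      also have "\<dots> = (\<Sum>r\<in>Cl. w t * x * e r * (y * z))"
        using x t unfolding coefficients_in_def
        by (intro sum.mono_neutral_right finite_Seq) (auto simp: Cl_def)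
      also have "\<dots> = (\<Sum>r\<in>Cl. (w t * x * u r) * (w r * y * z))"
        using w(5) by (intro sum.cong refl) (simp add: mult.assoc flip: mult.assoc[of "u _" "w _"])
      finally show ?thesis .
    qed
    have sum_L: "(\<Sum>r\<in>Cl. f r) \<in> L" if "\<And>r. r \<in> Cl \<Longrightarrow> f r \<in> L" for f
    proof -
      have "(\<Sum>r\<in>D. f r) \<in> L" if "D \<subseteq> Cl" "finite D" for D
        using that(2,1) \<open>\<And>r. r \<in> Cl \<Longrightarrow> f r \<in> L\<close>
        by (induction D rule: finite_induct) (auto simp: 0 intro: subalg_closed[OF L(1)])
      then show ?thesis using finite_Seq by (simp add: Cl_def)
    qed
    have "p * (x * y) = x * y" "x * y * p = x * y"
      using x y unfolding coefficients_in_def by (auto simp: mult.assoc simp flip: mult.assoc[of p])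
    moreover have "w t * (x * y) * u s \<in> L" if "t \<in> Cl" "s \<in> Cl" for t s
      unfolding split[OF that(1)] using x y that unfolding coefficients_in_def
      by - (rule sum_L, rule subalg_closed(2)[OF L(1)], blast+)
    moreover have "w t * (x * y) * e s = 0" if "t \<in> Cl" "s \<in> Seq - Cl" for t s
      unfolding split[OF that(1)] using y that unfolding coefficients_in_def
      by (intro sum.neutral) auto
    ultimately show ?thesis unfolding coefficients_in_def by blast
  qed
qed

text \<open>The coefficients that occur are some \<open>X c * e0\<close>, some same-colour
  \<open>T a * e0\<close>, and scattering coefficients on \<open>e0\<close>; the latter lie in
  \<open>L\<close> because \<open>separated_inverses\<close> produces their denominators inside
  \<open>L\<close>.\<close>

lemma coefficients_generators:
  assumes L: "subalg L" "e0 \<in> L" and X_L: "\<And>c. c \<in> {1..n} \<Longrightarrow> X c * e0 \<in> L"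
    and T_L: "\<And>a. a \<in> {1..<n} \<Longrightarrow> t0 a = t0 (Suc a) \<Longrightarrow> T a * e0 \<in> L"
  shows "coefficients_in L S" "a \<in> {1..<n} \<Longrightarrow> coefficients_in L (T a)"
proof -
  have "0 *\<^sub>s e0 \<in> L" using L by (intro subalg_closed)
  then have 0: "0 \<in> L" by simp
  have wu_L: "w t * u s * x \<in> L" if "t \<in> Cl" "s \<in> Cl" "e0 * x \<in> L" for t s x
    using that 0 by (auto simp: w_u)
  have r: "1 \<in> {1..n}" using n_pos by auto
  show "coefficients_in L S"
    unfolding coefficients_in_def
  proof (intro conjI ballI)
    show "p * S = S" "S * p = S" using S_corner[OF n_pos] by (auto simp: in_corner_def)
    have X1: "X 1 = S" by (simp add: jm.simps)
    fix t assume t: "t \<in> Cl"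
    show "w t * S * u s \<in> L" if s: "s \<in> Cl" for s
    proof -
      have c: "pos n s 1 \<in> {1..n}" using pos_range[OF s r] by simp
      have "w t * S * u s = w t * u s * X (pos n s 1)"
        using u_X[OF Cl_Seq[OF s] r] by (simp only: X1 mult.assoc)
      also have "\<dots> \<in> L" using X_L[OF c] X_e[OF c] t s by (intro wu_L) auto
      finally show ?thesis .
    qed
    show "w t * S * e s = 0" if s: "s \<in> Seq - Cl" for s
    proof -
      have "w t * S * e s = w t * e s * S" using X_e[OF r] by (simp only: X1 mult.assoc)
      moreover have "w t * e s = 0" using w_e[OF t] s t by auto
      ultimately show ?thesis by simp
    qed
  qed
  have b_L: "b c d t0 \<in> L" if c: "c \<in> {1..n}" "d \<in> {1..n}" "t0 c \<noteq> t0 d" for c d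
  proof -
    have "\<omega> \<noteq> \<omega>' \<and> q * \<omega> \<noteq> \<omega>'" if "\<omega> \<in># N (t0 c)" "\<omega>' \<in># N (t0 d)" for \<omega> \<omega>'
      using separated that Seq_J[OF t0 c(1)] Seq_J[OF t0 c(2)] c(3) unfolding separated_def N_def by blast
    from separated_inverses(1)[OF e0e0 X_e[OF c(1)] X_e[OF c(2)] X_X[OF c(1,2)] q0 e_kill[OF t0 c(1)] e_kill[OF t0 c(2)]
        this L X_L[OF c(1)] X_L[OF c(2)]]
    obtain y where y: "y \<in> L" "is_inverse e0 ((X d - X c) * e0) y" by blast
    have "X d * y = X d * e0 * y" using y(2) by (simp add: is_inverse_def mult.assoc)
    then have "b c d t0 = (q - 1) *\<^sub>s (X d * e0 * y)"
      unfolding b_def scatter_def inverse_in_eq[OF y(2)] by simp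
    then show ?thesis using y(1) X_L[OF c(2)] L(1) by (simp add: subalg_closed)
  qed
  fix a assume a: "a \<in> {1..<n}"
  have ra: "a \<in> {1..n}" "Suc a \<in> {1..n}" using a by auto
  show "coefficients_in L (T a)"
    unfolding coefficients_in_def
  proof (intro conjI ballI)
    show "p * T a = T a" "T a * p = T a" using T_corner[OF a] by (auto simp: in_corner_def)
    fix t assume t: "t \<in> Cl"
    show "w t * T a * u s \<in> L" if s: "s \<in> Cl" for s
    proof (cases "s a = s (Suc a)")
      case True
      let ?c = "pos n s a"
      have c: "?c \<in> {1..<n}" "t0 ?c = t0 (Suc ?c)"
        using pos_range[OF s ra(1)] pos_range[OF s ra(2)] pos_Suc[of s a n] True by auto
      have "w t * T a * u s = w t * u s * T ?c"
        using u_T[OF Cl_Seq[OF s] a True] by (simp add: mult.assoc)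
      also have "\<dots> \<in> L" using T_L[OF c] T_e_same[OF t0 c] t s by (intro wu_L) auto
      finally show ?thesis .
    next
      case False
      let ?c = "pos n s a" and ?d = "pos n s (Suc a)"
      have c: "?c \<in> {1..n}" "?d \<in> {1..n}" "t0 ?c \<noteq> t0 ?d"
        using pos_range[OF s ra(1)] pos_range[OF s ra(2)] False by auto
      have sS: "s \<in> Seq" "content n s = content n t0" using s by (auto simp: Cl_def)
      have ss: "s \<circ> sw a \<in> Cl" using Seq_sw[OF sS(1) a] content_sw[OF a] s by (simp add: Cl_def)
      have bu: "b a (Suc a) s * u s = u s * b ?c ?d t0"
        by (rule b_u[OF sS(1) t0 asc sS(2) ra False c])
      have "T a * u s = T a * e s * u s" using u_left[OF sS(1)] by (simp add: mult.assoc)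
      also have "\<dots> = \<sigma> a s * (q *\<^sub>s (e s * u s) - b a (Suc a) s * u s) + b a (Suc a) s * u s"
        unfolding T_diff[OF sS(1) a False] by (simp add: algebra_simps)
      also have "\<dots> = u (s \<circ> sw a) * (q *\<^sub>s e0 - b ?c ?d t0) + u s * b ?c ?d t0"
        unfolding bu u_left[OF sS(1)] using \<sigma>_u[OF sS(1) a False] u_e0[OF ss]
        by (simp add: right_diff_distrib flip: mult.assoc)
      finally have "w t * T a * u s = w t * u (s \<circ> sw a) * (q *\<^sub>s e0 - b ?c ?d t0) + w t * u s * b ?c ?d t0"
        by (simp add: mult.assoc distrib_left)
      moreover have "e0 * b ?c ?d t0 = b ?c ?d t0" using b_corner[OF t0 c] by simp
      ultimately show ?thesis
        using wu_L[OF t ss, of "q *\<^sub>s e0 - b ?c ?d t0"] wu_L[OF t s, of "b ?c ?d t0"] b_L[OF c] L e0e0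
        by (simp add: right_diff_distrib subalg_closed)
    qed
    show "w t * T a * e s = 0" if s: "s \<in> Seq - Cl" for s
    proof -
      have ws: "w t * e s = 0" using w_e[OF t] s t by auto
      show ?thesis
      proof (cases "s a = s (Suc a)")
        case True
        then have "w t * T a * e s = w t * e s * T a" using T_e_same[of s a] s a by (simp add: mult.assoc)
        then show ?thesis using ws by simp
      next
        case False
        have sS: "s \<in> Seq" using s by auto
        have "s \<circ> sw a \<in> Seq - Cl" using Seq_sw[OF sS a] content_sw[OF a] s by (simp add: Cl_def)
        then have "w t * e (s \<circ> sw a) = 0" using w_e[OF t] t by auto
        then have "w t * \<sigma> a s = 0"
          using mult_right_cong(1)[of "w t" "e (s \<circ> sw a)" 0 0 "\<sigma> a s"] \<sigma>_left[OF sS a False] by simp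
        moreover have "w t * b a (Suc a) s = 0"
          using mult_right_cong(1)[of "w t" "e s" 0 0 "b a (Suc a) s"] b_corner[OF sS ra False] ws by simp
        ultimately show ?thesis
          using T_diff[OF sS a False] by (simp add: mult.assoc distrib_left) (simp flip: mult.assoc)
      qed
    qed
  qed
qed

lemma block_generators_L:
  assumes L: "subalg L" "e0 \<in> L" and v: "\<And>j. j \<in> J \<Longrightarrow> v j \<noteq> 0"
    and S_L: "\<And>j. j \<in> J \<Longrightarrow> 0 < size_block j \<Longrightarrow> S_block (v j) j \<in> L"
    and T_L: "\<And>j a. j \<in> J \<Longrightarrow> a \<in> {1..<size_block j} \<Longrightarrow> T_block j a \<in> L"
  shows "c \<in> {1..n} \<Longrightarrow> X c * e0 \<in> L" "a \<in> {1..<n} \<Longrightarrow> t0 a = t0 (Suc a) \<Longrightarrow> T a * e0 \<in> L"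
proof -
  assume c: "c \<in> {1..n}"
  obtain k where k: "1 \<le> k" "k \<le> size_block (t0 c)" "c = start (t0 c) + k" using every_position[OF c] .
  let ?j = "t0 c"
  have j: "?j \<in> J" using Seq_J[OF t0 c] .
  have "jm q (S_block (v ?j) ?j) (T_block ?j) k \<in> L"
    using k(1,2)
  proof (induction k rule: nat_induct_at_least)
    case base
    then show ?case using S_L[OF j] by (simp add: jm.simps)
  next
    case (Suc k)
    then show ?case using T_L[OF j, of k] L(1) by (simp add: jm.simps subalg_closed)
  qed
  then have "(1 / v ?j) *\<^sub>s (X c * e0) \<in> L"
    using block_jm[OF v[OF j] k(1,2)] k(3) by simp
  from subalg_closed(3)[OF L(1) this, of "v ?j"]
  show "X c * e0 \<in> L" using v[OF j] by simp
next
  assume a: "a \<in> {1..<n}" "t0 a = t0 (Suc a)"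
  have r: "a \<in> {1..n}" "Suc a \<in> {1..n}" using a by auto
  let ?j = "t0 a"
  obtain k where k: "1 \<le> k" "k \<le> size_block ?j" "a = start ?j + k" using every_position[OF r(1)] .
  obtain k' where k': "k' \<le> size_block ?j" "Suc a = start ?j + k'" using every_position[OF r(2)] a(2) by metis
  have "k \<in> {1..<size_block ?j}" using k k' by auto
  then show "T a * e0 \<in> L" using T_L[OF Seq_J[OF t0 r(1)]] k(3) by (metis T_block_def)
qed

end

section \<open>The module induced from a representation of the block, with a verification of all
  Hecke relations\<close>

section \<open>Induced representations\<close>

text \<open>Elementary matrices with entries in \<open>endo\<close>. The induced module is a sum of
  copies of one space, one for each colour sequence, realised as functions on pairs.\<close>

lift_definition matrix_unit :: "'s \<Rightarrow> 's \<Rightarrow> ('y, 'f::field) endo \<Rightarrow> ('s \<times> 'y, 'f) endo"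
  is "\<lambda>t s z f (r, y). if r = t then z (\<lambda>y. f (s, y)) y else 0"
  by (auto simp: fun_eq_iff plus_fun_def)

lemma matrix_unit_mult: "matrix_unit t s z * matrix_unit s' r w = (if s = s' then matrix_unit t r (z * w) else 0)"
proof (transfer, intro ext)
  fix t s s' r :: 's and z w :: "('y \<Rightarrow> 'f::field) \<Rightarrow> 'y \<Rightarrow> 'f" and f and a :: "'s \<times> 'y"
  assume "(\<forall>f g. z (f + g) = z f + z g) \<and> (\<forall>c f. z (\<lambda>x. c * f x) = (\<lambda>x. c * z f x))"
  \<comment> \<open>Homogeneity with the scalar \<open>0\<close> gives that \<open>z\<close> maps
    zero to zero, which is needed for mismatched indices.\<close>
  from conjunct2[OF this, rule_format, of 0 "\<lambda>x. f (r, x)"]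
  show "((\<lambda>f (r, y). if r = t then z (\<lambda>y. f (s, y)) y else 0) ((\<lambda>f (a, y). if a = s' then w (\<lambda>y. f (r, y)) y else 0) f)) a =
      (if s = s' then \<lambda>f (a, y). if a = t then z (w (\<lambda>y. f (r, y))) y else 0 else (\<lambda>f x. 0)) f a"
    by (auto split: prod.split)
qed

lemma matrix_unit_simps:
  "matrix_unit t s (z + w) = matrix_unit t s z + matrix_unit t s w"
  "matrix_unit t s (z - w) = matrix_unit t s z - matrix_unit t s w"
  "matrix_unit t s (c *\<^sub>s z) = c *\<^sub>s matrix_unit t s z"
  "matrix_unit t s 0 = 0"
  by (transfer, auto simp: fun_eq_iff)+

lemma matrix_unit_inject:
  assumes "matrix_unit t s z = matrix_unit t s w"
  shows "z = w"
proof -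
  have "Rep_endo (matrix_unit t s z) (\<lambda>r. f (snd r)) (t, y) = Rep_endo z f y" for z and f y
    by (simp add: matrix_unit.rep_eq)
  note this[of z, unfolded assms] this[of w]
  then have "Rep_endo z f y = Rep_endo w f y" for f y by metis
  then show ?thesis by (simp add: Rep_endo_inject[symmetric] fun_eq_iff)
qed

lemma peval_matrix_unit:
  assumes "in_corner p x"
  shows "peval (matrix_unit t t p) P (matrix_unit t t x) = matrix_unit t t (peval p P x)"
proof (induction P)
  case 0
  then show ?case by (simp add: matrix_unit_simps)
next
  case (pCons a P)
  have "in_corner (matrix_unit t t p) (matrix_unit t t x)"
    using assms by (simp add: in_corner_def matrix_unit_mult)
  then show ?case
    by (simp add: peval_pCons[OF assms] peval_pCons pCons matrix_unit_mult matrix_unit_simps)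
qed

text \<open>The input for the construction of the module: commuting \<open>y k\<close> in the role
  of Jucys-Murphy elements at the positions of \<open>t0\<close>, and \<open>\<tau> k\<close> in the
  role of \<open>T k\<close> where two neighbouring positions have the same colour.\<close>

locale block_data =
  fixes p :: "('y, 'f::field) endo" and q :: 'f and n J and N :: "nat \<Rightarrow> 'f multiset" and t0 y \<tau>
  assumes pp: "p * p = p" and q0: "q \<noteq> 0" and n_pos: "0 < n" and finite_J: "finite J" and asc: "ascending n t0"
    and y_corner: "\<And>k. k \<in> {1..n} \<Longrightarrow> in_corner p (y k)"
    and y_y: "\<And>k l. k \<in> {1..n} \<Longrightarrow> l \<in> {1..n} \<Longrightarrow> y k * y l = y l * y k"
    and y_kill: "\<And>k. k \<in> {1..n} \<Longrightarrow> peval p (root_poly (N (t0 k))) (y k) = 0"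
    and disjoint: "\<And>i j \<omega> \<omega>'. i \<in> J \<Longrightarrow> j \<in> J \<Longrightarrow> i \<noteq> j \<Longrightarrow> \<omega> \<in># N i \<Longrightarrow> \<omega>' \<in># N j \<Longrightarrow> \<omega> \<noteq> \<omega>' \<and> q * \<omega> \<noteq> \<omega>'"
    and \<tau>_pair: "\<And>k. k \<in> {1..<n} \<Longrightarrow> t0 k = t0 (Suc k) \<Longrightarrow> affine_pair p q (\<tau> k) (y k) (y (Suc k))"
    and \<tau>_y: "\<And>k l. k \<in> {1..<n} \<Longrightarrow> t0 k = t0 (Suc k) \<Longrightarrow> l \<in> {1..n} \<Longrightarrow> l \<noteq> k \<Longrightarrow> l \<noteq> Suc k \<Longrightarrow> \<tau> k * y l = y l * \<tau> k"
    and \<tau>_\<tau>: "\<And>k l. k \<in> {1..<n} \<Longrightarrow> t0 k = t0 (Suc k) \<Longrightarrow> l \<in> {1..<n} \<Longrightarrow> t0 l = t0 (Suc l) \<Longrightarrow> Suc k < l \<Longrightarrow>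
      \<tau> k * \<tau> l = \<tau> l * \<tau> k"
    and \<tau>_braid: "\<And>k. 1 \<le> k \<Longrightarrow> Suc k < n \<Longrightarrow> t0 k = t0 (Suc k) \<Longrightarrow> t0 (Suc k) = t0 (Suc (Suc k)) \<Longrightarrow>
      \<tau> k * \<tau> (Suc k) * \<tau> k = \<tau> (Suc k) * \<tau> k * \<tau> (Suc k)"
begin

definition Cl where "Cl = {t \<in> {1..n} \<rightarrow>\<^sub>E J. content n t = content n t0}"

abbreviation "\<beta> t c d \<equiv> scatter q p (y (pos n t c)) (y (pos n t d))"

definition e where "e t = matrix_unit t t p"
definition unit where "unit = (\<Sum>t\<in>Cl. e t)"
text \<open>On the summand \<open>t\<close>, strand \<open>c\<close> is governed by its position
  after stable sorting; this is the rule that \<open>u_X\<close> expresses in the Hecke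
  algebra.\<close>

definition x where "x c = (\<Sum>t\<in>Cl. matrix_unit t t (y (pos n t c)))"
definition b where "b c d t = matrix_unit t t (\<beta> t c d)"
definition \<sigma> where "\<sigma> a t = matrix_unit (t \<circ> sw a) t p"
text \<open>For equal colours the formula of \<open>u_T\<close>; for different colours that of
  \<open>T_diff\<close>, with the crossing replaced by the bare permutation of summands.\<close>

definition T_part where "T_part a t = (if t a = t (Suc a) then matrix_unit t t (\<tau> (pos n t a))
  else matrix_unit (t \<circ> sw a) t (q *\<^sub>s p - \<beta> t a (Suc a)) + matrix_unit t t (\<beta> t a (Suc a)))"
definition T where "T a = (\<Sum>t\<in>Cl. T_part a t)"

lemma finite_Cl: "finite Cl"
  unfolding Cl_def using finite_J by (intro finite_subset[OF _ finite_PiE[of "{1..n}" "\<lambda>_. J"]]) auto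

lemma Cl_sw: "t \<in> Cl \<Longrightarrow> a \<in> {1..<n} \<Longrightarrow> t \<circ> sw a \<in> Cl"
  using content_transpose[of a n "Suc a" t] sw_range[of a n]
  by (auto simp: Cl_def PiE_iff extensional_def)

lemma Cl_J: "t \<in> Cl \<Longrightarrow> c \<in> {1..n} \<Longrightarrow> t c \<in> J"
  by (auto simp: Cl_def)

lemma pos_Cl: "t \<in> Cl \<Longrightarrow> c \<in> {1..n} \<Longrightarrow> pos n t c \<in> {1..n}" "t \<in> Cl \<Longrightarrow> c \<in> {1..n} \<Longrightarrow> t0 (pos n t c) = t c"
  using pos_in_block[OF asc, of t c] by (auto simp: Cl_def)

lemma pos_neq: "t \<in> Cl \<Longrightarrow> c \<in> {1..n} \<Longrightarrow> d \<in> {1..n} \<Longrightarrow> c \<noteq> d \<Longrightarrow> pos n t c \<noteq> pos n t d"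
  using pos_inject[OF asc, of t c d] by (auto simp: Cl_def)

lemma pos_same:
  assumes "t \<in> Cl" "a \<in> {1..<n}" "t a = t (Suc a)"
  shows "pos n t a \<in> {1..<n}" "t0 (pos n t a) = t0 (Suc (pos n t a))"
  using pos_Cl[OF assms(1), of a] pos_Cl[OF assms(1), of "Suc a"] pos_Suc[of t a n] assms by auto

lemma y_unit [simp]: "k \<in> {1..n} \<Longrightarrow> p * y k = y k" "k \<in> {1..n} \<Longrightarrow> y k * p = y k"
  using y_corner by (auto simp: in_corner_def)

lemma \<tau>_unit [simp]:
  assumes "k \<in> {1..<n}" "t0 k = t0 (Suc k)"
  shows "p * \<tau> k = \<tau> k" "\<tau> k * p = \<tau> k"
  using affine_pair.unit(1,2)[OF \<tau>_pair[OF assms]] .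

lemma inverses:
  assumes t: "t \<in> Cl" and c: "c \<in> {1..n}" "d \<in> {1..n}" "t c \<noteq> t d"
  shows "\<exists>w. is_inverse p ((y (pos n t d) - y (pos n t c)) * p) w"
    "\<exists>w. is_inverse p ((y (pos n t d) - q *\<^sub>s y (pos n t c)) * p) w"
proof -
  note k = pos_Cl[OF t c(1)] and l = pos_Cl[OF t c(2)]
  have "peval p (root_poly (N (t c))) (y (pos n t c) * p) = 0" "peval p (root_poly (N (t d))) (y (pos n t d) * p) = 0"
    using y_kill[OF k(1)] y_kill[OF l(1)] k l by simp_all
  from separated_inverses[OF pp _ _ y_y[OF k(1) l(1)] q0 this disjoint[OF Cl_J[OF t c(1)] Cl_J[OF t c(2)] c(3)], of UNIV]
  show "\<exists>w. is_inverse p ((y (pos n t d) - y (pos n t c)) * p) w"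
    "\<exists>w. is_inverse p ((y (pos n t d) - q *\<^sub>s y (pos n t c)) * p) w"
    using k(1) l(1) by (auto simp: subalg_def)
qed

lemma pair_data:
  assumes t: "t \<in> Cl" and c: "c \<in> {1..n}" "d \<in> {1..n}" "t c \<noteq> t d"
  obtains w where "scatter_pair p (y (pos n t c)) (y (pos n t d)) w"
proof -
  note k = pos_Cl[OF t c(1)] and l = pos_Cl[OF t c(2)]
  obtain w where "is_inverse p ((y (pos n t d) - y (pos n t c)) * p) w" using inverses(1)[OF assms] by blast
  then have "scatter_pair p (y (pos n t c)) (y (pos n t d)) w"
    using pp k(1) l(1) y_y by unfold_locales auto
  then show ?thesis by (rule that)
qed

lemma \<beta>_corner:
  assumes "t \<in> Cl" "c \<in> {1..n}" "d \<in> {1..n}" "t c \<noteq> t d"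
  shows "p * \<beta> t c d = \<beta> t c d" "\<beta> t c d * p = \<beta> t c d"
proof -
  obtain w where "scatter_pair p (y (pos n t c)) (y (pos n t d)) w" using pair_data[OF assms] .
  then show "p * \<beta> t c d = \<beta> t c d" "\<beta> t c d * p = \<beta> t c d" by (rule scatter_pair.scatter_corner)+
qed

lemma \<beta>_commute:
  assumes "t \<in> Cl" "c \<in> {1..n}" "d \<in> {1..n}" "t c \<noteq> t d"
    and "z * y (pos n t c) = y (pos n t c) * z" "z * y (pos n t d) = y (pos n t d) * z" "z * p = p * z"
  shows "z * \<beta> t c d = \<beta> t c d * z"
proof -
  obtain w where "scatter_pair p (y (pos n t c)) (y (pos n t d)) w" using pair_data[OF assms(1-4)] .
  then show ?thesis by (rule scatter_pair.scatter_commute) fact+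
qed

lemma \<beta>_y:
  assumes "t \<in> Cl" "c \<in> {1..n}" "d \<in> {1..n}" "t c \<noteq> t d" "k \<in> {1..n}"
  shows "y k * \<beta> t c d = \<beta> t c d * y k"
  using assms y_y[OF assms(5)] pos_Cl by (intro \<beta>_commute) auto

lemma \<beta>_\<beta>:
  assumes "t \<in> Cl" "c \<in> {1..n}" "d \<in> {1..n}" "t c \<noteq> t d" "c' \<in> {1..n}" "d' \<in> {1..n}" "t c' \<noteq> t d'"
  shows "\<beta> t c d * \<beta> t c' d' = \<beta> t c' d' * \<beta> t c d"
  using assms \<beta>_y[OF assms(1-4)] \<beta>_corner[OF assms(1-4)] pos_Cl by (intro \<beta>_commute) auto

lemma \<beta>_swap:
  assumes "t \<in> Cl" "c \<in> {1..n}" "d \<in> {1..n}" "t c \<noteq> t d"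
  shows "\<beta> t c d + \<beta> t d c = (q - 1) *\<^sub>s p"
proof -
  obtain w where "scatter_pair p (y (pos n t c)) (y (pos n t d)) w" using pair_data[OF assms] .
  then show ?thesis by (rule scatter_pair.scatter_swap)
qed

lemma \<beta>_diff:
  assumes "t \<in> Cl" "c \<in> {1..n}" "d \<in> {1..n}" "t c \<noteq> t d"
  shows "\<beta> t c d * y (pos n t d) = \<beta> t c d * y (pos n t c) + (q - 1) *\<^sub>s y (pos n t d)"
proof -
  obtain w where w: "scatter_pair p (y (pos n t c)) (y (pos n t d)) w" using pair_data[OF assms] .
  note k = pos_Cl(1)[OF assms(1,2)] pos_Cl(1)[OF assms(1,3)]
  have "\<beta> t c d * (y (pos n t d) - y (pos n t c)) = (q - 1) *\<^sub>s (y (pos n t d) * (w * (y (pos n t d) - y (pos n t c))))"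
    by (simp add: scatter_pair.scatter_eq[OF w] mult.assoc)
  also have "\<dots> = (q - 1) *\<^sub>s y (pos n t d)" using k by (simp only: scatter_pair.d'[OF w] y_unit)
  finally show ?thesis by (simp add: right_diff_distrib diff_eq_eq add.commute)
qed

lemma \<beta>_sw:
  assumes "a \<in> {1..<n}" "t a \<noteq> t (Suc a)" "c \<in> {1..n}" "d \<in> {1..n}"
  shows "\<beta> (t \<circ> sw a) c d = \<beta> t (sw a c) (sw a d)"
  using assms by (simp add: pos_sw)

lemma diagonal_mult:
  "t \<in> Cl \<Longrightarrow> (\<Sum>r\<in>Cl. matrix_unit r r (F r)) * matrix_unit t s z = matrix_unit t s (F t * z)"
  unfolding sum_distrib_right using finite_Cl by (simp add: sum.remove[of Cl t] matrix_unit_mult)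

lemma e_unit: "t \<in> Cl \<Longrightarrow> unit * matrix_unit t s z = matrix_unit t s (p * z)"
  unfolding unit_def e_def by (rule diagonal_mult)

lemma x_mult: "t \<in> Cl \<Longrightarrow> x c * matrix_unit t s z = matrix_unit t s (y (pos n t c) * z)"
  unfolding x_def by (rule diagonal_mult)

lemma T_part_mult: "r \<noteq> t \<Longrightarrow> T_part a r * matrix_unit t s z = 0"
  by (simp add: T_part_def matrix_unit_mult distrib_right)

lemma T_mult_part: "t \<in> Cl \<Longrightarrow> T a * matrix_unit t s z = T_part a t * matrix_unit t s z"
  unfolding T_def sum_distrib_right using finite_Cl T_part_mult
  by (simp add: sum.remove[of Cl t])

lemma T_mult_same: "t \<in> Cl \<Longrightarrow> t a = t (Suc a) \<Longrightarrow> T a * matrix_unit t s z = matrix_unit t s (\<tau> (pos n t a) * z)"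
  by (simp add: T_mult_part T_part_def matrix_unit_mult)

lemma T_mult_diff: "t \<in> Cl \<Longrightarrow> t a \<noteq> t (Suc a) \<Longrightarrow> T a * matrix_unit t s z =
    matrix_unit (t \<circ> sw a) s ((q *\<^sub>s p - \<beta> t a (Suc a)) * z) + matrix_unit t s (\<beta> t a (Suc a) * z)"
  by (simp add: T_mult_part T_part_def matrix_unit_mult distrib_right)

text \<open>Expresses the action on the swapped summand by the coefficient of the original one, so
  that each swapped pair is governed by a two by two matrix in the single element
  \<open>\<beta> t a (Suc a)\<close>.\<close>

lemma T_mult_swapped:
  assumes t: "t \<in> Cl" and a: "a \<in> {1..<n}" and ne: "t a \<noteq> t (Suc a)"
  shows "T a * matrix_unit (t \<circ> sw a) s z =
    matrix_unit t s ((p + \<beta> t a (Suc a)) * z) + matrix_unit (t \<circ> sw a) s (((q - 1) *\<^sub>s p - \<beta> t a (Suc a)) * z)"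
proof -
  define r where "r = t \<circ> sw a"
  have ra: "a \<in> {1..n}" "Suc a \<in> {1..n}" using a by auto
  have r: "r \<in> Cl" "r a \<noteq> r (Suc a)" "r \<circ> sw a = t" using Cl_sw[OF t a] ne by (simp_all add: r_def)
  have "\<beta> r a (Suc a) = (q - 1) *\<^sub>s p - \<beta> t a (Suc a)"
    using \<beta>_swap[OF t ra ne] \<beta>_sw[OF a ne ra] by (simp add: r_def algebra_simps)
  then show ?thesis
    unfolding r_def[symmetric] T_mult_diff[OF r(1,2)] r(3) by (simp add: scl_simps add.commute)
qed

lemma unit_unit: "unit * unit = unit"
proof -
  have "unit * e t = e t" if "t \<in> Cl" for t using that by (simp add: e_def e_unit pp)
  then have "unit * (\<Sum>t\<in>Cl. e t) = (\<Sum>t\<in>Cl. e t)" by (simp add: sum_distrib_left)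
  then show ?thesis by (simp add: unit_def)
qed

lemma e_unit_right: "t \<in> Cl \<Longrightarrow> e t * unit = e t"
  unfolding unit_def e_def sum_distrib_left using finite_Cl
  by (simp add: sum.remove[of Cl t] matrix_unit_mult pp)

lemma T_part_unit:
  assumes t: "t \<in> Cl" and a: "a \<in> {1..<n}"
  shows "T_part a t * e t = T_part a t" "unit * T_part a t = T_part a t"
proof -
  have r: "a \<in> {1..n}" "Suc a \<in> {1..n}" using a by auto
  show "T_part a t * e t = T_part a t" "unit * T_part a t = T_part a t"
    using pos_same[OF t a] \<beta>_corner[OF t r] t Cl_sw[OF t a]
    by (auto simp: T_part_def e_def matrix_unit_mult e_unit pp distrib_left distrib_right left_diff_distrib right_diff_distrib)
qed

lemma T_corner:
  assumes a: "a \<in> {1..<n}"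
  shows "in_corner unit (T a)"
proof -
  have "T_part a t * unit = T_part a t" if "t \<in> Cl" for t
    using T_part_unit(1)[OF that a] e_unit_right[OF that] by (metis mult.assoc)
  then show ?thesis
    using T_part_unit(2)[OF _ a] by (simp add: in_corner_def T_def sum_distrib_left sum_distrib_right)
qed

lemma x_corner:
  assumes c: "c \<in> {1..n}"
  shows "in_corner unit (x c)"
proof -
  have "matrix_unit t t (y (pos n t c)) * unit = matrix_unit t t (y (pos n t c))"
      "unit * matrix_unit t t (y (pos n t c)) = matrix_unit t t (y (pos n t c))" if "t \<in> Cl" for t
  proof -
    have "matrix_unit t t (y (pos n t c)) = matrix_unit t t (y (pos n t c)) * e t"
      using pos_Cl(1)[OF that c] by (simp add: e_def matrix_unit_mult)
    then show "matrix_unit t t (y (pos n t c)) * unit = matrix_unit t t (y (pos n t c))"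
      using e_unit_right[OF that] by (metis mult.assoc)
    show "unit * matrix_unit t t (y (pos n t c)) = matrix_unit t t (y (pos n t c))"
      using that pos_Cl(1)[OF that c] by (simp add: e_unit)
  qed
  then show ?thesis by (simp add: in_corner_def x_def sum_distrib_left sum_distrib_right)
qed

lemma eqI:
  assumes "z * unit = z" "w * unit = w" "\<And>t. t \<in> Cl \<Longrightarrow> z * matrix_unit t t p = w * matrix_unit t t p"
  shows "z = w"
proof -
  have "z * unit = w * unit" using assms(3) by (simp add: unit_def e_def sum_distrib_left)
  then show ?thesis using assms by simp
qed

lemma e_T:
  assumes t: "t \<in> Cl" and a: "a \<in> {1..<n}" and same: "t a = t (Suc a)"
  shows "e t * T a = matrix_unit t t (\<tau> (pos n t a))"
proof -
  have "e t * T_part a s = (if s = t then matrix_unit t t (\<tau> (pos n t a)) else 0)" if "s \<in> Cl" for s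
    using same pos_same[OF t a same] by (auto simp: e_def T_part_def matrix_unit_mult distrib_left)
  then show ?thesis using t finite_Cl by (simp add: T_def sum_distrib_left)
qed


text \<open>On two swapped summands \<open>T a\<close> is a two by two matrix with trace
  \<open>q - 1\<close> and determinant \<open>- q\<close>, so the relation is its characteristic
  equation.\<close>

lemma T_quadratic:
  assumes a: "a \<in> {1..<n}"
  shows "T a * T a = (q - 1) *\<^sub>s T a + q *\<^sub>s unit"
proof (rule eqI)
  note c = T_corner[OF a, unfolded in_corner_def]
  show "T a * T a * unit = T a * T a" using c by (simp add: mult.assoc)
  show "((q - 1) *\<^sub>s T a + q *\<^sub>s unit) * unit = (q - 1) *\<^sub>s T a + q *\<^sub>s unit"
    using c by (simp add: distrib_right unit_unit)
  fix t assume t: "t \<in> Cl"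
  have r: "a \<in> {1..n}" "Suc a \<in> {1..n}" using a by auto
  show "T a * T a * matrix_unit t t p = ((q - 1) *\<^sub>s T a + q *\<^sub>s unit) * matrix_unit t t p"
  proof (cases "t a = t (Suc a)")
    case True
    note k = pos_same[OF t a True]
    have "T a * T a * matrix_unit t t p = matrix_unit t t (\<tau> (pos n t a) * \<tau> (pos n t a))"
      using k by (simp add: mult.assoc T_mult_same[OF t True])
    then show ?thesis
      using k by (simp add: affine_pair.TT[OF \<tau>_pair[OF k]] distrib_right T_mult_same[OF t True] e_unit[OF t] pp matrix_unit_simps)
  next
    case False
    define s d where "s = t \<circ> sw a" and "d = \<beta> t a (Suc a)"
    have [simp]: "p * d = d" "d * p = d" "p * (d * d) = d * d"
      unfolding d_def using \<beta>_corner[OF t r False] by (simp_all flip: mult.assoc)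
    note T = T_mult_diff[OF t False, folded s_def d_def] T_mult_swapped[OF t a False, folded s_def d_def]
    show ?thesis
      by (simp add: mult.assoc T pp distrib_left distrib_right left_diff_distrib right_diff_distrib matrix_unit_simps
          scl_simps e_unit[OF t])
  qed
qed

text \<open>Identifies the \<open>x c\<close> as Jucys-Murphy elements of the module; as they
  visibly commute, the relation between \<open>S\<close> and \<open>T 1\<close> comes for
  free.\<close>

lemma T_x_T:
  assumes a: "a \<in> {1..<n}"
  shows "T a * x a * T a = q *\<^sub>s x (Suc a)"
proof (rule eqI)
  have r: "a \<in> {1..n}" "Suc a \<in> {1..n}" using a by auto
  show "T a * x a * T a * unit = T a * x a * T a" "q *\<^sub>s x (Suc a) * unit = q *\<^sub>s x (Suc a)"
    using T_corner[OF a] x_corner[OF r(2)] by (simp_all add: in_corner_def mult.assoc)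
  fix t assume t: "t \<in> Cl"
  show "T a * x a * T a * matrix_unit t t p = q *\<^sub>s x (Suc a) * matrix_unit t t p"
  proof (cases "t a = t (Suc a)")
    case True
    note k = pos_same[OF t a True]
    let ?k = "pos n t a"
    interpret pair: affine_pair p q "\<tau> ?k" "y ?k" "y (Suc ?k)" by (rule \<tau>_pair[OF k])
    have "\<tau> ?k * (y ?k * \<tau> ?k) = q *\<^sub>s y (Suc ?k)"
      by (simp add: pair.straighten(2) pair.TT distrib_left)
    then show ?thesis
      by (simp add: mult.assoc T_mult_same[OF t True] x_mult[OF t] pos_Suc[of t a n, OF True] matrix_unit_simps)
  next
    case False
    let ?k = "pos n t a" and ?l = "pos n t (Suc a)"
    define s d k l where "s = t \<circ> sw a" and "d = \<beta> t a (Suc a)" and "k = y ?k" and "l = y ?l"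
    note kl = pos_Cl(1)[OF t r(1)] pos_Cl(1)[OF t r(2)]
    have [simp]: "p * d = d" "d * p = d" unfolding d_def by (rule \<beta>_corner[OF t r False])+
    have [simp]: "p * k = k" "k * p = k" "p * l = l" "l * p = l" using kl by (simp_all add: k_def l_def)
    have [simp]: "p * (d * k) = d * k" by (simp flip: mult.assoc)
    have com: "k * d = d * k" "l * d = d * l" unfolding d_def k_def l_def using \<beta>_y[OF t r False] kl by auto
    \<comment> \<open>The defining property of the scattering coefficient,
      \<open>d (l - k) = (q - 1) l\<close>, used to eliminate \<open>d * l\<close>.\<close>
    have dl: "d * l = d * k + (q - 1) *\<^sub>s l" unfolding d_def k_def l_def by (rule \<beta>_diff[OF t r False])
    have s: "s \<in> Cl" unfolding s_def by (rule Cl_sw[OF t a])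
    note T = T_mult_diff[OF t False, folded s_def d_def] T_mult_swapped[OF t a False, folded s_def d_def]
    have x: "x a * matrix_unit t t z = matrix_unit t t (k * z)" "x a * matrix_unit s t z = matrix_unit s t (l * z)" for z
      using x_mult[OF t, of a t z] x_mult[OF s, of a t z] pos_sw[OF a False, of a] r by (simp_all add: s_def k_def l_def)
    have z: "l * (q *\<^sub>s p - d) = l - d * k" by (simp add: right_diff_distrib com dl scl_simps)
    have "T a * matrix_unit t t p = matrix_unit s t (q *\<^sub>s p - d) + matrix_unit t t d"
      by (simp add: T left_diff_distrib pp)
    then have "x a * (T a * matrix_unit t t p) = matrix_unit s t (l - d * k) + matrix_unit t t (d * k)"
      by (simp only: distrib_left x z com)
    then have "T a * (x a * (T a * matrix_unit t t p)) = T a * (matrix_unit s t (l - d * k) + matrix_unit t t (d * k))"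
      by (simp only:)
    also have "\<dots> = matrix_unit t t ((p + d) * (l - d * k) + d * (d * k)) +
        matrix_unit s t (((q - 1) *\<^sub>s p - d) * (l - d * k) + (q *\<^sub>s p - d) * (d * k))"
      by (simp only: distrib_left T matrix_unit_simps(1) add_ac)
    also have "(p + d) * (l - d * k) + d * (d * k) = q *\<^sub>s l"
      by (simp add: distrib_right right_diff_distrib dl scl_simps)
    also have "((q - 1) *\<^sub>s p - d) * (l - d * k) + (q *\<^sub>s p - d) * (d * k) = 0"
      by (simp add: left_diff_distrib right_diff_distrib dl scl_simps)
    finally show ?thesis
      by (simp add: mult.assoc x_mult[OF t] matrix_unit_simps flip: l_def)
  qed
qed

lemma x_x:
  assumes a: "a \<in> {1..n}" and c: "c \<in> {1..n}"
  shows "x a * x c = x c * x a"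
proof (rule eqI)
  show "x a * x c * unit = x a * x c" "x c * x a * unit = x c * x a"
    using x_corner[OF a] x_corner[OF c] by (simp_all add: in_corner_def mult.assoc)
  fix t assume t: "t \<in> Cl"
  note k = pos_Cl(1)[OF t a] pos_Cl(1)[OF t c]
  show "x a * x c * matrix_unit t t p = x c * x a * matrix_unit t t p"
    using k y_y[OF k] by (simp add: mult.assoc x_mult[OF t])
qed

lemma x_T:
  assumes a: "a \<in> {1..<n}" and c: "c \<in> {1..n}" "c \<noteq> a" "c \<noteq> Suc a"
  shows "x c * T a = T a * x c"
proof (rule eqI)
  have r: "a \<in> {1..n}" "Suc a \<in> {1..n}" using a by auto
  show "x c * T a * unit = x c * T a" "T a * x c * unit = T a * x c"
    using T_corner[OF a] x_corner[OF c(1)] by (simp_all add: in_corner_def mult.assoc)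
  fix t assume t: "t \<in> Cl"
  note l = pos_Cl(1)[OF t c(1)]
  show "x c * T a * matrix_unit t t p = T a * x c * matrix_unit t t p"
  proof (cases "t a = t (Suc a)")
    case True
    note k = pos_same[OF t a True]
    have "\<tau> (pos n t a) * y (pos n t c) = y (pos n t c) * \<tau> (pos n t a)"
      using pos_neq[OF t c(1) r(1) c(2)] pos_neq[OF t c(1) r(2) c(3)] pos_Suc[of t a n, OF True]
      by (intro \<tau>_y k l) auto
    then show ?thesis using k l by (simp add: mult.assoc T_mult_same[OF t True] x_mult[OF t])
  next
    case False
    define s where "s = t \<circ> sw a"
    have t': "s \<in> Cl" using Cl_sw[OF t a] by (simp add: s_def)
    have "pos n s c = pos n t c" using pos_sw[OF a False c(1)] c by (simp add: s_def sw_other)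
    moreover note \<beta>_corner[OF t r False] \<beta>_y[OF t r False l]
    ultimately show ?thesis
      using l by (simp add: mult.assoc T_mult_diff[OF t False, folded s_def] x_mult[OF t] x_mult[OF t'] distrib_left
          left_diff_distrib right_diff_distrib pp)
  qed
qed

lemma T_T:
  assumes a: "a \<in> {1..<n}" and c: "c \<in> {1..<n}" and far: "Suc a < c"
  shows "T a * T c = T c * T a"
proof (rule eqI)
  have r: "a \<in> {1..n}" "Suc a \<in> {1..n}" "c \<in> {1..n}" "Suc c \<in> {1..n}" using a c by auto
  show "T a * T c * unit = T a * T c" "T c * T a * unit = T c * T a"
    using T_corner[OF a] T_corner[OF c] by (simp_all add: in_corner_def mult.assoc)
  fix t assume t: "t \<in> Cl"
  define s r' where "s = t \<circ> sw a" and "r' = t \<circ> sw c"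
  have s: "s \<in> Cl" "r' \<in> Cl" using Cl_sw[OF t] a c by (auto simp: s_def r'_def)
  have v: "s c = t c" "s (Suc c) = t (Suc c)" "r' a = t a" "r' (Suc a) = t (Suc a)"
    using far by (simp_all add: s_def r'_def sw_other)
  have comp: "r' \<circ> sw a = s \<circ> sw c" by (simp only: s_def r'_def comp_assoc sw_far[OF far])
  have pc: "pos n s c = pos n t c" "pos n s (Suc c) = pos n t (Suc c)" if "t a \<noteq> t (Suc a)"
    using pos_sw[OF a that] r far by (simp_all add: s_def r'_def sw_other)
  have pa: "pos n r' a = pos n t a" "pos n r' (Suc a) = pos n t (Suc a)" if "t c \<noteq> t (Suc c)"
    using pos_sw[OF c that] r far by (simp_all add: s_def r'_def sw_other)
  have neq: "pos n t a \<noteq> pos n t c" "pos n t a \<noteq> pos n t (Suc c)" "pos n t (Suc a) \<noteq> pos n t c" "pos n t (Suc a) \<noteq> pos n t (Suc c)"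
    using pos_neq[OF t] r far by auto
  note k = pos_Cl(1)[OF t r(1)] pos_Cl(1)[OF t r(2)] pos_Cl(1)[OF t r(3)] pos_Cl(1)[OF t r(4)]
  have \<beta>\<tau>: "\<tau> (pos n t g) * \<beta> t h (Suc h) = \<beta> t h (Suc h) * \<tau> (pos n t g)"
    if "t g = t (Suc g)" "t h \<noteq> t (Suc h)" "(g, h) \<in> {(a, c), (c, a)}" for g h
  proof (rule \<beta>_commute[OF t _ _ that(2)])
    have g: "g \<in> {1..<n}" using that(3) a c by auto
    note kg = pos_same[OF t g that(1)]
    have "pos n t h \<noteq> pos n t g" "pos n t h \<noteq> pos n t (Suc g)" "pos n t (Suc h) \<noteq> pos n t g" "pos n t (Suc h) \<noteq> pos n t (Suc g)"
      using that(3) neq by auto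
    moreover have "pos n t h \<in> {1..n}" "pos n t (Suc h) \<in> {1..n}" using that(3) k by auto
    ultimately show "\<tau> (pos n t g) * y (pos n t h) = y (pos n t h) * \<tau> (pos n t g)"
      "\<tau> (pos n t g) * y (pos n t (Suc h)) = y (pos n t (Suc h)) * \<tau> (pos n t g)"
      using \<tau>_y[OF kg] pos_Suc[of t g n, OF that(1)] by auto
    show "\<tau> (pos n t g) * p = p * \<tau> (pos n t g)" using kg by simp
    show "h \<in> {1..n}" "Suc h \<in> {1..n}" using that(3) r by auto
  qed
  show "T a * T c * matrix_unit t t p = T c * T a * matrix_unit t t p"
  proof (cases "t a = t (Suc a)"; cases "t c = t (Suc c)")
    assume eq: "t a = t (Suc a)" "t c = t (Suc c)"
    note ka = pos_same[OF t a eq(1)] and kc = pos_same[OF t c eq(2)]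
    have "Suc (pos n t a) < pos n t c \<or> Suc (pos n t c) < pos n t a"
      using neq pos_Suc[of t a n, OF eq(1)] pos_Suc[of t c n, OF eq(2)] by linarith
    then have "\<tau> (pos n t a) * \<tau> (pos n t c) = \<tau> (pos n t c) * \<tau> (pos n t a)"
      using \<tau>_\<tau>[OF ka kc] \<tau>_\<tau>[OF kc ka] by auto
    then show ?thesis using ka kc by (simp add: mult.assoc T_mult_same[OF t eq(1)] T_mult_same[OF t eq(2)])
  next
    assume ne: "t a = t (Suc a)" "t c \<noteq> t (Suc c)"
    note ka = pos_same[OF t a ne(1)] and b = \<beta>_corner[OF t r(3,4) ne(2)]
    have "r' a = r' (Suc a)" using v ne by simp
    note m = T_mult_same[OF s(2) this] T_mult_same[OF t ne(1)] T_mult_diff[OF t ne(2), folded r'_def]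
    show ?thesis
      using ka b pa(1)[OF ne(2)] \<beta>\<tau>[OF ne]
      by (simp add: mult.assoc m distrib_left left_diff_distrib right_diff_distrib pp)
  next
    assume ne: "t a \<noteq> t (Suc a)" "t c = t (Suc c)"
    note kc = pos_same[OF t c ne(2)] and b = \<beta>_corner[OF t r(1,2) ne(1)]
    have "s c = s (Suc c)" using v ne by simp
    note m = T_mult_same[OF s(1) this] T_mult_same[OF t ne(2)] T_mult_diff[OF t ne(1), folded s_def]
    show ?thesis
      using kc b pc(1)[OF ne(1)] \<beta>\<tau>[OF ne(2,1)]
      by (simp add: mult.assoc m distrib_left left_diff_distrib right_diff_distrib pp)
  next
    assume ne: "t a \<noteq> t (Suc a)" "t c \<noteq> t (Suc c)"
    define d f where "d = \<beta> t a (Suc a)" and "f = \<beta> t c (Suc c)"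
    have [simp]: "p * d = d" "d * p = d" "p * f = f" "f * p = f"
      unfolding d_def f_def using \<beta>_corner[OF t r(1,2) ne(1)] \<beta>_corner[OF t r(3,4) ne(2)] by auto
    have df: "d * f = f * d" unfolding d_def f_def by (rule \<beta>_\<beta>[OF t r(1,2) ne(1) r(3,4) ne(2)])
    have ne': "s c \<noteq> s (Suc c)" "r' a \<noteq> r' (Suc a)" using v ne by auto
    note m = T_mult_diff[OF t ne(1), folded d_def s_def] T_mult_diff[OF t ne(2), folded f_def r'_def]
    have m': "T c * matrix_unit s t z = matrix_unit (s \<circ> sw c) t ((q *\<^sub>s p - f) * z) + matrix_unit s t (f * z)"
        "T a * matrix_unit r' t z = matrix_unit (s \<circ> sw c) t ((q *\<^sub>s p - d) * z) + matrix_unit r' t (d * z)" for z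
      using T_mult_diff[OF s(1) ne'(1)] T_mult_diff[OF s(2) ne'(2)]
      by (simp_all only: pc[OF ne(1)] pa[OF ne(2)] d_def f_def comp)
    show ?thesis
      by (simp add: mult.assoc m m' distrib_left left_diff_distrib right_diff_distrib df pp matrix_unit_simps add_ac scl_simps)
  qed
qed


sublocale braid_system q n Cl e \<sigma> b T
proof
  fix t a assume t: "t \<in> Cl" and a: "a \<in> {1..<n}"
  show "t \<circ> sw a \<in> Cl" by (rule Cl_sw[OF t a])
  define s where "s = t \<circ> sw a"
  have s: "s \<in> Cl" "s \<circ> sw a = t" using Cl_sw[OF t a] by (simp_all add: s_def)
  have ra: "a \<in> {1..n}" "Suc a \<in> {1..n}" using a by auto
  show "e (t \<circ> sw a) * \<sigma> a t = \<sigma> a t" "\<sigma> a t * e t = \<sigma> a t" "\<sigma> a (t \<circ> sw a) * \<sigma> a t = e t"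
    unfolding s_def[symmetric] e_def \<sigma>_def s(2) by (simp_all add: matrix_unit_mult pp)
  show "T a * e t = \<sigma> a t * (q *\<^sub>s e t - b a (Suc a) t) + b a (Suc a) t" if "t a \<noteq> t (Suc a)"
    unfolding e_def \<sigma>_def b_def T_mult_diff[OF t that] s_def[symmetric]
    using \<beta>_corner[OF t ra that] by (simp add: matrix_unit_mult pp left_diff_distrib right_diff_distrib matrix_unit_simps)
  show "T a * e t = e t * T a" if same: "t a = t (Suc a)"
    using e_T[OF t a same] T_mult_same[OF t same, of t p] pos_same[OF t a same] by (simp add: e_def)
  show "T a * T a * e t = (q - 1) *\<^sub>s (T a * e t) + q *\<^sub>s e t"
    unfolding T_quadratic[OF a] by (simp add: distrib_right e_def e_unit[OF t] pp)
  show "b c d (t \<circ> sw a) * \<sigma> a t = \<sigma> a t * b (sw a c) (sw a d) t"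
    if d: "t a \<noteq> t (Suc a)" "c \<in> {1..n}" "d \<in> {1..n}" "t (sw a c) \<noteq> t (sw a d)" for c d
  proof -
    have "\<beta> s c d = \<beta> t (sw a c) (sw a d)" using \<beta>_sw[OF a d(1-3)] by (simp add: s_def)
    moreover have "sw a c \<in> {1..n}" "sw a d \<in> {1..n}" using sw_range[OF a] d by auto
    ultimately show ?thesis
      unfolding s_def[symmetric] b_def \<sigma>_def using \<beta>_corner[OF t _ _ d(4)] by (simp add: matrix_unit_mult)
  qed
  fix c assume same: "t a = t (Suc a)" and c: "c \<in> {1..n}" "t c \<noteq> t a"
  note k = pos_same[OF t a same] and l = pos_Cl(1)[OF t c(1)]
  let ?k = "pos n t a" and ?l = "pos n t c"
  interpret pair: affine_pair p q "\<tau> ?k" "y ?k" "y (Suc ?k)" by (rule \<tau>_pair[OF k])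
  have Suc_k: "pos n t (Suc a) = Suc ?k" using pos_Suc[of t a n] same by simp
  have ne: "t a \<noteq> t c" "t (Suc a) \<noteq> t c" "c \<noteq> a" "c \<noteq> Suc a" using c same by auto
  have \<tau>y: "\<tau> ?k * y ?l = y ?l * \<tau> ?k"
    using pos_neq[OF t c(1) ra(1) ne(3)] pos_neq[OF t c(1) ra(2) ne(4)] Suc_k by (intro \<tau>_y k l) auto
  obtain d1 where d1: "scatter_pair p (y ?k) (y ?l) d1" using pair_data[OF t ra(1) c(1) ne(1)] .
  obtain d2 where d2: "scatter_pair p (y (Suc ?k)) (y ?l) d2"
    using pair_data[OF t ra(2) c(1) ne(2)] Suc_k by auto
  have \<tau>p: "\<tau> ?k * p = p * \<tau> ?k" by simp
  note s = pair.T_scatter[OF \<tau>p \<tau>y scatter_pair.d[OF d1] scatter_pair.d[OF d2]]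
    pair.T_scatter'[OF \<tau>p \<tau>y scatter_pair.d[OF d1] scatter_pair.d[OF d2]]
  note \<beta>' = scatter_pair.scatter_eq[OF d1] scatter_pair.scatter_eq[OF d2]
  have Tb: "matrix_unit t t z * T a = matrix_unit t t (z * \<tau> ?k)" if "z * p = z" for z
  proof -
    have "matrix_unit t t z * T a = matrix_unit t t z * (e t * T a)"
      using that by (simp add: e_def matrix_unit_mult flip: mult.assoc)
    then show ?thesis by (simp add: e_T[OF t a same] matrix_unit_mult)
  qed
  note b1 = \<beta>_corner(2)[OF t ra(1) c(1) ne(1)] and b2 = \<beta>_corner(2)[OF t ra(2) c(1) ne(2)]
  show "T a * b (Suc a) c t = b a c t * T a + b a c t * b (Suc a) c t - (q - 1) *\<^sub>s b a c t"
    unfolding b_def T_mult_same[OF t same] Tb[OF b1]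
    unfolding Suc_k \<beta>' s(1) by (simp only: matrix_unit_mult if_True refl) (simp only: matrix_unit_simps)
  show "T a * b a c t = b (Suc a) c t * T a - b (Suc a) c t * b a c t + (q - 1) *\<^sub>s b a c t"
    unfolding b_def T_mult_same[OF t same] Tb[OF b2]
    unfolding Suc_k \<beta>' s(2) by (simp only: matrix_unit_mult if_True refl) (simp only: matrix_unit_simps)
next
  fix t c d assume t: "t \<in> Cl" and c: "c \<in> {1..n}" "d \<in> {1..n}" "t c \<noteq> t d"
  note k = pos_Cl(1)[OF t c(1)] and l = pos_Cl(1)[OF t c(2)]
  show "e t * b c d t = b c d t \<and> b c d t * e t = b c d t"
    unfolding e_def b_def using \<beta>_corner[OF t c] by (simp add: matrix_unit_mult)
  show "b c d t + b d c t = (q - 1) *\<^sub>s e t"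
    unfolding e_def b_def using \<beta>_swap[OF t c] by (simp flip: matrix_unit_simps)
  show "b c d t * b c' d' t = b c' d' t * b c d t" if "c' \<in> {1..n}" "d' \<in> {1..n}" "t c' \<noteq> t d'" for c' d'
    unfolding b_def using \<beta>_\<beta>[OF t c that] by (simp add: matrix_unit_mult)
  obtain w where w: "is_inverse p ((y (pos n t d) - q *\<^sub>s y (pos n t c)) * p) w" using inverses(2)[OF t c] by blast
  obtain w' where w': "scatter_pair p (y (pos n t c)) (y (pos n t d)) w'" using pair_data[OF t c] .
  have "is_inverse p (q *\<^sub>s p - \<beta> t c d) ((y (pos n t d) - y (pos n t c)) * w)"
    using scatter_pair.scatter_inverse(1)[OF w' w] .
  then have "is_inverse (e t) (q *\<^sub>s e t - b c d t) (matrix_unit t t ((y (pos n t d) - y (pos n t c)) * w))"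
    unfolding e_def b_def is_inverse_def by (simp add: matrix_unit_mult flip: matrix_unit_simps)
  then show "\<exists>w. is_inverse (e t) (q *\<^sub>s e t - b c d t) w" by blast
  show "(q - 1) *\<^sub>s b c f t - b c d t * b c f t + b c d t * b d f t - b d f t * b c f t = 0"
    if f: "f \<in> {1..n}" "t c \<noteq> t f" "t d \<noteq> t f" for f
  proof -
    obtain w1 where w1: "scatter_pair p (y (pos n t d)) (y (pos n t f)) w1" using pair_data[OF t c(2) f(1,3)] .
    obtain w2 where w2: "scatter_pair p (y (pos n t c)) (y (pos n t f)) w2" using pair_data[OF t c(1) f(1,2)] .
    have "(q - 1) *\<^sub>s \<beta> t c f - \<beta> t c d * \<beta> t c f + \<beta> t c d * \<beta> t d f - \<beta> t d f * \<beta> t c f = 0"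
      by (rule scatter_triple[OF w' w1 w2])
    then show ?thesis unfolding b_def by (simp add: matrix_unit_mult flip: matrix_unit_simps)
  qed
qed (simp add: e_def matrix_unit_mult pp)

lemma defect_same:
  assumes t: "t \<in> Cl" and a: "1 \<le> a" "Suc a < n" and same: "t a = t (Suc a)" "t (Suc a) = t (Suc (Suc a))"
  shows "defect a * e t = 0"
proof -
  have r: "a \<in> {1..<n}" "Suc a \<in> {1..<n}" using a by auto
  note T = T_mult_same[OF t same(1)] T_mult_same[OF t same(2)]
  note k = pos_same[OF t r(1) same(1)] and l = pos_same[OF t r(2) same(2)]
  have s: "pos n t (Suc a) = Suc (pos n t a)" using pos_Suc[of t a n] same by simp
  have "\<tau> (pos n t a) * \<tau> (Suc (pos n t a)) * \<tau> (pos n t a) = \<tau> (Suc (pos n t a)) * \<tau> (pos n t a) * \<tau> (Suc (pos n t a))"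
    using k l s by (intro \<tau>_braid) auto
  then show ?thesis
    unfolding defect_def e_def left_diff_distrib mult.assoc using k l by (simp only: T s mult.assoc \<tau>_unit diff_self)
qed

text \<open>The double crossing is a permutation of summands, and both sides act by the same
  \<open>\<tau>\<close> because stable sorting sends the equal pair to the same place before and
  after the crossing.\<close>

lemma defect_pair:
  assumes t: "t \<in> Cl" and a: "1 \<le> a" "Suc a < n" and d: "t a = t (Suc a)" "t (Suc a) \<noteq> t (Suc (Suc a))"
  shows "defect a * e t = 0"
proof -
  have r: "a \<in> {1..<n}" "Suc a \<in> {1..<n}" "a \<in> {1..n}" using a by auto
  define s where "s = t \<circ> sw (Suc a)"
  define r where "r = s \<circ> sw a"
  have s: "s \<in> Cl" "s a \<noteq> s (Suc a)" using Cl_sw[OF t r(2)] d by (simp_all add: s_def sw_other)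
  have r': "r \<in> Cl" "r (Suc a) = r (Suc (Suc a))" using Cl_sw[OF s(1) r(1)] d by (simp_all add: r_def s_def sw_other)
  have "pos n r (Suc a) = pos n s a" using pos_sw[OF r(1) s(2), of "Suc a"] a by (simp add: r_def)
  also have "\<dots> = pos n t a" using pos_sw[OF r(2) d(2) r(3)] by (simp add: s_def sw_other)
  finally have pos: "pos n r (Suc a) = pos n t a" .
  have "\<sigma> a s * \<sigma> (Suc a) t = matrix_unit r t p" by (simp add: \<sigma>_def matrix_unit_mult pp flip: s_def r_def)
  moreover have "matrix_unit r t p * T a * e t = matrix_unit r t (\<tau> (pos n t a))"
    using pos_same[OF t r(1) d(1)] by (simp add: e_def mult.assoc T_mult_same[OF t d(1)] matrix_unit_mult)
  moreover have "T (Suc a) * matrix_unit r t p = matrix_unit r t (\<tau> (pos n t a))"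
    using pos_same[OF t r(1) d(1)] pos by (simp add: T_mult_same[OF r'])
  ultimately show ?thesis
    using defect_mixed[OF t a d, folded s_def] by simp
qed

text \<open>Equal colours and the pattern \<open>iij\<close> are immediate, and for three colours
  the permutations satisfy the braid relation. The patterns \<open>iji\<close> and
  \<open>jii\<close> are reached from \<open>iij\<close> by swaps along which the vanishing of the
  defect is transported.\<close>

lemma defect_0:
  assumes a: "1 \<le> a" "Suc a < n"
  shows "defect a = 0"
proof (rule eqI)
  have r: "a \<in> {1..<n}" "Suc a \<in> {1..<n}" using a by auto
  note c = T_corner[OF r(1), unfolded in_corner_def] T_corner[OF r(2), unfolded in_corner_def]
  show "defect a * unit = defect a" using c by (simp add: defect_def left_diff_distrib mult.assoc)
  have quad: "T c * T c = (q - 1) *\<^sub>s T c + q *\<^sub>s unit" "unit * T c = T c \<and> T c * unit = T c" if "c \<in> {a, Suc a}" for c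
    using T_quadratic[of c] T_corner[of c] that r by (auto simp: in_corner_def)
  note transport = defect_transport[OF quad]
  have iji: "defect a * e t = 0" if t: "t \<in> Cl" and d: "t a = t (Suc (Suc a))" "t a \<noteq> t (Suc a)" for t
  proof -
    define s where "s = t \<circ> sw (Suc a)"
    have s: "s \<in> Cl" "s a = s (Suc a)" "s (Suc a) \<noteq> s (Suc (Suc a))" "s \<circ> sw (Suc a) = t"
      using Cl_sw[OF t r(2)] d by (simp_all add: s_def sw_other)
    show ?thesis
      using defect_move[OF s(1) r(2) s(3) transport(1) defect_pair[OF s(1) a s(2,3)]] s(4) by simp
  qed
  fix t assume t: "t \<in> Cl"
  consider "t a = t (Suc a)" "t (Suc a) = t (Suc (Suc a))" | "t a = t (Suc a)" "t (Suc a) \<noteq> t (Suc (Suc a))"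
    | "t a = t (Suc (Suc a))" "t a \<noteq> t (Suc a)" | "t a \<noteq> t (Suc a)" "t (Suc a) = t (Suc (Suc a))"
    | "t a \<noteq> t (Suc a)" "t a \<noteq> t (Suc (Suc a))" "t (Suc a) \<noteq> t (Suc (Suc a))"
    by metis
  then have "defect a * e t = 0"
  proof cases
    case 1
    then show ?thesis by (rule defect_same[OF t a])
  next
    case 2
    then show ?thesis by (rule defect_pair[OF t a])
  next
    case 3
    then show ?thesis by (rule iji[OF t])
  next
    case 4
    define s where "s = t \<circ> sw a"
    have s: "s \<in> Cl" "s a = s (Suc (Suc a))" "s a \<noteq> s (Suc a)" "s \<circ> sw a = t"
      using Cl_sw[OF t r(1)] 4 by (simp_all add: s_def sw_other)
    show ?thesis
      using defect_move[OF s(1) r(1) s(3) transport(2) iji[OF s(1-3)]] s(4) by simp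
  next
    case 5
    then show ?thesis
      unfolding defect_distinct[OF t a 5] \<sigma>_def by (simp only: matrix_unit_mult pp refl if_True comp_assoc) (simp only: sw_braid flip: comp_assoc)
  qed
  then show "defect a * matrix_unit t t p = 0 * matrix_unit t t p" by (simp add: e_def)
qed (simp)

lemma hecke_tuple:
  assumes P: "\<And>t. t \<in> Cl \<Longrightarrow> peval p P (y (pos n t 1)) = 0"
  shows "hecke_tuple unit q P n (x 1) T"
proof -
  have r: "1 \<in> {1..n}" using n_pos by auto
  note xc = x_corner[OF r]
  have kill: "peval unit P (x 1) = 0"
  proof (rule eqI)
    show "peval unit P (x 1) * unit = peval unit P (x 1)" by (rule peval_corner(2)[OF unit_unit xc])
    fix t assume t: "t \<in> Cl"
    let ?m = "matrix_unit t t p"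
    note y = y_corner[OF pos_Cl(1)[OF t r]] pos_Cl(1)[OF t r]
    have "?m * peval ?m P (matrix_unit t t (y (pos n t 1))) = peval unit P (x 1) * ?m"
      using y by (intro peval_intertwine) (simp_all add: e_unit[OF t] x_mult[OF t] matrix_unit_mult pp)
    then show "peval unit P (x 1) * ?m = 0 * ?m"
      unfolding peval_matrix_unit[OF y(1)] P[OF t] by (simp add: matrix_unit_simps)
  qed simp
  have quad: "(T a + unit) * (T a - q *\<^sub>s unit) = 0" if a: "a \<in> {1..<n}" for a
    using T_corner[OF a] by (simp add: in_corner_def distrib_right right_diff_distrib T_quadratic[OF a] unit_unit scl_simps)
  have STST: "x 1 * T 1 * x 1 * T 1 = T 1 * x 1 * T 1 * x 1" if "1 < n"
  proof -
    \<comment> \<open>Up to the factor \<open>q\<close> this is \<open>x 2\<close>, so the relation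
      is the commutation of \<open>x 1\<close> with \<open>x 2\<close>.\<close>
    have TxT: "T 1 * (x 1 * T 1) = q *\<^sub>s x 2" using T_x_T[of 1] that by (simp add: mult.assoc numeral_2_eq_2)
    have "x 1 * (T 1 * (x 1 * T 1)) = T 1 * (x 1 * T 1) * x 1"
      unfolding TxT using x_x[of 1 2] that by simp
    then show ?thesis by (simp only: mult.assoc)
  qed
  have ST: "x 1 * T a = T a * x 1" if "a \<in> {1..<n}" "1 < a" for a using x_T[OF that(1) r] that by simp
  have TTT: "T a * T (a + 1) * T a = T (a + 1) * T a * T (a + 1)" if "1 \<le> a" "a + 1 < n" for a
    using defect_0[of a] that by (simp add: defect_def)
  have TT: "T a * T c = T c * T a" if "a \<in> {1..<n}" "c \<in> {1..<n}" "a + 1 < c" for a c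
    using T_T[OF that(1,2)] that(3) by simp
  show ?thesis
    unfolding hecke_tuple_def using unit_unit xc kill T_corner quad STST ST TTT TT by blast
qed

lemma jm_eq: "1 \<le> c \<Longrightarrow> c \<le> n \<Longrightarrow> jm q (x 1) T c = x c"
proof (induction c rule: nat_induct_at_least)
  case base
  then show ?case by (simp add: jm.simps)
next
  case (Suc c)
  then show ?case using T_x_T[of c] q0 by (simp add: jm.simps)
qed

end

section \<open>Recognising a sum of matrix algebras by matrix coefficients\<close>

section \<open>Matrix decompositions\<close>

text \<open>The elements \<open>u \<nu> i\<close> and \<open>w \<nu> i\<close> act as columns and
  rows. That the products \<open>u w\<close> sum to the unit gives multiplicativity and injectivity
  of the coefficient map; the orthogonality of the \<open>w u\<close> shows that sandwiching entries
  between \<open>u\<close> and \<open>w\<close> inverts it. Everything is computed in one faithful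
  representation of \<open>A\<close>.\<close>

lemma matrix_decomposition:
  fixes A :: "('f::field, 'a) module" and C :: "'l \<Rightarrow> ('f, 'b) module"
    and \<rho> :: "'a \<Rightarrow> ('x, 'f) endo" and \<theta> :: "'l \<Rightarrow> 'b \<Rightarrow> ('x, 'f) endo" and m :: "'l \<Rightarrow> nat"
  assumes A: "falgebra A" "alg_rep A p \<rho>" "inj_on \<rho> (carrier A)" and fin: "finite L"
    and C: "\<And>\<nu>. \<nu> \<in> L \<Longrightarrow> falgebra (C \<nu>)" "\<And>\<nu>. \<nu> \<in> L \<Longrightarrow> alg_rep (C \<nu>) (\<epsilon> \<nu>) (\<theta> \<nu>)"
      "\<And>\<nu>. \<nu> \<in> L \<Longrightarrow> inj_on (\<theta> \<nu>) (carrier (C \<nu>))" "\<And>\<nu>. \<nu> \<in> L \<Longrightarrow> \<theta> \<nu> ` carrier (C \<nu>) \<subseteq> \<rho> ` carrier A"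
    and u: "\<And>\<nu> i. \<nu> \<in> L \<Longrightarrow> i < m \<nu> \<Longrightarrow> u \<nu> i \<in> \<rho> ` carrier A"
    and w: "\<And>\<nu> i. \<nu> \<in> L \<Longrightarrow> i < m \<nu> \<Longrightarrow> w \<nu> i \<in> \<rho> ` carrier A"
    and wu: "\<And>\<nu> \<mu> i k. \<nu> \<in> L \<Longrightarrow> \<mu> \<in> L \<Longrightarrow> i < m \<nu> \<Longrightarrow> k < m \<mu> \<Longrightarrow>
        w \<nu> i * u \<mu> k = (if \<nu> = \<mu> \<and> i = k then \<epsilon> \<nu> else 0)"
    and uw: "(\<Sum>\<nu>\<in>L. \<Sum>i<m \<nu>. u \<nu> i * w \<nu> i) = p"
    and coefficient: "\<And>x \<nu> i k. x \<in> carrier A \<Longrightarrow> \<nu> \<in> L \<Longrightarrow> i < m \<nu> \<Longrightarrow> k < m \<nu> \<Longrightarrow>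
        w \<nu> i * \<rho> x * u \<nu> k \<in> \<theta> \<nu> ` carrier (C \<nu>)"
    and off_diagonal: "\<And>x \<nu> \<mu> i k. x \<in> carrier A \<Longrightarrow> \<nu> \<in> L \<Longrightarrow> \<mu> \<in> L \<Longrightarrow> \<nu> \<noteq> \<mu> \<Longrightarrow> i < m \<nu> \<Longrightarrow> k < m \<mu> \<Longrightarrow>
        w \<nu> i * \<rho> x * u \<mu> k = 0"
  shows "\<exists>\<Phi>. \<Phi> \<in> algebra_iso A (direct_sum_algebra L (\<lambda>\<nu>. matrix_algebra (m \<nu>) (C \<nu>)))"
proof -
  interpret A: representation A p \<rho>
    using A by (simp add: representation_def representation_axioms_def)
  have rep: "representation (C \<nu>) (\<epsilon> \<nu>) (\<theta> \<nu>)" if "\<nu> \<in> L" for \<nu>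
    using C that by (simp add: representation_def representation_axioms_def)
  have ring: "ring (C \<nu>)" if "\<nu> \<in> L" for \<nu>
    using C(1)[OF that] by (simp add: falgebra_def)
  define D where "D = direct_sum_algebra L (\<lambda>\<nu>. matrix_algebra (m \<nu>) (C \<nu>))"
  note D_simps = D_def direct_sum_algebra_def matrix_algebra_def
  \<comment> \<open>The coefficient lies in the image of \<open>\<theta> \<nu>\<close>, and
    faithfulness allows it to be read in \<open>C \<nu>\<close>.\<close>
  define \<Phi> where "\<Phi> x = (\<lambda>\<nu>\<in>L. \<lambda>(i, k)\<in>{..<m \<nu>} \<times> {..<m \<nu>}.
      inv_into (carrier (C \<nu>)) (\<theta> \<nu>) (w \<nu> i * \<rho> x * u \<nu> k))" for x
  have entry: "f \<nu> (i, k) \<in> carrier (C \<nu>)" if "f \<in> carrier D" "\<nu> \<in> L" "i < m \<nu>" "k < m \<nu>" for f \<nu> i k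
    using that by (fastforce simp: D_simps PiE_iff)
  have eqI: "f = g" if f: "f \<in> carrier D" "g \<in> carrier D"
    and eq: "\<And>\<nu> i k. \<nu> \<in> L \<Longrightarrow> i < m \<nu> \<Longrightarrow> k < m \<nu> \<Longrightarrow> \<theta> \<nu> (f \<nu> (i, k)) = \<theta> \<nu> (g \<nu> (i, k))" for f g
  proof (rule PiE_ext)
    show "f \<in> (\<Pi>\<^sub>E \<nu>\<in>L. carrier (matrix_algebra (m \<nu>) (C \<nu>)))" "g \<in> (\<Pi>\<^sub>E \<nu>\<in>L. carrier (matrix_algebra (m \<nu>) (C \<nu>)))"
      using f by (simp_all add: D_def direct_sum_algebra_def)
    fix \<nu> assume \<nu>: "\<nu> \<in> L"
    show "f \<nu> = g \<nu>"
    proof (rule PiE_ext)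
      show "f \<nu> \<in> {..<m \<nu>} \<times> {..<m \<nu>} \<rightarrow>\<^sub>E carrier (C \<nu>)" "g \<nu> \<in> {..<m \<nu>} \<times> {..<m \<nu>} \<rightarrow>\<^sub>E carrier (C \<nu>)"
        using f \<nu> by (auto simp: D_simps PiE_iff)
      fix r assume r: "r \<in> {..<m \<nu>} \<times> {..<m \<nu>}"
      then obtain i k where ik: "r = (i, k)" "i < m \<nu>" "k < m \<nu>" by auto
      show "f \<nu> r = g \<nu> r"
        unfolding ik(1) using C(3)[OF \<nu>] eq[OF \<nu> ik(2,3)] entry[OF f(1) \<nu> ik(2,3)] entry[OF f(2) \<nu> ik(2,3)]
        by (auto dest: inj_onD)
    qed
  qed
  have \<Phi>_entry: "\<theta> \<nu> (\<Phi> x \<nu> (i, k)) = w \<nu> i * \<rho> x * u \<nu> k"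
    if "x \<in> carrier A" "\<nu> \<in> L" "i < m \<nu>" "k < m \<nu>" for x \<nu> i k
    using that coefficient[OF that] by (simp add: \<Phi>_def f_inv_into_f)
  have \<Phi>_closed: "\<Phi> x \<in> carrier D" if "x \<in> carrier A" for x
    using coefficient[OF that] by (auto simp: \<Phi>_def D_simps intro!: inv_into_into split: if_splits)
  have mult_closed: "f \<otimes>\<^bsub>D\<^esub> g \<in> carrier D" if "f \<in> carrier D" "g \<in> carrier D" for f g
  proof -
    have "(\<Oplus>\<^bsub>C \<nu>\<^esub>l\<in>{..<m \<nu>}. f \<nu> (i, l) \<otimes>\<^bsub>C \<nu>\<^esub> g \<nu> (l, k)) \<in> carrier (C \<nu>)" if "\<nu> \<in> L" "i < m \<nu>" "k < m \<nu>" for \<nu> i k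
    proof -
      interpret ring "C \<nu>" using ring[OF that(1)] .
      show ?thesis using entry[OF \<open>f \<in> carrier D\<close> that(1,2)] entry[OF \<open>g \<in> carrier D\<close> that(1) _ that(3)]
        by (intro finsum_closed) auto
    qed
    then show ?thesis by (auto simp: D_simps split: if_splits)
  qed
  have add_closed: "f \<oplus>\<^bsub>D\<^esub> g \<in> carrier D" if "f \<in> carrier D" "g \<in> carrier D" for f g
  proof -
    have "f \<nu> (i, k) \<oplus>\<^bsub>C \<nu>\<^esub> g \<nu> (i, k) \<in> carrier (C \<nu>)" if "\<nu> \<in> L" "i < m \<nu>" "k < m \<nu>" for \<nu> i k
    proof -
      interpret ring "C \<nu>" using ring[OF that(1)] .
      show ?thesis using entry[OF \<open>f \<in> carrier D\<close> that] entry[OF \<open>g \<in> carrier D\<close> that] by simp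
    qed
    then show ?thesis by (auto simp: D_simps split: if_splits)
  qed
  have smult_closed: "c \<odot>\<^bsub>D\<^esub> f \<in> carrier D" if "f \<in> carrier D" for c f
  proof -
    have "c \<odot>\<^bsub>C \<nu>\<^esub> f \<nu> (i, k) \<in> carrier (C \<nu>)" if "\<nu> \<in> L" "i < m \<nu>" "k < m \<nu>" for \<nu> i k
      using falgebra.smult_closed[OF C(1)] entry[OF \<open>f \<in> carrier D\<close> that] that by blast
    then show ?thesis by (auto simp: D_simps split: if_splits)
  qed
  have one_closed: "\<one>\<^bsub>D\<^esub> \<in> carrier D"
  proof -
    have "(if i = k then \<one>\<^bsub>C \<nu>\<^esub> else \<zero>\<^bsub>C \<nu>\<^esub>) \<in> carrier (C \<nu>)" if "\<nu> \<in> L" for \<nu> and i k :: nat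
    proof -
      interpret ring "C \<nu>" using ring[OF that(1)] .
      show ?thesis by simp
    qed
    then show ?thesis by (auto simp: D_simps split: if_splits)
  qed
  have product: "w \<nu> i * (\<rho> x * \<rho> y) * u \<nu> k = (\<Sum>l<m \<nu>. (w \<nu> i * \<rho> x * u \<nu> l) * (w \<nu> l * \<rho> y * u \<nu> k))"
    if x: "x \<in> carrier A" "y \<in> carrier A" and \<nu>: "\<nu> \<in> L" "i < m \<nu>" "k < m \<nu>" for x y \<nu> i k
  proof -
    have "w \<nu> i * (\<rho> x * \<rho> y) * u \<nu> k = w \<nu> i * \<rho> x * p * \<rho> y * u \<nu> k"
      using x by (simp add: mult.assoc)
    also have "\<dots> = (\<Sum>\<mu>\<in>L. \<Sum>l<m \<mu>. (w \<nu> i * \<rho> x * u \<mu> l) * (w \<mu> l * \<rho> y * u \<nu> k))"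
      unfolding uw[symmetric] by (simp add: sum_distrib_left sum_distrib_right mult.assoc)
    also have "\<dots> = (\<Sum>l<m \<nu>. (w \<nu> i * \<rho> x * u \<nu> l) * (w \<nu> l * \<rho> y * u \<nu> k)) +
        (\<Sum>\<mu>\<in>L - {\<nu>}. \<Sum>l<m \<mu>. (w \<nu> i * \<rho> x * u \<mu> l) * (w \<mu> l * \<rho> y * u \<nu> k))"
      by (rule sum.remove[OF fin \<nu>(1)])
    also have "(\<Sum>\<mu>\<in>L - {\<nu>}. \<Sum>l<m \<mu>. (w \<nu> i * \<rho> x * u \<mu> l) * (w \<mu> l * \<rho> y * u \<nu> k)) = 0"
      using off_diagonal[OF x(1) \<nu>(1) _ _ \<nu>(2)] by (intro sum.neutral ballI) auto
    finally show ?thesis by simp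
  qed
  have hom_mult: "\<Phi> (x \<otimes>\<^bsub>A\<^esub> y) = \<Phi> x \<otimes>\<^bsub>D\<^esub> \<Phi> y" if x: "x \<in> carrier A" "y \<in> carrier A" for x y
  proof (rule eqI)
    show "\<Phi> (x \<otimes>\<^bsub>A\<^esub> y) \<in> carrier D" "\<Phi> x \<otimes>\<^bsub>D\<^esub> \<Phi> y \<in> carrier D"
      using x by (auto intro: \<Phi>_closed mult_closed)
    fix \<nu> i k assume \<nu>: "\<nu> \<in> L" "i < m \<nu>" "k < m \<nu>"
    interpret C: representation "C \<nu>" "\<epsilon> \<nu>" "\<theta> \<nu>" by (rule rep[OF \<nu>(1)])
    have c: "\<Phi> x \<nu> (i, l) \<in> carrier (C \<nu>)" "\<Phi> y \<nu> (l, k) \<in> carrier (C \<nu>)" if "l < m \<nu>" for l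
      using entry[OF \<Phi>_closed[OF x(1)] \<nu>(1,2) that] entry[OF \<Phi>_closed[OF x(2)] \<nu>(1) that \<nu>(3)] by auto
    have "(\<Phi> x \<otimes>\<^bsub>D\<^esub> \<Phi> y) \<nu> (i, k) = (\<Oplus>\<^bsub>C \<nu>\<^esub>l\<in>{..<m \<nu>}. \<Phi> x \<nu> (i, l) \<otimes>\<^bsub>C \<nu>\<^esub> \<Phi> y \<nu> (l, k))"
      using \<nu> by (simp add: D_simps)
    also have "\<theta> \<nu> \<dots> = (\<Sum>l<m \<nu>. \<theta> \<nu> (\<Phi> x \<nu> (i, l) \<otimes>\<^bsub>C \<nu>\<^esub> \<Phi> y \<nu> (l, k)))"
      using c by (intro C.hom_finsum) auto
    also have "\<dots> = (\<Sum>l<m \<nu>. (w \<nu> i * \<rho> x * u \<nu> l) * (w \<nu> l * \<rho> y * u \<nu> k))"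
      using c x \<nu> by (intro sum.cong refl) (simp add: \<Phi>_entry)
    finally show "\<theta> \<nu> (\<Phi> (x \<otimes>\<^bsub>A\<^esub> y) \<nu> (i, k)) = \<theta> \<nu> ((\<Phi> x \<otimes>\<^bsub>D\<^esub> \<Phi> y) \<nu> (i, k))"
      using product[OF x \<nu>] x \<nu> by (simp add: \<Phi>_entry)
  qed
  have hom_add: "\<Phi> (x \<oplus>\<^bsub>A\<^esub> y) = \<Phi> x \<oplus>\<^bsub>D\<^esub> \<Phi> y" if x: "x \<in> carrier A" "y \<in> carrier A" for x y
  proof (rule eqI)
    show "\<Phi> (x \<oplus>\<^bsub>A\<^esub> y) \<in> carrier D" "\<Phi> x \<oplus>\<^bsub>D\<^esub> \<Phi> y \<in> carrier D"
      using x by (auto intro: \<Phi>_closed add_closed)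
    fix \<nu> i k assume \<nu>: "\<nu> \<in> L" "i < m \<nu>" "k < m \<nu>"
    interpret C: representation "C \<nu>" "\<epsilon> \<nu>" "\<theta> \<nu>" by (rule rep[OF \<nu>(1)])
    have "(\<Phi> x \<oplus>\<^bsub>D\<^esub> \<Phi> y) \<nu> (i, k) = \<Phi> x \<nu> (i, k) \<oplus>\<^bsub>C \<nu>\<^esub> \<Phi> y \<nu> (i, k)"
      using \<nu> by (simp add: D_simps)
    then show "\<theta> \<nu> (\<Phi> (x \<oplus>\<^bsub>A\<^esub> y) \<nu> (i, k)) = \<theta> \<nu> ((\<Phi> x \<oplus>\<^bsub>D\<^esub> \<Phi> y) \<nu> (i, k))"
      using entry[OF \<Phi>_closed[OF x(1)] \<nu>] entry[OF \<Phi>_closed[OF x(2)] \<nu>] x \<nu>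
      by (simp add: \<Phi>_entry distrib_left distrib_right)
  qed
  have hom_smult: "\<Phi> (c \<odot>\<^bsub>A\<^esub> x) = c \<odot>\<^bsub>D\<^esub> \<Phi> x" if x: "x \<in> carrier A" for c x
  proof (rule eqI)
    show "\<Phi> (c \<odot>\<^bsub>A\<^esub> x) \<in> carrier D" "c \<odot>\<^bsub>D\<^esub> \<Phi> x \<in> carrier D"
      using x by (auto intro: \<Phi>_closed smult_closed)
    fix \<nu> i k assume \<nu>: "\<nu> \<in> L" "i < m \<nu>" "k < m \<nu>"
    interpret C: representation "C \<nu>" "\<epsilon> \<nu>" "\<theta> \<nu>" by (rule rep[OF \<nu>(1)])
    have "(c \<odot>\<^bsub>D\<^esub> \<Phi> x) \<nu> (i, k) = c \<odot>\<^bsub>C \<nu>\<^esub> \<Phi> x \<nu> (i, k)"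
      using \<nu> by (simp add: D_simps)
    then show "\<theta> \<nu> (\<Phi> (c \<odot>\<^bsub>A\<^esub> x) \<nu> (i, k)) = \<theta> \<nu> ((c \<odot>\<^bsub>D\<^esub> \<Phi> x) \<nu> (i, k))"
      using entry[OF \<Phi>_closed[OF x] \<nu>] x \<nu> by (simp add: \<Phi>_entry)
  qed
  have hom_one: "\<Phi> \<one>\<^bsub>A\<^esub> = \<one>\<^bsub>D\<^esub>"
  proof (rule eqI)
    show "\<Phi> \<one>\<^bsub>A\<^esub> \<in> carrier D" "\<one>\<^bsub>D\<^esub> \<in> carrier D" by (auto intro: \<Phi>_closed one_closed)
    fix \<nu> i k assume \<nu>: "\<nu> \<in> L" "i < m \<nu>" "k < m \<nu>"
    interpret C: representation "C \<nu>" "\<epsilon> \<nu>" "\<theta> \<nu>" by (rule rep[OF \<nu>(1)])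
    obtain z where "z \<in> carrier A" "w \<nu> i = \<rho> z" using w[OF \<nu>(1,2)] by blast
    then have "w \<nu> i * p = w \<nu> i" by simp
    moreover have "\<one>\<^bsub>D\<^esub> \<nu> (i, k) = (if i = k then \<one>\<^bsub>C \<nu>\<^esub> else \<zero>\<^bsub>C \<nu>\<^esub>)" using \<nu> by (simp add: D_simps)
    ultimately show "\<theta> \<nu> (\<Phi> \<one>\<^bsub>A\<^esub> \<nu> (i, k)) = \<theta> \<nu> (\<one>\<^bsub>D\<^esub> \<nu> (i, k))"
      using \<nu> by (simp add: \<Phi>_entry wu)
  qed
  have inj: "inj_on \<Phi> (carrier A)"
  proof (rule inj_onI)
    fix x y assume x: "x \<in> carrier A" "y \<in> carrier A" and eq: "\<Phi> x = \<Phi> y"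
    have "w \<nu> i * \<rho> x * u \<mu> k = w \<nu> i * \<rho> y * u \<mu> k"
      if "\<nu> \<in> L" "\<mu> \<in> L" "i < m \<nu>" "k < m \<mu>" for \<nu> \<mu> i k
      using that \<Phi>_entry[OF x(1), of \<nu> i k] \<Phi>_entry[OF x(2), of \<nu> i k] off_diagonal[OF x(1)] off_diagonal[OF x(2)] eq
      by (cases "\<nu> = \<mu>") auto
    then have "w \<nu> i * \<rho> x * p = w \<nu> i * \<rho> y * p" if "\<nu> \<in> L" "i < m \<nu>" for \<nu> i
      unfolding uw[symmetric] sum_distrib_left mult.assoc[symmetric] using that by (intro sum.cong refl) simp
    then have "w \<nu> i * \<rho> x = w \<nu> i * \<rho> y" if "\<nu> \<in> L" "i < m \<nu>" for \<nu> i
      using that x by (simp add: mult.assoc)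
    then have "p * \<rho> x = p * \<rho> y"
      unfolding uw[symmetric] sum_distrib_right mult.assoc by (intro sum.cong refl) simp
    then show "x = y" using x A(3) by (auto dest: inj_onD)
  qed
  have surj: "f \<in> \<Phi> ` carrier A" if f: "f \<in> carrier D" for f
  proof -
    \<comment> \<open>The elementary matrix with the prescribed entry at \<open>(i, k)\<close>;
      these are summed to a preimage of \<open>f\<close>.\<close>
    define g where "g \<nu> i k = u \<nu> i * \<theta> \<nu> (f \<nu> (i, k)) * w \<nu> k" for \<nu> i k
    have K: "\<exists>x\<in>carrier A. \<rho> x = (\<Sum>s\<in>B. h s)" if "finite B" "\<And>s. s \<in> B \<Longrightarrow> \<exists>x\<in>carrier A. \<rho> x = h s"
      for B and h :: "'s \<Rightarrow> ('x, 'f) endo"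
      using that
    proof (induction B rule: finite_induct)
      case empty
      show ?case using A.zero_closed A.hom_zero by (metis sum.empty)
    next
      case (insert s B)
      then obtain x y where "x \<in> carrier A" "\<rho> x = h s" "y \<in> carrier A" "\<rho> y = (\<Sum>s\<in>B. h s)" by blast
      then have "x \<oplus>\<^bsub>A\<^esub> y \<in> carrier A" "\<rho> (x \<oplus>\<^bsub>A\<^esub> y) = (\<Sum>s\<in>insert s B. h s)" using insert by simp_all
      then show ?case by blast
    qed
    have "\<exists>x\<in>carrier A. \<rho> x = g \<nu> i k" if \<nu>: "\<nu> \<in> L" "i < m \<nu>" "k < m \<nu>" for \<nu> i k
    proof -
      have "\<theta> \<nu> (f \<nu> (i, k)) \<in> \<rho> ` carrier A" using C(4)[OF \<nu>(1)] entry[OF f \<nu>] by blast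
      then obtain y where "y \<in> carrier A" "\<rho> y = \<theta> \<nu> (f \<nu> (i, k))" by auto
      moreover obtain x where "x \<in> carrier A" "\<rho> x = u \<nu> i" using u[OF \<nu>(1,2)] by auto
      moreover obtain z where "z \<in> carrier A" "\<rho> z = w \<nu> k" using w[OF \<nu>(1,3)] by auto
      ultimately have "x \<otimes>\<^bsub>A\<^esub> y \<otimes>\<^bsub>A\<^esub> z \<in> carrier A" "\<rho> (x \<otimes>\<^bsub>A\<^esub> y \<otimes>\<^bsub>A\<^esub> z) = g \<nu> i k" by (simp_all add: g_def)
      then show ?thesis by blast
    qed
    then have "\<exists>x\<in>carrier A. \<rho> x = (\<Sum>\<nu>\<in>L. \<Sum>i<m \<nu>. \<Sum>k<m \<nu>. g \<nu> i k)"
      using fin by (intro K) auto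
    then obtain x where x: "x \<in> carrier A" "\<rho> x = (\<Sum>\<nu>\<in>L. \<Sum>i<m \<nu>. \<Sum>k<m \<nu>. g \<nu> i k)" by blast
    have "\<Phi> x = f"
    proof (rule eqI[OF \<Phi>_closed[OF x(1)] f])
      fix \<nu> i k assume \<nu>: "\<nu> \<in> L" "i < m \<nu>" "k < m \<nu>"
      interpret C: representation "C \<nu>" "\<epsilon> \<nu>" "\<theta> \<nu>" by (rule rep[OF \<nu>(1)])
      let ?c = "\<theta> \<nu> (f \<nu> (i, k))"
      have "w \<nu> i * g \<mu> i' k' * u \<nu> k = (if \<mu> = \<nu> \<and> i' = i \<and> k' = k then ?c else 0)"
        if "\<mu> \<in> L" "i' < m \<mu>" "k' < m \<mu>" for \<mu> i' k'
      proof -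
        have "w \<nu> i * g \<mu> i' k' * u \<nu> k = (w \<nu> i * u \<mu> i') * \<theta> \<mu> (f \<mu> (i', k')) * (w \<mu> k' * u \<nu> k)"
          by (simp add: g_def mult.assoc)
        then show ?thesis using that \<nu> entry[OF f \<nu>] by (auto simp: wu)
      qed
      then have "w \<nu> i * \<rho> x * u \<nu> k = (\<Sum>\<mu>\<in>L. \<Sum>i'<m \<mu>. \<Sum>k'<m \<mu>. if \<mu> = \<nu> \<and> i' = i \<and> k' = k then ?c else 0)"
        unfolding x(2) sum_distrib_left sum_distrib_right by (intro sum.cong refl) auto
      also have "\<dots> = (\<Sum>i'<m \<nu>. \<Sum>k'<m \<nu>. if i' = i \<and> k' = k then ?c else 0)"
        using fin \<nu>(1) by (simp add: sum.remove[of L \<nu>])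
      also have "\<dots> = (\<Sum>i'<m \<nu>. if i' = i then ?c else 0)"
        using \<nu> by (intro sum.cong refl) auto
      also have "\<dots> = ?c" using \<nu> by simp
      finally show "\<theta> \<nu> (\<Phi> x \<nu> (i, k)) = ?c" using x \<nu> by (simp add: \<Phi>_entry)
    qed
    then show ?thesis using x(1) by blast
  qed
  have "bij_betw \<Phi> (carrier A) (carrier D)"
    using inj \<Phi>_closed surj by (auto simp: bij_betw_def)
  then have "\<Phi> \<in> algebra_iso A D"
    using \<Phi>_closed hom_mult hom_add hom_one hom_smult
    unfolding algebra_iso_def ring_iso_def ring_hom_def by auto
  then show ?thesis unfolding D_def by blast
qed

section \<open>Counting the colour sequences of a given content\<close>

section \<open>Counting colour sequences\<close>

definition sequence_of :: "nat \<Rightarrow> nat list \<Rightarrow> nat \<Rightarrow> nat" where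
  "sequence_of n xs = (\<lambda>c\<in>{1..n}. xs ! (c - 1))"

lemma content_sequence_of:
  assumes "length xs = n"
  shows "content n (sequence_of n xs) j = count (mset xs) j"
proof -
  have "{c \<in> {1..n}. sequence_of n xs c = j} = Suc ` {i. i < length xs \<and> j = xs ! i}"
  proof (intro equalityI subsetI)
    fix c assume "c \<in> {c \<in> {1..n}. sequence_of n xs c = j}"
    then have "c = Suc (c - 1)" "c - 1 < length xs" "j = xs ! (c - 1)" using assms by (auto simp: sequence_of_def)
    then show "c \<in> Suc ` {i. i < length xs \<and> j = xs ! i}" by blast
  qed (use assms in \<open>auto simp: sequence_of_def\<close>)
  then show ?thesis
    by (simp add: content_def card_image count_mset length_filter_conv_card count_list_eq_length_filter)
qed

lemma weak_compositions_finite: "finite J \<Longrightarrow> finite (weak_compositions J n)"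
proof (rule finite_subset)
  assume J: "finite J"
  show "weak_compositions J n \<subseteq> J \<rightarrow>\<^sub>E {..n}"
  proof
    fix \<nu> assume "\<nu> \<in> weak_compositions J n"
    then have \<nu>: "\<nu> \<in> J \<rightarrow>\<^sub>E UNIV" "(\<Sum>j\<in>J. \<nu> j) = n" by (auto simp: weak_compositions_def)
    have "\<nu> j \<le> n" if "j \<in> J" for j using member_le_sum[OF that, of \<nu>] J \<nu>(2) by simp
    then show "\<nu> \<in> J \<rightarrow>\<^sub>E {..n}" using \<nu>(1) by (auto simp: PiE_iff)
  qed
  show "finite (J \<rightarrow>\<^sub>E {..n})" using J by (intro finite_PiE) auto
qed

lemma content_sum:
  assumes "finite J" "t \<in> {1..n} \<rightarrow>\<^sub>E J"
  shows "(\<lambda>j\<in>J. content n t j) \<in> weak_compositions J n"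
proof -
  have "(\<Sum>j\<in>J. card {c \<in> {1..n}. t c = j}) = (\<Sum>j\<in>J. \<Sum>c\<in>{c \<in> {1..n}. t c = j}. 1)" by simp
  also have "\<dots> = (\<Sum>c\<in>{1..n}. 1)" using assms by (intro sum.group) auto
  finally show ?thesis by (simp add: weak_compositions_def content_def)
qed

context
  fixes J :: "nat set" and n :: nat and \<nu> :: "nat \<Rightarrow> nat"
  assumes J: "finite J" and \<nu>: "\<nu> \<in> weak_compositions J n"
begin

text \<open>The colour sequences of content \<open>\<nu>\<close> are the rearrangements of this
  multiset: their number is the multinomial coefficient, and the sorted one is ascending.\<close>

definition colours :: "nat multiset" where
  "colours = (\<Sum>j\<in>J. replicate_mset (\<nu> j) j)"

lemma count_colours: "count colours j = (if j \<in> J then \<nu> j else 0)"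
  using J by (auto simp: colours_def count_sum count_replicate_mset)

lemma size_colours: "size colours = n"
  using \<nu> by (simp add: colours_def weak_compositions_def)

lemma set_colours: "set_mset colours \<subseteq> J"
  using count_colours by (metis count_eq_zero_iff subsetI)

lemma sequence_of_bij:
  "bij_betw (sequence_of n) (permutations_of_multiset colours) {t \<in> {1..n} \<rightarrow>\<^sub>E J. (\<lambda>j\<in>J. content n t j) = \<nu>}"
proof (rule bij_betw_byWitness[where f' = "\<lambda>t. map (\<lambda>i. t (Suc i)) [0..<n]"])
  have len: "length xs = n" "set xs \<subseteq> J" "mset xs = colours" if "xs \<in> permutations_of_multiset colours" for xs
  proof -
    show *: "mset xs = colours" using that by (rule permutations_of_multisetD)
    show "length xs = n" "set xs \<subseteq> J" using size_colours set_colours unfolding *[symmetric] by auto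
  qed
  show "\<forall>xs\<in>permutations_of_multiset colours. map (\<lambda>i. sequence_of n xs (Suc i)) [0..<n] = xs"
    using len(1) by (auto simp: sequence_of_def intro!: nth_equalityI)
  show "\<forall>t\<in>{t \<in> {1..n} \<rightarrow>\<^sub>E J. (\<lambda>j\<in>J. content n t j) = \<nu>}. sequence_of n (map (\<lambda>i. t (Suc i)) [0..<n]) = t"
    by (auto simp: sequence_of_def fun_eq_iff PiE_iff extensional_def)
  have ext: "\<nu> \<in> extensional J" using \<nu> by (auto simp: weak_compositions_def PiE_iff)
  show "sequence_of n ` permutations_of_multiset colours \<subseteq> {t \<in> {1..n} \<rightarrow>\<^sub>E J. (\<lambda>j\<in>J. content n t j) = \<nu>}"
  proof clarify
    fix xs assume xs: "xs \<in> permutations_of_multiset colours"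
    have "sequence_of n xs \<in> {1..n} \<rightarrow>\<^sub>E J" using subsetD[OF len(2)[OF xs] nth_mem] len(1)[OF xs] by (auto simp: sequence_of_def)
    moreover have "(\<lambda>j\<in>J. content n (sequence_of n xs) j) = \<nu>"
      using ext by (auto simp: fun_eq_iff content_sequence_of[OF len(1)[OF xs]] len(3)[OF xs] count_colours extensional_def)
    ultimately show "sequence_of n xs \<in> {1..n} \<rightarrow>\<^sub>E J \<and> (\<lambda>j\<in>J. content n (sequence_of n xs) j) = \<nu>" ..
  qed
  show "(\<lambda>t. map (\<lambda>i. t (Suc i)) [0..<n]) ` {t \<in> {1..n} \<rightarrow>\<^sub>E J. (\<lambda>j\<in>J. content n t j) = \<nu>} \<subseteq> permutations_of_multiset colours"
  proof (intro subsetI, elim imageE CollectE conjE)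
    fix ys t assume ys: "ys = map (\<lambda>i. t (Suc i)) [0..<n]" and t: "t \<in> {1..n} \<rightarrow>\<^sub>E J"
      and c: "(\<lambda>j\<in>J. content n t j) = \<nu>"
    have "sequence_of n ys = t" using t by (auto simp: ys sequence_of_def fun_eq_iff PiE_iff extensional_def)
    then have count: "count (mset ys) j = content n t j" for j using content_sequence_of[of ys n j] by (simp add: ys)
    have "content n t j = (if j \<in> J then \<nu> j else 0)" for j
      using t fun_cong[OF c, of j] by (auto simp: content_def)
    then have "mset ys = colours" by (intro multiset_eqI) (simp add: count count_colours)
    then show "ys \<in> permutations_of_multiset colours" by (rule permutations_of_multisetI)
  qed
qed

lemma card_sequences: "card {t \<in> {1..n} \<rightarrow>\<^sub>E J. (\<lambda>j\<in>J. content n t j) = \<nu>} = multinomial J \<nu> n"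
proof -
  have "(\<Prod>j\<in>set_mset colours. fact (count colours j)) = (\<Prod>j\<in>J. fact (\<nu> j) :: nat)"
    using J set_colours by (intro prod.mono_neutral_cong_left) (auto simp: count_colours not_in_iff)
  then show ?thesis
    using bij_betw_same_card[OF sequence_of_bij] by (simp add: card_permutations_of_multiset multinomial_def size_colours)
qed

lemma ascending_sequence:
  obtains t where "t \<in> {1..n} \<rightarrow>\<^sub>E J" "(\<lambda>j\<in>J. content n t j) = \<nu>" "ascending n t"
proof -
  let ?xs = "sorted_list_of_multiset colours"
  have "?xs \<in> permutations_of_multiset colours" by (intro permutations_of_multisetI) simp
  then have "sequence_of n ?xs \<in> {t \<in> {1..n} \<rightarrow>\<^sub>E J. (\<lambda>j\<in>J. content n t j) = \<nu>}"
    using sequence_of_bij by (auto simp: bij_betw_def)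
  moreover have "length ?xs = n" using size_colours by (metis mset_sorted_list_of_multiset size_mset)
  then have "ascending n (sequence_of n ?xs)"
    using sorted_nth_mono[OF sorted_sorted_list_of_multiset, of _ _ colours] by (auto simp: ascending_def sequence_of_def)
  ultimately show ?thesis using that by blast
qed

end

section \<open>The small algebras embed into the corner\<close>

section \<open>Comparison with the induced representations\<close>

text \<open>Growth commutes with the scaling by \<open>v j\<close>, so root bounds for a small
  algebra transfer to the large one.\<close>

lemma grow_funpow_scale:
  "(grow q ^^ k) (image_mset (\<lambda>\<omega>. c * \<omega>) M) = image_mset (\<lambda>\<omega>. c * \<omega>) ((grow q ^^ k) M)"
  by (induction k) (simp_all add: grow_def multiset.map_comp comp_def mult_ac)

lemma affine_pair_scale:
  assumes "affine_pair p q T x y"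
  shows "affine_pair p q T (c *\<^sub>s x) (c *\<^sub>s y)"
proof -
  interpret affine_pair p q T x y by fact
  show ?thesis
    by unfold_locales (simp_all add: pp TT Tx Ty yx scl_simps in_corner_def algebra_simps)
qed

lemma jm_commute:
  assumes "z * S = S * z" "\<And>a. a \<in> {1..<m} \<Longrightarrow> z * T a = T a * z" "1 \<le> k" "k \<le> m"
  shows "z * jm q S T k = jm q S T k * z"
  using assms(3,4)
proof (induction k rule: nat_induct_at_least)
  case base
  then show ?case using assms(1) by (simp add: jm.simps)
next
  case (Suc k)
  then have "z * (T k * jm q S T k * T k) = T k * jm q S T k * T k * z"
    using assms(2)[of k] by (intro commute_mult) auto
  then show ?case using Suc by (simp add: jm.simps)
qed

text \<open>A second family of block generators on another space, with abstract commuting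
  \<open>\<S> j\<close> and \<open>\<T> j\<close>. It will come from a faithful representation of
  the tensor product, and feeds the induced module.\<close>

locale block_rep = block p q P n S T J M K t0
  for p :: "('x, 'f::field) endo" and q :: 'f and P n S T J M K t0 +
  fixes v :: "nat \<Rightarrow> 'f" and M' :: "nat \<Rightarrow> 'f multiset" and pc :: "('y, 'f) endo"
    and \<S> :: "nat \<Rightarrow> ('y, 'f) endo" and \<T> :: "nat \<Rightarrow> nat \<Rightarrow> ('y, 'f) endo"
  assumes v0: "j \<in> J \<Longrightarrow> v j \<noteq> 0" and M_eq: "j \<in> J \<Longrightarrow> M j = image_mset (\<lambda>\<omega>. v j * \<omega>) (M' j)"
    and tuples: "j \<in> J \<Longrightarrow> hecke_tuple pc q (root_poly (M' j)) (size_block j) (\<S> j) (\<T> j)"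
    and \<S>\<S>: "j \<in> J \<Longrightarrow> k \<in> J \<Longrightarrow> j \<noteq> k \<Longrightarrow> 0 < size_block j \<Longrightarrow> 0 < size_block k \<Longrightarrow> \<S> j * \<S> k = \<S> k * \<S> j"
    and \<S>\<T>: "j \<in> J \<Longrightarrow> k \<in> J \<Longrightarrow> j \<noteq> k \<Longrightarrow> 0 < size_block j \<Longrightarrow> a \<in> {1..<size_block k} \<Longrightarrow> \<S> j * \<T> k a = \<T> k a * \<S> j"
    and \<T>\<T>: "j \<in> J \<Longrightarrow> k \<in> J \<Longrightarrow> j \<noteq> k \<Longrightarrow> c \<in> {1..<size_block j} \<Longrightarrow> a \<in> {1..<size_block k} \<Longrightarrow>
      \<T> j c * \<T> k a = \<T> k a * \<T> j c"
begin

abbreviation "index c \<equiv> c - start (t0 c)"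
abbreviation "Y j \<equiv> jm q (\<S> j) (\<T> j)"

text \<open>The factor \<open>v (t0 c)\<close> undoes the normalisation in \<open>S_block\<close>,
  so the eigenvalues are again those of the large algebra.\<close>

definition y where "y c = v (t0 c) *\<^sub>s Y (t0 c) (index c)"
definition \<tau> where "\<tau> c = \<T> (t0 c) (index c)"

lemma index_range:
  assumes "c \<in> {1..n}"
  shows "1 \<le> index c" "index c \<le> size_block (t0 c)" "start (t0 c) + index c = c"
proof -
  obtain k where "1 \<le> k" "k \<le> size_block (t0 c)" "c = start (t0 c) + k" using every_position[OF assms] .
  then show "1 \<le> index c" "index c \<le> size_block (t0 c)" "start (t0 c) + index c = c" by linarith+
qed

lemma index_same:
  assumes "c \<in> {1..<n}" "t0 c = t0 (Suc c)"
  shows "index c \<in> {1..<size_block (t0 c)}" "index (Suc c) = Suc (index c)"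
  using index_range[of c] index_range[of "Suc c"] assms by auto

lemma t0_J: "c \<in> {1..n} \<Longrightarrow> t0 c \<in> J"
  using Seq_J[OF t0] .

lemma heckes: "j \<in> J \<Longrightarrow> hecke pc q (root_poly (M' j)) (size_block j) (\<S> j) (\<T> j)"
  using tuples q0 by unfold_locales

lemma pc_idem: "pc * pc = pc"
  using hecke.pp[OF heckes[OF t0_J[of 1]]] n_pos by simp

lemma Y_\<T>:
  assumes "j \<in> J" "k \<in> J" "j \<noteq> k" "1 \<le> c" "c \<le> size_block j" "a \<in> {1..<size_block k}"
  shows "\<T> k a * Y j c = Y j c * \<T> k a"
proof (rule jm_commute[OF _ _ assms(4,5)])
  show "\<T> k a * \<S> j = \<S> j * \<T> k a" using \<S>\<T>[OF assms(1-3) _ assms(6)] assms by simp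
  show "\<T> k a * \<T> j b = \<T> j b * \<T> k a" if "b \<in> {1..<size_block j}" for b
    using \<T>\<T>[OF assms(1-3) that assms(6)] by simp
qed

lemma Y_Y:
  assumes "j \<in> J" "k \<in> J" "j \<noteq> k" "1 \<le> c" "c \<le> size_block j" "1 \<le> d" "d \<le> size_block k"
  shows "Y j c * Y k d = Y k d * Y j c"
proof (rule jm_commute[OF _ _ assms(6,7)])
  show "Y j c * \<T> k b = \<T> k b * Y j c" if "b \<in> {1..<size_block k}" for b
    using Y_\<T>[OF assms(1-5) that] by simp
  have "\<S> k * Y j c = Y j c * \<S> k"
    using \<S>\<S>[OF assms(1-3)] \<S>\<T>[OF assms(2,1)] assms by (intro jm_commute[OF _ _ assms(4,5)]) auto
  then show "Y j c * \<S> k = \<S> k * Y j c" by simp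
qed

lemma Y_first_kill:
  assumes "j \<in> J" "0 < size_block j"
  shows "peval pc (root_poly (M j)) (v j *\<^sub>s Y j 1) = 0"
proof -
  interpret H: hecke pc q "root_poly (M' j)" "size_block j" "\<S> j" "\<T> j" by (rule heckes[OF assms(1)])
  have "peval pc (root_poly (M j)) (v j *\<^sub>s \<S> j) = v j ^ size (M' j) *\<^sub>s peval pc (root_poly (M' j)) (\<S> j)"
    unfolding M_eq[OF assms(1)] by (rule peval_scale_roots[OF pc_idem H.S_corner[OF assms(2)]])
  then show ?thesis using H.S_kill[OF assms(2)] by (simp add: jm.simps)
qed

sublocale Z: block_data pc q n J N t0 y \<tau>
proof (rule block_data.intro)
  show "pc * pc = pc" "q \<noteq> 0" "0 < n" "finite J" "ascending n t0"
    using pc_idem q0 n_pos finite_J asc by auto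
  fix k assume k: "k \<in> {1..n}"
  let ?j = "t0 k"
  interpret H: hecke pc q "root_poly (M' ?j)" "size_block ?j" "\<S> ?j" "\<T> ?j" by (rule heckes[OF t0_J[OF k]])
  note ik = index_range[OF k]
  have Yc: "in_corner pc (Y ?j (index k))" using H.X_corner[OF ik(1,2)] .
  then show "in_corner pc (y k)" by (simp add: y_def in_corner_def)
  \<comment> \<open>Within a block the roots grow at most \<open>size_block\<close> times, which is
    at most \<open>n\<close>, so the bound \<open>N\<close> of the large algebra applies.\<close>
  have "card {c \<in> {1..n}. t0 c = ?j} \<le> card {1..n}" by (intro card_mono) auto
  then have "size_block ?j \<le> n" by (simp add: content_def)
  then have dvd: "root_poly ((grow q ^^ size_block ?j) (M' ?j)) dvd root_poly ((grow q ^^ n) (M' ?j))"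
    by (rule root_poly_dvd_grow)
  have "0 < size_block ?j" "index k \<in> {1..size_block ?j}" using ik by auto
  from peval_dvd[OF pc_idem Yc dvd H.X_kill[OF this(1) refl this(2)]]
  have kill: "peval pc (root_poly ((grow q ^^ n) (M' ?j))) (Y ?j (index k)) = 0" .
  show "peval pc (root_poly (N ?j)) (y k) = 0"
    unfolding N_def M_eq[OF t0_J[OF k]] grow_funpow_scale y_def peval_scale_roots[OF pc_idem Yc] kill by simp
  show "y k * y l = y l * y k" if l: "l \<in> {1..n}" for l
  proof (cases "t0 l = ?j")
    case True
    then show ?thesis using H.X_X[of "index k" "index l"] ik index_range[OF l] by (simp add: y_def mult.commute)
  next
    case False
    have "Y ?j (index k) * Y (t0 l) (index l) = Y (t0 l) (index l) * Y ?j (index k)"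
      using False ik index_range[OF l] t0_J[OF k] t0_J[OF l] by (intro Y_Y) auto
    then show ?thesis by (simp add: y_def mult.commute)
  qed
next
  fix i j \<omega> \<omega>' assume "i \<in> J" "j \<in> J" "i \<noteq> j" "\<omega> \<in># N i" "\<omega>' \<in># N j"
  then show "\<omega> \<noteq> \<omega>' \<and> q * \<omega> \<noteq> \<omega>'" using separated unfolding separated_def N_def by blast
next
  fix k assume k: "k \<in> {1..<n}" and same: "t0 k = t0 (Suc k)"
  let ?j = "t0 k"
  have kn: "k \<in> {1..n}" "Suc k \<in> {1..n}" using k by auto
  interpret H: hecke pc q "root_poly (M' ?j)" "size_block ?j" "\<S> ?j" "\<T> ?j" by (rule heckes[OF t0_J[OF kn(1)]])
  note ik = index_same[OF k same]
  have Suc_k: "y (Suc k) = v ?j *\<^sub>s Y ?j (Suc (index k))" using ik(2) same by (simp add: y_def)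
  show "affine_pair pc q (\<tau> k) (y k) (y (Suc k))"
    unfolding Suc_k unfolding y_def \<tau>_def using H.pair[OF ik(1)] by (intro affine_pair_scale) simp
  show "\<tau> k * y l = y l * \<tau> k" if l: "l \<in> {1..n}" "l \<noteq> k" "l \<noteq> Suc k" for l
  proof (cases "t0 l = ?j")
    case True
    have "index l \<noteq> index k" "index l \<noteq> index k + 1"
      using index_range(3)[OF l(1)] index_range(3)[OF kn(1)] True l by auto
    then have "\<T> ?j (index k) * Y ?j (index l) = Y ?j (index l) * \<T> ?j (index k)"
      using index_range[OF l(1)] True by (intro H.T_X ik) auto
    then show ?thesis using True by (simp add: y_def \<tau>_def)
  next
    case False
    have "\<T> ?j (index k) * Y (t0 l) (index l) = Y (t0 l) (index l) * \<T> ?j (index k)"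
      using False index_range[OF l(1)] t0_J[OF l(1)] t0_J[OF kn(1)] ik(1) by (intro Y_\<T>) auto
    then show ?thesis by (simp add: y_def \<tau>_def)
  qed
  show "\<tau> k * \<tau> l = \<tau> l * \<tau> k" if l: "l \<in> {1..<n}" "t0 l = t0 (Suc l)" "Suc k < l" for l
  proof (cases "t0 l = ?j")
    case True
    have "index k + 1 < index l"
      using index_range(3)[of l] index_range(3)[OF kn(1)] True l by auto
    then show ?thesis using H.T_T[OF ik(1)] index_same(1)[OF l(1,2)] True by (simp add: \<tau>_def)
  next
    case False
    then show ?thesis
      using \<T>\<T>[OF t0_J[OF kn(1)] t0_J, of l] ik(1) index_same(1)[OF l(1,2)] l(1) by (simp add: \<tau>_def)
  qed
next
  fix k assume k: "1 \<le> k" "Suc k < n" and same: "t0 k = t0 (Suc k)" "t0 (Suc k) = t0 (Suc (Suc k))"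
  let ?j = "t0 k"
  have kn: "k \<in> {1..<n}" "Suc k \<in> {1..<n}" using k by auto
  have "?j \<in> J" using t0_J[of k] k by auto
  from heckes[OF this] interpret H: hecke pc q "root_poly (M' ?j)" "size_block ?j" "\<S> ?j" "\<T> ?j" .
  show "\<tau> k * \<tau> (Suc k) * \<tau> k = \<tau> (Suc k) * \<tau> k * \<tau> (Suc k)"
    using H.braid[of "index k"] index_same[OF kn(1) same(1)] index_same[OF kn(2) same(2)] same by (simp add: \<tau>_def)
qed

text \<open>The first strand is always first in its colour block, so on each summand
  \<open>x 1\<close> is a scaled first generator of a small algebra; its relation is a factor of
  \<open>P\<close>.\<close>

lemma Z_tuple: "hecke_tuple Z.unit q P n (Z.x 1) Z.T"
proof (rule Z.hecke_tuple)
  fix t assume t: "t \<in> Z.Cl"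
  have r: "1 \<in> {1..n}" using n_pos by auto
  let ?k = "pos n t 1"
  note k = Z.pos_Cl[OF t r]
  have "{c \<in> {1..1::nat}. t c = t 1} = {1}" by auto
  moreover have "off n t = off n t0" using t by (intro off_eq) (simp add: Z.Cl_def)
  ultimately have "?k = start (t 1) + 1" by (simp add: pos_def)
  then have "index ?k = 1" using k by simp
  then have y: "y ?k = v (t 1) *\<^sub>s Y (t 1) 1" using k by (simp add: y_def)
  have j: "t 1 \<in> J" "0 < size_block (t 1)" using t0_J[OF k(1)] index_range[OF k(1)] k(2) by auto
  have dvd: "root_poly (M (t 1)) dvd P"
    unfolding P_eq root_poly_sum using finite_J j(1) by (rule dvd_prodI)
  have "peval pc (root_poly (M (t 1))) (y ?k) = 0" unfolding y by (rule Y_first_kill[OF j])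
  then show "peval pc P (y ?k) = 0" by (rule peval_dvd[OF pc_idem Z.y_corner[OF k(1)] dvd])
qed

end

text \<open>An element of the tensor product that is killed by \<open>\<theta>\<close> acts as zero in the representation
  induced from a faithful representation \<open>\<pi>\<close> of the tensor product.\<close>

lemma (in block) block_injective:
  assumes \<rho>: "alg_rep (hecke_algebra q P n) p \<rho>" "inj_on \<rho> (carrier (hecke_algebra q P n))"
    and S: "S = \<rho> (hecke_gen q P n GenS)" and T: "\<And>a. a \<in> {1..<n} \<Longrightarrow> T a = \<rho> (hecke_gen q P n (GenT a))"
    and v0: "\<And>j. j \<in> J \<Longrightarrow> v j \<noteq> 0" and M_eq: "\<And>j. j \<in> J \<Longrightarrow> M j = image_mset (\<lambda>\<omega>. v j * \<omega>) (M' j)"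
  defines "B \<equiv> \<lambda>j. hecke_algebra q (root_poly (M' j)) (size_block j)"
    and "g \<equiv> \<lambda>j. hecke_gen q (root_poly (M' j)) (size_block j)"
  assumes \<theta>: "alg_rep (tensor_algebra J B) e0 \<theta>"
    and \<theta>S: "\<And>j. j \<in> J \<Longrightarrow> 0 < size_block j \<Longrightarrow> \<theta> (tensor_gen J B j (g j GenS)) = S_block (v j) j"
    and \<theta>T: "\<And>j a. j \<in> J \<Longrightarrow> a \<in> {1..<size_block j} \<Longrightarrow> \<theta> (tensor_gen J B j (g j (GenT a))) = T_block j a"
  shows "inj_on \<theta> (carrier (tensor_algebra J B))"
    "\<theta> ` carrier (tensor_algebra J B) \<subseteq> \<rho> ` carrier (hecke_algebra q P n)"
proof -
  interpret B: tensor_factors J B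
    by (rule tensor_factors.intro) (simp_all add: finite_J B_def falgebra_hecke)
  let ?C = "tensor_algebra J B" and ?A = "hecke_algebra q P n"
  interpret C: falgebra ?C by (rule B.falgebra_tensor)
  obtain pc :: "(((nat \<Rightarrow> (hecke_generator list \<Rightarrow> 'f) set) \<Rightarrow> 'f) set, 'f) endo" and \<pi>
    where \<pi>: "alg_rep ?C pc \<pi>" "inj_on \<pi> (carrier ?C)"
    by (rule C.faithful_representation)
  interpret \<pi>: representation ?C pc \<pi> using \<pi>(1) by unfold_locales
  interpret \<theta>: representation ?C e0 \<theta> using \<theta> by unfold_locales
  interpret \<rho>: representation ?A p \<rho>
    using \<rho>(1) falgebra_hecke by (simp add: representation_def representation_axioms_def)
  define \<S> \<T> where "\<S> j = \<pi> (tensor_gen J B j (g j GenS))" and "\<T> j a = \<pi> (tensor_gen J B j (g j (GenT a)))" for j a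
  have g: "0 < size_block j \<Longrightarrow> g j GenS \<in> carrier (B j)" "a \<in> {1..<size_block j} \<Longrightarrow> g j (GenT a) \<in> carrier (B j)" for j a
    unfolding B_def g_def by (rule hecke_gen_closed; assumption)+
  interpret block_rep p q P n S T J M K t0 v M' pc \<S> \<T>
  proof
    fix j assume j: "j \<in> J"
    show "v j \<noteq> 0" "M j = image_mset (\<lambda>\<omega>. v j * \<omega>) (M' j)" using v0 M_eq j by auto
    have "alg_rep (B j) pc (\<lambda>a. \<pi> (tensor_gen J B j a))" by (rule B.tensor_components(1)[OF \<pi>(1) j])
    from hecke_tuple_rep[OF this[unfolded B_def]]
    show "hecke_tuple pc q (root_poly (M' j)) (size_block j) (\<S> j) (\<T> j)"
      unfolding \<S>_def \<T>_def g_def B_def .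
    fix k assume k: "k \<in> J" "j \<noteq> k"
    note comm = B.tensor_components(2)[OF \<pi>(1) j k]
    show "0 < size_block j \<Longrightarrow> 0 < size_block k \<Longrightarrow> \<S> j * \<S> k = \<S> k * \<S> j"
      "\<And>a. 0 < size_block j \<Longrightarrow> a \<in> {1..<size_block k} \<Longrightarrow> \<S> j * \<T> k a = \<T> k a * \<S> j"
      "\<And>c a. c \<in> {1..<size_block j} \<Longrightarrow> a \<in> {1..<size_block k} \<Longrightarrow> \<T> j c * \<T> k a = \<T> k a * \<T> j c"
      unfolding \<S>_def \<T>_def using comm g by blast+
  qed
  obtain \<Psi> where \<Psi>: "alg_rep ?A Z.unit \<Psi>" "\<Psi> (hecke_gen q P n GenS) = Z.x 1"
    "\<And>a. a \<in> {1..<n} \<Longrightarrow> \<Psi> (hecke_gen q P n (GenT a)) = Z.T a"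
    using hecke_universal[OF Z_tuple] n_pos by metis
  interpret \<Psi>: representation ?A Z.unit \<Psi>
    using \<Psi>(1) falgebra_hecke by (simp add: representation_def representation_axioms_def)
  \<comment> \<open>The correspondence between the faithful representation and the induced module,
    through a common element of the Hecke algebra. Constructions made from generators and
    polynomials can be followed on both sides at once.\<close>
  define R where "R z z' \<longleftrightarrow> (\<exists>a\<in>carrier ?A. \<rho> a = z \<and> \<Psi> a = z')" for z z'
  have R_mult: "R (z * w) (z' * w')" if "R z z'" "R w w'" for z z' w w'
    using that unfolding R_def by (metis \<rho>.m_closed \<rho>.hom_mult \<Psi>.hom_mult)
  have R_scl: "R (c *\<^sub>s z) (c *\<^sub>s z')" if "R z z'" for c z z'
    using that unfolding R_def by (metis \<rho>.smult_closed \<rho>.hom_smult \<Psi>.hom_smult)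
  have R_T: "R (T a) (Z.T a)" if "a \<in> {1..<n}" for a
    unfolding R_def using hecke_gen_closed(2)[OF that] T[OF that] \<Psi>(3)[OF that] by metis
  have R_p: "R p Z.unit"
    unfolding R_def using \<rho>.one_closed \<rho>.hom_one \<Psi>.hom_one by blast
  have "R (X c) (jm q (Z.x 1) Z.T c)" if "1 \<le> c" "c \<le> n" for c
    using that
  proof (induction c rule: nat_induct_at_least)
    case base
    show ?case using hecke_gen_closed(1)[OF n_pos] S \<Psi>(2) unfolding R_def by (auto simp: jm.simps)
  next
    case (Suc c)
    then have "R (T c * X c * T c) (Z.T c * jm q (Z.x 1) Z.T c * Z.T c)" by (intro R_mult R_T) auto
    then show ?case using Suc R_scl by (simp add: jm.simps)
  qed
  then have R_X: "R (X c) (Z.x c)" if "c \<in> {1..n}" for c using Z.jm_eq that by auto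
  have R_E: "R (E j c) (peval Z.unit (colour_poly q n J M j) (Z.x c))" if c: "c \<in> {1..n}" for j c
  proof -
    obtain a where a: "a \<in> carrier ?A" "\<rho> a = X c" "\<Psi> a = Z.x c" using R_X[OF c] unfolding R_def by blast
    have "poly_eval_algebra ?A f a \<in> carrier ?A" for f by (rule poly_eval_closed[OF falgebra_hecke a(1)])
    then show ?thesis
      unfolding R_def E_def using \<rho>.hom_poly_eval[OF a(1)] \<Psi>.hom_poly_eval[OF a(1)] a(2,3) by metis
  qed
  let ?m = "\<lambda>z. matrix_unit t0 t0 z"
  have t0_Z: "t0 \<in> Z.Cl" using t0 by (simp add: Z.Cl_def Seq_def)
  have pos_t0: "pos n t0 c = c" if "c \<in> {1..n}" for c using pos_ascending[OF asc that] .
  have x_m: "Z.x c * ?m z = ?m (y c * z)" if "c \<in> {1..n}" for c z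
    using Z.x_mult[OF t0_Z] pos_t0[OF that] by simp
  \<comment> \<open>The idempotents \<open>E\<close> selected by \<open>t0\<close> act as the
    identity on the summand \<open>t0\<close>, since there the eigenvalues of strand
    \<open>c\<close> have colour \<open>t0 c\<close> and \<open>colour_poly\<close> is congruent to
    one.\<close>
  have E_m: "peval Z.unit (colour_poly q n J M (t0 c)) (Z.x c) * ?m pc = ?m pc" if c: "c \<in> {1..n}" for c
  proof -
    let ?f = "colour_poly q n J M (t0 c)"
    note yc = Z.y_corner[OF c]
    have "?m pc * peval (?m pc) ?f (?m (y c)) = peval Z.unit ?f (Z.x c) * ?m pc"
      using yc by (intro peval_intertwine)
        (simp_all add: Z.e_unit[OF t0_Z] x_m[OF c] matrix_unit_mult pc_idem in_corner_def)
    moreover have "peval pc 1 (y c) = peval pc ?f (y c)"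
      using colour[OF t0_J[OF c]] Z.y_kill[OF c] by (intro peval_cong[OF pc_idem yc])
    ultimately show ?thesis by (simp add: peval_matrix_unit[OF yc] matrix_unit_mult pc_idem)
  qed
  have "\<exists>z'. R (eprod t0 k) z' \<and> z' * ?m pc = ?m pc" if "k \<le> n" for k
    using that
  proof (induction k)
    case 0
    show ?case using R_p Z.e_unit[OF t0_Z] pc_idem by (intro exI[of _ Z.unit]) simp
  next
    case (Suc k)
    then obtain z' where z': "R (eprod t0 k) z'" "z' * ?m pc = ?m pc" by auto
    have c: "Suc k \<in> {1..n}" using Suc by auto
    let ?E = "peval Z.unit (colour_poly q n J M (t0 (Suc k))) (Z.x (Suc k))"
    have "R (eprod t0 (Suc k)) (z' * ?E)" using R_mult[OF z'(1) R_E[OF c]] by simp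
    moreover have "z' * ?E * ?m pc = ?m pc" using E_m[OF c] z'(2) by (simp add: mult.assoc)
    ultimately show ?case by blast
  qed
  then obtain z0 where z0: "R e0 z0" "z0 * ?m pc = ?m pc" unfolding e_def by blast
  \<comment> \<open>Such a preimage of \<open>\<theta> c\<close> acts on the diagonal summand
    \<open>t0\<close> as the faithful \<open>\<pi> c\<close>. The property is stable under the
    algebra operations and holds for generators, hence for the whole tensor product.\<close>
  define G where "G c \<longleftrightarrow> (\<exists>a\<in>carrier ?A. \<rho> a = \<theta> c \<and> \<Psi> a * ?m pc = ?m (\<pi> c))" for c
  have G_I: "G c" if "R (\<theta> c) z'" "z' * ?m pc = ?m (\<pi> c)" for c z'
    using that unfolding R_def G_def by blast
  have G_add: "G (c \<oplus>\<^bsub>?C\<^esub> d)" if cd: "c \<in> carrier ?C" "d \<in> carrier ?C" "G c" "G d" for c d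
  proof -
    obtain a b where "a \<in> carrier ?A" "\<rho> a = \<theta> c" "\<Psi> a * ?m pc = ?m (\<pi> c)"
      "b \<in> carrier ?A" "\<rho> b = \<theta> d" "\<Psi> b * ?m pc = ?m (\<pi> d)" using cd unfolding G_def by blast
    then show ?thesis
      unfolding G_def using cd by (intro bexI[of _ "a \<oplus>\<^bsub>?A\<^esub> b"]) (auto simp: distrib_right matrix_unit_simps)
  qed
  have G_smult: "G (\<kappa> \<odot>\<^bsub>?C\<^esub> c)" if cd: "c \<in> carrier ?C" "G c" for c \<kappa>
  proof -
    obtain a where "a \<in> carrier ?A" "\<rho> a = \<theta> c" "\<Psi> a * ?m pc = ?m (\<pi> c)" using cd unfolding G_def by blast
    then show ?thesis
      unfolding G_def using cd by (intro bexI[of _ "\<kappa> \<odot>\<^bsub>?A\<^esub> a"]) (auto simp: matrix_unit_simps)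
  qed
  have G_mult: "G (c \<otimes>\<^bsub>?C\<^esub> d)" if cd: "c \<in> carrier ?C" "d \<in> carrier ?C" "G c" "G d" for c d
  proof -
    obtain a b where ab: "a \<in> carrier ?A" "\<rho> a = \<theta> c" "\<Psi> a * ?m pc = ?m (\<pi> c)"
      "b \<in> carrier ?A" "\<rho> b = \<theta> d" "\<Psi> b * ?m pc = ?m (\<pi> d)" using cd unfolding G_def by blast
    have "\<Psi> a * \<Psi> b * ?m pc = \<Psi> a * (?m pc * ?m (\<pi> d))" using ab cd by (simp add: mult.assoc matrix_unit_mult)
    also have "\<dots> = ?m (\<pi> c) * ?m (\<pi> d)" using ab by (simp flip: mult.assoc)
    finally show ?thesis
      unfolding G_def using cd ab by (intro bexI[of _ "a \<otimes>\<^bsub>?A\<^esub> b"]) (auto simp: matrix_unit_mult)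
  qed
  have G_one: "G \<one>\<^bsub>?C\<^esub>" using z0 by (intro G_I) auto
  have G_gen: "G (tensor_gen J B j b)" if j: "j \<in> J" and b: "b \<in> carrier (B j)" for j b
  proof -
    interpret Bj: falgebra "B j" using B.falg[OF j] .
    note closed = B.tensor_gen_closed[OF j]
    note hom = B.tensor_components(1)[OF \<pi>(1) j] B.tensor_components(1)[OF \<theta> j]
    interpret \<pi>j: representation "B j" pc "\<lambda>b. \<pi> (tensor_gen J B j b)" using hom(1) by unfold_locales
    interpret \<theta>j: representation "B j" e0 "\<lambda>b. \<theta> (tensor_gen J B j b)" using hom(2) by unfold_locales
    have cong: "G c \<Longrightarrow> \<theta> c = \<theta> d \<Longrightarrow> \<pi> c = \<pi> d \<Longrightarrow> G d" for c d by (simp add: G_def)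
    have Bj: "hecke_algebra q (root_poly (M' j)) (size_block j) = B j" by (simp add: B_def)
    show ?thesis
      using b[unfolded B_def]
    proof (induction rule: hecke_induct)
      case one
      show ?case using cong[OF G_one] \<pi>j.hom_one \<theta>j.hom_one by (simp add: Bj)
    next
      case S
      have r: "start j + 1 \<in> {1..n}" "t0 (start j + 1) = j" using in_block[of 1 j] S by auto
      show ?case
      proof (rule G_I)
        have "R (X (start j + 1) * e0) (Z.x (start j + 1) * z0)" by (intro R_mult R_X r z0)
        then show "R (\<theta> (tensor_gen J B j (hecke_gen q (root_poly (M' j)) (size_block j) GenS)))
            ((1 / v j) *\<^sub>s (Z.x (start j + 1) * z0))"
          using \<theta>S[OF j S] R_scl by (simp add: g_def S_block_def)
        have "y (start j + 1) = v j *\<^sub>s \<S> j" using r by (simp add: y_def jm.simps)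
        then show "(1 / v j) *\<^sub>s (Z.x (start j + 1) * z0) * ?m pc =
            ?m (\<pi> (tensor_gen J B j (hecke_gen q (root_poly (M' j)) (size_block j) GenS)))"
          using z0(2) x_m[OF r(1)] Z.y_corner[OF r(1)] v0[OF j]
          by (simp add: mult.assoc in_corner_def matrix_unit_simps \<S>_def g_def)
      qed
    next
      case (T a)
      note r = in_block_T[OF T]
      have same: "t0 (start j + a) = t0 (Suc (start j + a))" using r by simp
      show ?case
      proof (rule G_I)
        have "R (T (start j + a) * e0) (Z.T (start j + a) * z0)" by (intro R_mult R_T r z0)
        then show "R (\<theta> (tensor_gen J B j (hecke_gen q (root_poly (M' j)) (size_block j) (GenT a)))) (Z.T (start j + a) * z0)"
          using \<theta>T[OF j T] by (simp add: g_def T_block_def)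
        have "\<tau> (start j + a) = \<T> j a" using r by (simp add: \<tau>_def)
        then show "Z.T (start j + a) * z0 * ?m pc =
            ?m (\<pi> (tensor_gen J B j (hecke_gen q (root_poly (M' j)) (size_block j) (GenT a))))"
          using z0(2) Z.T_mult_same[OF t0_Z same, of t0 pc] pos_t0[of "start j + a"] r Z.\<tau>_unit(2)[OF r(1) same]
          by (simp add: mult.assoc \<T>_def g_def)
      qed
    next
      case (add b d)
      note bd = add[unfolded Bj]
      show ?case
        unfolding Bj by (rule cong[OF G_add[OF closed[OF bd(1)] closed[OF bd(2)] bd(3,4)]]) (use bd closed in simp_all)
    next
      case (mult b d)
      note bd = mult[unfolded Bj]
      show ?case
        unfolding Bj by (rule cong[OF G_mult[OF closed[OF bd(1)] closed[OF bd(2)] bd(3,4)]]) (use bd closed in simp_all)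
    next
      case (smult k b)
      note bd = smult[unfolded Bj]
      show ?case
        unfolding Bj by (rule cong[OF G_smult[of "tensor_gen J B j b" k, OF closed[OF bd(1)] bd(2)]]) (use bd closed in simp_all)
    qed
  qed
  have G: "G c" if "c \<in> carrier ?C" for c
    using that
  proof (induction rule: B.tensor_induct)
    case one
    show ?case by (rule G_one)
  next
    case (gen k a)
    then show ?case by (rule G_gen)
  next
    case (add x y)
    then show ?case by (rule G_add)
  next
    case (mult x y)
    then show ?case by (rule G_mult)
  next
    case (smult c x)
    then show ?case by (intro G_smult)
  qed
  show "\<theta> ` carrier ?C \<subseteq> \<rho> ` carrier ?A" using G unfolding G_def by force
  show "inj_on \<theta> (carrier ?C)"
  proof (rule inj_onI)
    fix c d assume cd: "c \<in> carrier ?C" "d \<in> carrier ?C" and eq: "\<theta> c = \<theta> d"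
    obtain a b where ab: "a \<in> carrier ?A" "\<rho> a = \<theta> c" "\<Psi> a * ?m pc = ?m (\<pi> c)"
      "b \<in> carrier ?A" "\<rho> b = \<theta> d" "\<Psi> b * ?m pc = ?m (\<pi> d)" using G cd unfolding G_def by metis
    \<comment> \<open>Equal values of \<open>\<theta>\<close> give the same element of the Hecke
      algebra; its action on the summand \<open>t0\<close> determines \<open>\<pi> c\<close>, hence
      \<open>c\<close>.\<close>
    have "a = b" using inj_onD[OF \<rho>(2), of a b] ab eq by simp
    then have "\<pi> c = \<pi> d" using ab by (metis matrix_unit_inject)
    then show "c = d" by (rule inj_onD[OF \<pi>(2) _ cd])
  qed
qed

section \<open>Assembly of the blocks and specialisation to powers of \<open>q\<close>\<close>

section \<open>The decomposition\<close>

lemma (in representation) subalg_image: "subalg (h ` carrier A)"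
  unfolding subalg_def by (auto simp flip: hom_add hom_mult hom_smult)

lemma hecke_rep_commute:
  assumes h: "alg_rep (hecke_algebra q P n) p h" and a: "a \<in> carrier (hecke_algebra q P n)"
    and z: "z * p = p * z" "0 < n \<Longrightarrow> z * h (hecke_gen q P n GenS) = h (hecke_gen q P n GenS) * z"
      "\<And>c. c \<in> {1..<n} \<Longrightarrow> z * h (hecke_gen q P n (GenT c)) = h (hecke_gen q P n (GenT c)) * z"
  shows "z * h a = h a * z"
proof -
  interpret representation "hecke_algebra q P n" p h
    using h falgebra_hecke by (simp add: representation_def representation_axioms_def)
  show ?thesis
    using a
  proof (induction rule: hecke_induct)
    case (add x y)
    then show ?case by (simp add: distrib_left distrib_right)
  next
    case (mult x y)
    then show ?case using commute_mult(2)[OF mult.IH] by simp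
  qed (use z in simp_all)
qed

text \<open>Allows \<open>size_block\<close> to be replaced by the composition, with which it agrees
  on \<open>J\<close>.\<close>

lemma tensor_algebra_cong:
  assumes "\<And>k. k \<in> K \<Longrightarrow> A k = B k"
  shows "tensor_algebra K A = tensor_algebra K B"
proof -
  have P: "(\<Pi>\<^sub>E k\<in>K. carrier (A k)) = (\<Pi>\<^sub>E k\<in>K. carrier (B k))" using assms by (intro PiE_cong) simp
  have M: "product_monoid K A = product_monoid K B"
    unfolding product_monoid_def P using assms by (simp cong: restrict_cong)
  have "multilinear_relations K A = multilinear_relations K B"
    unfolding multilinear_relations_def M P Let_def using assms by (intro arg_cong2[of _ _ _ _ "(\<union>)"] Collect_cong) (metis+)
  then show ?thesis unfolding tensor_algebra_def M by simp
qed

context block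
begin

text \<open>The block relations give one representation of each small algebra in the corner; they
  commute with each other because their generators do.\<close>

lemma block_representation:
  assumes v0: "\<And>j. j \<in> J \<Longrightarrow> v j \<noteq> 0" and M_eq: "\<And>j. j \<in> J \<Longrightarrow> M j = image_mset (\<lambda>\<omega>. v j * \<omega>) (M' j)"
  defines "B \<equiv> \<lambda>j. hecke_algebra q (root_poly (M' j)) (size_block j)"
    and "g \<equiv> \<lambda>j. hecke_gen q (root_poly (M' j)) (size_block j)"
  shows "\<exists>\<theta>. alg_rep (tensor_algebra J B) e0 \<theta> \<and>
    (\<forall>j\<in>J. 0 < size_block j \<longrightarrow> \<theta> (tensor_gen J B j (g j GenS)) = S_block (v j) j) \<and>
    (\<forall>j\<in>J. \<forall>a\<in>{1..<size_block j}. \<theta> (tensor_gen J B j (g j (GenT a))) = T_block j a)"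
proof -
  interpret B: tensor_factors J B
    by (rule tensor_factors.intro) (simp_all add: finite_J B_def falgebra_hecke)
  have "\<exists>h. alg_rep (B j) e0 h \<and> (0 < size_block j \<longrightarrow> h (g j GenS) = S_block (v j) j) \<and>
      (\<forall>a\<in>{1..<size_block j}. h (g j (GenT a)) = T_block j a)" if j: "j \<in> J" for j
    using hecke_universal[OF block_tuple[OF j v0[OF j] M_eq[OF j]]] unfolding B_def g_def by metis
  then obtain h where h: "\<And>j. j \<in> J \<Longrightarrow> alg_rep (B j) e0 (h j)"
    "\<And>j. j \<in> J \<Longrightarrow> 0 < size_block j \<Longrightarrow> h j (g j GenS) = S_block (v j) j"
    "\<And>j a. j \<in> J \<Longrightarrow> a \<in> {1..<size_block j} \<Longrightarrow> h j (g j (GenT a)) = T_block j a"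
    by metis
  have unit: "e0 * h j a = h j a" "h j a * e0 = h j a" if "j \<in> J" "a \<in> carrier (B j)" for j a
  proof -
    interpret representation "B j" e0 "h j"
      using h(1)[OF that(1)] B.falg[OF that(1)] by (simp add: representation_def representation_axioms_def)
    show "e0 * h j a = h j a" "h j a * e0 = h j a" using that by simp_all
  qed
  have gen: "0 < size_block j \<Longrightarrow> g j GenS \<in> carrier (B j)" "c \<in> {1..<size_block j} \<Longrightarrow> g j (GenT c) \<in> carrier (B j)" for j c
    unfolding B_def g_def by (rule hecke_gen_closed; assumption)+
  \<comment> \<open>Reduces commutation with a factor to its generators. It is applied twice, for
    the two sides of the commutator.\<close>
  have step: "z * h k b = h k b * z"
    if k: "k \<in> J" "b \<in> carrier (B k)" and z: "z * e0 = e0 * z" "0 < size_block k \<Longrightarrow> z * S_block (v k) k = S_block (v k) k * z"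
      "\<And>c. c \<in> {1..<size_block k} \<Longrightarrow> z * T_block k c = T_block k c * z" for z k b
  proof -
    have "0 < size_block k \<Longrightarrow> z * h k (g k GenS) = h k (g k GenS) * z"
      "\<And>c. c \<in> {1..<size_block k} \<Longrightarrow> z * h k (g k (GenT c)) = h k (g k (GenT c)) * z"
      using z h(2,3)[OF k(1)] by auto
    from hecke_rep_commute[OF h(1)[OF k(1), unfolded B_def] k(2)[unfolded B_def] z(1) this[unfolded g_def]]
    show ?thesis .
  qed
  have comm: "h j a * h k b = h k b * h j a"
    if "j \<in> J" "k \<in> J" "j \<noteq> k" "a \<in> carrier (B j)" "b \<in> carrier (B k)" for j k a b
  proof (rule step[OF that(2,5)])
    note jk = that
    have kj: "k \<noteq> j" using jk by simp
    show "h j a * e0 = e0 * h j a" using unit that by simp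
    show "h j a * S_block (v k) k = S_block (v k) k * h j a" if k0: "0 < size_block k"
    proof (rule step[OF jk(1,4), symmetric])
      show "S_block (v k) k * e0 = e0 * S_block (v k) k"
        using unit[OF jk(2) gen(1)[OF k0]] h(2)[OF jk(2) k0] by simp
      show "S_block (v k) k * S_block (v j) j = S_block (v j) j * S_block (v k) k" if "0 < size_block j"
        by (rule blocks_commute(1)[OF kj k0 that])
      show "S_block (v k) k * T_block j c = T_block j c * S_block (v k) k" if "c \<in> {1..<size_block j}" for c
        by (rule blocks_commute(2)[OF kj k0 that])
    qed
    show "h j a * T_block k c = T_block k c * h j a" if c: "c \<in> {1..<size_block k}" for c
    proof (rule step[OF jk(1,4), symmetric])
      show "T_block k c * e0 = e0 * T_block k c"
        using unit[OF jk(2) gen(2)[OF c]] h(3)[OF jk(2) c] by simp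
      show "T_block k c * S_block (v j) j = S_block (v j) j * T_block k c" if "0 < size_block j"
        by (rule blocks_commute(2)[OF jk(3) that c, symmetric])
      show "T_block k c * T_block j d = T_block j d * T_block k c" if "d \<in> {1..<size_block j}" for d
        by (rule blocks_commute(3)[OF kj c that])
    qed
  qed
  obtain \<theta> where \<theta>: "alg_rep (tensor_algebra J B) e0 \<theta>"
    "\<And>k a. k \<in> J \<Longrightarrow> a \<in> carrier (B k) \<Longrightarrow> \<theta> (tensor_gen J B k a) = h k a"
    using B.tensor_universal[OF e0e0 h(1) comm] by blast
  show ?thesis by (intro exI[of _ \<theta>] conjI ballI impI \<theta>(1)) (use \<theta>(2) h(2,3) gen in auto)
qed

text \<open>Collects for one content the data that \<open>matrix_decomposition\<close> asks for,
  including the vanishing of the coefficients between different contents.\<close>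

lemma block_summary:
  assumes \<rho>: "alg_rep (hecke_algebra q P n) p \<rho>" "inj_on \<rho> (carrier (hecke_algebra q P n))"
    and S_eq: "S = \<rho> (hecke_gen q P n GenS)" and T_eq: "\<And>a. T a = \<rho> (hecke_gen q P n (GenT a))"
    and v0: "\<And>j. j \<in> J \<Longrightarrow> v j \<noteq> 0" and M_eq: "\<And>j. j \<in> J \<Longrightarrow> M j = image_mset (\<lambda>\<omega>. v j * \<omega>) (M' j)"
  defines "C \<equiv> tensor_algebra J (\<lambda>j. hecke_algebra q (root_poly (M' j)) (size_block j))"
  shows "\<exists>\<theta> w. alg_rep C e0 \<theta> \<and> inj_on \<theta> (carrier C) \<and> \<theta> ` carrier C \<subseteq> \<rho> ` carrier (hecke_algebra q P n) \<and>
    (\<forall>t\<in>Cl. w t \<in> K \<and> u t * w t = e t \<and> (\<forall>s\<in>Seq. w t * u s = (if t = s then e0 else 0)) \<and>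
      (\<forall>x\<in>carrier (hecke_algebra q P n). (\<forall>s\<in>Cl. w t * \<rho> x * u s \<in> \<theta> ` carrier C) \<and>
        (\<forall>s\<in>Seq - Cl. w t * \<rho> x * u s = 0)))"
proof -
  let ?B = "\<lambda>j. hecke_algebra q (root_poly (M' j)) (size_block j)" and ?A = "hecke_algebra q P n"
  let ?g = "\<lambda>j. hecke_gen q (root_poly (M' j)) (size_block j)"
  interpret B: tensor_factors J ?B
    by (rule tensor_factors.intro) (simp_all add: finite_J falgebra_hecke)
  interpret \<rho>: representation ?A p \<rho>
    using \<rho>(1) falgebra_hecke by (simp add: representation_def representation_axioms_def)
  obtain \<theta> where \<theta>: "alg_rep C e0 \<theta>"
    "\<And>j. j \<in> J \<Longrightarrow> 0 < size_block j \<Longrightarrow> \<theta> (tensor_gen J ?B j (?g j GenS)) = S_block (v j) j"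
    "\<And>j a. j \<in> J \<Longrightarrow> a \<in> {1..<size_block j} \<Longrightarrow> \<theta> (tensor_gen J ?B j (?g j (GenT a))) = T_block j a"
    using block_representation[of v M'] v0 M_eq unfolding C_def by auto
  note inj = block_injective[OF \<rho> S_eq T_eq v0 M_eq \<theta>[unfolded C_def]]
  interpret \<theta>: representation C e0 \<theta>
    using \<theta>(1) B.falgebra_tensor by (simp add: C_def representation_def representation_axioms_def)
  let ?L = "\<theta> ` carrier C"
  have L: "subalg ?L" "e0 \<in> ?L" using \<theta>.subalg_image imageI[OF \<theta>.one_closed, of \<theta>] by simp_all
  have SL: "S_block (v j) j \<in> ?L" if "j \<in> J" "0 < size_block j" for j
    using imageI[OF B.tensor_gen_closed[OF that(1) hecke_gen_closed(1)[OF that(2)]], of \<theta>]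
    unfolding \<theta>(2)[OF that] C_def .
  have TL: "T_block j a \<in> ?L" if "j \<in> J" "a \<in> {1..<size_block j}" for j a
    using imageI[OF B.tensor_gen_closed[OF that(1) hecke_gen_closed(2)[OF that(2)]], of \<theta>]
    unfolding \<theta>(3)[OF that] C_def .
  have XL: "X c * e0 \<in> ?L" if "c \<in> {1..n}" for c
    by (rule block_generators_L(1)[OF L v0 SL TL that])
  have TL': "T a * e0 \<in> ?L" if "a \<in> {1..<n}" "t0 a = t0 (Suc a)" for a
    by (rule block_generators_L(2)[OF L v0 SL TL that])
  have gens: "coefficients_in ?L S" "a \<in> {1..<n} \<Longrightarrow> coefficients_in ?L (T a)" for a
    using coefficients_generators[OF L XL TL'] by blast+
  have coeff: "coefficients_in ?L (\<rho> x)" if "x \<in> carrier ?A" for x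
    using that
  proof (induction rule: hecke_induct)
    case one
    then show ?case using coefficients_closed(1)[OF L] by simp
  next
    case S
    show ?case using gens(1) by (simp only: S_eq[symmetric])
  next
    case (T a)
    show ?case using gens(2)[OF T] by (simp only: T_eq[symmetric])
  next
    case (add x y)
    then show ?case using coefficients_closed(2)[OF L] by simp
  next
    case (mult x y)
    then show ?case using coefficients_closed(3)[OF L] by simp
  next
    case (smult c x)
    then show ?case using coefficients_closed(4)[OF L] by simp
  qed
  have wu: "w t * u s = (if t = s then e0 else 0)" if t: "t \<in> Cl" and s: "s \<in> Seq" for t s
  proof (cases "t = s")
    case False
    have "w t * u s = w t * e s * u s" by (simp only: mult.assoc u_left[OF s])
    then show ?thesis using w_e[OF t s False] False by simp
  qed (use w(4)[OF t] in simp)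
  have off: "w t * \<rho> x * u s = 0" if "t \<in> Cl" "s \<in> Seq - Cl" "x \<in> carrier ?A" for t s x
  proof -
    have "w t * \<rho> x * u s = w t * \<rho> x * e s * u s" using that by (simp only: mult.assoc u_left DiffD1)
    then show ?thesis using coeff[OF that(3)] that unfolding coefficients_in_def by simp
  qed
  have diag: "w t * \<rho> x * u s \<in> ?L" if "t \<in> Cl" "s \<in> Cl" "x \<in> carrier ?A" for t s x
    using coeff[OF that(3)] that unfolding coefficients_in_def by blast
  show ?thesis
    using \<theta>(1) inj[folded C_def] w(1,5) wu off diag by (intro exI[of _ \<theta>] exI[of _ w]) auto
qed

end

text \<open>The decomposition for arbitrary separated root multisets; the scaling from
  \<open>M'\<close> to \<open>M\<close> records the parameters. Powers of \<open>q\<close> enter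
  only when \<open>separated\<close> is verified.\<close>

lemma hecke_decomposition:
  fixes q :: "'f::field" and M M' :: "nat \<Rightarrow> 'f multiset"
  assumes J: "finite J" and n: "0 < n" and q: "q \<noteq> 0" and sep: "separated q n J M"
    and v0: "\<And>j. j \<in> J \<Longrightarrow> v j \<noteq> 0" and M_eq: "\<And>j. j \<in> J \<Longrightarrow> M j = image_mset (\<lambda>\<omega>. v j * \<omega>) (M' j)"
  shows "\<exists>\<Phi>. \<Phi> \<in> algebra_iso (hecke_algebra q (root_poly (\<Sum>j\<in>J. M j)) n)
    (direct_sum_algebra (weak_compositions J n) (\<lambda>\<nu>. matrix_algebra (multinomial J \<nu> n)
      (tensor_algebra J (\<lambda>j. hecke_algebra q (root_poly (M' j)) (\<nu> j)))))"
proof -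
  define P where "P = root_poly (\<Sum>j\<in>J. M j)"
  let ?A = "hecke_algebra q P n"
  interpret A: falgebra ?A by (rule falgebra_hecke)
  obtain p :: "((hecke_generator list \<Rightarrow> 'f) set, 'f) endo" and \<rho> where \<rho>: "alg_rep ?A p \<rho>" "inj_on \<rho> (carrier ?A)"
    by (rule A.faithful_representation)
  interpret \<rho>: representation ?A p \<rho> using \<rho>(1) by unfold_locales
  define S T where "S = \<rho> (hecke_gen q P n GenS)" and "T a = \<rho> (hecke_gen q P n (GenT a))" for a
  have tuple: "hecke_tuple p q P n S T"
    using hecke_tuple_rep[OF \<rho>(1)] unfolding S_def T_def[abs_def] .
  define K where "K = \<rho> ` carrier ?A"
  interpret coloured_hecke p q P n S T J M K
  proof (unfold_locales)
    show "subalg K" unfolding K_def by (rule \<rho>.subalg_image)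
    show "p \<in> K" unfolding K_def using \<rho>.hom_one[symmetric] by blast
    show "S \<in> K" unfolding K_def S_def by (rule imageI[OF hecke_gen_closed(1)[OF n]])
    show "T a \<in> K" if "a \<in> {1..<n}" for a
      unfolding K_def T_def by (rule imageI[OF hecke_gen_closed(2)[OF that]])
  qed (use tuple J n q sep P_def in auto)
  define D where "D \<nu> = {t \<in> Seq. (\<lambda>j\<in>J. content n t j) = \<nu>}" for \<nu>
  define C where "C \<nu> = tensor_algebra J (\<lambda>j. hecke_algebra q (root_poly (M' j)) (\<nu> j))" for \<nu>
  define L where "L = weak_compositions J n"
  have L: "finite L" unfolding L_def by (rule weak_compositions_finite[OF J])
  have summary: "\<exists>\<epsilon> \<theta> w. alg_rep (C \<nu>) \<epsilon> \<theta> \<and> inj_on \<theta> (carrier (C \<nu>)) \<and> \<theta> ` carrier (C \<nu>) \<subseteq> \<rho> ` carrier ?A \<and>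
    (\<forall>t\<in>D \<nu>. w t \<in> K \<and> u t * w t = e t \<and> (\<forall>s\<in>Seq. w t * u s = (if t = s then \<epsilon> else 0)) \<and>
      (\<forall>x\<in>carrier ?A. (\<forall>s\<in>D \<nu>. w t * \<rho> x * u s \<in> \<theta> ` carrier (C \<nu>)) \<and>
        (\<forall>s\<in>Seq - D \<nu>. w t * \<rho> x * u s = 0)))" if \<nu>: "\<nu> \<in> L" for \<nu>
  proof -
    obtain t0 where seq: "t0 \<in> {1..n} \<rightarrow>\<^sub>E J" "(\<lambda>j\<in>J. content n t0 j) = \<nu>" "ascending n t0"
      using ascending_sequence[OF J \<nu>[unfolded L_def]] .
    interpret block p q P n S T J M K t0
      using seq(1,3) by unfold_locales (simp_all add: Seq_def)
    \<comment> \<open>Contents are functions on all naturals, compositions only on \<open>J\<close>;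
      outside \<open>J\<close> both contents vanish.\<close>
    have "content n t = content n t0 \<longleftrightarrow> (\<lambda>j\<in>J. content n t j) = \<nu>" if "t \<in> Seq" for t
    proof -
      have "content n s j = 0" if "s \<in> {1..n} \<rightarrow>\<^sub>E J" "j \<notin> J" for s j
        using that by (auto simp: content_def)
      from this[of t] this[of t0] have 0: "content n t j = content n t0 j" if "j \<notin> J" for j
        using that seq(1) \<open>t \<in> Seq\<close> by (simp add: Seq_def)
      show ?thesis
      proof
        assume "(\<lambda>j\<in>J. content n t j) = \<nu>"
        then have "restrict (content n t) J = restrict (content n t0) J" using seq(2) by simp
        then have "content n t j = content n t0 j" for j using 0[of j] by (cases "j \<in> J") (metis restrict_apply')+
        then show "content n t = content n t0" by (rule ext)
      qed (use seq(2) in simp)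
    qed
    then have D: "Cl = D \<nu>" unfolding Cl_def D_def by auto
    have C: "tensor_algebra J (\<lambda>j. hecke_algebra q (root_poly (M' j)) (size_block j)) = C \<nu>"
      unfolding C_def using seq(2) by (intro tensor_algebra_cong) auto
    show ?thesis by (rule exI[of _ e0], rule block_summary[OF \<rho> S_def T_def v0 M_eq, unfolded C D])
  qed
  obtain \<epsilon> \<theta> w where main: "\<And>\<nu>. \<nu> \<in> L \<Longrightarrow> alg_rep (C \<nu>) (\<epsilon> \<nu>) (\<theta> \<nu>) \<and> inj_on (\<theta> \<nu>) (carrier (C \<nu>)) \<and>
    \<theta> \<nu> ` carrier (C \<nu>) \<subseteq> \<rho> ` carrier ?A \<and>
    (\<forall>t\<in>D \<nu>. w \<nu> t \<in> K \<and> u t * w \<nu> t = e t \<and> (\<forall>s\<in>Seq. w \<nu> t * u s = (if t = s then \<epsilon> \<nu> else 0)) \<and>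
      (\<forall>x\<in>carrier ?A. (\<forall>s\<in>D \<nu>. w \<nu> t * \<rho> x * u s \<in> \<theta> \<nu> ` carrier (C \<nu>)) \<and>
        (\<forall>s\<in>Seq - D \<nu>. w \<nu> t * \<rho> x * u s = 0)))"
    using summary by metis
  let ?m = "\<lambda>\<nu>. multinomial J \<nu> n"
  \<comment> \<open>Rows and columns of \<open>matrix_algebra\<close> are numbered by naturals, so
    the sequences of each content are enumerated.\<close>
  have "\<exists>g. bij_betw g {..<?m \<nu>} (D \<nu>)" if "\<nu> \<in> L" for \<nu>
  proof -
    have "finite (D \<nu>)" using finite_Seq by (simp add: D_def)
    moreover have "card (D \<nu>) = ?m \<nu>"
      using card_sequences[OF J that[unfolded L_def]] by (simp add: D_def Seq_def)
    ultimately show ?thesis using ex_bij_betw_nat_finite[of "D \<nu>"] by (simp add: atLeast0LessThan)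
  qed
  then obtain g where g: "\<And>\<nu>. \<nu> \<in> L \<Longrightarrow> bij_betw (g \<nu>) {..<?m \<nu>} (D \<nu>)" by metis
  have gD: "g \<nu> i \<in> D \<nu>" if "\<nu> \<in> L" "i < ?m \<nu>" for \<nu> i
    using bij_betwE[OF g[OF that(1)]] that(2) by auto
  have D_Seq: "t \<in> Seq" if "t \<in> D \<nu>" for t \<nu> using that by (simp add: D_def)
  have D_disj: "t \<in> Seq - D \<nu>" if "t \<in> D \<mu>" "\<nu> \<noteq> \<mu>" for t \<nu> \<mu> using that by (auto simp: D_def)
  have g_eq: "g \<nu> i = g \<mu> k \<longleftrightarrow> \<nu> = \<mu> \<and> i = k" if "\<nu> \<in> L" "\<mu> \<in> L" "i < ?m \<nu>" "k < ?m \<mu>" for \<nu> \<mu> i k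
  proof
    assume eq: "g \<nu> i = g \<mu> k"
    then have "\<nu> = \<mu>" using gD[OF that(1,3)] gD[OF that(2,4)] by (simp add: D_def)
    then show "\<nu> = \<mu> \<and> i = k" using eq that g[OF that(1)] by (auto simp: bij_betw_def dest: inj_onD)
  qed simp
  have "\<exists>\<Phi>. \<Phi> \<in> algebra_iso ?A (direct_sum_algebra L (\<lambda>\<nu>. matrix_algebra (?m \<nu>) (C \<nu>)))"
  proof (rule matrix_decomposition[OF falgebra_hecke \<rho> L])
    show "(\<Sum>\<nu>\<in>L. \<Sum>i<?m \<nu>. u (g \<nu> i) * w \<nu> (g \<nu> i)) = p"
    proof -
      have "(\<Sum>i<?m \<nu>. u (g \<nu> i) * w \<nu> (g \<nu> i)) = (\<Sum>t\<in>D \<nu>. e t)" if \<nu>: "\<nu> \<in> L" for \<nu>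
      proof -
        have "(\<Sum>i<?m \<nu>. u (g \<nu> i) * w \<nu> (g \<nu> i)) = (\<Sum>t\<in>D \<nu>. u t * w \<nu> t)"
          by (rule sum.reindex_bij_betw[OF g[OF \<nu>]])
        also have "\<dots> = (\<Sum>t\<in>D \<nu>. e t)" using main[OF \<nu>] by (intro sum.cong) auto
        finally show ?thesis .
      qed
      then have "(\<Sum>\<nu>\<in>L. \<Sum>i<?m \<nu>. u (g \<nu> i) * w \<nu> (g \<nu> i)) = (\<Sum>\<nu>\<in>L. \<Sum>t\<in>D \<nu>. e t)" by simp
      also have "\<dots> = (\<Sum>t\<in>Seq. e t)"
        unfolding D_def using finite_Seq L content_sum[OF J] by (intro sum.group) (auto simp: L_def Seq_def)
      finally show ?thesis by (simp only: e_sum)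
    qed
  next
    fix \<nu> assume \<nu>: "\<nu> \<in> L"
    show "alg_rep (C \<nu>) (\<epsilon> \<nu>) (\<theta> \<nu>)" "inj_on (\<theta> \<nu>) (carrier (C \<nu>))" "\<theta> \<nu> ` carrier (C \<nu>) \<subseteq> \<rho> ` carrier ?A"
      using main[OF \<nu>] by auto
    show "falgebra (C \<nu>)"
      unfolding C_def by (rule tensor_factors.falgebra_tensor, rule tensor_factors.intro) (simp_all add: J falgebra_hecke)
    fix i assume i: "i < ?m \<nu>"
    note t = gD[OF \<nu> i]
    show "u (g \<nu> i) \<in> \<rho> ` carrier ?A" using u_K[OF D_Seq[OF t]] by (simp add: K_def)
    show "w \<nu> (g \<nu> i) \<in> \<rho> ` carrier ?A" using main[OF \<nu>] t by (simp add: K_def)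
    show "w \<nu> (g \<nu> i) * \<rho> x * u (g \<nu> k) \<in> \<theta> \<nu> ` carrier (C \<nu>)" if "x \<in> carrier ?A" "k < ?m \<nu>" for x k
      using main[OF \<nu>] t gD[OF \<nu> that(2)] that(1) by blast
    fix \<mu> k assume \<mu>: "\<mu> \<in> L" and k: "k < ?m \<mu>"
    note s = gD[OF \<mu> k]
    show "w \<nu> (g \<nu> i) * u (g \<mu> k) = (if \<nu> = \<mu> \<and> i = k then \<epsilon> \<nu> else 0)"
      using main[OF \<nu>] t D_Seq[OF s] g_eq[OF \<nu> \<mu> i k] by simp
    show "w \<nu> (g \<nu> i) * \<rho> x * u (g \<mu> k) = 0" if "x \<in> carrier ?A" "\<nu> \<noteq> \<mu>" for x
      using main[OF \<nu>] t D_disj[OF s that(2)] that(1) by blast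
  qed
  then show ?thesis unfolding L_def C_def P_def .
qed

text \<open>Growth multiplies by \<open>q\<close> or its inverse, so it never leaves the multiples
  of \<open>c\<close> by powers of \<open>q\<close>.\<close>

lemma grow_coset:
  assumes "q \<noteq> 0" "\<And>\<omega>. \<omega> \<in># M \<Longrightarrow> \<exists>k::int. \<omega> = c * q powi k" "\<omega> \<in># (grow q ^^ n) M"
  shows "\<exists>k::int. \<omega> = c * q powi k"
  using assms(3)
proof (induction n arbitrary: \<omega>)
  case (Suc n)
  have *: "\<exists>l::int. q * (c * q powi k) = c * q powi l" "\<exists>l::int. c * q powi k / q = c * q powi l" for k :: int
  proof -
    show "\<exists>l::int. q * (c * q powi k) = c * q powi l"
      using assms(1) by (intro exI[of _ "k + 1"]) (simp add: power_int_add)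
    show "\<exists>l::int. c * q powi k / q = c * q powi l"
      using assms(1) by (intro exI[of _ "k - 1"]) (simp add: power_int_diff)
  qed
  have "\<exists>\<omega>'. \<omega>' \<in># N \<and> (\<omega> = \<omega>' \<or> \<omega> = q * \<omega>' \<or> \<omega> = \<omega>' / q)" if "\<omega> \<in># grow q N" for N
    using that by (auto simp: grow_def)
  from this[of "(grow q ^^ n) M"] Suc.prems obtain \<omega>' where \<omega>': "\<omega>' \<in># (grow q ^^ n) M" "\<omega> = \<omega>' \<or> \<omega> = q * \<omega>' \<or> \<omega> = \<omega>' / q"
    by auto
  with Suc.IH[OF \<omega>'(1)] * show ?case by auto
qed (use assms(2) in simp)

theorem theorem3p20:
  fixes d p n r p' :: nat
    and \<zeta> q :: "'f::field"
    and e :: enat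
    and I :: "int set"
    and J' :: "nat set"
    and \<Lambda> :: "int \<Rightarrow> nat \<Rightarrow> nat"
    and v :: "nat \<Rightarrow> 'f"
  assumes "d \<ge> 1" and "p \<ge> 1" and "n \<ge> 2" and "r = d * p"
    and "mult_order \<zeta> = enat p"
    and "q \<noteq> 0" and "q \<noteq> 1" and "mult_order q = e" and "e \<ge> 2"
    and "I = residue_indices e"
    and "p' = (LEAST m. m \<ge> 1 \<and> \<zeta> ^ m \<in> cyclic_subgroup q)"
    and "J' = {1..p'}"
    and "finite {(i, j). i \<in> I \<and> j \<in> J' \<and> \<Lambda> i j \<noteq> 0}"
    and "(\<Sum>(i, j) \<in> {(i, j). i \<in> I \<and> j \<in> J' \<and> \<Lambda> i j \<noteq> 0}. \<Lambda> i j) = r"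
    and "\<And>j. j \<in> J' \<Longrightarrow> v j \<noteq> 0"
    and "\<And>k l. k \<in> J' \<Longrightarrow> l \<in> J' \<Longrightarrow> k \<noteq> l \<Longrightarrow> v k / v l \<notin> cyclic_subgroup q"
  shows "\<exists>\<Phi>. \<Phi> \<in> algebra_iso
           (multi_cyclotomic_hecke_algebra I J' \<Lambda> q v n)
           (direct_sum_algebra (weak_compositions J' n)
             (\<lambda>\<nu>. matrix_algebra (multinomial J' \<nu> n)
               (tensor_algebra J'
                 (\<lambda>j. cyclotomic_hecke_algebra I (\<lambda>i. \<Lambda> i j) q (\<nu> j)))))"
proof -
  note q0 = \<open>q \<noteq> 0\<close> and v0 = assms(15) and cosets = assms(16)
  let ?I = "\<lambda>j. {i \<in> I. \<Lambda> i j \<noteq> 0}"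
  have J: "finite J'" using assms(12) by simp
  \<comment> \<open>The roots of the small algebra of colour \<open>j\<close>, with multiplicity;
    scaled by \<open>v j\<close> they are the roots of colour \<open>j\<close> of the large
    one.\<close>
  define M' where "M' j = (\<Sum>i\<in>?I j. replicate_mset (\<Lambda> i j) (q powi i))" for j
  define M where "M j = image_mset (\<lambda>\<omega>. v j * \<omega>) (M' j)" for j
  have fin: "finite (?I j)" if "j \<in> J'" for j
    using finite_subset[OF _ finite_imageI[OF assms(13), of fst], of "?I j"] that by force
  have M'_poly: "root_poly (M' j) = (\<Prod>i\<in>?I j. [:- (q powi i), 1:] ^ \<Lambda> i j)" for j
    by (simp add: M'_def root_poly_sum root_poly_replicate)
  have image_sum: "image_mset f (\<Sum>i\<in>X. h i) = (\<Sum>i\<in>X. image_mset f (h i))" for f :: "'f \<Rightarrow> 'f" and h :: "int \<Rightarrow> 'f multiset" and X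
    by (induction X rule: infinite_finite_induct) auto
  have M_poly: "root_poly (M j) = (\<Prod>i\<in>?I j. [:- (v j * q powi i), 1:] ^ \<Lambda> i j)" for j
    by (simp add: M_def M'_def image_sum root_poly_sum root_poly_replicate)
  have "(\<Prod>(i, j) \<in> {(i, j). i \<in> I \<and> j \<in> J' \<and> \<Lambda> i j \<noteq> 0}. [:- (v j * q powi i), 1:] ^ \<Lambda> i j) =
      (\<Prod>(j, i) \<in> (SIGMA j:J'. ?I j). [:- (v j * q powi i), 1:] ^ \<Lambda> i j)"
    by (rule prod.reindex_bij_witness[of _ "\<lambda>(j, i). (i, j)" "\<lambda>(i, j). (j, i)"]) auto
  also have "\<dots> = root_poly (\<Sum>j\<in>J'. M j)"
    using J fin by (simp add: root_poly_sum M_poly prod.Sigma)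
  finally have P: "multi_cyclotomic_hecke_algebra I J' \<Lambda> q v n = hecke_algebra q (root_poly (\<Sum>j\<in>J'. M j)) n"
    by (simp add: multi_cyclotomic_hecke_algebra_def)
  have coset: "\<exists>k::int. \<omega> = v j * q powi k" if "\<omega> \<in># (grow q ^^ n) (M j)" "j \<in> J'" for \<omega> j
  proof (rule grow_coset[OF q0 _ that(1)])
    fix \<omega> assume "\<omega> \<in># M j"
    then show "\<exists>k::int. \<omega> = v j * q powi k"
      using fin[OF that(2)] by (auto simp: M_def M'_def set_mset_sum split: if_splits)
  qed
  have ratio: "v j * q powi a \<noteq> v k * q powi b" if "j \<in> J'" "k \<in> J'" "j \<noteq> k" for j k and a b :: int
  proof
    assume "v j * q powi a = v k * q powi b"
    then have "v j / v k = q powi (b - a)"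
      using v0 q0 that by (simp add: power_int_diff field_simps)
    then show False using cosets[OF that] by (auto simp: cyclic_subgroup_def)
  qed
  have "separated q n J' M"
    unfolding separated_def
  proof (intro ballI impI allI)
    fix j k \<omega> \<omega>' assume jk: "j \<in> J'" "k \<in> J'" "j \<noteq> k"
      and \<omega>: "\<omega> \<in># (grow q ^^ n) (M j)" and \<omega>': "\<omega>' \<in># (grow q ^^ n) (M k)"
    obtain a b :: int where ab: "\<omega> = v j * q powi a" "\<omega>' = v k * q powi b"
      using coset[OF \<omega> jk(1)] coset[OF \<omega>' jk(2)] by blast
    \<comment> \<open>The factor \<open>q\<close> in the second inequality only shifts the exponent,
      so the same coset condition excludes it.\<close>
    have "q powi (a + 1) = q powi a * q" using q0 by (simp add: power_int_add)
    then have "q * \<omega> = v j * q powi (a + 1)" unfolding ab by (simp only: mult_ac)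
    then have "q * \<omega> \<noteq> \<omega>'" using ratio[OF jk, of "a + 1" b] ab(2) by metis
    then show "\<omega> \<noteq> \<omega>' \<and> q * \<omega> \<noteq> \<omega>'" using ratio[OF jk, of a b] ab by simp
  qed
  from hecke_decomposition[where M' = M', OF J _ q0 this v0] \<open>n \<ge> 2\<close>
  show ?thesis
    unfolding P cyclotomic_hecke_algebra_def M'_poly[symmetric] by (simp add: M_def)
qed

end
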